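(* Let $m\ge 1$ and let $\Sigma$ be a simplicial complex on the vertex set $[m]=\{1,\dots,m\}$ containing the empty simplex $\emptyset$ and possibly having ghost vertices. There is a quasi-isomorphism of differential graded algebras $$C^{*}(\mathcal{Z}_{\mathbb{R}}(\Sigma))\longrightarrow B(\Sigma)$$ from the normalized integral singular cochain algebra of the real moment-angle complex $\mathcal{Z}_{\mathbb{R}}(\Sigma)$ to the dga $B(\Sigma)$, natural with respect to inclusions of subcomplexes of $\Sigma$.
   Context: All coefficients are in $\mathbb{Z}$. A simplicial complex $\Sigma$ on $[m]$ is a collection of subsets of $[m]$ closed under taking subsets, with $\emptyset\in\Sigma$; ghost vertices ($i\in[m]$ with $\{i\}\notin\Sigma$) are allowed. Subcomplexes are taken on the same set $[m]$. Real moment-angle complex: $\mathcal{Z}_{\mathbb{R}}(\Sigma)=\bigcup_{\sigma\in\Sigma}(D^1,S^0)^\sigma\subset(D^1)^m$, where $D^1=[-1,1]$, $S^0=\{-1,1\}$ and $(D^1,S^0)^\sigma=\{(z_1,\dots,z_m)\in(D^1)^m : z_i\in S^0\text{ if } i\notin\sigma\}$. Singular cochains: $C(X)$ is the normalized singular chain complex of $X$ (singular chains modulo degenerate simplices), a differential graded coalgebra with the Alexander--Whitney diagonal $\Delta x=\sum_{k=0}^n x(0\dots k)\otimes x(k\dots n)$ for an $n$-simplex $x$. $C^*(X)$ is its dual, with differential $(d\gamma)(x)=-(-1)^{|\gamma|}\gamma(dx)$ and product dual to $\Delta$ (with $(f\otimes g)(a\otimes b)=(-1)^{|g||a|}f(a)g(b)$).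 The dga $B(\Sigma)$ is the (not graded-commutative) unital dga over $\mathbb{Z}$ with generators $s_i$ of degree $0$ and $t_i$ of degree $1$, $i\in[m]$, differential $$d s_i=-t_i,\qquad d t_i=0,$$ and relations $$s_is_i=s_i,\quad t_is_i=t_i,\quad s_it_i=0,\quad t_it_i=0\quad (i\in[m]),\qquad \prod_{j\in\sigma}t_j=0\quad\text{for every }\sigma\subset[m]\text{ with }\sigma\notin\Sigma,$$ plus the rule that variables corresponding to distinct subscripts commute in the graded sense. An inclusion $\Sigma'\subset\Sigma$ induces the restriction $C^*(\mathcal{Z}_{\mathbb{R}}(\Sigma))\to C^*(\mathcal{Z}_{\mathbb{R}}(\Sigma'))$ and the canonical projection $B(\Sigma)\to B(\Sigma')$; naturality refers to these maps. *)

theory Defs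
  imports "HOL-Homology.Homology" "HOL-Algebra.QuotRing"
begin

section \<open>Differential graded algebras over the integers\<close>

text \<open>Cohomologically graded, concentrated in non-negative degrees, with unit and not necessarily
  graded commutative. The carrier is the direct sum of the homogeneous components.\<close>

record 'a dga = "'a ring" +
  component :: "nat \<Rightarrow> 'a set"
  diff :: "'a \<Rightarrow> 'a"

locale dga = ring A for A :: "('a, 'b) dga_scheme" (structure) +
  assumes component_subgroup: "additive_subgroup (component A n) A"
    and one_component: "\<one> \<in> component A 0"
    and mult_component:
      "\<lbrakk>x \<in> component A i; y \<in> component A j\<rbrakk> \<Longrightarrow> x \<otimes> y \<in> component A (i + j)"
    and direct_sum:
      "x \<in> carrier A \<Longrightarrow>
        \<exists>!f. (\<forall>n. f n \<in> component A n) \<and> finite {n. f n \<noteq> \<zero>} \<and>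
             x = (\<Oplus>n\<in>{n. f n \<noteq> \<zero>}. f n)"
    and diff_component: "x \<in> component A n \<Longrightarrow> diff A x \<in> component A (Suc n)"
    and diff_add:
      "\<lbrakk>x \<in> carrier A; y \<in> carrier A\<rbrakk> \<Longrightarrow> diff A (x \<oplus> y) = diff A x \<oplus> diff A y"
    and diff_diff: "x \<in> carrier A \<Longrightarrow> diff A (diff A x) = \<zero>"
    and leibniz:
      "\<lbrakk>x \<in> component A i; y \<in> component A j\<rbrakk> \<Longrightarrow>
        diff A (x \<otimes> y) = diff A x \<otimes> y \<oplus> ((\<ominus> \<one>) [^] i) \<otimes> (x \<otimes> diff A y)"

definition dga_hom :: "('a, 'c) dga_scheme \<Rightarrow> ('b, 'd) dga_scheme \<Rightarrow> ('a \<Rightarrow> 'b) set" where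
  "dga_hom A B = {f \<in> ring_hom A B.
     (\<forall>n. f ` component A n \<subseteq> component B n) \<and>
     (\<forall>x \<in> carrier A. f (diff A x) = diff B (f x))}"

definition cocycle_group :: "('a, 'c) dga_scheme \<Rightarrow> nat \<Rightarrow> 'a monoid" where
  "cocycle_group A n =
     \<lparr>carrier = {x \<in> component A n. diff A x = \<zero>\<^bsub>A\<^esub>}, monoid.mult = add A, one = \<zero>\<^bsub>A\<^esub>\<rparr>"

definition coboundaries :: "('a, 'c) dga_scheme \<Rightarrow> nat \<Rightarrow> 'a set" where
  "coboundaries A n = (case n of 0 \<Rightarrow> {\<zero>\<^bsub>A\<^esub>} | Suc k \<Rightarrow> diff A ` component A k)"

definition cohomology :: "('a, 'c) dga_scheme \<Rightarrow> nat \<Rightarrow> 'a set monoid" where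
  "cohomology A n = cocycle_group A n Mod coboundaries A n"

text \<open>On a coset \<open>X\<close> the union below is over equal cosets, so it sends the class of a cocycle
  \<open>x\<close> to the class of \<open>f x\<close>. Maps out of a quotient are written in this way throughout.\<close>

definition cohomology_map ::
    "('b, 'd) dga_scheme \<Rightarrow> nat \<Rightarrow> ('a \<Rightarrow> 'b) \<Rightarrow> 'a set \<Rightarrow> 'b set" where
  "cohomology_map B n f X = (\<Union>x\<in>X. coboundaries B n #>\<^bsub>cocycle_group B n\<^esub> f x)"

definition dga_quasi_iso ::
    "('a, 'c) dga_scheme \<Rightarrow> ('b, 'd) dga_scheme \<Rightarrow> ('a \<Rightarrow> 'b) \<Rightarrow> bool" where
  "dga_quasi_iso A B f \<longleftrightarrow> dga A \<and> dga B \<and> f \<in> dga_hom A B \<and>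
     (\<forall>n. cohomology_map B n f \<in> iso (cohomology A n) (cohomology B n))"


section \<open>Normalized singular cochains\<close>

text \<open>\<open>singular_degeneracy n j y\<close> is the \<open>n\<close>-simplex \<open>s\<^sub>j y\<close> obtained from an
  \<open>(n - 1)\<close>-simplex \<open>y\<close> by repeating its \<open>j\<close>-th vertex.\<close>

definition singular_degeneracy ::
    "nat \<Rightarrow> nat \<Rightarrow> ((nat \<Rightarrow> real) \<Rightarrow> 'a) \<Rightarrow> (nat \<Rightarrow> real) \<Rightarrow> 'a" where
  "singular_degeneracy n j y =
     restrict (y \<circ> (\<lambda>t i. if i < j then t i else if i = j then t j + t (Suc j) else t (Suc i)))
       (standard_simplex n)"

definition degenerate_simplex :: "nat \<Rightarrow> 'a topology \<Rightarrow> ((nat \<Rightarrow> real) \<Rightarrow> 'a) \<Rightarrow> bool" where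
  "degenerate_simplex n X x \<longleftrightarrow>
     (\<exists>j y. j < n \<and> singular_simplex (n - 1) X y \<and> x = singular_degeneracy n j y)"

definition degenerate_chains :: "nat \<Rightarrow> 'a topology \<Rightarrow> 'a chain set" where
  "degenerate_chains n X = {c. Poly_Mapping.keys c \<subseteq> Collect (degenerate_simplex n X)}"

definition normalized_chain_group :: "nat \<Rightarrow> 'a topology \<Rightarrow> 'a chain set monoid" where
  "normalized_chain_group n X = chain_group n X Mod degenerate_chains n X"

text \<open>An element of the dual of \<open>normalized_chain_group n X\<close> is represented by its composite with
  the projection from \<open>chain_group n X\<close>, extended by \<open>0\<close> to all of \<open>'a chain\<close> so
  that the representation is unique.\<close>

definition normalized_cochains :: "nat \<Rightarrow> 'a topology \<Rightarrow> ('a chain \<Rightarrow> int) set" where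
  "normalized_cochains n X =
     {\<lambda>c. if singular_chain n X c then g (degenerate_chains n X #>\<^bsub>chain_group n X\<^esub> c) else 0 |
      g. g \<in> hom (normalized_chain_group n X) integer_group}"

text \<open>For a simplex \<open>x\<close>, \<open>singular_interval x j l\<close> is the \<open>l\<close>-simplex
  \<open>x(j \<dots> j + l)\<close>.\<close>

definition singular_interval ::
    "((nat \<Rightarrow> real) \<Rightarrow> 'a) \<Rightarrow> nat \<Rightarrow> nat \<Rightarrow> (nat \<Rightarrow> real) \<Rightarrow> 'a" where
  "singular_interval x j l =
     restrict (x \<circ> (\<lambda>t i. if i < j then 0 else t (i - j))) (standard_simplex l)"

type_synonym 'a cochain = "nat \<Rightarrow> 'a chain \<Rightarrow> int"

definition cochain_one :: "'a topology \<Rightarrow> 'a cochain" where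
  "cochain_one X = (\<lambda>n c. if n = 0 \<and> singular_chain 0 X c
     then \<Sum>x\<in>Poly_Mapping.keys c. Poly_Mapping.lookup c x else 0)"

text \<open>The value of \<open>f \<otimes> g\<close> on the Alexander--Whitney diagonal of \<open>x\<close>, with
  \<open>(f \<otimes> g)(a \<otimes> b) = (-1)\<^bsup>|g||a|\<^esup> f(a) g(b)\<close>, extended linearly to chains.\<close>

definition cochain_mult ::
    "'a topology \<Rightarrow> 'a cochain \<Rightarrow> 'a cochain \<Rightarrow> 'a cochain" where
  "cochain_mult X f g = (\<lambda>n c. if singular_chain n X c
     then \<Sum>x\<in>Poly_Mapping.keys c. Poly_Mapping.lookup c x *
            (\<Sum>k\<le>n. (-1) ^ ((n - k) * k) * f k (frag_of (singular_interval x 0 k))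
                                      * g (n - k) (frag_of (singular_interval x k (n - k))))
     else 0)"

text \<open>The sign is that of \<open>(d\<gamma>)(c) = -(-1)\<^bsup>|\<gamma>|\<^esup> \<gamma>(dc)\<close> with
  \<open>|\<gamma>| = n - 1\<close>.\<close>

definition cochain_diff :: "'a topology \<Rightarrow> 'a cochain \<Rightarrow> 'a cochain" where
  "cochain_diff X f = (\<lambda>n c. if n > 0 \<and> singular_chain n X c
     then - ((-1) ^ (n - 1)) * f (n - 1) (chain_boundary n c) else 0)"

definition cochain_dga :: "'a topology \<Rightarrow> 'a cochain dga" where
  "cochain_dga X =
     \<lparr>carrier = {f. (\<forall>n. f n \<in> normalized_cochains n X) \<and> finite {n. f n \<noteq> (\<lambda>c. 0)}},
      monoid.mult = cochain_mult X,
      one = cochain_one X,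
      zero = (\<lambda>n c. 0),
      add = (\<lambda>f g n c. f n c + g n c),
      component = (\<lambda>n. {f. f n \<in> normalized_cochains n X \<and> (\<forall>k. k \<noteq> n \<longrightarrow> f k = (\<lambda>c. 0))}),
      diff = cochain_diff X\<rparr>"

text \<open>Restriction of cochains to a subspace \<open>Y\<close>; a singular chain of the subspace is literally
  a singular chain of the ambient space.\<close>

definition cochain_restriction :: "'a topology \<Rightarrow> 'a cochain \<Rightarrow> 'a cochain" where
  "cochain_restriction Y f = (\<lambda>n c. if singular_chain n Y c then f n c else 0)"


section \<open>Simplicial complexes and real moment-angle complexes\<close>

definition simplicial_complex_on :: "nat \<Rightarrow> nat set set \<Rightarrow> bool" where
  "simplicial_complex_on m \<Sigma> \<longleftrightarrow>
     \<Sigma> \<subseteq> Pow {1..m} \<and> {} \<in> \<Sigma> \<and> (\<forall>\<sigma>\<in>\<Sigma>. \<forall>\<tau>. \<tau> \<subseteq> \<sigma> \<longrightarrow> \<tau> \<in> \<Sigma>)"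

definition real_moment_angle_set :: "nat \<Rightarrow> nat set set \<Rightarrow> (nat \<Rightarrow> real) set" where
  "real_moment_angle_set m \<Sigma> =
     (\<Union>\<sigma>\<in>\<Sigma>. {z \<in> {1..m} \<rightarrow>\<^sub>E {-1..1}. \<forall>i\<in>{1..m}. i \<notin> \<sigma> \<longrightarrow> z i \<in> {-1, 1}})"

definition real_moment_angle :: "nat \<Rightarrow> nat set set \<Rightarrow> (nat \<Rightarrow> real) topology" where
  "real_moment_angle m \<Sigma> = subtopology (powertop_real {1..m}) (real_moment_angle_set m \<Sigma>)"


section \<open>The dga \<open>B(\<Sigma>)\<close>\<close>

datatype B_gen = SGen nat | TGen nat

fun subscript :: "B_gen \<Rightarrow> nat" where
  "subscript (SGen i) = i"
| "subscript (TGen i) = i"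

fun gen_degree :: "B_gen \<Rightarrow> nat" where
  "gen_degree (SGen i) = 0"
| "gen_degree (TGen i) = 1"

definition B_gens :: "nat \<Rightarrow> B_gen set" where
  "B_gens m = SGen ` {1..m} \<union> TGen ` {1..m}"

text \<open>The free associative unital ring on the generators: integral linear combinations of words,
  multiplied by concatenation.\<close>

definition word_mult :: "(B_gen list \<Rightarrow>\<^sub>0 int) \<Rightarrow> (B_gen list \<Rightarrow>\<^sub>0 int) \<Rightarrow> (B_gen list \<Rightarrow>\<^sub>0 int)"
    (infixl \<open>\<star>\<close> 70) where
  "a \<star> b = frag_extend (\<lambda>u. frag_extend (\<lambda>v. frag_of (u @ v)) b) a"

definition free_ring :: "nat \<Rightarrow> (B_gen list \<Rightarrow>\<^sub>0 int) ring" where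
  "free_ring m =
     \<lparr>carrier = {a. Poly_Mapping.keys a \<subseteq> lists (B_gens m)},
      monoid.mult = (\<star>), one = frag_of [], zero = 0, add = (+)\<rparr>"

definition word_degree :: "B_gen list \<Rightarrow> nat" where
  "word_degree w = sum_list (map gen_degree w)"

definition free_component :: "nat \<Rightarrow> nat \<Rightarrow> (B_gen list \<Rightarrow>\<^sub>0 int) set" where
  "free_component m n = {a. Poly_Mapping.keys a \<subseteq> {w \<in> lists (B_gens m). word_degree w = n}}"

text \<open>The derivation of the free ring with \<open>d s\<^sub>i = - t\<^sub>i\<close> and \<open>d t\<^sub>i = 0\<close>.\<close>

fun gen_diff :: "B_gen \<Rightarrow> B_gen list \<Rightarrow>\<^sub>0 int" where
  "gen_diff (SGen i) = - frag_of [TGen i]"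
| "gen_diff (TGen i) = 0"

fun word_diff :: "B_gen list \<Rightarrow> B_gen list \<Rightarrow>\<^sub>0 int" where
  "word_diff [] = 0"
| "word_diff (g # w) =
     gen_diff g \<star> frag_of w + frag_cmul ((-1) ^ gen_degree g) (frag_of [g] \<star> word_diff w)"

definition free_diff :: "(B_gen list \<Rightarrow>\<^sub>0 int) \<Rightarrow> (B_gen list \<Rightarrow>\<^sub>0 int)" where
  "free_diff = frag_extend word_diff"

text \<open>The factors of \<open>\<Prod>\<^bsub>j\<in>\<sigma>\<^esub> t\<^sub>j\<close> are taken in increasing order; because of the commutation
  relations another order changes the product only by a sign.\<close>

definition B_relations :: "nat \<Rightarrow> nat set set \<Rightarrow> (B_gen list \<Rightarrow>\<^sub>0 int) set" where
  "B_relations m \<Sigma> =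
     (\<Union>i\<in>{1..m}. let s = frag_of [SGen i]; t = frag_of [TGen i]
        in {s \<star> s - s, t \<star> s - t, s \<star> t, t \<star> t}) \<union>
     {frag_of [g] \<star> frag_of [h]
        - frag_cmul ((-1) ^ (gen_degree g * gen_degree h)) (frag_of [h] \<star> frag_of [g]) | g h.
        g \<in> B_gens m \<and> h \<in> B_gens m \<and> subscript g \<noteq> subscript h} \<union>
     {frag_of (map TGen (sorted_list_of_set \<sigma>)) | \<sigma>. \<sigma> \<subseteq> {1..m} \<and> \<sigma> \<notin> \<Sigma>}"

text \<open>The two-sided ideal generated by the relations. It is already closed under
  \<^term>\<open>free_diff\<close>, so it is also the differential ideal that they generate.\<close>

definition B_ideal :: "nat \<Rightarrow> nat set set \<Rightarrow> (B_gen list \<Rightarrow>\<^sub>0 int) set" where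
  "B_ideal m \<Sigma> = Idl\<^bsub>free_ring m\<^esub> (B_relations m \<Sigma>)"

definition B_class :: "nat \<Rightarrow> nat set set \<Rightarrow> (B_gen list \<Rightarrow>\<^sub>0 int) \<Rightarrow> (B_gen list \<Rightarrow>\<^sub>0 int) set" where
  "B_class m \<Sigma> a = B_ideal m \<Sigma> +>\<^bsub>free_ring m\<^esub> a"

definition B_dga :: "nat \<Rightarrow> nat set set \<Rightarrow> (B_gen list \<Rightarrow>\<^sub>0 int) set dga" where
  "B_dga m \<Sigma> = ring.extend (free_ring m Quot B_ideal m \<Sigma>)
     (dga.fields (\<lambda>n. B_class m \<Sigma> ` free_component m n)
                 (\<lambda>X. \<Union>a\<in>X. B_class m \<Sigma> (free_diff a)))"

text \<open>The canonical projection onto \<open>B(\<Sigma>')\<close> for a subcomplex \<open>\<Sigma>'\<close>.\<close>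

definition B_projection ::
    "nat \<Rightarrow> nat set set \<Rightarrow> (B_gen list \<Rightarrow>\<^sub>0 int) set \<Rightarrow> (B_gen list \<Rightarrow>\<^sub>0 int) set" where
  "B_projection m \<Sigma>' X = (\<Union>a\<in>X. B_class m \<Sigma>' a)"

end

theory Submission
  imports Defs "HOL-Combinatorics.Multiset_Permutations"
begin

text \<open>The faces of the cube that lie in the real moment-angle complex correspond to words in the
  \<open>s\<^sub>i\<close>, \<open>1 - s\<^sub>i\<close> and \<open>t\<^sub>i\<close> (one letter for each coordinate), and these words form a basis of
  \<open>B(\<Sigma>)\<close>. Each face is triangulated by its monotone vertex paths, and the quasi-isomorphism evaluates
  a cochain on these triangulations. It is multiplicative because the front and back pieces of a
  monotone path are again monotone paths. Words are realized as cup products of the cochains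
  \<open>s\<^sub>i\<close>, which test the sign of the \<open>i\<close>-th coordinate of a vertex, and \<open>t\<^sub>i = - d s\<^sub>i\<close>; this
  identifies \<open>B(\<Sigma>)\<close> with the integer functions on the faces. The map is surjective and its kernel is
  dual to the quotient of the singular chains by the degenerate simplices and the triangulated
  faces. That quotient is acyclic: a subdivided cycle consists of small simplices, which are rounded
  to cubical chains, and an acyclic carrier argument compares the cycle with its rounding. Being also
  free, the quotient is contractible, so the kernel is acyclic.\<close>

section \<open>Vertex maps and normalized cochains\<close>

text \<open>The relations of \<open>B(\<Sigma>)\<close> fail in general among the cochains that
  realize the words, because a coordinate may fall along an arbitrary simplex; they hold after
  evaluation on monotone paths, where coordinates only rise. Hence the free ring, not
  \<open>B(\<Sigma>)\<close>, is mapped to cochains. A product is evaluated on a face from the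
  values of its factors on faces, so the elements with vanishing values form an ideal, and rewriting
  of words identifies it with the ideal of relations. The dga axioms of \<open>B(\<Sigma>)\<close>
  are thereby inherited from cochains and never checked on relations.

  Dualizing over the integers takes a contraction, which is chosen simplex by simplex; a retraction
  onto a complement of the degenerate simplices and cube chains makes it descend to the quotient.
  The obstacle is a relative cycle whose boundary mixes degenerate and cubical chains. The two parts
  separate because cube chains are independent modulo degenerate ones; the first is filled since
  degenerate chains are acyclic, the second since rounding undoes subdivision on cube chains. What
  remains is an absolute cycle.\<close>

definition push :: "nat \<Rightarrow> (nat \<Rightarrow> nat) \<Rightarrow> (nat \<Rightarrow> real) \<Rightarrow> nat \<Rightarrow> real" where
  "push l \<theta> t = (\<lambda>i. \<Sum>k | k \<le> l \<and> \<theta> k = i. t k)"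

text \<open>Faces, degeneracies and front or back intervals are all instances of this operation, so
  simplicial identities reduce to comparing vertex maps by \<open>reindex_reindex\<close> and
  \<open>reindex_cong\<close>.\<close>

definition reindex :: "nat \<Rightarrow> (nat \<Rightarrow> nat) \<Rightarrow> ((nat \<Rightarrow> real) \<Rightarrow> 'a) \<Rightarrow> (nat \<Rightarrow> real) \<Rightarrow> 'a" where
  "reindex l \<theta> x = restrict (x \<circ> push l \<theta>) (standard_simplex l)"

text \<open>Change of variables for pushed-forward weights, by grouping over the fibres of
  \<open>\<theta>\<close>. Constant \<open>c\<close> gives the total mass, an indicator gives
  functoriality, and vertex coordinates give the action on affine simplices.\<close>

lemma sum_push:
  assumes "\<And>k. k \<le> l \<Longrightarrow> \<theta> k \<le> n"
  shows "(\<Sum>i\<le>n. c i * push l \<theta> t i) = (\<Sum>k\<le>l. c (\<theta> k) * t k)"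
proof -
  have "(\<Sum>i\<le>n. c i * push l \<theta> t i) = (\<Sum>i\<le>n. \<Sum>k\<in>{k\<in>{..l}. \<theta> k = i}. c (\<theta> k) * t k)"
    by (auto simp: push_def sum_distrib_left intro!: sum.cong)
  also have "\<dots> = (\<Sum>k\<le>l. c (\<theta> k) * t k)"
    using assms by (intro sum.group) auto
  finally show ?thesis .
qed

lemma push_in_standard_simplex:
  assumes "\<And>k. k \<le> l \<Longrightarrow> \<theta> k \<le> n" and t: "t \<in> standard_simplex l"
  shows "push l \<theta> t \<in> standard_simplex n"
proof -
  have t0: "\<And>i. 0 \<le> t i" "(\<Sum>i\<le>l. t i) = 1"
    using t by (auto simp: standard_simplex_def)
  have le: "push l \<theta> t i \<le> 1" for i
  proof -
    have "push l \<theta> t i \<le> (\<Sum>k\<le>l. t k)"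
      unfolding push_def by (rule sum_mono2) (auto simp: t0)
    then show ?thesis using t0 by simp
  qed
  moreover have "push l \<theta> t i = 0" if "i > n" for i
    unfolding push_def using assms(1) that by (intro sum.neutral) (auto simp: leD)
  moreover have "(\<Sum>i\<le>n. push l \<theta> t i) = 1"
    using sum_push[OF assms(1), where c="\<lambda>_. 1" and t=t] t0 by simp
  moreover have "0 \<le> push l \<theta> t i" for i
    unfolding push_def by (intro sum_nonneg) (auto simp: t0)
  ultimately show ?thesis by (simp add: standard_simplex_def)
qed

lemma push_push:
  assumes "\<And>k. k \<le> l' \<Longrightarrow> \<theta>' k \<le> l"
  shows "push l \<theta> (push l' \<theta>' t) = push l' (\<theta> \<circ> \<theta>') t"
proof
  fix i
  have "push l \<theta> (push l' \<theta>' t) i = (\<Sum>k\<le>l. (if \<theta> k = i then 1 else 0) * push l' \<theta>' t k)"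
    unfolding push_def[of l \<theta>] by (intro sum.mono_neutral_cong_left) auto
  also have "\<dots> = (\<Sum>k\<le>l'. (if \<theta> (\<theta>' k) = i then 1 else 0) * t k)"
    using assms by (rule sum_push)
  also have "\<dots> = push l' (\<theta> \<circ> \<theta>') t i"
    unfolding push_def by (intro sum.mono_neutral_cong_right) auto
  finally show "push l \<theta> (push l' \<theta>' t) i = push l' (\<theta> \<circ> \<theta>') t i" .
qed

lemma reindex_reindex:
  assumes "\<And>k. k \<le> l' \<Longrightarrow> \<theta>' k \<le> l"
  shows "reindex l' \<theta>' (reindex l \<theta> x) = reindex l' (\<theta> \<circ> \<theta>') x"
  using push_in_standard_simplex[OF assms]
  by (auto simp: reindex_def push_push[OF assms] fun_eq_iff restrict_def)

lemma reindex_cong: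
  assumes "\<And>k. k \<le> l \<Longrightarrow> \<theta> k = \<theta>' k"
  shows "reindex l \<theta> x = reindex l \<theta>' x"
proof -
  have "push l \<theta> = push l \<theta>'"
    unfolding push_def using assms by (intro ext sum.cong) auto
  then show ?thesis by (simp add: reindex_def)
qed

lemma push_id:
  assumes "t \<in> standard_simplex l"
  shows "push l (\<lambda>k. k) t = t"
proof
  fix i
  have "{k. k \<le> l \<and> k = i} = (if i \<le> l then {i} else {})" by auto
  then show "push l (\<lambda>k. k) t i = t i"
    using assms by (auto simp: push_def standard_simplex_def)
qed

lemma reindex_id: "singular_simplex l X x \<Longrightarrow> reindex l (\<lambda>k. k) x = x"
  by (auto simp: reindex_def push_id singular_simplex_def extensional_def restrict_def fun_eq_iff)

lemma continuous_map_push: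
  "continuous_map (powertop_real UNIV) (powertop_real UNIV) (push l \<theta>)"
  unfolding continuous_map_componentwise push_def
  by (auto intro!: continuous_map_sum continuous_map_product_projection)

lemma singular_simplex_reindex:
  assumes "singular_simplex n X x" and "\<And>k. k \<le> l \<Longrightarrow> \<theta> k \<le> n"
  shows "singular_simplex l X (reindex l \<theta> x)"
proof -
  have "continuous_map (subtopology (powertop_real UNIV) (standard_simplex l))
          (subtopology (powertop_real UNIV) (standard_simplex n)) (push l \<theta>)"
    using push_in_standard_simplex[OF assms(2)]
    by (auto simp: continuous_map_in_subtopology continuous_map_from_subtopology continuous_map_push)
  then have "continuous_map (subtopology (powertop_real UNIV) (standard_simplex l)) X (x \<circ> push l \<theta>)"
    using assms(1) continuous_map_compose unfolding singular_simplex_def by blast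
  then show ?thesis
    by (simp add: singular_simplex_def reindex_def)
qed

text \<open>The coface map of the simplex category; \<open>squash\<close> is the codegeneracy that
  hits \<open>j\<close> twice.\<close>

definition skip :: "nat \<Rightarrow> nat \<Rightarrow> nat" where
  "skip j k = (if k < j then k else Suc k)"

definition squash :: "nat \<Rightarrow> nat \<Rightarrow> nat" where
  "squash j k = (if k \<le> j then k else k - 1)"

lemma singular_face_eq_reindex:
  assumes "j \<le> Suc n"
  shows "singular_face (Suc n) j x = reindex n (skip j) x"
proof -
  have "simplical_face j t = push n (skip j) t" if "t \<in> standard_simplex n" for t
  proof
    fix i
    have "{k. k \<le> n \<and> skip j k = i} =
        (if i < j then {i} else if i = j then {} else if i \<le> Suc n then {i - 1} else {})"
      using assms by (auto simp: skip_def split: if_splits)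
    then show "simplical_face j t i = push n (skip j) t i"
      using that by (auto simp: push_def simplical_face_def standard_simplex_def)
  qed
  then show ?thesis
    by (auto simp: singular_face_def reindex_def)
qed

lemma singular_degeneracy_eq_reindex:
  assumes "j < n"
  shows "singular_degeneracy n j y = reindex n (squash j) y"
proof -
  have "(\<lambda>i. if i < j then t i else if i = j then t j + t (Suc j) else t (Suc i)) = push n (squash j) t"
    if "t \<in> standard_simplex n" for t
  proof
    fix i
    have "{k. k \<le> n \<and> squash j k = i} =
        (if i < j then {i} else if i = j then {j, Suc j} else if Suc i \<le> n then {Suc i} else {})"
      using assms by (auto simp: squash_def split: if_splits)
    then show "(if i < j then t i else if i = j then t j + t (Suc j) else t (Suc i)) = push n (squash j) t i"
      using that by (auto simp: push_def standard_simplex_def)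
  qed
  then show ?thesis
    by (auto simp: singular_degeneracy_def reindex_def)
qed

lemma singular_interval_eq_reindex: "singular_interval x j l = reindex l (\<lambda>k. j + k) x"
proof -
  have "(\<lambda>i. if i < j then 0 else t (i - j)) = push l (\<lambda>k. j + k) t"
    if "t \<in> standard_simplex l" for t
  proof
    fix i
    have "{k. k \<le> l \<and> j + k = i} = (if j \<le> i \<and> i \<le> j + l then {i - j} else {})"
      by auto
    then show "(if i < j then 0 else t (i - j)) = push l (\<lambda>k. j + k) t i"
      using that by (auto simp: push_def standard_simplex_def)
  qed
  then show ?thesis
    by (auto simp: singular_interval_def reindex_def)
qed

lemma singular_simplex_interval:
  "\<lbrakk>singular_simplex n X x; j + l \<le> n\<rbrakk> \<Longrightarrow> singular_simplex l X (singular_interval x j l)"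
  unfolding singular_interval_eq_reindex by (rule singular_simplex_reindex) auto

lemma singular_interval_interval:
  "j' + l' \<le> l \<Longrightarrow> singular_interval (singular_interval x j l) j' l' = singular_interval x (j + j') l'"
  unfolding singular_interval_eq_reindex by (subst reindex_reindex) (auto intro: reindex_cong)

lemma singular_interval_id: "singular_simplex n X x \<Longrightarrow> singular_interval x 0 n = x"
  using reindex_id[of n X x] reindex_cong[of n "\<lambda>k. 0 + k" "\<lambda>k. k" x] by (simp add: singular_interval_eq_reindex)

lemma singular_interval_face_left:
  assumes "i \<le> Suc k" "Suc k \<le> n"
  shows "singular_face (Suc k) i (singular_interval x 0 (Suc k)) =
    singular_interval (singular_face n i x) 0 k"
proof -
  obtain n' where n: "n = Suc n'" using assms by (cases n) auto
  show ?thesis unfolding n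
    using assms by (subst singular_face_eq_reindex, simp)+
      (auto simp: singular_interval_eq_reindex reindex_reindex skip_def n intro!: reindex_cong)
qed

lemma singular_interval_face_right:
  assumes "i \<le> Suc l" "j + Suc l \<le> n"
  shows "singular_face (Suc l) i (singular_interval x j (Suc l)) =
      (if i = 0 then singular_interval x (Suc j) l else singular_interval (singular_face n (j + i) x) j l)"
proof -
  obtain n' where n: "n = Suc n'" using assms by (cases n) auto
  show ?thesis unfolding n
    using assms by (cases "i=0") (simp_all add: singular_face_eq_reindex singular_interval_eq_reindex n reindex_reindex skip_def, (rule reindex_cong; auto simp: skip_def)+)
qed

lemma degenerate_simplex_iff:
  "degenerate_simplex n X x \<longleftrightarrow> (\<exists>j y. j < n \<and> singular_simplex (n - 1) X y \<and> x = reindex n (squash j) y)"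
  unfolding degenerate_simplex_def using singular_degeneracy_eq_reindex by metis

lemma degenerate_imp_singular_simplex: "degenerate_simplex n X x \<Longrightarrow> singular_simplex n X x"
  unfolding degenerate_simplex_iff by (auto simp: squash_def intro!: singular_simplex_reindex)

text \<open>The idempotent vertex map sending \<open>Suc j\<close> to \<open>j\<close> is
  \<open>squash j\<close> followed by \<open>skip (Suc j)\<close>, so the simplices it fixes are
  those degenerate at \<open>j\<close>. This criterion mentions no lower simplex and passes easily
  through further reindexing.\<close>

lemma degenerate_simplexI:
  assumes "singular_simplex n X x" "j < n" "x = reindex n (\<lambda>k. if k = Suc j then j else k) x"
  shows "degenerate_simplex n X x"
proof -
  have "x = reindex n (squash j) (reindex (n - 1) (skip (Suc j)) x)"
    using assms(2) by (subst assms(3), subst reindex_reindex)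
      (auto simp: squash_def skip_def intro!: reindex_cong)
  moreover have "singular_simplex (n - 1) X (reindex (n - 1) (skip (Suc j)) x)"
    using assms by (intro singular_simplex_reindex) (auto simp: skip_def)
  ultimately show ?thesis
    unfolding degenerate_simplex_iff using assms(2) by blast
qed

lemma degenerate_simplexE:
  assumes "degenerate_simplex n X x"
  obtains j where "j < n" "singular_simplex n X x" "x = reindex n (\<lambda>k. if k = Suc j then j else k) x"
proof -
  obtain j y where j: "j < n" "singular_simplex (n - 1) X y" "x = reindex n (squash j) y"
    using assms unfolding degenerate_simplex_iff by auto
  have "reindex n (\<lambda>k. if k = Suc j then j else k) x = x"
    unfolding j(3) using j(1) by (subst reindex_reindex) (auto simp: squash_def intro!: reindex_cong)
  then show thesis
    using that j(1) degenerate_imp_singular_simplex[OF assms] by simp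
qed

text \<open>The two pieces share vertex \<open>k\<close>, so a cut never separates the repeated pair
  \<open>j\<close>, \<open>Suc j\<close>: it lies in front if \<open>j < k\<close> and at the back
  otherwise.\<close>

lemma degenerate_singular_interval:
  assumes "degenerate_simplex n X x" "k \<le> n"
  shows "degenerate_simplex k X (singular_interval x 0 k) \<or>
     degenerate_simplex (n - k) X (singular_interval x k (n - k))"
proof -
  obtain j where j: "j < n" "singular_simplex n X x" "x = reindex n (\<lambda>k. if k = Suc j then j else k) x"
    using degenerate_simplexE[OF assms(1)] by metis
  have 1: "singular_simplex k X (singular_interval x 0 k)"
       "singular_simplex (n-k) X (singular_interval x k (n - k))"
    using j assms by (auto intro!: singular_simplex_interval)
  show ?thesis
  proof (cases "j < k")
    case True
    have "singular_interval x 0 k = reindex k (\<lambda>k. if k = Suc j then j else k) (singular_interval x 0 k)"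
      unfolding singular_interval_eq_reindex using True assms(2)
      by (subst j(3)) (auto simp: reindex_reindex intro!: reindex_cong)
    then show ?thesis using degenerate_simplexI[OF 1(1) True] by blast
  next
    case False
    have "singular_interval x k (n - k) =
      reindex (n - k) (\<lambda>i. if i = Suc (j - k) then j - k else i) (singular_interval x k (n - k))"
      unfolding singular_interval_eq_reindex using False assms(2) j(1)
      by (subst j(3), subst reindex_reindex, simp, subst reindex_reindex)
         (auto intro!: reindex_cong)
    then show ?thesis using degenerate_simplexI[OF 1(2), of "j - k"] False assms(2) j(1) by auto
  qed
qed

section \<open>Integer functionals on free abelian groups and normalized cochains\<close>

definition frag_eval :: "('b \<Rightarrow> int) \<Rightarrow> ('b \<Rightarrow>\<^sub>0 int) \<Rightarrow> int" where
  "frag_eval u c = (\<Sum>x\<in>Poly_Mapping.keys c. Poly_Mapping.lookup c x * u x)"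

lemma frag_eval_superset:
  assumes "finite S" "Poly_Mapping.keys c \<subseteq> S"
  shows "frag_eval u c = (\<Sum>x\<in>S. Poly_Mapping.lookup c x * u x)"
  unfolding frag_eval_def using assms
  by (intro sum.mono_neutral_left) (auto simp: in_keys_iff)

lemma frag_eval_0 [simp]: "frag_eval u 0 = 0"
  by (simp add: frag_eval_def)

lemma frag_eval_of [simp]: "frag_eval u (frag_of x) = u x"
  by (simp add: frag_eval_def)

lemma frag_eval_add: "frag_eval u (a + b) = frag_eval u a + frag_eval u b"
proof -
  let ?S = "Poly_Mapping.keys a \<union> Poly_Mapping.keys b"
  have "frag_eval u (a + b) = (\<Sum>x\<in>?S. Poly_Mapping.lookup (a + b) x * u x)"
    using keys_add[of a b] by (intro frag_eval_superset) auto
  also have "\<dots> = frag_eval u a + frag_eval u b"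
    by (simp add: frag_eval_superset[of ?S a] frag_eval_superset[of ?S b] lookup_add
        distrib_right sum.distrib)
  finally show ?thesis .
qed

lemma frag_eval_cmul: "frag_eval u (frag_cmul k a) = k * frag_eval u a"
proof -
  have "frag_eval u (frag_cmul k a) = (\<Sum>x\<in>Poly_Mapping.keys a. Poly_Mapping.lookup (frag_cmul k a) x * u x)"
    using keys_cmul[of k a] by (intro frag_eval_superset) auto
  then show ?thesis by (simp add: frag_eval_def sum_distrib_left mult.assoc)
qed

lemma frag_eval_minus: "frag_eval u (- a) = - frag_eval u a"
  using frag_eval_cmul[of u "-1" a] by simp

lemma frag_eval_diff: "frag_eval u (a - b) = frag_eval u a - frag_eval u b"
  using frag_eval_add[of u a "- b"] by (simp add: frag_eval_minus)

lemma frag_eval_sum: "frag_eval u (\<Sum>i\<in>I. g i) = (\<Sum>i\<in>I. frag_eval u (g i))"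
  by (induction I rule: infinite_finite_induct) (simp_all add: frag_eval_add)

lemma frag_eval_extend: "frag_eval u (frag_extend f c) = frag_eval (\<lambda>x. frag_eval u (f x)) c"
  by (simp add: frag_extend_def frag_eval_sum frag_eval_cmul frag_eval_def[of "\<lambda>x. frag_eval u (f x)"])

lemma frag_eval_cong: "(\<And>x. x \<in> Poly_Mapping.keys c \<Longrightarrow> u x = v x) \<Longrightarrow> frag_eval u c = frag_eval v c"
  by (simp add: frag_eval_def)

lemma frag_eval_lincomb: "frag_eval (\<lambda>x. k * u x + l * v x) c = k * frag_eval u c + l * frag_eval v c"
  by (simp add: frag_eval_def algebra_simps sum.distrib sum_distrib_left)

lemma frag_eval_plus: "frag_eval (\<lambda>x. u x + v x) c = frag_eval u c + frag_eval v c"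
  using frag_eval_lincomb[of 1 u 1 v] by simp

lemma frag_eval_mult: "frag_eval (\<lambda>x. k * u x) c = k * frag_eval u c"
  using frag_eval_lincomb[of k u 0 u] by simp

lemma frag_eval_zero [simp]: "frag_eval (\<lambda>x. 0) c = 0"
  by (simp add: frag_eval_def)

text \<open>A homomorphism out of the quotient amounts to a function on simplices that vanishes on
  the degenerate ones. Later arguments use this description in place of cosets.\<close>

lemma normalized_cochains_iff:
  "g \<in> normalized_cochains n X \<longleftrightarrow>
     (\<exists>u. (\<forall>x. degenerate_simplex n X x \<longrightarrow> u x = 0) \<and>
          g = (\<lambda>c. if singular_chain n X c then frag_eval u c else 0))"
proof -
  let ?G = "chain_group n X" and ?D = "degenerate_chains n X"
  let ?N = "normalized_chain_group n X"
  have DX: "?D \<subseteq> singular_chain_set n X"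
    unfolding degenerate_chains_def singular_chain_def
    using degenerate_imp_singular_simplex by auto
  have D: "0 \<in> ?D" "a + b \<in> ?D" "- a \<in> ?D" if "a \<in> ?D" "b \<in> ?D" for a b
    using that keys_add[of a b] by (auto simp: degenerate_chains_def)
  have D0: "0 \<in> ?D" by (simp add: degenerate_chains_def)
  have coset: "?D #>\<^bsub>?G\<^esub> c = {d + c | d. d \<in> ?D}" for c
    by (auto simp: r_coset_def)
  have coset_self: "c \<in> ?D #>\<^bsub>?G\<^esub> c" for c
    unfolding coset using D0 by force
  have coset_eq: "?D #>\<^bsub>?G\<^esub> (d + c) = ?D #>\<^bsub>?G\<^esub> c" if "d \<in> ?D" for c d
  proof -
    have "d' + c \<in> ?D #>\<^bsub>?G\<^esub> (d + c)" if "d' \<in> ?D" for d'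
    proof -
      have "d' + - d \<in> ?D" by (rule D(2)[OF that D(3)[OF \<open>d \<in> ?D\<close> D0]])
      moreover have "d' + c = (d' + - d) + (d + c)" by simp
      ultimately show ?thesis unfolding coset by blast
    qed
    moreover have "d' + (d + c) \<in> ?D #>\<^bsub>?G\<^esub> c" if "d' \<in> ?D" for d'
    proof -
      have "d' + d \<in> ?D" by (rule D(2)[OF that \<open>d \<in> ?D\<close>])
      moreover have "d' + (d + c) = (d' + d) + c" by simp
      ultimately show ?thesis unfolding coset by blast
    qed
    ultimately show ?thesis unfolding coset by blast
  qed
  have carr: "carrier ?N = (\<lambda>c. ?D #>\<^bsub>?G\<^esub> c) ` singular_chain_set n X"
    by (simp add: normalized_chain_group_def carrier_FactGroup)
  have mult: "(?D #>\<^bsub>?G\<^esub> a) \<otimes>\<^bsub>?N\<^esub> (?D #>\<^bsub>?G\<^esub> b) = ?D #>\<^bsub>?G\<^esub> (a + b)" for a b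
  proof -
    have "(?D #>\<^bsub>?G\<^esub> a) <#>\<^bsub>?G\<^esub> (?D #>\<^bsub>?G\<^esub> b) = ?D #>\<^bsub>?G\<^esub> (a + b)"
    proof (intro equalityI subsetI)
      fix z assume "z \<in> (?D #>\<^bsub>?G\<^esub> a) <#>\<^bsub>?G\<^esub> (?D #>\<^bsub>?G\<^esub> b)"
      then obtain d e where "d \<in> ?D" "e \<in> ?D" "z = (d + a) + (e + b)"
        unfolding coset set_mult_def by auto
      moreover have "(d + a) + (e + b) = (d + e) + (a + b)" by (simp add: algebra_simps)
      ultimately show "z \<in> ?D #>\<^bsub>?G\<^esub> (a + b)"
        unfolding coset using D(2)[of d e] by blast
    next
      fix z assume "z \<in> ?D #>\<^bsub>?G\<^esub> (a + b)"
      then obtain d where d: "d \<in> ?D" "z = d + (a + b)"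
        unfolding coset by blast
      then have "z = (d + a) + (0 + b)" by simp
      moreover have "d + a \<in> ?D #>\<^bsub>?G\<^esub> a" "0 + b \<in> ?D #>\<^bsub>?G\<^esub> b"
        using D0 d(1) unfolding coset by blast+
      ultimately show "z \<in> (?D #>\<^bsub>?G\<^esub> a) <#>\<^bsub>?G\<^esub> (?D #>\<^bsub>?G\<^esub> b)"
        unfolding set_mult_def by auto
    qed
    then show ?thesis by (simp add: normalized_chain_group_def)
  qed
  show ?thesis
  proof
    assume "g \<in> normalized_cochains n X"
    then obtain h where h: "h \<in> hom ?N integer_group"
      and g: "g = (\<lambda>c. if singular_chain n X c then h (?D #>\<^bsub>?G\<^esub> c) else 0)"
      unfolding normalized_cochains_def by auto
    have hadd: "h (?D #>\<^bsub>?G\<^esub> (a + b)) = h (?D #>\<^bsub>?G\<^esub> a) + h (?D #>\<^bsub>?G\<^esub> b)"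
      if "singular_chain n X a" "singular_chain n X b" for a b
      using hom_mult[OF h, of "?D #>\<^bsub>?G\<^esub> a" "?D #>\<^bsub>?G\<^esub> b"] that mult[of a b]
      by (simp add: carr)
    have h0: "h (?D #>\<^bsub>?G\<^esub> 0) = 0"
      using hadd[of 0 0] by simp
    let ?u = "\<lambda>x. h (?D #>\<^bsub>?G\<^esub> frag_of x)"
    have "h (?D #>\<^bsub>?G\<^esub> c) = frag_eval ?u c" if "singular_chain n X c" for c
    proof -
      \<comment> \<open>Membership is carried through the induction because additivity of
        \<open>h\<close> in the difference step is available for singular chains only.\<close>
      have "singular_chain n X c \<and> h (?D #>\<^bsub>?G\<^esub> c) = frag_eval ?u c"
        using that[unfolded singular_chain_def]
      proof (induction c rule: frag_induction)
        case zero then show ?case by (simp add: h0)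
      next
        case (one x) then show ?case by (simp add: singular_chain_of)
      next
        case (diff a b)
        then have "h (?D #>\<^bsub>?G\<^esub> ((a - b) + b)) = h (?D #>\<^bsub>?G\<^esub> (a - b)) + h (?D #>\<^bsub>?G\<^esub> b)"
          by (intro hadd) (auto simp: singular_chain_diff)
        with diff show ?case by (simp add: frag_eval_diff singular_chain_diff)
      qed
      then show ?thesis by simp
    qed
    moreover have "?u x = 0" if "degenerate_simplex n X x" for x
    proof -
      have "frag_of x \<in> ?D" using that by (simp add: degenerate_chains_def)
      then show ?thesis using coset_eq[of "frag_of x" 0] h0 by simp
    qed
    ultimately show "\<exists>u. (\<forall>x. degenerate_simplex n X x \<longrightarrow> u x = 0) \<and>
          g = (\<lambda>c. if singular_chain n X c then frag_eval u c else 0)"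
      unfolding g by (intro exI[of _ ?u]) auto
  next
    assume "\<exists>u. (\<forall>x. degenerate_simplex n X x \<longrightarrow> u x = 0) \<and>
          g = (\<lambda>c. if singular_chain n X c then frag_eval u c else 0)"
    then obtain u where u: "\<And>x. degenerate_simplex n X x \<Longrightarrow> u x = 0"
      and g: "g = (\<lambda>c. if singular_chain n X c then frag_eval u c else 0)" by blast
    have uD: "frag_eval u d = 0" if "d \<in> ?D" for d
      using that u by (auto simp: frag_eval_def degenerate_chains_def intro!: sum.neutral)
    \<comment> \<open>Any representative of the coset gives the same value, since
      \<open>frag_eval u\<close> vanishes on degenerate chains.\<close>
    define h where "h Y = frag_eval u (SOME c. c \<in> Y)" for Y
    have h: "h (?D #>\<^bsub>?G\<^esub> c) = frag_eval u c" for c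
    proof -
      have "(SOME b. b \<in> ?D #>\<^bsub>?G\<^esub> c) \<in> ?D #>\<^bsub>?G\<^esub> c"
        using coset_self by (rule someI)
      then obtain d where "(SOME b. b \<in> ?D #>\<^bsub>?G\<^esub> c) = d + c" "d \<in> ?D"
        unfolding coset by auto
      then show ?thesis by (simp add: h_def frag_eval_add uD)
    qed
    have "h \<in> hom ?N integer_group"
      by (rule homI) (auto simp: carr mult h frag_eval_add)
    moreover have "g = (\<lambda>c. if singular_chain n X c then h (?D #>\<^bsub>?G\<^esub> c) else 0)"
      unfolding g h ..
    ultimately show "g \<in> normalized_cochains n X"
      unfolding normalized_cochains_def by blast
  qed
qed

definition to_cochain :: "nat \<Rightarrow> 'a topology \<Rightarrow> (((nat \<Rightarrow> real) \<Rightarrow> 'a) \<Rightarrow> int) \<Rightarrow> 'a chain \<Rightarrow> int" where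
  "to_cochain n X u = (\<lambda>c. if singular_chain n X c then frag_eval u c else 0)"

lemma to_cochain_normalized:
  "(\<And>x. degenerate_simplex n X x \<Longrightarrow> u x = 0) \<Longrightarrow> to_cochain n X u \<in> normalized_cochains n X"
  unfolding normalized_cochains_iff to_cochain_def by blast

lemma normalized_cochain_eq_to_cochain:
  assumes "g \<in> normalized_cochains n X"
  shows "g = to_cochain n X (\<lambda>x. g (frag_of x))"
proof -
  obtain u where g: "g = (\<lambda>c. if singular_chain n X c then frag_eval u c else 0)"
    using assms unfolding normalized_cochains_iff by blast
  have "frag_eval u c = frag_eval (\<lambda>x. g (frag_of x)) c" if "singular_chain n X c" for c
    using that unfolding g by (intro frag_eval_cong) (auto simp: singular_chain_def)
  then show ?thesis unfolding g to_cochain_def by (simp add: fun_eq_iff)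
qed

lemma normalized_cochain_eval:
  assumes "g \<in> normalized_cochains n X" "singular_chain n X c"
  shows "g c = frag_eval (\<lambda>x. g (frag_of x)) c"
  using normalized_cochain_eq_to_cochain[OF assms(1)] assms(2) unfolding to_cochain_def by metis

lemma normalized_cochain_degenerate:
  assumes "g \<in> normalized_cochains n X" "degenerate_simplex n X x"
  shows "g (frag_of x) = 0"
  using assms degenerate_imp_singular_simplex[OF assms(2)]
  unfolding normalized_cochains_iff by (auto simp: singular_chain_of)

lemma normalized_cochain_non_chain:
  assumes "g \<in> normalized_cochains n X" "\<not> singular_chain n X c"
  shows "g c = 0"
  using assms unfolding normalized_cochains_iff by auto

lemma normalized_cochain_eqI:
  assumes "g \<in> normalized_cochains n X" "h \<in> normalized_cochains n X"
    and "\<And>x. singular_simplex n X x \<Longrightarrow> g (frag_of x) = h (frag_of x)"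
  shows "g = h"
proof
  fix c show "g c = h c"
  proof (cases "singular_chain n X c")
    case True
    have "frag_eval (\<lambda>x. g (frag_of x)) c = frag_eval (\<lambda>x. h (frag_of x)) c"
      using True assms(3) by (intro frag_eval_cong) (auto simp: singular_chain_def)
    then show ?thesis
      using normalized_cochain_eval[OF assms(1) True] normalized_cochain_eval[OF assms(2) True] by simp
  next
    case False
    then show ?thesis using assms normalized_cochain_non_chain by metis
  qed
qed

lemma to_cochain_of: "singular_simplex n X x \<Longrightarrow> to_cochain n X u (frag_of x) = u x"
  by (simp add: to_cochain_def singular_chain_of)

section \<open>The algebra of normalized cochains\<close>

lemma to_cochain_cong:
  "(\<And>x. singular_simplex n X x \<Longrightarrow> u x = v x) \<Longrightarrow> to_cochain n X u = to_cochain n X v"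
  unfolding to_cochain_def by (auto simp: fun_eq_iff singular_chain_def intro!: frag_eval_cong)

lemma to_cochain_zero: "to_cochain n X (\<lambda>x. 0) = (\<lambda>c. 0)"
  by (simp add: to_cochain_def fun_eq_iff)

lemma zero_normalized_cochain: "(\<lambda>c. 0) \<in> normalized_cochains n X"
  using to_cochain_normalized[of n X "\<lambda>x. 0"] by (simp add: to_cochain_zero)

lemma lincomb_normalized_cochain:
  assumes "g \<in> normalized_cochains n X" "h \<in> normalized_cochains n X"
  shows "(\<lambda>c. k * g c + l * h c) \<in> normalized_cochains n X"
proof -
  have "to_cochain n X (\<lambda>x. k * g (frag_of x) + l * h (frag_of x)) = (\<lambda>c. k * g c + l * h c)"
    using assms by (auto simp: to_cochain_def frag_eval_lincomb fun_eq_iff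
        normalized_cochain_eval normalized_cochain_non_chain)
  then show ?thesis
    using to_cochain_normalized[of n X "\<lambda>x. k * g (frag_of x) + l * h (frag_of x)"] assms
    by (simp add: normalized_cochain_degenerate)
qed

lemma normalized_cochain_add:
  "\<lbrakk>g \<in> normalized_cochains n X; singular_chain n X a; singular_chain n X b\<rbrakk> \<Longrightarrow> g (a + b) = g a + g b"
  by (simp add: normalized_cochain_eval singular_chain_add frag_eval_add)

lemma normalized_cochain_cmul:
  "\<lbrakk>g \<in> normalized_cochains n X; singular_chain n X a\<rbrakk> \<Longrightarrow> g (frag_cmul k a) = k * g a"
  by (simp add: normalized_cochain_eval singular_chain_cmul frag_eval_cmul)

lemma normalized_cochain_sum:
  "\<lbrakk>g \<in> normalized_cochains n X; \<And>i. i \<in> I \<Longrightarrow> singular_chain n X (a i)\<rbrakk> \<Longrightarrow> g (sum a I) = (\<Sum>i\<in>I. g (a i))"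
  by (simp add: normalized_cochain_eval singular_chain_sum frag_eval_sum)

section \<open>Cup product and coboundary, simplex by simplex\<close>

definition cup_value ::
    "'a cochain \<Rightarrow> 'a cochain \<Rightarrow> nat \<Rightarrow> ((nat \<Rightarrow> real) \<Rightarrow> 'a) \<Rightarrow> int" where
  "cup_value f g n x = (\<Sum>k\<le>n. (-1) ^ ((n - k) * k) * f k (frag_of (singular_interval x 0 k))
                                      * g (n - k) (frag_of (singular_interval x k (n - k))))"

lemma cochain_mult_eq: "cochain_mult X f g n = to_cochain n X (cup_value f g n)"
  by (simp add: cochain_mult_def to_cochain_def frag_eval_def cup_value_def fun_eq_iff)

lemma cochain_one_eq: "cochain_one X n = to_cochain n X (\<lambda>x. if n = 0 then 1 else 0)"
  by (auto simp: cochain_one_def to_cochain_def frag_eval_def fun_eq_iff)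

lemma cup_value_degenerate:
  assumes "\<And>n. f n \<in> normalized_cochains n X" "\<And>n. g n \<in> normalized_cochains n X"
    and "degenerate_simplex n X x"
  shows "cup_value f g n x = 0"
  unfolding cup_value_def
proof (intro sum.neutral ballI)
  fix k assume "k \<in> {..n}"
  then have "degenerate_simplex k X (singular_interval x 0 k) \<or>
     degenerate_simplex (n - k) X (singular_interval x k (n - k))"
    using degenerate_singular_interval[OF assms(3)] by simp
  then show "(-1) ^ ((n - k) * k) * f k (frag_of (singular_interval x 0 k))
                  * g (n - k) (frag_of (singular_interval x k (n - k))) = 0"
    using normalized_cochain_degenerate[OF assms(1)] normalized_cochain_degenerate[OF assms(2)] by auto
qed

lemma cochain_mult_normalized:
  "\<lbrakk>\<And>n. f n \<in> normalized_cochains n X; \<And>n. g n \<in> normalized_cochains n X\<rbrakk>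
    \<Longrightarrow> cochain_mult X f g n \<in> normalized_cochains n X"
  unfolding cochain_mult_eq by (intro to_cochain_normalized cup_value_degenerate[where X = X])

lemma cochain_one_normalized: "cochain_one X n \<in> normalized_cochains n X"
  unfolding cochain_one_eq
  by (intro to_cochain_normalized) (auto simp: degenerate_simplex_def)

definition face_sum :: "nat \<Rightarrow> ('a chain \<Rightarrow> int) \<Rightarrow> ((nat \<Rightarrow> real) \<Rightarrow> 'a) \<Rightarrow> int" where
  "face_sum n g x = (\<Sum>i\<le>Suc n. (-1) ^ i * g (frag_of (singular_face (Suc n) i x)))"

lemma cochain_boundary_of:
  assumes "g \<in> normalized_cochains n X" "singular_simplex (Suc n) X x"
  shows "g (chain_boundary (Suc n) (frag_of x)) = face_sum n g x"
proof -
  have "singular_chain n X (frag_of (singular_face (Suc n) i x))" if "i \<le> Suc n" for i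
    using singular_simplex_singular_face[OF assms(2), of i] that by (simp add: singular_chain_of)
  then show ?thesis
    using normalized_cochain_sum[OF assms(1), of "{..Suc n}" "\<lambda>k. frag_cmul ((-1) ^ k) (frag_of (singular_face (Suc n) k x))"]
    by (simp add: chain_boundary_of face_sum_def
        normalized_cochain_cmul[OF assms(1)] singular_chain_cmul del: sum.atMost_Suc)
qed

lemma cochain_boundary:
  assumes "g \<in> normalized_cochains n X" "singular_chain (Suc n) X c"
  shows "g (chain_boundary (Suc n) c) = frag_eval (face_sum n g) c"
proof -
  have "g (chain_boundary (Suc n) c) =
     frag_eval (\<lambda>y. g (frag_of y)) (frag_extend (\<lambda>x. chain_boundary (Suc n) (frag_of x)) c)"
    using normalized_cochain_eval[OF assms(1) singular_chain_boundary_alt[OF assms(2)]]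
    by (simp add: chain_boundary_def)
  also have "\<dots> = frag_eval (\<lambda>x. frag_eval (\<lambda>y. g (frag_of y)) (chain_boundary (Suc n) (frag_of x))) c"
    by (rule frag_eval_extend)
  also have "\<dots> = frag_eval (face_sum n g) c"
  proof (rule frag_eval_cong)
    fix x assume "x \<in> Poly_Mapping.keys c"
    then have x: "singular_simplex (Suc n) X x"
      using assms(2) by (auto simp: singular_chain_def)
    then have "singular_chain n X (chain_boundary (Suc n) (frag_of x))"
      by (simp add: singular_chain_boundary_alt singular_chain_of)
    then show "frag_eval (\<lambda>y. g (frag_of y)) (chain_boundary (Suc n) (frag_of x)) = face_sum n g x"
      using normalized_cochain_eval[OF assms(1)] cochain_boundary_of[OF assms(1) x] by metis
  qed
  finally show ?thesis .
qed

lemma degenerate_face: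
  assumes "j < Suc n" "singular_simplex (Suc n) X x"
    and x: "x = reindex (Suc n) (\<lambda>k. if k = Suc j then j else k) x"
    and "i \<le> Suc n" "i \<noteq> j" "i \<noteq> Suc j"
  shows "degenerate_simplex n X (singular_face (Suc n) i x)"
proof -
  \<comment> \<open>The repeated pair moves down by one when the omitted vertex lies below
    it.\<close>
  let ?j = "if i < j then j - 1 else j"
  have "singular_face (Suc n) i x = reindex n (\<lambda>k. if k = Suc ?j then ?j else k) (singular_face (Suc n) i x)"
    unfolding singular_face_eq_reindex[OF assms(4)]
    using assms by (subst (1 2) x, subst (1 2) reindex_reindex, simp add: skip_def, subst reindex_reindex)
      (auto simp: skip_def intro!: reindex_cong)
  moreover have "singular_simplex n X (singular_face (Suc n) i x)"
    using singular_simplex_singular_face[OF assms(2), of i] assms(4) by simp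
  ultimately show ?thesis
    using assms by (intro degenerate_simplexI[where j = ?j]) auto
qed

text \<open>Faces \<open>j\<close> and \<open>Suc j\<close> coincide and carry opposite signs; every
  other face still repeats a vertex.\<close>

lemma face_sum_degenerate:
  assumes g: "g \<in> normalized_cochains n X" and "degenerate_simplex (Suc n) X x"
  shows "face_sum n g x = 0"
proof -
  obtain j where j: "j < Suc n" "singular_simplex (Suc n) X x"
    "x = reindex (Suc n) (\<lambda>k. if k = Suc j then j else k) x"
    using degenerate_simplexE[OF assms(2)] .
  have "singular_face (Suc n) j x = singular_face (Suc n) (Suc j) x"
  proof -
    have "reindex n (skip j) (reindex (Suc n) (\<lambda>k. if k = Suc j then j else k) x) =
      reindex n (skip (Suc j)) (reindex (Suc n) (\<lambda>k. if k = Suc j then j else k) x)"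
      using j(1) by (subst (1 2) reindex_reindex) (auto simp: skip_def intro!: reindex_cong)
    then show ?thesis
      using j by (simp add: singular_face_eq_reindex)
  qed
  moreover have "face_sum n g x = (\<Sum>i\<in>{j, Suc j}. (-1) ^ i * g (frag_of (singular_face (Suc n) i x)))"
    unfolding face_sum_def
  proof (rule sum.mono_neutral_right)
    show "\<forall>i\<in>{..Suc n} - {j, Suc j}. (- 1) ^ i * g (frag_of (singular_face (Suc n) i x)) = 0"
      using degenerate_face[OF j] normalized_cochain_degenerate[OF g] by auto
  qed (use j in auto)
  ultimately show ?thesis by simp
qed

lemma cochain_diff_eq:
  assumes "\<And>n. f n \<in> normalized_cochains n X"
  shows "cochain_diff X f n = (case n of 0 \<Rightarrow> (\<lambda>c. 0) |
     Suc k \<Rightarrow> to_cochain (Suc k) X (\<lambda>x. - ((-1) ^ k) * face_sum k (f k) x))"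
proof (cases n)
  case 0
  then show ?thesis by (simp add: cochain_diff_def)
next
  case (Suc k)
  then show ?thesis
    using cochain_boundary[OF assms]
    by (auto simp: cochain_diff_def to_cochain_def fun_eq_iff frag_eval_mult[of "- ((-1) ^ k)", simplified])
qed

lemma cochain_diff_normalized:
  assumes "\<And>n. f n \<in> normalized_cochains n X"
  shows "cochain_diff X f n \<in> normalized_cochains n X"
  using assms by (cases n)
    (auto simp: cochain_diff_eq zero_normalized_cochain face_sum_degenerate[OF assms] intro!: to_cochain_normalized)

text \<open>Both sides run over all triples with sum \<open>n\<close>; this is the reindexing behind
  associativity of the cup product.\<close>

lemma sum_triangle_assoc:
  fixes F :: "nat \<Rightarrow> nat \<Rightarrow> nat \<Rightarrow> 'b::comm_monoid_add"
  shows "(\<Sum>k\<le>n. \<Sum>j\<le>k. F j (k - j) (n - k)) = (\<Sum>j\<le>n. \<Sum>k\<le>n - j. F j k (n - j - k))"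
proof -
  have "(\<Sum>k\<le>n. \<Sum>j\<le>k. F j (k - j) (n - k)) = (\<Sum>k\<le>n. \<Sum>j\<le>k. F j (k - j) (n - (j + (k - j))))"
    by (intro sum.cong) auto
  also have "\<dots> = (\<Sum>(j, k)\<in>{(j, k). j + k \<le> n}. F j k (n - (j + k)))"
    by (rule sum.triangle_reindex_eq[symmetric])
  also have "\<dots> = (\<Sum>(j, k)\<in>Sigma {..n} (\<lambda>j. {..n - j}). F j k (n - j - k))"
    by (intro sum.cong) auto
  also have "\<dots> = (\<Sum>j\<le>n. \<Sum>k\<le>n - j. F j k (n - j - k))"
    by (simp add: sum.Sigma)
  finally show ?thesis .
qed

lemma cochain_mult_of:
  "singular_simplex n X x \<Longrightarrow> cochain_mult X f g n (frag_of x) = cup_value f g n x"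
  unfolding cochain_mult_eq by (rule to_cochain_of)

lemma cochain_mult_assoc: "cochain_mult X (cochain_mult X f g) h = cochain_mult X f (cochain_mult X g h)"
proof
  fix n
  have "cup_value (cochain_mult X f g) h n x = cup_value f (cochain_mult X g h) n x"
    if x: "singular_simplex n X x" for x
  proof -
    \<comment> \<open>The contribution of cutting \<open>x\<close> into three pieces. The sign
      exponent is the sum of the pairwise products of the degrees, hence the same for both
      bracketings.\<close>
    define F where "F j k l = (-1) ^ (l * (j + k) + k * j) * f j (frag_of (singular_interval x 0 j)) *
        g k (frag_of (singular_interval x j k)) * h l (frag_of (singular_interval x (j + k) l))" for j k l
    have "cup_value (cochain_mult X f g) h n x = (\<Sum>k\<le>n. \<Sum>j\<le>k. F j (k - j) (n - k))"
      unfolding cup_value_def[of "cochain_mult X f g"]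
    proof (intro sum.cong refl)
      fix k assume "k \<in> {..n}"
      then have k: "k \<le> n" by simp
      have "cochain_mult X f g k (frag_of (singular_interval x 0 k)) =
        (\<Sum>j\<le>k. (-1) ^ ((k - j) * j) * f j (frag_of (singular_interval x 0 j))
                  * g (k - j) (frag_of (singular_interval x j (k - j))))"
        using singular_simplex_interval[OF x, of 0 k] k
        by (auto simp: cochain_mult_of cup_value_def singular_interval_interval intro!: sum.cong)
      then show "(-1) ^ ((n - k) * k) * cochain_mult X f g k (frag_of (singular_interval x 0 k))
          * h (n - k) (frag_of (singular_interval x k (n - k))) = (\<Sum>j\<le>k. F j (k - j) (n - k))"
        by (auto simp: F_def sum_distrib_left sum_distrib_right power_add mult_ac intro!: sum.cong)
    qed
    also have "\<dots> = (\<Sum>j\<le>n. \<Sum>k\<le>n - j. F j k (n - j - k))"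
      by (rule sum_triangle_assoc)
    also have "\<dots> = cup_value f (cochain_mult X g h) n x"
      unfolding cup_value_def[of f "cochain_mult X g h"]
    proof (intro sum.cong refl)
      fix j assume "j \<in> {..n}"
      then have j: "j \<le> n" by simp
      have sign: "(n - j - k) * (j + k) + k * j = (n - j) * j + (n - j - k) * k" if "k \<le> n - j" for k
      proof -
        obtain l where "n - j = k + l" using \<open>k \<le> n - j\<close> le_Suc_ex[of k "n - j"] by auto
        then show ?thesis by (simp add: algebra_simps)
      qed
      have "cochain_mult X g h (n - j) (frag_of (singular_interval x j (n - j))) =
        (\<Sum>k\<le>n - j. (-1) ^ ((n - j - k) * k) * g k (frag_of (singular_interval x j k))
                  * h (n - j - k) (frag_of (singular_interval x (j + k) (n - j - k))))"
        using singular_simplex_interval[OF x, of j "n - j"] j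
        by (auto simp: cochain_mult_of cup_value_def singular_interval_interval intro!: sum.cong)
      moreover have "F j k (n - j - k) = (-1) ^ ((n - j) * j) * f j (frag_of (singular_interval x 0 j))
          * ((-1) ^ ((n - j - k) * k) * g k (frag_of (singular_interval x j k))
              * h (n - j - k) (frag_of (singular_interval x (j + k) (n - j - k))))" if "k \<le> n - j" for k
        unfolding F_def sign[OF that] power_add by (simp only: mult_ac)
      ultimately show "(\<Sum>k\<le>n - j. F j k (n - j - k)) = (-1) ^ ((n - j) * j) * f j (frag_of (singular_interval x 0 j))
         * cochain_mult X g h (n - j) (frag_of (singular_interval x j (n - j)))"
        by (simp add: sum_distrib_left)
    qed
    finally show ?thesis .
  qed
  then show "cochain_mult X (cochain_mult X f g) h n = cochain_mult X f (cochain_mult X g h) n"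
    unfolding cochain_mult_eq[of X _ _ n] by (rule to_cochain_cong)
qed

lemma cochain_mult_one_left:
  assumes "\<And>n. f n \<in> normalized_cochains n X"
  shows "cochain_mult X (cochain_one X) f = f"
proof
  fix n
  have "cup_value (cochain_one X) f n x = f n (frag_of x)" if x: "singular_simplex n X x" for x
  proof -
    have "cup_value (cochain_one X) f n x = (\<Sum>k\<in>{0}. (-1) ^ ((n - k) * k) *
        cochain_one X k (frag_of (singular_interval x 0 k)) * f (n - k) (frag_of (singular_interval x k (n - k))))"
      unfolding cup_value_def by (intro sum.mono_neutral_right) (auto simp: cochain_one_def)
    then show ?thesis
      using x singular_simplex_interval[OF x, of 0 0]
      by (simp add: singular_interval_id cochain_one_eq to_cochain_of)
  qed
  then show "cochain_mult X (cochain_one X) f n = f n"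
    using assms by (intro normalized_cochain_eqI[OF cochain_mult_normalized])
      (auto simp: cochain_one_normalized cochain_mult_of)
qed

lemma cochain_mult_one_right:
  assumes "\<And>n. f n \<in> normalized_cochains n X"
  shows "cochain_mult X f (cochain_one X) = f"
proof
  fix n
  have "cup_value f (cochain_one X) n x = f n (frag_of x)" if x: "singular_simplex n X x" for x
  proof -
    have "cup_value f (cochain_one X) n x = (\<Sum>k\<in>{n}. (-1) ^ ((n - k) * k) *
        f k (frag_of (singular_interval x 0 k)) * cochain_one X (n - k) (frag_of (singular_interval x k (n - k))))"
      unfolding cup_value_def by (intro sum.mono_neutral_right) (auto simp: cochain_one_def)
    then show ?thesis
      using x singular_simplex_interval[OF x, of n 0]
      by (simp add: singular_interval_id cochain_one_eq to_cochain_of)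
  qed
  then show "cochain_mult X f (cochain_one X) n = f n"
    using assms by (intro normalized_cochain_eqI[OF cochain_mult_normalized])
      (auto simp: cochain_one_normalized cochain_mult_of)
qed

lemma cochain_mult_distrib_right:
  "cochain_mult X (\<lambda>n c. f n c + g n c) h = (\<lambda>n c. cochain_mult X f h n c + cochain_mult X g h n c)"
proof -
  have "cup_value (\<lambda>n c. f n c + g n c) h n = (\<lambda>x. cup_value f h n x + cup_value g h n x)" for n
    by (auto simp: cup_value_def fun_eq_iff algebra_simps sum.distrib)
  then show ?thesis
    by (intro ext) (simp add: cochain_mult_eq to_cochain_def frag_eval_plus)
qed

lemma cochain_mult_distrib_left:
  "cochain_mult X h (\<lambda>n c. f n c + g n c) = (\<lambda>n c. cochain_mult X h f n c + cochain_mult X h g n c)"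
proof -
  have "cup_value h (\<lambda>n c. f n c + g n c) n = (\<lambda>x. cup_value h f n x + cup_value h g n x)" for n
    by (auto simp: cup_value_def fun_eq_iff algebra_simps sum.distrib)
  then show ?thesis
    by (intro ext) (simp add: cochain_mult_eq to_cochain_def frag_eval_plus)
qed

lemma to_cochain_eq_zero: "(\<And>x. u x = 0) \<Longrightarrow> to_cochain n X u = (\<lambda>c. 0)"
  by (simp add: to_cochain_def frag_eval_def fun_eq_iff)

lemma finite_support_cochain_mult:
  assumes "finite {n. f n \<noteq> (\<lambda>c. 0)}" "finite {n. g n \<noteq> (\<lambda>c. 0)}"
  shows "finite {n. cochain_mult X f g n \<noteq> (\<lambda>c. 0)}"
proof -
  obtain N M where N: "\<And>n. f n \<noteq> (\<lambda>c. 0) \<Longrightarrow> n \<le> N" and M: "\<And>n. g n \<noteq> (\<lambda>c. 0) \<Longrightarrow> n \<le> M"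
    using assms unfolding finite_nat_set_iff_bounded_le by auto
  have "cochain_mult X f g n = (\<lambda>c. 0)" if "n > N + M" for n
    unfolding cochain_mult_eq
  proof (rule to_cochain_eq_zero)
    fix x
    have "f k = (\<lambda>c. 0) \<or> g (n - k) = (\<lambda>c. 0)" for k
    proof -
      have "\<not> (k \<le> N \<and> n - k \<le> M)" using that by linarith
      then show ?thesis using N M by blast
    qed
    then show "cup_value f g n x = 0"
      unfolding cup_value_def by (intro sum.neutral) (metis mult_zero_left mult_zero_right)
  qed
  then have "{n. cochain_mult X f g n \<noteq> (\<lambda>c. 0)} \<subseteq> {..N + M}"
    by (auto simp: not_le[symmetric])
  then show ?thesis using finite_subset by blast
qed

lemma cochain_dga_simps:
  "carrier (cochain_dga X) = {f. (\<forall>n. f n \<in> normalized_cochains n X) \<and> finite {n. f n \<noteq> (\<lambda>c. 0)}}"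
  "monoid.mult (cochain_dga X) = cochain_mult X"
  "one (cochain_dga X) = cochain_one X"
  "zero (cochain_dga X) = (\<lambda>n c. 0)"
  "add (cochain_dga X) = (\<lambda>f g n c. f n c + g n c)"
  "component (cochain_dga X) = (\<lambda>n. {f. f n \<in> normalized_cochains n X \<and> (\<forall>k. k \<noteq> n \<longrightarrow> f k = (\<lambda>c. 0))})"
  "diff (cochain_dga X) = cochain_diff X"
  by (simp_all add: cochain_dga_def)

lemma cochain_componentD:
  assumes "f \<in> component (cochain_dga X) i"
  shows "f n \<in> normalized_cochains n X" "n \<noteq> i \<Longrightarrow> f n = (\<lambda>c. 0)" "f \<in> carrier (cochain_dga X)"
proof -
  have f: "f i \<in> normalized_cochains i X" "\<And>k. k \<noteq> i \<Longrightarrow> f k = (\<lambda>c. 0)"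
    using assms by (auto simp: cochain_dga_simps)
  show f': "f n \<in> normalized_cochains n X" for n
    using f zero_normalized_cochain by (cases "n = i") auto
  show "n \<noteq> i \<Longrightarrow> f n = (\<lambda>c. 0)" by (rule f)
  have "{n. f n \<noteq> (\<lambda>c. 0)} \<subseteq> {i}" using f(2) by auto
  then show "f \<in> carrier (cochain_dga X)"
    using f' finite_subset by (auto simp: cochain_dga_simps)
qed

lemma cochain_carrierD: "f \<in> carrier (cochain_dga X) \<Longrightarrow> f n \<in> normalized_cochains n X"
  by (simp add: cochain_dga_simps)

lemma lincomb_cochain_carrier:
  assumes "f \<in> carrier (cochain_dga X)" "g \<in> carrier (cochain_dga X)"
  shows "(\<lambda>n c. k * f n c + l * g n c) \<in> carrier (cochain_dga X)"
proof -
  have "{n. (\<lambda>c. k * f n c + l * g n c) \<noteq> (\<lambda>c. 0)} \<subseteq> {n. f n \<noteq> (\<lambda>c. 0)} \<union> {n. g n \<noteq> (\<lambda>c. 0)}"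
    by (auto simp: fun_eq_iff)
  then have "finite {n. (\<lambda>c. k * f n c + l * g n c) \<noteq> (\<lambda>c. 0)}"
    using assms by (auto simp: cochain_dga_simps intro: finite_subset)
  then show ?thesis
    using assms by (simp add: cochain_dga_simps lincomb_normalized_cochain)
qed

lemma ring_cochain_dga: "ring (cochain_dga X)"
proof (rule ringI)
  show "abelian_group (cochain_dga X)"
  proof (rule abelian_groupI)
    fix f g assume "f \<in> carrier (cochain_dga X)" "g \<in> carrier (cochain_dga X)"
    then show "f \<oplus>\<^bsub>cochain_dga X\<^esub> g \<in> carrier (cochain_dga X)"
      using lincomb_cochain_carrier[of f X g 1 1] by (simp add: cochain_dga_simps(5))
  next
    fix f assume f: "f \<in> carrier (cochain_dga X)"
    show "\<exists>g\<in>carrier (cochain_dga X). g \<oplus>\<^bsub>cochain_dga X\<^esub> f = \<zero>\<^bsub>cochain_dga X\<^esub>"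
      using lincomb_cochain_carrier[OF f f, of "-1" 0]
      by (intro bexI[of _ "\<lambda>n c. - f n c"]) (simp_all add: cochain_dga_simps(4,5))
  qed (auto simp: cochain_dga_simps zero_normalized_cochain algebra_simps)
  show "monoid (cochain_dga X)"
  proof (rule monoidI)
    show "\<one>\<^bsub>cochain_dga X\<^esub> \<in> carrier (cochain_dga X)"
    proof -
      have "{n. cochain_one X n \<noteq> (\<lambda>c. 0)} \<subseteq> {0}" by (auto simp: cochain_one_def)
      then show ?thesis
        using finite_subset by (auto simp: cochain_dga_simps cochain_one_normalized)
    qed
  next
    fix f g assume "f \<in> carrier (cochain_dga X)" "g \<in> carrier (cochain_dga X)"
    then show "f \<otimes>\<^bsub>cochain_dga X\<^esub> g \<in> carrier (cochain_dga X)"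
      by (simp add: cochain_dga_simps cochain_mult_normalized finite_support_cochain_mult)
  qed (auto simp: cochain_dga_simps cochain_mult_assoc cochain_mult_one_left cochain_mult_one_right)
qed (simp_all add: cochain_dga_simps cochain_mult_distrib_left cochain_mult_distrib_right)

lemma cochain_dga_minus:
  assumes "f \<in> carrier (cochain_dga X)"
  shows "\<ominus>\<^bsub>cochain_dga X\<^esub> f = (\<lambda>n c. - f n c)"
proof -
  interpret ring "cochain_dga X" by (rule ring_cochain_dga)
  have "(\<lambda>n c. - f n c) \<in> carrier (cochain_dga X)"
    using lincomb_cochain_carrier[OF assms assms, of "-1" 0] by simp
  then show ?thesis
    using assms by (intro minus_equality) (simp_all add: cochain_dga_simps(4,5))
qed

lemma (in ring) minus_one_power_mult:
  assumes "x \<in> carrier R"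
  shows "((\<ominus> \<one>) [^] (i::nat)) \<otimes> x = (if even i then x else \<ominus> x)"
proof -
  have "(\<ominus> \<one>) [^] (i::nat) = (if even i then \<one> else \<ominus> \<one>)"
    by (induction i) (auto simp: l_minus r_minus)
  then show ?thesis using assms by (auto simp: l_minus)
qed

lemma cochain_dga_sign_mult:
  assumes "f \<in> carrier (cochain_dga X)"
  shows "((\<ominus>\<^bsub>cochain_dga X\<^esub> \<one>\<^bsub>cochain_dga X\<^esub>) [^]\<^bsub>cochain_dga X\<^esub> (i::nat)) \<otimes>\<^bsub>cochain_dga X\<^esub> f
     = (\<lambda>n c. (-1) ^ i * f n c)"
  using ring.minus_one_power_mult[OF ring_cochain_dga assms, of i] cochain_dga_minus[OF assms]
  by auto

lemma finsum_cochain_dga: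
  assumes "finite I" "\<And>i. i \<in> I \<Longrightarrow> F i \<in> carrier (cochain_dga X)"
  shows "finsum (cochain_dga X) F I = (\<lambda>n c. \<Sum>i\<in>I. F i n c)"
proof -
  interpret ring "cochain_dga X" by (rule ring_cochain_dga)
  show ?thesis
    using assms by (induction I rule: finite_induct) (auto simp: Pi_def cochain_dga_simps(4,5))
qed

lemma cochain_mult_component:
  assumes f: "f \<in> component (cochain_dga X) i" and g: "g \<in> component (cochain_dga X) j"
  shows "cup_value f g n x = (if n = i + j then (-1) ^ (i * j) *
     f i (frag_of (singular_interval x 0 i)) * g j (frag_of (singular_interval x i j)) else 0)"
proof -
  have "cup_value f g n x = (\<Sum>k\<in>{k. k \<le> n \<and> k = i \<and> n - k = j}. (-1) ^ ((n - k) * k) * f k (frag_of (singular_interval x 0 k))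
             * g (n - k) (frag_of (singular_interval x k (n - k))))"
    unfolding cup_value_def
  proof (rule sum.mono_neutral_right)
    have "f k = (\<lambda>c. 0) \<or> g (n - k) = (\<lambda>c. 0)" if "\<not> (k = i \<and> n - k = j)" for k
      using cochain_componentD(2)[OF f] cochain_componentD(2)[OF g] that by blast
    then show "\<forall>k\<in>{..n} - {k. k \<le> n \<and> k = i \<and> n - k = j}. (-1) ^ ((n - k) * k) * f k (frag_of (singular_interval x 0 k))
             * g (n - k) (frag_of (singular_interval x k (n - k))) = 0"
      by (auto, (metis mult_zero_left mult_zero_right)+)
  qed auto
  also have "{k. k \<le> n \<and> k = i \<and> n - k = j} = (if n = i + j then {i} else {})"
    by auto
  finally show ?thesis by (simp add: mult.commute)
qed

lemma cochain_diff_component: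
  assumes "f \<in> component (cochain_dga X) i"
  shows "cochain_diff X f \<in> component (cochain_dga X) (Suc i)"
proof -
  note f = cochain_componentD[OF assms]
  have "cochain_diff X f k = (\<lambda>c. 0)" if "k \<noteq> Suc i" for k
    using f(2)[of "k - 1"] that by (cases k) (auto simp: cochain_diff_def fun_eq_iff)
  then show ?thesis
    using cochain_diff_normalized[OF f(1)] by (simp add: cochain_dga_simps)
qed

lemma cochain_diff_of:
  assumes "f n \<in> normalized_cochains n X" "singular_simplex (Suc n) X x"
  shows "cochain_diff X f (Suc n) (frag_of x) = - ((-1) ^ n) * face_sum n (f n) x"
  using assms by (simp add: cochain_diff_def singular_chain_of cochain_boundary_of)

text \<open>The Leibniz rule before the sign conventions enter. Faces up to \<open>i\<close> alter
  the front piece and later ones the back piece. Completing both groups to full boundaries adds the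
  last face of the front and the first face of the back, which yield the same product with opposite
  signs.\<close>

lemma face_sum_split:
  assumes x: "singular_simplex (Suc (i + j)) X x"
    and g: "\<And>y. singular_simplex (i + j) X y \<Longrightarrow>
       g (frag_of y) = u (frag_of (singular_interval y 0 i)) * v (frag_of (singular_interval y i j))"
  shows "face_sum (i + j) g x = face_sum i u (singular_interval x 0 (Suc i)) * v (frag_of (singular_interval x (Suc i) j))
      + (-1) ^ i * (u (frag_of (singular_interval x 0 i)) * face_sum j v (singular_interval x i (Suc j)))"
proof -
  define a where "a k = (-1) ^ k * u (frag_of (singular_face (Suc i) k (singular_interval x 0 (Suc i))))
     * v (frag_of (singular_interval x (Suc i) j))" for k
  define b where "b k = (-1) ^ (i + k) * u (frag_of (singular_interval x 0 i)) *
     v (frag_of (singular_face (Suc j) k (singular_interval x i (Suc j))))" for k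
  have face: "singular_simplex (i + j) X (singular_face (Suc (i + j)) k x)" if "k \<le> Suc (i + j)" for k
    using singular_simplex_singular_face[OF x, of k] that by simp
  have right: "singular_interval (singular_face (Suc (i + j)) k x) i j = singular_interval x (Suc i) j" if "k \<le> i" for k
    using that by (auto simp: singular_face_eq_reindex singular_interval_eq_reindex reindex_reindex skip_def intro!: reindex_cong)
  have left: "singular_interval (singular_face (Suc (i + j)) k x) 0 i = singular_interval x 0 i" if "i < k" "k \<le> Suc (i + j)" for k
    using that by (auto simp: singular_face_eq_reindex singular_interval_eq_reindex reindex_reindex skip_def intro!: reindex_cong)
  have "face_sum (i + j) g x = (\<Sum>k\<le>Suc (i + j). if k \<le> i then a k else b (k - i))"
    unfolding face_sum_def
  proof (intro sum.cong refl)
    fix k assume "k \<in> {..Suc (i + j)}"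
    then have k: "k \<le> Suc (i + j)" by simp
    show "(-1) ^ k * g (frag_of (singular_face (Suc (i + j)) k x)) = (if k \<le> i then a k else b (k - i))"
    proof (cases "k \<le> i")
      case True
      then show ?thesis
        using singular_interval_face_left[of k i "Suc (i + j)" x] g[OF face[OF k]]
        by (simp add: a_def right)
    next
      case False
      then show ?thesis
        using singular_interval_face_right[of "k - i" j i "Suc (i + j)" x] g[OF face[OF k]] k
        by (simp add: b_def left)
    qed
  qed
  also have "\<dots> = (\<Sum>k\<in>{..i} \<union> {Suc i..Suc (i + j)}. if k \<le> i then a k else b (k - i))"
    by (intro sum.cong) auto
  also have "\<dots> = (\<Sum>k\<le>i. a k) + (\<Sum>k\<in>{Suc i..Suc (i + j)}. b (k - i))"
    by (subst sum.union_disjoint) (auto intro!: sum.cong arg_cong2[where f = "(+)"])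
  also have "(\<Sum>k\<in>{Suc i..Suc (i + j)}. b (k - i)) = (\<Sum>k\<le>j. b (Suc k))"
    by (rule sum.reindex_bij_witness[where i = "\<lambda>k. k + Suc i" and j = "\<lambda>k. k - Suc i"])
      (auto simp: Suc_diff_le[symmetric])
  also have "(\<Sum>k\<le>i. a k) + (\<Sum>k\<le>j. b (Suc k)) = (\<Sum>k\<le>Suc i. a k) + (\<Sum>k\<le>Suc j. b k)"
  proof -
    have "a (Suc i) + b 0 = 0"
    proof -
      have "singular_face (Suc i) (Suc i) (singular_interval x 0 (Suc i)) = singular_interval x 0 i"
        by (auto simp: singular_face_eq_reindex singular_interval_eq_reindex reindex_reindex skip_def intro!: reindex_cong)
      moreover have "singular_face (Suc j) 0 (singular_interval x i (Suc j)) = singular_interval x (Suc i) j"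
        by (auto simp: singular_face_eq_reindex singular_interval_eq_reindex reindex_reindex skip_def intro!: reindex_cong)
      ultimately show ?thesis by (simp add: a_def b_def)
    qed
    then show ?thesis
      by (subst (2) sum.atMost_Suc_shift) simp
  qed
  also have "(\<Sum>k\<le>Suc i. a k) = face_sum i u (singular_interval x 0 (Suc i)) * v (frag_of (singular_interval x (Suc i) j))"
    by (simp only: a_def face_sum_def sum_distrib_right)
  also have "(\<Sum>k\<le>Suc j. b k) = (-1) ^ i * (u (frag_of (singular_interval x 0 i)) * face_sum j v (singular_interval x i (Suc j)))"
    by (simp only: b_def face_sum_def sum_distrib_left power_add mult_ac)
  finally show ?thesis .
qed

lemma cochain_leibniz:
  assumes f: "f \<in> component (cochain_dga X) i" and g: "g \<in> component (cochain_dga X) j"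
  shows "cochain_diff X (cochain_mult X f g) =
     (\<lambda>n c. cochain_mult X (cochain_diff X f) g n c + (-1) ^ i * cochain_mult X f (cochain_diff X g) n c)"
proof
  fix n
  note fg = cochain_componentD[OF f] cochain_componentD[OF g]
  note dfg = cochain_diff_component[OF f] cochain_diff_component[OF g]
  note dfg' = cochain_componentD[OF dfg(1)] cochain_componentD[OF dfg(2)]
  have fgn: "cochain_mult X f g k \<in> normalized_cochains k X" for k
    by (intro cochain_mult_normalized fg)
  have rhs: "(\<lambda>c. cochain_mult X (cochain_diff X f) g n c + (-1) ^ i * cochain_mult X f (cochain_diff X g) n c)
      \<in> normalized_cochains n X"
    using lincomb_normalized_cochain[of "cochain_mult X (cochain_diff X f) g n" n X
        "cochain_mult X f (cochain_diff X g) n" 1 "(-1) ^ i"]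
      cochain_mult_normalized[OF dfg'(1) fg(4)] cochain_mult_normalized[OF fg(1) dfg'(4)] by simp
  show "cochain_diff X (cochain_mult X f g) n =
      (\<lambda>c. cochain_mult X (cochain_diff X f) g n c + (-1) ^ i * cochain_mult X f (cochain_diff X g) n c)"
  proof (rule normalized_cochain_eqI[OF cochain_diff_normalized[OF fgn] rhs])
    fix x assume x: "singular_simplex n X x"
    note v = cochain_mult_component[OF dfg(1) g, of n x] cochain_mult_component[OF f dfg(2), of n x]
    show "cochain_diff X (cochain_mult X f g) n (frag_of x) = cochain_mult X (cochain_diff X f) g n (frag_of x)
        + (-1) ^ i * cochain_mult X f (cochain_diff X g) n (frag_of x)"
    proof (cases "n = Suc (i + j)")
      case True
      note x' = x[unfolded True]
      \<comment> \<open>The sign of the cup product is absorbed into the left factor, giving the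
        product form that \<open>face_sum_split\<close> requires.\<close>
      let ?u = "\<lambda>c. (-1) ^ (i * j) * f i c"
      have "face_sum (i + j) (cochain_mult X f g (i + j)) x = face_sum i ?u (singular_interval x 0 (Suc i)) * g j (frag_of (singular_interval x (Suc i) j))
         + (-1) ^ i * (?u (frag_of (singular_interval x 0 i)) * face_sum j (g j) (singular_interval x i (Suc j)))"
        by (rule face_sum_split[OF x']) (simp add: cochain_mult_of cochain_mult_component[OF f g])
      moreover have "face_sum i ?u (singular_interval x 0 (Suc i)) = (-1) ^ (i * j) * face_sum i (f i) (singular_interval x 0 (Suc i))"
        by (simp only: face_sum_def sum_distrib_left mult_ac)
      moreover have "cochain_diff X f (Suc i) (frag_of (singular_interval x 0 (Suc i))) = - ((-1) ^ i) * face_sum i (f i) (singular_interval x 0 (Suc i))"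
        using singular_simplex_interval[OF x', of 0 "Suc i"] fg by (intro cochain_diff_of) auto
      moreover have "cochain_diff X g (Suc j) (frag_of (singular_interval x i (Suc j))) = - ((-1) ^ j) * face_sum j (g j) (singular_interval x i (Suc j))"
        using singular_simplex_interval[OF x', of i "Suc j"] fg by (intro cochain_diff_of) auto
      ultimately show ?thesis
        using x' fgn by (simp add: True cochain_diff_of cochain_mult_of v[unfolded True] power_add algebra_simps)
    next
      case False
      then have "cochain_diff X (cochain_mult X f g) n (frag_of x) = 0"
      proof (cases n)
        case (Suc k)
        then have "cup_value f g k = (\<lambda>x. 0)" using False by (auto simp: cochain_mult_component[OF f g])
        then have "cochain_mult X f g k = (\<lambda>c. 0)" by (simp add: cochain_mult_eq to_cochain_zero)
        then show ?thesis by (simp add: cochain_diff_def Suc)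
      qed (simp add: cochain_diff_def)
      then show ?thesis using x False by (simp add: cochain_mult_of v)
    qed
  qed
qed

lemma cochain_diff_diff:
  assumes "\<And>n. f n \<in> normalized_cochains n X"
  shows "cochain_diff X (cochain_diff X f) = (\<lambda>n c. 0)"
proof (intro ext)
  fix n c
  show "cochain_diff X (cochain_diff X f) n c = 0"
  proof (cases "n \<ge> 2 \<and> singular_chain n X c")
    case True
    then have "singular_chain (n - 1) X (chain_boundary n c)" "chain_boundary (n - 1) (chain_boundary n c) = 0"
      using singular_chain_boundary[of n X c] chain_boundary_boundary[of n X c] by auto
    moreover have "f (n - 1 - 1) 0 = 0"
      using normalized_cochain_eval[OF assms singular_chain_0] by simp
    ultimately show ?thesis by (simp add: cochain_diff_def)
  next
    case False
    then have "n = 0 \<or> n = 1 \<or> \<not> singular_chain n X c" by auto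
    then show ?thesis by (auto simp: cochain_diff_def)
  qed
qed

lemma cochain_diff_add:
  "cochain_diff X (\<lambda>n c. f n c + g n c) = (\<lambda>n c. cochain_diff X f n c + cochain_diff X g n c)"
  by (auto simp: cochain_diff_def fun_eq_iff algebra_simps)

lemma cochain_component_single:
  "f n \<in> normalized_cochains n X \<Longrightarrow> (\<lambda>k. if k = n then f n else (\<lambda>c. 0)) \<in> component (cochain_dga X) n"
  by (simp add: cochain_dga_simps)

lemma dga_cochain_dga: "dga (cochain_dga X)"
proof -
  let ?C = "cochain_dga X"
  interpret ring ?C by (rule ring_cochain_dga)
  show ?thesis
  proof (intro dga.intro ring_cochain_dga dga_axioms.intro)
    fix n
    show "additive_subgroup (component ?C n) ?C"
    proof
      show "component ?C n \<subseteq> carrier (add_monoid ?C)"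
        using cochain_componentD(3) by auto
      show "\<one>\<^bsub>add_monoid ?C\<^esub> \<in> component ?C n"
        by (simp add: cochain_dga_simps zero_normalized_cochain)
      fix f g assume f: "f \<in> component ?C n" and g: "g \<in> component ?C n"
      show "f \<otimes>\<^bsub>add_monoid ?C\<^esub> g \<in> component ?C n"
        using f g lincomb_normalized_cochain[of "f n" n X "g n" 1 1]
        by (simp add: cochain_dga_simps fun_eq_iff)
      have "\<ominus>\<^bsub>?C\<^esub> f \<in> component ?C n"
        using f lincomb_normalized_cochain[of "f n" n X "f n" "-1" 0]
        by (simp add: cochain_dga_minus[OF cochain_componentD(3)[OF f]] cochain_dga_simps(6) fun_eq_iff)
      then show "inv\<^bsub>add_monoid ?C\<^esub> f \<in> component ?C n"
        by (simp add: a_inv_def)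
    qed
  next
    show "\<one>\<^bsub>?C\<^esub> \<in> component ?C 0"
      by (auto simp: cochain_dga_simps cochain_one_normalized) (simp add: cochain_one_def)
  next
    fix f g i j assume f: "f \<in> component ?C i" and g: "g \<in> component ?C j"
    have "cochain_mult X f g k = (\<lambda>c. 0)" if "k \<noteq> i + j" for k
      unfolding cochain_mult_eq using that
      by (intro to_cochain_eq_zero) (simp add: cochain_mult_component[OF f g])
    then show "f \<otimes>\<^bsub>?C\<^esub> g \<in> component ?C (i + j)"
      using cochain_mult_normalized[OF cochain_componentD(1)[OF f] cochain_componentD(1)[OF g]]
      by (simp add: cochain_dga_simps)
    show "diff ?C (f \<otimes>\<^bsub>?C\<^esub> g) = diff ?C f \<otimes>\<^bsub>?C\<^esub> g \<oplus>\<^bsub>?C\<^esub> ((\<ominus>\<^bsub>?C\<^esub> \<one>\<^bsub>?C\<^esub>) [^]\<^bsub>?C\<^esub> i) \<otimes>\<^bsub>?C\<^esub> (f \<otimes>\<^bsub>?C\<^esub> diff ?C g)"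
    proof -
      have "f \<otimes>\<^bsub>?C\<^esub> diff ?C g \<in> carrier ?C"
        using cochain_componentD(3)[OF f] cochain_componentD(3)[OF cochain_diff_component[OF g]]
        by (simp add: cochain_dga_simps(7))
      then show ?thesis
        unfolding cochain_dga_sign_mult[OF \<open>f \<otimes>\<^bsub>?C\<^esub> diff ?C g \<in> carrier ?C\<close>]
        using cochain_leibniz[OF f g] by (simp add: cochain_dga_simps(2,5,7))
    qed
  next
    fix f assume f: "f \<in> carrier ?C"
    let ?F = "\<lambda>f n k. if k = n then f n else (\<lambda>c. 0)"
    have fn: "\<And>n. f n \<in> normalized_cochains n X" and fin: "finite {n. f n \<noteq> (\<lambda>c. 0)}"
      using f by (auto simp: cochain_dga_simps)
    show "diff ?C (diff ?C f) = \<zero>\<^bsub>?C\<^esub>"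
      by (simp add: cochain_dga_simps cochain_diff_diff[OF fn])
    have sum: "finsum ?C h {n. h n \<noteq> \<zero>\<^bsub>?C\<^esub>} = (\<lambda>k. h k k)"
      if "\<And>n. h n \<in> component ?C n" "finite {n. h n \<noteq> \<zero>\<^bsub>?C\<^esub>}" for h
    proof -
      have "finsum ?C h {n. h n \<noteq> \<zero>\<^bsub>?C\<^esub>} = (\<lambda>k c. \<Sum>n\<in>{n. h n \<noteq> \<zero>\<^bsub>?C\<^esub>}. h n k c)"
        using that cochain_componentD(3) by (intro finsum_cochain_dga) auto
      also have "\<dots> = (\<lambda>k c. h k k c)"
      proof (intro ext)
        fix k c
        have "(\<Sum>n\<in>{n. h n \<noteq> \<zero>\<^bsub>?C\<^esub>}. h n k c) = (\<Sum>n\<in>{n. h n \<noteq> \<zero>\<^bsub>?C\<^esub>}. if n = k then h k k c else 0)"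
          using cochain_componentD(2)[OF that(1)] by (intro sum.cong) (auto simp: fun_eq_iff)
        also have "\<dots> = h k k c"
          using that(2) by (auto simp: cochain_dga_simps)
        finally show "(\<Sum>n\<in>{n. h n \<noteq> \<zero>\<^bsub>?C\<^esub>}. h n k c) = h k k c" .
      qed
      finally show ?thesis .
    qed
    show "\<exists>!h. (\<forall>n. h n \<in> component ?C n) \<and> finite {n. h n \<noteq> \<zero>\<^bsub>?C\<^esub>} \<and> f = finsum ?C h {n. h n \<noteq> \<zero>\<^bsub>?C\<^esub>}"
    proof (rule ex1I[of _ "?F f"])
      have "{n. ?F f n \<noteq> \<zero>\<^bsub>?C\<^esub>} \<subseteq> {n. f n \<noteq> (\<lambda>c. 0)}"
        by (auto simp: cochain_dga_simps fun_eq_iff split: if_splits)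
      then have "finite {n. ?F f n \<noteq> \<zero>\<^bsub>?C\<^esub>}" using fin finite_subset by blast
      moreover have "\<And>n. ?F f n \<in> component ?C n"
        using fn cochain_component_single by blast
      ultimately show "(\<forall>n. ?F f n \<in> component ?C n) \<and> finite {n. ?F f n \<noteq> \<zero>\<^bsub>?C\<^esub>} \<and>
          f = finsum ?C (?F f) {n. ?F f n \<noteq> \<zero>\<^bsub>?C\<^esub>}"
        using sum[of "?F f"] by simp
    next
      fix h assume h: "(\<forall>n. h n \<in> component ?C n) \<and> finite {n. h n \<noteq> \<zero>\<^bsub>?C\<^esub>} \<and>
          f = finsum ?C h {n. h n \<noteq> \<zero>\<^bsub>?C\<^esub>}"
      then have "f = (\<lambda>k. h k k)" using sum[of h] by simp
      moreover have "h n k = (\<lambda>c. 0)" if "k \<noteq> n" for n k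
        using h cochain_componentD(2)[of "h n" X n k] that by blast
      ultimately show "h = ?F f"
        by (intro ext) simp
    qed
  next
    fix f n assume "f \<in> component ?C n"
    then show "diff ?C f \<in> component ?C (Suc n)"
      by (simp add: cochain_dga_simps(7) cochain_diff_component)
  next
    fix f g show "diff ?C (f \<oplus>\<^bsub>?C\<^esub> g) = diff ?C f \<oplus>\<^bsub>?C\<^esub> diff ?C g"
      by (simp add: cochain_dga_simps(5,7) cochain_diff_add)
  qed
qed

section \<open>Affine simplices and their vertices\<close>

definition affine_simplex :: "nat \<Rightarrow> nat \<Rightarrow> (nat \<Rightarrow> nat \<Rightarrow> real) \<Rightarrow> (nat \<Rightarrow> real) \<Rightarrow> nat \<Rightarrow> real" where
  "affine_simplex m n V = restrict (\<lambda>t. \<lambda>i\<in>{1..m}. \<Sum>k\<le>n. V k i * t k) (standard_simplex n)"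

lemma affine_simplex_cong:
  "(\<And>k i. \<lbrakk>k \<le> n; i \<in> {1..m}\<rbrakk> \<Longrightarrow> V k i = W k i) \<Longrightarrow> affine_simplex m n V = affine_simplex m n W"
  unfolding affine_simplex_def by (intro restrict_ext) (auto intro!: sum.cong)

lemma reindex_affine_simplex:
  assumes "\<And>k. k \<le> l \<Longrightarrow> \<theta> k \<le> n"
  shows "reindex l \<theta> (affine_simplex m n V) = affine_simplex m l (\<lambda>k. V (\<theta> k))"
  unfolding reindex_def affine_simplex_def
  using push_in_standard_simplex[OF assms] sum_push[OF assms]
  by (auto simp: fun_eq_iff restrict_def)

definition basis_point :: "nat \<Rightarrow> nat \<Rightarrow> real" where
  "basis_point k = (\<lambda>j. if j = k then 1 else 0)"

lemma basis_point_in: "k \<le> n \<Longrightarrow> basis_point k \<in> standard_simplex n"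
  by (simp add: basis_point_def)

lemma affine_simplex_basis_point:
  assumes "k \<le> n" "i \<in> {1..m}"
  shows "affine_simplex m n V (basis_point k) i = V k i"
proof -
  have "(\<Sum>j\<le>n. V j i * basis_point k j) = (\<Sum>j\<le>n. if j = k then V k i else 0)"
    by (intro sum.cong) (auto simp: basis_point_def)
  then show ?thesis using assms basis_point_in[OF assms(1)] by (simp add: affine_simplex_def)
qed

lemma affine_simplex_eqD:
  "\<lbrakk>affine_simplex m n V = affine_simplex m n W; k \<le> n; i \<in> {1..m}\<rbrakk> \<Longrightarrow> V k i = W k i"
  by (metis affine_simplex_basis_point)

lemma degenerate_affine_simplex:
  assumes "degenerate_simplex n X (affine_simplex m n V)"
  obtains j where "j < n" "\<And>i. i \<in> {1..m} \<Longrightarrow> V (Suc j) i = V j i"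
proof -
  let ?\<theta> = "\<lambda>j k. if k = Suc j then j else k"
  obtain j where j: "j < n" "affine_simplex m n V = reindex n (?\<theta> j) (affine_simplex m n V)"
    using degenerate_simplexE[OF assms] by metis
  have "reindex n (?\<theta> j) (affine_simplex m n V) = affine_simplex m n (\<lambda>k. V (?\<theta> j k))"
    using j(1) by (intro reindex_affine_simplex) auto
  with j(2) have "V (Suc j) i = V j i" if "i \<in> {1..m}" for i
    using affine_simplex_eqD[of m n V "\<lambda>k. V (?\<theta> j k)" "Suc j" i] that j(1) by simp
  with that j(1) show thesis by blast
qed

lemma singular_simplex_affine:
  assumes "\<And>t. t \<in> standard_simplex n \<Longrightarrow> (\<lambda>i\<in>{1..m}. \<Sum>k\<le>n. V k i * t k) \<in> S"
  shows "singular_simplex n (subtopology (powertop_real {1..m}) S) (affine_simplex m n V)"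
proof -
  have "continuous_map (subtopology (powertop_real UNIV) (standard_simplex n)) euclideanreal
     (\<lambda>t. \<Sum>k\<le>n. V k i * t k)" for i
    by (force intro: continuous_intros continuous_map_from_subtopology continuous_map_product_projection)
  then have "continuous_map (subtopology (powertop_real UNIV) (standard_simplex n)) (powertop_real {1..m})
     (\<lambda>t. \<lambda>i\<in>{1..m}. \<Sum>k\<le>n. V k i * t k)"
    by (auto simp: continuous_map_componentwise)
  then show ?thesis
    unfolding singular_simplex_def continuous_map_in_subtopology affine_simplex_def
    using assms by (auto elim: continuous_map_eq)
qed

section \<open>Cubical faces and their triangulations\<close>

text \<open>A face of the cube \<open>[-1, 1]\<^sup>m\<close> is encoded by a function with values in \<open>{-1, 0, 1}\<close>, where
  \<open>0\<close> marks a free coordinate.\<close>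

definition zeros :: "nat \<Rightarrow> (nat \<Rightarrow> real) \<Rightarrow> nat set" where
  "zeros m f = {i\<in>{1..m}. f i = 0}"

definition cube_faces :: "nat \<Rightarrow> nat set set \<Rightarrow> (nat \<Rightarrow> real) set" where
  "cube_faces m \<Sigma> = {f \<in> {1..m} \<rightarrow>\<^sub>E {-1, 0, 1}. zeros m f \<in> \<Sigma>}"

text \<open>A list of the free coordinates of a face determines the path that raises them one after the
  other from \<open>-1\<close> to \<open>1\<close>.\<close>

definition path_vertex :: "(nat \<Rightarrow> real) \<Rightarrow> nat list \<Rightarrow> nat \<Rightarrow> nat \<Rightarrow> real" where
  "path_vertex f l k = (\<lambda>i. if i \<in> set (take k l) then 1 else if i \<in> set l then -1 else f i)"

definition path_simplex :: "nat \<Rightarrow> (nat \<Rightarrow> real) \<Rightarrow> nat list \<Rightarrow> (nat \<Rightarrow> real) \<Rightarrow> nat \<Rightarrow> real" where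
  "path_simplex m f l = affine_simplex m (length l) (path_vertex f l)"

text \<open>The parity of the number of inversions. The recursion on lists treats orderings of an
  arbitrary finite set of coordinates without renumbering them.\<close>

fun perm_sign :: "nat list \<Rightarrow> int" where
  "perm_sign [] = 1"
| "perm_sign (a # l) = (-1) ^ card {b \<in> set l. b < a} * perm_sign l"

text \<open>The iterated Eilenberg--Zilber shuffle product of the oriented intervals in the free
  directions.\<close>

definition cube_chain :: "nat \<Rightarrow> (nat \<Rightarrow> real) \<Rightarrow> (nat \<Rightarrow> real) chain" where
  "cube_chain m f = (\<Sum>l\<in>permutations_of_set (zeros m f). frag_cmul (perm_sign l) (frag_of (path_simplex m f l)))"

lemma finite_zeros [simp]: "finite (zeros m f)" and zeros_subset: "zeros m f \<subseteq> {1..m}"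
  by (auto simp: zeros_def)

lemma length_permutations_zeros: "l \<in> permutations_of_set (zeros m f) \<Longrightarrow> length l = card (zeros m f)"
  by (rule length_finite_permutations_of_set)

definition fix_coords :: "nat set \<Rightarrow> real \<Rightarrow> (nat \<Rightarrow> real) \<Rightarrow> nat \<Rightarrow> real" where
  "fix_coords A c f = (\<lambda>i. if i \<in> A then c else f i)"

lemma zeros_fix_coords: "c \<noteq> 0 \<Longrightarrow> zeros m (fix_coords A c f) = zeros m f - A"
  by (auto simp: zeros_def fix_coords_def)

lemma fix_coords_cube_faces:
  assumes "simplicial_complex_on m \<Sigma>" "f \<in> cube_faces m \<Sigma>" "A \<subseteq> zeros m f" "c = 1 \<or> c = -1"
  shows "fix_coords A c f \<in> cube_faces m \<Sigma>"
proof -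
  have "zeros m (fix_coords A c f) \<in> \<Sigma>"
    using assms zeros_fix_coords[of c m A f] unfolding cube_faces_def simplicial_complex_on_def by auto
  moreover have "fix_coords A c f \<in> {1..m} \<rightarrow>\<^sub>E {-1, 0, 1}"
    using assms(2-4) zeros_subset[of m f] by (auto simp: cube_faces_def fix_coords_def PiE_iff extensional_def)
  ultimately show ?thesis by (simp add: cube_faces_def)
qed

lemma finite_cube_faces [simp]: "finite (cube_faces m \<Sigma>)"
proof -
  have "finite ({1..m} \<rightarrow>\<^sub>E {-1, 0, 1::real})" by (intro finite_PiE) auto
  then show ?thesis by (auto simp: cube_faces_def)
qed

text \<open>Along a front piece the directions traversed later are still at \<open>-1\<close>;
  dually, along a back piece the earlier ones have already arrived at \<open>1\<close>.\<close>

lemma singular_interval_path_left: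
  assumes "distinct (l1 @ l2)"
  shows "singular_interval (path_simplex m f (l1 @ l2)) 0 (length l1) =
     path_simplex m (fix_coords (set l2) (-1) f) l1"
  unfolding path_simplex_def singular_interval_eq_reindex
  using assms by (subst reindex_affine_simplex)
    (auto simp: path_vertex_def fix_coords_def intro!: affine_simplex_cong dest: in_set_takeD)

lemma singular_interval_path_right:
  assumes "distinct (l1 @ l2)"
  shows "singular_interval (path_simplex m f (l1 @ l2)) (length l1) (length l2) =
     path_simplex m (fix_coords (set l1) 1 f) l2"
  unfolding path_simplex_def singular_interval_eq_reindex
  using assms by (subst reindex_affine_simplex)
    (auto simp: path_vertex_def fix_coords_def intro!: affine_simplex_cong dest: in_set_takeD)

lemma path_point_in:
  assumes f: "f \<in> {1..m} \<rightarrow>\<^sub>E {-1, 0, 1}" and l: "set l = zeros m f"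
    and t: "t \<in> standard_simplex (length l)" and i: "i \<in> {1..m}"
  shows "(\<Sum>k\<le>length l. path_vertex f l k i * t k) \<in> {-1..1}"
    and "f i \<noteq> 0 \<Longrightarrow> (\<Sum>k\<le>length l. path_vertex f l k i * t k) = f i"
proof -
  have t: "\<And>k. 0 \<le> t k" "(\<Sum>k\<le>length l. t k) = 1"
    using t by (auto simp: standard_simplex_def)
  have "\<bar>path_vertex f l k i\<bar> \<le> 1" for k
    using f i by (force simp: path_vertex_def PiE_iff)
  then have "\<bar>\<Sum>k\<le>length l. path_vertex f l k i * t k\<bar> \<le> (\<Sum>k\<le>length l. 1 * t k)"
    using t(1) by (intro order_trans[OF sum_abs] sum_mono) (simp add: abs_mult mult_left_le_one_le)
  then show "(\<Sum>k\<le>length l. path_vertex f l k i * t k) \<in> {-1..1}"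
    using t(2) by (auto simp: abs_le_iff)
  show "(\<Sum>k\<le>length l. path_vertex f l k i * t k) = f i" if "f i \<noteq> 0"
  proof -
    have "i \<notin> set l" using l that by (auto simp: zeros_def)
    then have "path_vertex f l k i = f i" for k
      by (auto simp: path_vertex_def dest: in_set_takeD)
    then show ?thesis using t(2) by (simp flip: sum_distrib_left)
  qed
qed

lemma singular_simplex_path:
  assumes f: "f \<in> cube_faces m \<Sigma>" and l: "l \<in> permutations_of_set (zeros m f)"
  shows "singular_simplex (length l) (real_moment_angle m \<Sigma>) (path_simplex m f l)"
  unfolding real_moment_angle_def path_simplex_def
proof (rule singular_simplex_affine)
  fix t assume t: "t \<in> standard_simplex (length l)"
  have f': "f \<in> {1..m} \<rightarrow>\<^sub>E {-1, 0, 1}" "zeros m f \<in> \<Sigma>" using f by (auto simp: cube_faces_def)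
  have l': "set l = zeros m f" using l by (rule permutations_of_setD)
  note p = path_point_in[OF f'(1) l' t]
  have "(\<Sum>k\<le>length l. path_vertex f l k i * t k) \<in> {-1, 1}" if "i \<in> {1..m}" "i \<notin> zeros m f" for i
    using p(2)[OF that(1)] that f'(1) by (auto simp: zeros_def PiE_iff)
  then show "(\<lambda>i\<in>{1..m}. \<Sum>k\<le>length l. path_vertex f l k i * t k) \<in> real_moment_angle_set m \<Sigma>"
    unfolding real_moment_angle_set_def using f'(2) p(1)
    by (intro UN_I[of "zeros m f"]) auto
qed

lemma singular_chain_cube_chain:
  assumes "f \<in> cube_faces m \<Sigma>"
  shows "singular_chain (card (zeros m f)) (real_moment_angle m \<Sigma>) (cube_chain m f)"
  unfolding cube_chain_def
  using singular_simplex_path[OF assms]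
  by (intro singular_chain_sum singular_chain_cmul)
    (simp add: singular_chain_of length_permutations_zeros)

text \<open>Both the nondegeneracy of paths and the recovery of the list from the vertices rest on
  this.\<close>

lemma path_vertex_step:
  assumes "distinct l" "j < length l"
  shows "path_vertex f l (Suc j) i \<noteq> path_vertex f l j i \<longleftrightarrow> i = l ! j"
proof -
  have "l ! j \<notin> set (take j l)"
    using assms by (metis Suc_leI distinct_take id_take_nth_drop not_distinct_conv_prefix take_Suc_conv_app_nth)
  then show ?thesis
    using assms by (auto simp: path_vertex_def take_Suc_conv_app_nth dest: in_set_takeD)
qed

lemma path_simplex_nondegenerate:
  assumes "distinct l" "set l \<subseteq> {1..m}"
  shows "\<not> degenerate_simplex (length l) X (path_simplex m f l)"
proof
  assume "degenerate_simplex (length l) X (path_simplex m f l)"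
  then obtain j where "j < length l" "\<And>i. i \<in> {1..m} \<Longrightarrow> path_vertex f l (Suc j) i = path_vertex f l j i"
    unfolding path_simplex_def using degenerate_affine_simplex by metis
  then show False
    using path_vertex_step[OF assms(1), of j f "l ! j"] assms(2) nth_mem by blast
qed

lemma path_simplex_inject:
  assumes f: "f \<in> {1..m} \<rightarrow>\<^sub>E {-1, 0, 1}" and l: "l \<in> permutations_of_set (zeros m f)"
    and g: "g \<in> {1..m} \<rightarrow>\<^sub>E {-1, 0, 1}" and l': "l' \<in> permutations_of_set (zeros m g)"
    and len: "length l = length l'" and eq: "path_simplex m f l = path_simplex m g l'"
  shows "f = g \<and> l = l'"
proof -
  note ll = permutations_of_setD[OF l] permutations_of_setD[OF l']
  have v: "path_vertex f l k i = path_vertex g l' k i" if "k \<le> length l" "i \<in> {1..m}" for k i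
    using eq that len affine_simplex_eqD[of m "length l"] unfolding path_simplex_def by metis
  \<comment> \<open>The encoding is the midpoint of the two ends of the path: a free coordinate runs
    from \<open>-1\<close> to \<open>1\<close> and averages to the marker \<open>0\<close>, a fixed
    one is constant.\<close>
  have mid: "path_vertex h q 0 i + path_vertex h q (length q) i = 2 * h i"
    if "set q = zeros m h" "i \<in> {1..m}" for h q i
    using that by (auto simp: path_vertex_def zeros_def)
  have "f i = g i" if "i \<in> {1..m}" for i
    using mid[OF ll(1) that] mid[OF ll(3) that] v[OF _ that] len by simp
  then have "f = g" using f g by (metis PiE_ext)
  moreover have "l ! j = l' ! j" if "j < length l" for j
  proof -
    have "l ! j \<in> {1..m}" using ll(1) that zeros_subset nth_mem by blast
    then show ?thesis
      using path_vertex_step[OF ll(2) that, of f "l ! j"] path_vertex_step[OF ll(4), of j g "l ! j"] v that len by auto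
  qed
  ultimately show ?thesis using len by (auto intro: nth_equalityI)
qed

section \<open>Signs of orderings and signed sums over them\<close>

lemma perm_sign_nonzero: "perm_sign l = 1 \<or> perm_sign l = -1"
proof (induction l)
  case (Cons a l)
  then show ?case by (cases "even (card {b \<in> set l. b < a})") auto
qed simp

lemma perm_sign_swap: "distinct (l1 @ a # b # l2) \<Longrightarrow> perm_sign (l1 @ a # b # l2) = - perm_sign (l1 @ b # a # l2)"
proof (induction l1)
  case Nil
  have "{c. (c = b \<or> c \<in> set l2) \<and> c < a} = (if b < a then insert b {c\<in>set l2. c < a} else {c\<in>set l2. c < a})"
    "{c. (c = a \<or> c \<in> set l2) \<and> c < b} = (if a < b then insert a {c\<in>set l2. c < b} else {c\<in>set l2. c < b})" for a b
    by auto
  then show ?case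
    using Nil
    by (cases "a < b") auto
next
  case (Cons c l1)
  then show ?case by (simp add: insert_commute)
qed

text \<open>The inversions between a first block \<open>A\<close> and a second block
  \<open>B\<close>, that is, the exponent of the shuffle sign.\<close>

definition crossings :: "nat set \<Rightarrow> nat set \<Rightarrow> nat" where
  "crossings A B = (\<Sum>a\<in>A. card {b\<in>B. b < a})"

lemma perm_sign_append:
  "distinct (l1 @ l2) \<Longrightarrow>
    perm_sign (l1 @ l2) = (-1) ^ crossings (set l1) (set l2) * (perm_sign l1 * perm_sign l2)"
proof (induction l1)
  case (Cons a l1)
  have "{b \<in> set (l1 @ l2). b < a} = {b \<in> set l1. b < a} \<union> {b \<in> set l2. b < a}" by auto
  then have "card {b \<in> set (l1 @ l2). b < a} = card {b \<in> set l1. b < a} + card {b \<in> set l2. b < a}"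
    using Cons.prems by (simp only:) (rule card_Un_disjoint; auto)
  then show ?case
    using Cons by (simp add: crossings_def power_add)
qed (simp add: crossings_def)

lemma frag_self_minus_eq_0: "(c :: 'a \<Rightarrow>\<^sub>0 int) = - c \<Longrightarrow> c = 0"
proof (rule poly_mapping_eqI)
  fix k assume "c = - c"
  then have "Poly_Mapping.lookup c k = - Poly_Mapping.lookup c k" by (metis lookup_uminus)
  then show "Poly_Mapping.lookup c k = Poly_Mapping.lookup 0 k" by simp
qed

lemma permutations_split_adjacent:
  assumes "l \<in> permutations_of_set T" "Suc k < length l"
  obtains l1 a b l2 where "l = l1 @ a # b # l2" "length l1 = k"
proof -
  have "l = take k l @ l ! k # l ! Suc k # drop (Suc (Suc k)) l"
    using assms(2) by (simp add: Cons_nth_drop_Suc)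
  then show thesis using that[of "take k l"] assms(2) by simp
qed

text \<open>Exchanging the entries at \<open>k\<close> and \<open>Suc k\<close> is an involution
  that keeps \<open>F\<close> and reverses the sign. The sum is therefore its own negative, and free
  abelian groups have no 2-torsion.\<close>

lemma sum_permutations_adjacent_cancel:
  fixes F :: "nat list \<Rightarrow> 'a \<Rightarrow>\<^sub>0 int"
  assumes k: "Suc k < card T" and
    F: "\<And>l1 a b l2. \<lbrakk>l1 @ a # b # l2 \<in> permutations_of_set T; length l1 = k\<rbrakk> \<Longrightarrow>
          F (l1 @ b # a # l2) = F (l1 @ a # b # l2)"
  shows "(\<Sum>l\<in>permutations_of_set T. frag_cmul (perm_sign l) (F l)) = 0"
proof -
  define sw where "sw l = take k l @ l ! Suc k # l ! k # drop (Suc (Suc k)) l" for l :: "nat list"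
  have sw: "sw (l1 @ a # b # l2) = l1 @ b # a # l2" if "length l1 = k" for l1 a b l2
    using that by (simp add: sw_def nth_append)
  have len: "Suc k < length l" if "l \<in> permutations_of_set T" for l
    using k length_finite_permutations_of_set[OF that] by simp
  have *: "sw l \<in> permutations_of_set T \<and> sw (sw l) = l \<and>
      frag_cmul (perm_sign (sw l)) (F (sw l)) = - frag_cmul (perm_sign l) (F l)"
    if l: "l \<in> permutations_of_set T" for l
  proof -
    obtain l1 a b l2 where eq: "l = l1 @ a # b # l2" "length l1 = k"
      using permutations_split_adjacent[OF l len[OF l]] .
    have "perm_sign (l1 @ a # b # l2) = - perm_sign (l1 @ b # a # l2)"
      using perm_sign_swap permutations_of_setD(2)[OF l] eq(1) by blast
    then show ?thesis
      using l F[of l1 a b l2] eq by (auto simp: sw permutations_of_set_def)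
  qed
  let ?S = "\<Sum>l\<in>permutations_of_set T. frag_cmul (perm_sign l) (F l)"
  have "?S = (\<Sum>l\<in>permutations_of_set T. - frag_cmul (perm_sign l) (F l))"
    by (rule sum.reindex_bij_witness[where i = sw and j = sw]) (use * in auto)
  also have "\<dots> = - ?S" by (rule sum_negf)
  finally show ?thesis by (rule frag_self_minus_eq_0)
qed

lemma sum_permutations_Cons:
  assumes "finite T" "T \<noteq> {}"
  shows "(\<Sum>l\<in>permutations_of_set T. F l) = (\<Sum>a\<in>T. \<Sum>l\<in>permutations_of_set (T - {a}). F (a # l))"
proof -
  have "(\<Sum>l\<in>permutations_of_set T. F l) = (\<Sum>a\<in>T. \<Sum>l\<in>(#) a ` permutations_of_set (T - {a}). F l)"
    unfolding permutations_of_set_nonempty[OF assms(2)]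
    using assms(1) by (intro sum.UNION_disjoint) auto
  also have "\<dots> = (\<Sum>a\<in>T. \<Sum>l\<in>permutations_of_set (T - {a}). F (a # l))"
    by (intro sum.cong refl sum.reindex[THEN trans]) auto
  finally show ?thesis .
qed

lemma sum_permutations_rev:
  "(\<Sum>l\<in>permutations_of_set T. F (rev l)) = (\<Sum>l\<in>permutations_of_set T. F l)"
  by (rule sum.reindex_bij_witness[where i = rev and j = rev]) (auto simp: permutations_of_set_def)

lemma sum_permutations_snoc:
  assumes "finite T" "T \<noteq> {}"
  shows "(\<Sum>l\<in>permutations_of_set T. F l) = (\<Sum>a\<in>T. \<Sum>l\<in>permutations_of_set (T - {a}). F (l @ [a]))"
proof -
  have "(\<Sum>l\<in>permutations_of_set T. F l) = (\<Sum>a\<in>T. \<Sum>l\<in>permutations_of_set (T - {a}). F (rev l @ [a]))"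
    using sum_permutations_Cons[OF assms, of "\<lambda>l. F (rev l)"] by (simp add: sum_permutations_rev)
  then show ?thesis
    by (simp add: sum_permutations_rev[of "\<lambda>l. F (l @ [_])"])
qed

text \<open>An ordering with a cut is the same as a subset together with orderings of it and of its
  complement. This turns Alexander--Whitney cuts of paths into pairs of faces.\<close>

lemma sum_permutations_splits:
  assumes "finite T"
  shows "(\<Sum>l\<in>permutations_of_set T. \<Sum>k\<le>card T. F (take k l) (drop k l)) =
     (\<Sum>A\<in>Pow T. \<Sum>l1\<in>permutations_of_set A. \<Sum>l2\<in>permutations_of_set (T - A). F l1 l2)"
proof -
  let ?L = "permutations_of_set T \<times> {..card T}"
  let ?R = "Sigma (Pow T) (\<lambda>A. permutations_of_set A \<times> permutations_of_set (T - A))"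
  have "(\<Sum>l\<in>permutations_of_set T. \<Sum>k\<le>card T. F (take k l) (drop k l)) = (\<Sum>(l, k)\<in>?L. F (take k l) (drop k l))"
    by (simp add: sum.cartesian_product)
  also have "\<dots> = (\<Sum>(A, l1, l2)\<in>?R. F l1 l2)"
  proof (rule sum.reindex_bij_witness[where i = "\<lambda>(A, l1, l2). (l1 @ l2, length l1)"
        and j = "\<lambda>(l, k). (set (take k l), take k l, drop k l)"], goal_cases)
    case (2 p)
    then obtain l k where p: "p = (l, k)" "set l = T" "distinct l" "k \<le> card T"
      by (auto simp: permutations_of_set_def)
    have "set (take k l) \<union> set (drop k l) = T" "set (take k l) \<inter> set (drop k l) = {}"
      using p set_take_disj_set_drop_if_distinct[of l k k] by (auto simp flip: set_append)
    then show ?case using p by (auto simp: permutations_of_set_def)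
  next
    case (4 q)
    then show ?case using assms
      by (auto simp: permutations_of_set_def card_mono simp flip: distinct_card)
  qed (auto simp: permutations_of_set_def distinct_card)
  also have "\<dots> = (\<Sum>A\<in>Pow T. \<Sum>l1\<in>permutations_of_set A. \<Sum>l2\<in>permutations_of_set (T - A). F l1 l2)"
  proof -
    have "(\<Sum>(A, l1, l2)\<in>?R. F l1 l2) = (\<Sum>A\<in>Pow T. \<Sum>(l1, l2)\<in>permutations_of_set A \<times> permutations_of_set (T - A). F l1 l2)"
      using assms by (subst sum.Sigma) (auto simp: case_prod_unfold)
    then show ?thesis by (simp add: sum.cartesian_product)
  qed
  finally show ?thesis .
qed

text \<open>With \<open>a\<close> in last position its inversions are the larger entries, as many as
  the length minus the number of smaller ones. Together with the sign of the last face this is the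
  opposite of the coefficient obtained with \<open>a\<close> in front, so opposite faces of a cube
  get opposite signs.\<close>

lemma perm_sign_snoc:
  assumes "distinct (l @ [a])"
  shows "(-1) ^ Suc (length l) * perm_sign (l @ [a]) = - ((-1) ^ card {b \<in> set l. b < a}) * perm_sign l"
proof -
  have "crossings (set l) {a} = card {b \<in> set l. a < b}"
  proof -
    have "{c. c = a \<and> c < b} = (if a < b then {a} else {})" for b by auto
    then have "crossings (set l) {a} = (\<Sum>b\<in>set l. if a < b then 1 else 0)"
      unfolding crossings_def by (intro sum.cong) auto
    also have "\<dots> = card {b \<in> set l. a < b}"
      by (simp add: sum.If_cases Int_def)
    finally show ?thesis .
  qed
  moreover have "length l = card {b \<in> set l. b < a} + card {b \<in> set l. a < b}"
  proof -
    have "set l = {b \<in> set l. b < a} \<union> {b \<in> set l. a < b}"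
      using assms linorder_less_linear by auto
    then have "card (set l) = card {b \<in> set l. b < a} + card {b \<in> set l. a < b}"
      by (metis (no_types, lifting) card_Un_disjoint disjoint_iff finite_Un List.finite_set mem_Collect_eq order_less_asym)
    then show ?thesis using assms by (simp add: distinct_card)
  qed
  ultimately show ?thesis
    by (simp add: perm_sign_append[OF assms] power_add)
qed

lemma path_vertex_Cons:
  "a \<notin> set l \<Longrightarrow> path_vertex f (a # l) (Suc j) = path_vertex (fix_coords {a} 1 f) l j"
  by (auto simp: path_vertex_def fix_coords_def fun_eq_iff dest: in_set_takeD)

lemma path_vertex_snoc:
  "\<lbrakk>a \<notin> set l; j \<le> length l\<rbrakk> \<Longrightarrow> path_vertex f (l @ [a]) j = path_vertex (fix_coords {a} (-1) f) l j"
  by (auto simp: path_vertex_def fix_coords_def fun_eq_iff dest: in_set_takeD)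

text \<open>The cellular boundary of a product of intervals, oriented by increasing order of the
  free coordinates.\<close>

definition cube_boundary :: "nat \<Rightarrow> (nat \<Rightarrow> real) \<Rightarrow> (nat \<Rightarrow> real) \<Rightarrow>\<^sub>0 int" where
  "cube_boundary m f = (\<Sum>a\<in>zeros m f. frag_cmul ((-1) ^ card {b \<in> zeros m f. b < a})
     (frag_of (fix_coords {a} 1 f) - frag_of (fix_coords {a} (-1) f)))"

lemma singular_face_path_simplex:
  assumes "Suc n = length l" "k \<le> Suc n"
  shows "singular_face (Suc n) k (path_simplex m f l) = affine_simplex m n (\<lambda>j. path_vertex f l (skip k j))"
  unfolding path_simplex_def singular_face_eq_reindex[OF assms(2)] assms(1)[symmetric]
  by (rule reindex_affine_simplex) (auto simp: skip_def)

lemma frag_cmul_diff2: "frag_cmul k (a - b) = frag_cmul k a + - frag_cmul k b"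
  by (rule poly_mapping_eqI) (simp add: lookup_minus lookup_add algebra_simps)

text \<open>An inner face forgets the order of two consecutive steps, so the inner faces cancel in
  pairs. Face \<open>0\<close> fixes the first direction at \<open>1\<close> and the last face fixes
  the last direction at \<open>-1\<close>, which gives the two ends of each free direction.\<close>

lemma chain_boundary_cube_chain:
  "chain_boundary (card (zeros m f)) (cube_chain m f) = frag_extend (cube_chain m) (cube_boundary m f)"
proof (cases "card (zeros m f)")
  case 0
  then have "zeros m f = {}" by simp
  then show ?thesis by (simp add: 0 chain_boundary_def cube_boundary_def)
next
  case (Suc n)
  let ?T = "zeros m f" and ?P = "permutations_of_set (zeros m f)"
  have T: "?T \<noteq> {}" using Suc by auto
  have len: "length l = Suc n" if "l \<in> ?P" for l
    using length_permutations_zeros[OF that] Suc by simp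
  define D where "D k = (\<Sum>l\<in>?P. frag_cmul (perm_sign l) (frag_of (singular_face (Suc n) k (path_simplex m f l))))" for k
  have "chain_boundary (Suc n) (cube_chain m f) =
     (\<Sum>l\<in>?P. frag_cmul (perm_sign l) (\<Sum>k\<le>Suc n. frag_cmul ((-1) ^ k) (frag_of (singular_face (Suc n) k (path_simplex m f l)))))"
    by (simp add: cube_chain_def chain_boundary_sum chain_boundary_cmul chain_boundary_of comp_def del: sum.atMost_Suc)
  also have "\<dots> = (\<Sum>l\<in>?P. \<Sum>k\<le>Suc n. frag_cmul ((-1) ^ k) (frag_cmul (perm_sign l) (frag_of (singular_face (Suc n) k (path_simplex m f l)))))"
    by (simp add: frag_cmul_sum mult.commute del: sum.atMost_Suc)
  also have "\<dots> = (\<Sum>k\<le>Suc n. frag_cmul ((-1) ^ k) (D k))"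
    by (subst sum.swap) (simp add: D_def frag_cmul_sum del: sum.atMost_Suc)
  also have "\<dots> = (\<Sum>k\<in>{0, Suc n}. frag_cmul ((-1) ^ k) (D k))"
  proof (rule sum.mono_neutral_right)
    show "\<forall>k\<in>{..Suc n} - {0, Suc n}. frag_cmul ((-1) ^ k) (D k) = 0"
    proof
      fix k assume "k \<in> {..Suc n} - {0, Suc n}"
      then obtain k' where k: "k = Suc k'" "Suc k' < Suc n" by (cases k) auto
      have "D k = 0"
        unfolding D_def
      proof (rule sum_permutations_adjacent_cancel)
        show "Suc k' < card ?T" using k Suc by simp
        fix l1 a b l2 assume l: "l1 @ a # b # l2 \<in> ?P" "length l1 = k'"
        have "path_vertex f (l1 @ b # a # l2) (skip k j) = path_vertex f (l1 @ a # b # l2) (skip k j)" for j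
        proof -
          \<comment> \<open>The prefix of length \<open>Suc (length l1)\<close> is the one that is
            skipped; every other prefix contains both of \<open>a\<close> and \<open>b\<close> or
            neither.\<close>
          have "set (take (skip k j) (l1 @ b # a # l2)) = set (take (skip k j) (l1 @ a # b # l2))"
          proof (cases "skip k j \<le> length l1")
            case False
            then have "skip k j \<ge> Suc (Suc (length l1))"
              using l(2) k(1) by (auto simp: skip_def split: if_splits)
            then obtain i where "skip k j = Suc (Suc (length l1 + i))" by (auto simp: le_iff_add)
            then show ?thesis by (simp add: insert_commute)
          qed simp
          moreover have "set (l1 @ b # a # l2) = set (l1 @ a # b # l2)" by auto
          ultimately show ?thesis by (simp only: path_vertex_def)
        qed
        then show "frag_of (singular_face (Suc n) k (path_simplex m f (l1 @ b # a # l2))) =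
            frag_of (singular_face (Suc n) k (path_simplex m f (l1 @ a # b # l2)))"
          using len[OF l(1)] k by (simp add: singular_face_path_simplex)
      qed
      then show "frag_cmul ((-1) ^ k) (D k) = 0" by simp
    qed
  qed auto
  also have "\<dots> = D 0 + frag_cmul ((-1) ^ Suc n) (D (Suc n))" by simp
  also have "D 0 = (\<Sum>a\<in>?T. frag_cmul ((-1) ^ card {b \<in> ?T. b < a}) (cube_chain m (fix_coords {a} 1 f)))"
    unfolding D_def sum_permutations_Cons[OF finite_zeros T]
  proof (intro sum.cong refl)
    fix a assume a: "a \<in> ?T"
    have "frag_cmul (perm_sign (a # l)) (frag_of (singular_face (Suc n) 0 (path_simplex m f (a # l))))
       = frag_cmul ((-1) ^ card {b \<in> ?T. b < a}) (frag_cmul (perm_sign l) (frag_of (path_simplex m (fix_coords {a} 1 f) l)))"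
      if l: "l \<in> permutations_of_set (?T - {a})" for l
    proof -
      have sl: "set l = ?T - {a}" using l by (rule permutations_of_setD)
      have al: "a # l \<in> ?P" using l a by (auto simp: permutations_of_set_def)
      have "{b \<in> set l. b < a} = {b \<in> ?T. b < a}" using sl by auto
      moreover have "singular_face (Suc n) 0 (path_simplex m f (a # l)) = path_simplex m (fix_coords {a} 1 f) l"
        using singular_face_path_simplex[of n "a # l" 0 m f] len[OF al] path_vertex_Cons[of a l f] sl
        by (simp add: skip_def path_simplex_def)
      ultimately show ?thesis by simp
    qed
    then show "(\<Sum>l\<in>permutations_of_set (?T - {a}). frag_cmul (perm_sign (a # l)) (frag_of (singular_face (Suc n) 0 (path_simplex m f (a # l)))))
      = frag_cmul ((-1) ^ card {b \<in> ?T. b < a}) (cube_chain m (fix_coords {a} 1 f))"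
      by (simp add: cube_chain_def zeros_fix_coords frag_cmul_sum)
  qed
  also have "frag_cmul ((-1) ^ Suc n) (D (Suc n)) =
      (\<Sum>a\<in>?T. - frag_cmul ((-1) ^ card {b \<in> ?T. b < a}) (cube_chain m (fix_coords {a} (-1) f)))"
    unfolding D_def sum_permutations_snoc[OF finite_zeros T] frag_cmul_sum
  proof (intro sum.cong refl)
    fix a assume a: "a \<in> ?T"
    have "frag_cmul ((-1) ^ Suc n) (frag_cmul (perm_sign (l @ [a])) (frag_of (singular_face (Suc n) (Suc n) (path_simplex m f (l @ [a])))))
       = - frag_cmul ((-1) ^ card {b \<in> ?T. b < a}) (frag_cmul (perm_sign l) (frag_of (path_simplex m (fix_coords {a} (-1) f) l)))"
      if l: "l \<in> permutations_of_set (?T - {a})" for l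
    proof -
      have sl: "set l = ?T - {a}" "distinct l" using l by (auto dest: permutations_of_setD)
      have al: "l @ [a] \<in> ?P" using l a by (auto simp: permutations_of_set_def)
      have ll: "n = length l" using len[OF al] by simp
      have "{b \<in> set l. b < a} = {b \<in> ?T. b < a}" using sl by auto
      then have "(-1) ^ Suc n * perm_sign (l @ [a]) = - ((-1) ^ card {b \<in> ?T. b < a}) * perm_sign l"
        using perm_sign_snoc[of l a] sl ll by simp
      moreover have "singular_face (Suc n) (Suc n) (path_simplex m f (l @ [a])) = path_simplex m (fix_coords {a} (-1) f) l"
        using singular_face_path_simplex[of n "l @ [a]" "Suc n" m f] path_vertex_snoc[of a l _ f] sl(1) ll
        unfolding path_simplex_def[of m "fix_coords {a} (-1) f"]
        by (auto simp: skip_def intro!: affine_simplex_cong)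
      ultimately show ?thesis by (simp del: power_Suc)
    qed
    then show "(\<Sum>l\<in>permutations_of_set (?T - {a}). frag_cmul ((-1) ^ Suc n) (frag_cmul (perm_sign (l @ [a])) (frag_of (singular_face (Suc n) (Suc n) (path_simplex m f (l @ [a]))))))
      = - frag_cmul ((-1) ^ card {b \<in> ?T. b < a}) (cube_chain m (fix_coords {a} (-1) f))"
      by (simp add: cube_chain_def zeros_fix_coords frag_cmul_sum sum_negf del: minus_frag_cmul)
  qed
  finally have *: "chain_boundary (Suc n) (cube_chain m f) =
     (\<Sum>a\<in>?T. frag_cmul ((-1) ^ card {b \<in> ?T. b < a}) (cube_chain m (fix_coords {a} 1 f)))
     + (\<Sum>a\<in>?T. - frag_cmul ((-1) ^ card {b \<in> ?T. b < a}) (cube_chain m (fix_coords {a} (-1) f)))" .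
  have "frag_extend (cube_chain m) (cube_boundary m f) = (\<Sum>a\<in>?T. frag_cmul ((-1) ^ card {b \<in> ?T. b < a}) (cube_chain m (fix_coords {a} 1 f))
     + - frag_cmul ((-1) ^ card {b \<in> ?T. b < a}) (cube_chain m (fix_coords {a} (-1) f)))"
    unfolding cube_boundary_def
    by (simp add: frag_extend_sum frag_extend_cmul frag_extend_diff frag_extend_add comp_def frag_cmul_diff2)
  then show ?thesis unfolding Suc * sum.distrib by simp
qed

section \<open>Evaluation of cochains on triangulated faces\<close>

definition cube_eval :: "nat \<Rightarrow> (nat \<Rightarrow> real) cochain \<Rightarrow> (nat \<Rightarrow> real) \<Rightarrow> int" where
  "cube_eval m \<gamma> f = \<gamma> (card (zeros m f)) (cube_chain m f)"

lemma cube_eval_sum: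
  assumes "f \<in> cube_faces m \<Sigma>" "\<And>n. \<gamma> n \<in> normalized_cochains n (real_moment_angle m \<Sigma>)"
  shows "cube_eval m \<gamma> f =
    (\<Sum>l\<in>permutations_of_set (zeros m f). perm_sign l * \<gamma> (length l) (frag_of (path_simplex m f l)))"
proof -
  let ?n = "card (zeros m f)"
  have *: "singular_chain ?n (real_moment_angle m \<Sigma>) (frag_of (path_simplex m f l))"
    if "l \<in> permutations_of_set (zeros m f)" for l
    using singular_simplex_path[OF assms(1) that] length_permutations_zeros[OF that]
    by (simp add: singular_chain_of)
  have "cube_eval m \<gamma> f = (\<Sum>l\<in>permutations_of_set (zeros m f). \<gamma> ?n (frag_cmul (perm_sign l) (frag_of (path_simplex m f l))))"
    unfolding cube_eval_def cube_chain_def using *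
    by (intro normalized_cochain_sum[OF assms(2)] singular_chain_cmul) auto
  also have "\<dots> = (\<Sum>l\<in>permutations_of_set (zeros m f). perm_sign l * \<gamma> (length l) (frag_of (path_simplex m f l)))"
    using * by (intro sum.cong refl) (simp add: normalized_cochain_cmul[OF assms(2)] length_permutations_zeros)
  finally show ?thesis .
qed

text \<open>A path cut after the directions in \<open>A\<close> runs first through the face whose
  other directions are at \<open>-1\<close>, then through the face with \<open>A\<close> at
  \<open>1\<close>. On the right only values of the factors on faces occur; this yields
  multiplicativity of the evaluation and the ideal property of its kernel.\<close>

lemma cube_eval_mult:
  assumes \<Sigma>: "simplicial_complex_on m \<Sigma>" and f: "f \<in> cube_faces m \<Sigma>"
    and \<alpha>: "\<And>n. \<alpha> n \<in> normalized_cochains n (real_moment_angle m \<Sigma>)"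
    and \<beta>: "\<And>n. \<beta> n \<in> normalized_cochains n (real_moment_angle m \<Sigma>)"
  shows "cube_eval m (cochain_mult (real_moment_angle m \<Sigma>) \<alpha> \<beta>) f =
    (\<Sum>A\<in>Pow (zeros m f). (-1) ^ (card (zeros m f - A) * card A + crossings A (zeros m f - A)) *
       cube_eval m \<alpha> (fix_coords (zeros m f - A) (-1) f) * cube_eval m \<beta> (fix_coords A 1 f))"
proof -
  let ?X = "real_moment_angle m \<Sigma>" and ?T = "zeros m f"
  define F where "F l1 l2 = perm_sign (l1 @ l2) * ((-1) ^ (length l2 * length l1) *
     \<alpha> (length l1) (frag_of (path_simplex m (fix_coords (set l2) (-1) f) l1)) *
     \<beta> (length l2) (frag_of (path_simplex m (fix_coords (set l1) 1 f) l2)))" for l1 l2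
  have "cube_eval m (cochain_mult ?X \<alpha> \<beta>) f = (\<Sum>l\<in>permutations_of_set ?T. perm_sign l * cup_value \<alpha> \<beta> (length l) (path_simplex m f l))"
    using singular_simplex_path[OF f]
    by (simp add: cube_eval_sum[OF f cochain_mult_normalized[OF \<alpha> \<beta>]] cochain_mult_of)
  also have "\<dots> = (\<Sum>l\<in>permutations_of_set ?T. \<Sum>k\<le>card ?T. F (take k l) (drop k l))"
  proof (intro sum.cong refl)
    fix l assume l: "l \<in> permutations_of_set ?T"
    have len: "length l = card ?T" by (rule length_permutations_zeros[OF l])
    have dist: "distinct (take k l @ drop k l)" for k using permutations_of_setD(2)[OF l] by simp
    have "perm_sign l * ((-1) ^ ((length l - k) * k) * \<alpha> k (frag_of (singular_interval (path_simplex m f l) 0 k)) *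
         \<beta> (length l - k) (frag_of (singular_interval (path_simplex m f l) k (length l - k)))) = F (take k l) (drop k l)"
      if "k \<le> length l" for k
      using that singular_interval_path_left[OF dist[of k], of m f] singular_interval_path_right[OF dist[of k], of m f]
      by (simp add: F_def min_absorb2)
    then show "perm_sign l * cup_value \<alpha> \<beta> (length l) (path_simplex m f l) = (\<Sum>k\<le>card ?T. F (take k l) (drop k l))"
      by (simp add: cup_value_def sum_distrib_left len)
  qed
  also have "\<dots> = (\<Sum>A\<in>Pow ?T. \<Sum>l1\<in>permutations_of_set A. \<Sum>l2\<in>permutations_of_set (?T - A). F l1 l2)"
    by (rule sum_permutations_splits) simp
  also have "\<dots> = (\<Sum>A\<in>Pow ?T. (-1) ^ (card (?T - A) * card A + crossings A (?T - A)) *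
       cube_eval m \<alpha> (fix_coords (?T - A) (-1) f) * cube_eval m \<beta> (fix_coords A 1 f))"
  proof (intro sum.cong refl)
    fix A assume A: "A \<in> Pow ?T"
    then have TA: "?T - (?T - A) = A" by auto
    let ?g = "fix_coords (?T - A) (-1) f" and ?h = "fix_coords A 1 f"
    have g: "?g \<in> cube_faces m \<Sigma>" and h: "?h \<in> cube_faces m \<Sigma>"
      using A by (auto intro: fix_coords_cube_faces[OF \<Sigma> f])
    have zg: "zeros m ?g = A" and zh: "zeros m ?h = ?T - A"
      using TA by (simp_all add: zeros_fix_coords)
    have "F l1 l2 = (-1) ^ (card (?T - A) * card A + crossings A (?T - A)) *
         (perm_sign l1 * \<alpha> (length l1) (frag_of (path_simplex m ?g l1))) *
         (perm_sign l2 * \<beta> (length l2) (frag_of (path_simplex m ?h l2)))"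
      if "l1 \<in> permutations_of_set A" "l2 \<in> permutations_of_set (?T - A)" for l1 l2
    proof -
      have d: "set l1 = A" "set l2 = ?T - A" "distinct (l1 @ l2)" "length l1 = card A" "length l2 = card (?T - A)"
        using that by (auto simp: permutations_of_set_def simp flip: distinct_card)
      have "F l1 l2 = (-1) ^ crossings A (?T - A) * (perm_sign l1 * perm_sign l2) * ((-1) ^ (card (?T - A) * card A) *
     \<alpha> (length l1) (frag_of (path_simplex m ?g l1)) * \<beta> (length l2) (frag_of (path_simplex m ?h l2)))"
        unfolding F_def perm_sign_append[OF d(3)] d(1,2) by (simp only: d(4,5))
      then show ?thesis by (simp only: power_add mult_ac)
    qed
    then have "(\<Sum>l1\<in>permutations_of_set A. \<Sum>l2\<in>permutations_of_set (?T - A). F l1 l2) =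
      (-1) ^ (card (?T - A) * card A + crossings A (?T - A)) *
      (\<Sum>l1\<in>permutations_of_set A. perm_sign l1 * \<alpha> (length l1) (frag_of (path_simplex m ?g l1))) *
      (\<Sum>l2\<in>permutations_of_set (?T - A). perm_sign l2 * \<beta> (length l2) (frag_of (path_simplex m ?h l2)))"
      by (simp add: mult.assoc sum_product) (simp add: sum_distrib_left mult.assoc)
    then show "(\<Sum>l1\<in>permutations_of_set A. \<Sum>l2\<in>permutations_of_set (?T - A). F l1 l2) =
       (-1) ^ (card (?T - A) * card A + crossings A (?T - A)) * cube_eval m \<alpha> ?g * cube_eval m \<beta> ?h"
      unfolding cube_eval_sum[OF g \<alpha>] cube_eval_sum[OF h \<beta>] zg zh .
  qed
  finally show ?thesis .
qed

definition cube_chain_on :: "nat \<Rightarrow> nat \<Rightarrow> nat set set \<Rightarrow> ((nat \<Rightarrow> real) \<Rightarrow>\<^sub>0 int) \<Rightarrow> bool" where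
  "cube_chain_on n m \<Sigma> c \<longleftrightarrow> Poly_Mapping.keys c \<subseteq> {f \<in> cube_faces m \<Sigma>. card (zeros m f) = n}"

lemma cube_chain_on_of: "cube_chain_on n m \<Sigma> (frag_of f) \<longleftrightarrow> f \<in> cube_faces m \<Sigma> \<and> card (zeros m f) = n"
  by (simp add: cube_chain_on_def)

lemma cube_chain_on_0 [simp]: "cube_chain_on n m \<Sigma> 0"
  by (simp add: cube_chain_on_def)

lemma cube_chain_on_add: "\<lbrakk>cube_chain_on n m \<Sigma> a; cube_chain_on n m \<Sigma> b\<rbrakk> \<Longrightarrow> cube_chain_on n m \<Sigma> (a + b)"
  unfolding cube_chain_on_def using keys_add[of a b] by blast

lemma cube_chain_on_diff: "\<lbrakk>cube_chain_on n m \<Sigma> a; cube_chain_on n m \<Sigma> b\<rbrakk> \<Longrightarrow> cube_chain_on n m \<Sigma> (a - b)"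
  unfolding cube_chain_on_def using keys_diff[of a b] by blast

lemma cube_chain_on_cmul: "cube_chain_on n m \<Sigma> a \<Longrightarrow> cube_chain_on n m \<Sigma> (frag_cmul k a)"
  unfolding cube_chain_on_def using keys_cmul[of k a] by blast

lemma cube_chain_on_sum: "(\<And>i. i \<in> I \<Longrightarrow> cube_chain_on n m \<Sigma> (a i)) \<Longrightarrow> cube_chain_on n m \<Sigma> (sum a I)"
  by (induction I rule: infinite_finite_induct) (auto simp: cube_chain_on_add)

lemma cube_chain_on_extend:
  "(\<And>x. x \<in> Poly_Mapping.keys c \<Longrightarrow> cube_chain_on n m \<Sigma> (F x)) \<Longrightarrow> cube_chain_on n m \<Sigma> (frag_extend F c)"
  unfolding frag_extend_def by (intro cube_chain_on_sum cube_chain_on_cmul)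

lemma cube_chain_on_boundary:
  assumes "simplicial_complex_on m \<Sigma>" "f \<in> cube_faces m \<Sigma>" "card (zeros m f) = Suc n"
  shows "cube_chain_on n m \<Sigma> (cube_boundary m f)"
  unfolding cube_boundary_def using assms
  by (intro cube_chain_on_sum cube_chain_on_cmul cube_chain_on_diff)
     (auto simp: cube_chain_on_of zeros_fix_coords intro!: fix_coords_cube_faces)

lemma singular_chain_extend_cube_chain:
  "cube_chain_on n m \<Sigma> c \<Longrightarrow> singular_chain n (real_moment_angle m \<Sigma>) (frag_extend (cube_chain m) c)"
  using singular_chain_cube_chain[of _ m \<Sigma>]
  by (intro singular_chain_extend) (auto simp: cube_chain_on_def)

lemma chain_boundary_extend_cube_chain:
  assumes "cube_chain_on n m \<Sigma> c"
  shows "chain_boundary n (frag_extend (cube_chain m) c) =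
    frag_extend (cube_chain m) (frag_extend (cube_boundary m) c)"
proof -
  have "Poly_Mapping.keys c \<subseteq> {f \<in> cube_faces m \<Sigma>. card (zeros m f) = n}"
    using assms by (simp add: cube_chain_on_def)
  then show ?thesis
  proof (induction c rule: frag_induction)
    case (one f)
    then show ?case using chain_boundary_cube_chain[of m f] by simp
  qed (auto simp: frag_extend_diff chain_boundary_diff)
qed

lemma cochain_extend_cube_chain:
  assumes "\<gamma> n \<in> normalized_cochains n (real_moment_angle m \<Sigma>)" "cube_chain_on n m \<Sigma> c"
  shows "\<gamma> n (frag_extend (cube_chain m) c) = frag_eval (cube_eval m \<gamma>) c"
proof -
  have "Poly_Mapping.keys c \<subseteq> {f \<in> cube_faces m \<Sigma>. card (zeros m f) = n}"
    using assms by (simp add: cube_chain_on_def)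
  then have "singular_chain n (real_moment_angle m \<Sigma>) (frag_extend (cube_chain m) c) \<and>
      \<gamma> n (frag_extend (cube_chain m) c) = frag_eval (cube_eval m \<gamma>) c"
  proof (induction c rule: frag_induction)
    case zero
    then show ?case using normalized_cochain_eval[OF assms(1), of 0] by simp
  next
    case (one f)
    then show ?case using singular_chain_cube_chain[of f m \<Sigma>] by (auto simp: cube_eval_def)
  next
    case (diff a b)
    then have "\<gamma> n (frag_extend (cube_chain m) (a - b) + frag_extend (cube_chain m) b) = \<gamma> n (frag_extend (cube_chain m) (a - b)) + \<gamma> n (frag_extend (cube_chain m) b)"
      by (intro normalized_cochain_add[OF assms(1)]) (auto simp: frag_extend_diff singular_chain_diff)
    then show ?case using diff by (simp add: frag_extend_diff frag_eval_diff singular_chain_diff)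
  qed
  then show ?thesis by simp
qed

lemma cube_eval_diff:
  assumes \<Sigma>: "simplicial_complex_on m \<Sigma>" and f: "f \<in> cube_faces m \<Sigma>"
    and \<gamma>: "\<And>n. \<gamma> n \<in> normalized_cochains n (real_moment_angle m \<Sigma>)"
  shows "cube_eval m (cochain_diff (real_moment_angle m \<Sigma>) \<gamma>) f =
    - ((-1) ^ (card (zeros m f) - 1)) * frag_eval (cube_eval m \<gamma>) (cube_boundary m f)"
proof (cases "card (zeros m f)")
  case 0
  \<comment> \<open>In dimension 0 the truncated exponent is harmless: both sides vanish, the
    boundary being an empty sum.\<close>
  then show ?thesis by (simp add: cube_eval_def cochain_diff_def cube_boundary_def)
next
  case (Suc n)
  then show ?thesis
    using singular_chain_cube_chain[OF f] chain_boundary_cube_chain[of m f]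
      cochain_extend_cube_chain[where \<gamma> = \<gamma>, OF \<gamma>[of n] cube_chain_on_boundary[OF \<Sigma> f Suc]]
    by (simp add: cube_eval_def cochain_diff_def)
qed

section \<open>The free ring on the generators\<close>

lemma word_mult_add_left: "(a + b) \<star> c = a \<star> c + b \<star> c"
  by (simp add: word_mult_def frag_extend_add)

lemma word_mult_diff_left: "(a - b) \<star> c = a \<star> c - b \<star> c"
  by (simp add: word_mult_def frag_extend_diff)

lemma word_mult_cmul_left: "frag_cmul k a \<star> c = frag_cmul k (a \<star> c)"
  by (simp add: word_mult_def frag_extend_cmul)

lemma word_mult_0_left [simp]: "0 \<star> c = 0"
  by (simp add: word_mult_def)

lemma frag_extend_fun_diff: "frag_extend (\<lambda>x. F x - G x) c = frag_extend F c - frag_extend G c"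
  using frag_induction[OF subset_UNIV, of "\<lambda>c. frag_extend (\<lambda>x. F x - G x) c = frag_extend F c - frag_extend G c"]
  by (auto simp: frag_extend_diff)

lemma word_mult_diff_right: "c \<star> (a - b) = c \<star> a - c \<star> b"
  by (simp add: word_mult_def frag_extend_diff frag_extend_fun_diff)

lemma word_mult_0_right [simp]: "c \<star> 0 = 0"
  by (simp add: word_mult_def frag_extend_eq_0)

lemma word_mult_minus_right: "c \<star> (- a) = - (c \<star> a)"
  using word_mult_diff_right[of c 0 a] by simp

lemma word_mult_add_right: "c \<star> (a + b) = c \<star> a + c \<star> b"
  using word_mult_diff_right[of c a "- b"] by (simp add: word_mult_minus_right)

lemma word_mult_of [simp]: "frag_of u \<star> frag_of v = frag_of (u @ v)"
  by (simp add: word_mult_def)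

lemma word_mult_cmul_right: "c \<star> frag_cmul k a = frag_cmul k (c \<star> a)"
  by (simp add: word_mult_def frag_extend_cmul frag_extend_def[of _ c] frag_cmul_sum mult.commute)

lemma word_mult_assoc: "(a \<star> b) \<star> c = a \<star> (b \<star> c)"
  using subset_UNIV[of "Poly_Mapping.keys a"]
proof (induction a rule: frag_induction)
  case (one u)
  show ?case
    using subset_UNIV[of "Poly_Mapping.keys b"]
  proof (induction b rule: frag_induction)
    case (one v)
    show ?case
      using subset_UNIV[of "Poly_Mapping.keys c"]
      by (induction c rule: frag_induction) (auto simp: word_mult_diff_right)
  qed (auto simp: word_mult_diff_left word_mult_diff_right)
qed (auto simp: word_mult_diff_left)

lemma word_mult_one_left: "frag_of [] \<star> a = a"
  by (simp add: word_mult_def flip: frag_expansion)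

lemma word_mult_one_right: "a \<star> frag_of [] = a"
  by (simp add: word_mult_def flip: frag_expansion)

lemma keys_word_mult:
  assumes "w \<in> Poly_Mapping.keys (a \<star> b)"
  obtains u v where "u \<in> Poly_Mapping.keys a" "v \<in> Poly_Mapping.keys b" "w = u @ v"
proof -
  obtain u where u: "u \<in> Poly_Mapping.keys a" "w \<in> Poly_Mapping.keys (frag_extend (\<lambda>v. frag_of (u @ v)) b)"
    using assms keys_frag_extend unfolding word_mult_def by fast
  then obtain v where "v \<in> Poly_Mapping.keys b" "w = u @ v"
    using keys_frag_extend[of "\<lambda>v. frag_of (u @ v)" b] by auto
  with u that show thesis by blast
qed

lemma free_ring_simps:
  "carrier (free_ring m) = {a. Poly_Mapping.keys a \<subseteq> lists (B_gens m)}"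
  "monoid.mult (free_ring m) = (\<star>)" "one (free_ring m) = frag_of []"
  "zero (free_ring m) = 0" "add (free_ring m) = (+)"
  by (simp_all add: free_ring_def)

lemma free_carrier_unary:
  assumes "a \<in> carrier (free_ring m)"
  shows "- a \<in> carrier (free_ring m)" "frag_cmul k a \<in> carrier (free_ring m)"
  using assms keys_cmul[of k a] by (auto simp: free_ring_simps)

lemma free_carrier_closed:
  assumes "a \<in> carrier (free_ring m)" "b \<in> carrier (free_ring m)"
  shows "a + b \<in> carrier (free_ring m)" "a - b \<in> carrier (free_ring m)" "a \<star> b \<in> carrier (free_ring m)"
proof -
  show "a + b \<in> carrier (free_ring m)" "a - b \<in> carrier (free_ring m)"
    using assms keys_add[of a b] keys_diff[of a b] by (auto simp: free_ring_simps)
  have "w \<in> lists (B_gens m)" if w: "w \<in> Poly_Mapping.keys (a \<star> b)" for w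
    using keys_word_mult[OF w] assms unfolding free_ring_simps by (metis append_in_lists_conv mem_Collect_eq subsetD)
  then show "a \<star> b \<in> carrier (free_ring m)" unfolding free_ring_simps by blast
qed

lemma free_carrier_of: "frag_of w \<in> carrier (free_ring m) \<longleftrightarrow> w \<in> lists (B_gens m)"
  by (auto simp: free_ring_simps)

lemma free_carrier_0: "0 \<in> carrier (free_ring m)"
  by (simp add: free_ring_simps)

lemma ring_free_ring: "ring (free_ring m)"
proof (rule ringI)
  show "abelian_group (free_ring m)"
  proof (rule abelian_groupI)
    fix a assume "a \<in> carrier (free_ring m)"
    then show "\<exists>b\<in>carrier (free_ring m). b \<oplus>\<^bsub>free_ring m\<^esub> a = \<zero>\<^bsub>free_ring m\<^esub>"
      using free_carrier_unary(1)[of a m] by (intro bexI[of _ "- a"]) (auto simp: free_ring_simps(4,5))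
  qed (auto simp: free_ring_simps(4,5) free_carrier_closed free_carrier_0 algebra_simps)
  show "monoid (free_ring m)"
    by (rule monoidI) (auto simp: free_ring_simps(2,3) free_carrier_closed free_carrier_of
        word_mult_assoc word_mult_one_left word_mult_one_right)
qed (auto simp: free_ring_simps(2,5) word_mult_add_left word_mult_add_right)

lemma free_ring_minus: "a \<in> carrier (free_ring m) \<Longrightarrow> \<ominus>\<^bsub>free_ring m\<^esub> a = - a"
  using ring_free_ring[of m] free_carrier_unary(1)[of a m]
  by (intro abelian_group.minus_equality) (auto simp: ring_def free_ring_simps(4,5))

section \<open>Words as products of cochains\<close>

lemma cochain_mult_diff_right:
  "cochain_mult X (\<lambda>n c. f n c - g n c) h = (\<lambda>n c. cochain_mult X f h n c - cochain_mult X g h n c)"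
  using cochain_mult_distrib_right[of X "\<lambda>n c. f n c - g n c" g h] by (auto simp: fun_eq_iff algebra_simps)

lemma cochain_mult_diff_left:
  "cochain_mult X h (\<lambda>n c. f n c - g n c) = (\<lambda>n c. cochain_mult X h f n c - cochain_mult X h g n c)"
  using cochain_mult_distrib_left[of X h "\<lambda>n c. f n c - g n c" g] by (auto simp: fun_eq_iff algebra_simps)

text \<open>On the vertices of the cube this is the indicator of the end \<open>1\<close> of the
  \<open>i\<close>-th interval; the sign test extends it to all points, including those where the
  coordinate is \<open>0\<close>.\<close>

definition s_cochain :: "(nat \<Rightarrow> real) topology \<Rightarrow> nat \<Rightarrow> (nat \<Rightarrow> real) cochain" where
  "s_cochain X i n = (if n = 0 then to_cochain 0 X (\<lambda>x. if x (basis_point 0) i > 0 then 1 else 0) else (\<lambda>c. 0))"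

fun gen_cochain :: "(nat \<Rightarrow> real) topology \<Rightarrow> B_gen \<Rightarrow> (nat \<Rightarrow> real) cochain" where
  "gen_cochain X (SGen i) = s_cochain X i"
| "gen_cochain X (TGen i) = (\<lambda>n c. - cochain_diff X (s_cochain X i) n c)"

lemma s_cochain_component: "s_cochain X i \<in> component (cochain_dga X) 0"
proof -
  have "to_cochain 0 X (\<lambda>x. if x (basis_point 0) i > 0 then 1 else 0) \<in> normalized_cochains 0 X"
    by (rule to_cochain_normalized) (simp add: degenerate_simplex_def)
  then show ?thesis by (simp add: cochain_dga_simps s_cochain_def fun_eq_iff)
qed

lemma uminus_component:
  "f \<in> component (cochain_dga X) n \<Longrightarrow> (\<lambda>n c. - f n c) \<in> component (cochain_dga X) n"
  using lincomb_normalized_cochain[of "f n" n X "f n" "-1" 0] by (simp add: cochain_dga_simps fun_eq_iff)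

lemma gen_cochain_component: "gen_cochain X g \<in> component (cochain_dga X) (gen_degree g)"
  using s_cochain_component uminus_component[OF cochain_diff_component[OF s_cochain_component]]
  by (cases g) auto

fun word_cochain :: "(nat \<Rightarrow> real) topology \<Rightarrow> B_gen list \<Rightarrow> (nat \<Rightarrow> real) cochain" where
  "word_cochain X [] = cochain_one X"
| "word_cochain X (g # w) = cochain_mult X (gen_cochain X g) (word_cochain X w)"

lemma mult_component_cochain:
  "\<lbrakk>f \<in> component (cochain_dga X) i; g \<in> component (cochain_dga X) j\<rbrakk>
    \<Longrightarrow> cochain_mult X f g \<in> component (cochain_dga X) (i + j)"
  using dga.mult_component[OF dga_cochain_dga] by (simp add: cochain_dga_simps(2))

lemma one_component_cochain: "cochain_one X \<in> component (cochain_dga X) 0"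
  using dga.one_component[OF dga_cochain_dga] by (simp add: cochain_dga_simps(3))

lemma word_cochain_component: "word_cochain X w \<in> component (cochain_dga X) (word_degree w)"
  using mult_component_cochain[OF gen_cochain_component]
  by (induction w) (auto simp: word_degree_def one_component_cochain)

lemma word_cochain_normalized: "word_cochain X w n \<in> normalized_cochains n X"
  by (rule cochain_componentD(1)[OF word_cochain_component])

lemma word_cochain_append: "word_cochain X (u @ v) = cochain_mult X (word_cochain X u) (word_cochain X v)"
  by (induction u) (simp_all add: cochain_mult_one_left word_cochain_normalized cochain_mult_assoc)

text \<open>The source is the free ring because the relations fail for these cochains in general: on
  an edge along which the \<open>i\<close>-th coordinate changes from positive to nonpositive, the
  cochain of \<open>t_i s_i\<close> vanishes while that of \<open>t_i\<close> is
  \<open>-1\<close>.\<close>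

definition free_cochain :: "(nat \<Rightarrow> real) topology \<Rightarrow> (B_gen list \<Rightarrow>\<^sub>0 int) \<Rightarrow> (nat \<Rightarrow> real) cochain" where
  "free_cochain X a = (\<lambda>n c. frag_eval (\<lambda>w. word_cochain X w n c) a)"

lemma free_cochain_of [simp]: "free_cochain X (frag_of w) = word_cochain X w"
  by (simp add: free_cochain_def)

lemma free_cochain_0 [simp]: "free_cochain X 0 = (\<lambda>n c. 0)"
  by (simp add: free_cochain_def)

lemma free_cochain_diff: "free_cochain X (a - b) = (\<lambda>n c. free_cochain X a n c - free_cochain X b n c)"
  by (simp add: free_cochain_def frag_eval_diff)

lemma free_cochain_add: "free_cochain X (a + b) = (\<lambda>n c. free_cochain X a n c + free_cochain X b n c)"
  by (simp add: free_cochain_def frag_eval_add)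

lemma free_cochain_cmul: "free_cochain X (frag_cmul k a) = (\<lambda>n c. k * free_cochain X a n c)"
  by (simp add: free_cochain_def frag_eval_cmul)

lemma zero_cochain_carrier: "(\<lambda>n c. 0) \<in> carrier (cochain_dga X)"
  by (simp add: cochain_dga_simps zero_normalized_cochain)

lemma free_cochain_carrier: "free_cochain X a \<in> carrier (cochain_dga X)"
  using subset_UNIV[of "Poly_Mapping.keys a"]
proof (induction a rule: frag_induction)
  case (diff a b)
  then show ?case
    using lincomb_cochain_carrier[of "free_cochain X a" X "free_cochain X b" 1 "-1"]
    by (simp add: free_cochain_diff)
qed (auto simp: zero_cochain_carrier cochain_componentD(3)[OF word_cochain_component])

lemmas free_cochain_normalized = cochain_carrierD[OF free_cochain_carrier]

lemma cochain_mult_zero: "cochain_mult X (\<lambda>n c. 0) f = (\<lambda>n c. 0)" "cochain_mult X f (\<lambda>n c. 0) = (\<lambda>n c. 0)"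
  by (simp_all add: cochain_mult_def fun_eq_iff)

lemma free_cochain_mult: "free_cochain X (a \<star> b) = cochain_mult X (free_cochain X a) (free_cochain X b)"
  using subset_UNIV[of "Poly_Mapping.keys a"]
proof (induction a rule: frag_induction)
  case (one u)
  show ?case
    using subset_UNIV[of "Poly_Mapping.keys b"]
    by (induction b rule: frag_induction)
      (auto simp: word_mult_diff_right free_cochain_diff cochain_mult_diff_left cochain_mult_zero word_cochain_append)
qed (auto simp: word_mult_diff_left free_cochain_diff cochain_mult_diff_right cochain_mult_zero)

lemma cochain_diff_minus: "cochain_diff X (\<lambda>n c. - f n c) = (\<lambda>n c. - cochain_diff X f n c)"
  by (auto simp: cochain_diff_def fun_eq_iff)

lemma cochain_diff_subtract:
  "cochain_diff X (\<lambda>n c. f n c - g n c) = (\<lambda>n c. cochain_diff X f n c - cochain_diff X g n c)"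
  by (auto simp: cochain_diff_def fun_eq_iff algebra_simps)

lemma cochain_diff_zero: "cochain_diff X (\<lambda>n c. 0) = (\<lambda>n c. 0)"
  by (auto simp: cochain_diff_def fun_eq_iff)

lemma gen_diff_cochain: "free_cochain X (gen_diff g) = cochain_diff X (gen_cochain X g)"
proof (cases g)
  case (SGen i)
  have "free_cochain X (- frag_of [TGen i]) = (\<lambda>n c. - gen_cochain X (TGen i) n c)"
    using free_cochain_cmul[of X "-1" "frag_of [TGen i]"]
    by (simp add: cochain_mult_one_right cochain_componentD(1)[OF gen_cochain_component, of X "TGen i", simplified])
  then show ?thesis by (simp add: SGen)
next
  case (TGen i)
  then show ?thesis
    using cochain_diff_diff[of "s_cochain X i" X] cochain_componentD(1)[OF s_cochain_component]
    by (simp add: cochain_diff_minus)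
qed

text \<open>The Leibniz rule for the product of the unit with itself reads
  \<open>D = D + D\<close>.\<close>

lemma cochain_diff_one: "cochain_diff X (cochain_one X) = (\<lambda>n c. 0)"
proof -
  let ?D = "cochain_diff X (cochain_one X)"
  have D: "?D n \<in> normalized_cochains n X" for n
    by (rule cochain_componentD(1)[OF cochain_diff_component[OF one_component_cochain]])
  have "?D n c = ?D n c + ?D n c" for n c
    using fun_cong[OF fun_cong[OF cochain_leibniz[OF one_component_cochain one_component_cochain, of X], of n], of c]
    unfolding cochain_mult_one_left[OF cochain_one_normalized] cochain_mult_one_left[OF D] cochain_mult_one_right[OF D]
    by simp
  then show ?thesis by (intro ext) (metis add_cancel_left_right)
qed

lemma word_diff_cochain: "free_cochain X (word_diff w) = cochain_diff X (word_cochain X w)"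
proof (induction w)
  case Nil
  then show ?case by (simp add: cochain_diff_one)
next
  case (Cons g w)
  have g: "free_cochain X (frag_of [g]) = gen_cochain X g"
    by (simp add: cochain_mult_one_right cochain_componentD(1)[OF gen_cochain_component])
  have "free_cochain X (word_diff (g # w)) =
     (\<lambda>n c. cochain_mult X (cochain_diff X (gen_cochain X g)) (word_cochain X w) n c +
        (-1) ^ gen_degree g * cochain_mult X (gen_cochain X g) (cochain_diff X (word_cochain X w)) n c)"
    by (simp only: word_diff.simps free_cochain_add free_cochain_cmul free_cochain_mult gen_diff_cochain
        free_cochain_of[of X w] Cons.IH g)
  also have "\<dots> = cochain_diff X (word_cochain X (g # w))"
    using cochain_leibniz[OF gen_cochain_component word_cochain_component, of X g w] by simp
  finally show ?case .
qed

text \<open>Through this correspondence the Leibniz rule and the vanishing of the squared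
  differential pass from cochains to \<open>B_dga\<close>.\<close>

lemma free_diff_cochain: "free_cochain X (free_diff a) = cochain_diff X (free_cochain X a)"
  using subset_UNIV[of "Poly_Mapping.keys a"] unfolding free_diff_def
proof (induction a rule: frag_induction)
  case (one w)
  then show ?case by (simp add: word_diff_cochain)
qed (auto simp: frag_extend_diff free_cochain_diff cochain_diff_subtract cochain_diff_zero)

section \<open>Values of words on cubical faces\<close>

text \<open>The value of the cochain of the word on the path that raises the coordinates of
  \<open>l\<close> in order: a letter \<open>s\<close> tests the first vertex of the path, a letter
  \<open>t\<close> has to consume its first edge. The sign is that of a cup product whose left
  factor has degree 1.\<close>

fun word_value :: "B_gen list \<Rightarrow> (nat \<Rightarrow> real) \<Rightarrow> nat list \<Rightarrow> int" where
  "word_value [] f l = (if l = [] then 1 else 0)"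
| "word_value (SGen i # w) f l = (if i \<notin> set l \<and> f i > 0 then word_value w f l else 0)"
| "word_value (TGen i # w) f [] = 0"
| "word_value (TGen i # w) f (a # l) =
     (if a = i then (-1) ^ length l * word_value w (fix_coords {a} 1 f) l else 0)"

definition path_value :: "(B_gen list \<Rightarrow>\<^sub>0 int) \<Rightarrow> (nat \<Rightarrow> real) \<Rightarrow> nat list \<Rightarrow> int" where
  "path_value a f l = frag_eval (\<lambda>w. word_value w f l) a"

definition face_value :: "nat \<Rightarrow> (B_gen list \<Rightarrow>\<^sub>0 int) \<Rightarrow> (nat \<Rightarrow> real) \<Rightarrow> int" where
  "face_value m a f = (\<Sum>l\<in>permutations_of_set (zeros m f). perm_sign l * path_value a f l)"

lemma cup_value_component_left:
  assumes "f \<in> component (cochain_dga X) d" "d \<le> n"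
  shows "cup_value f g n x = (-1) ^ ((n - d) * d) * f d (frag_of (singular_interval x 0 d))
      * g (n - d) (frag_of (singular_interval x d (n - d)))"
proof -
  have "cup_value f g n x = (\<Sum>k\<in>{d}. (-1) ^ ((n - k) * k) * f k (frag_of (singular_interval x 0 k))
      * g (n - k) (frag_of (singular_interval x k (n - k))))"
    unfolding cup_value_def using cochain_componentD(2)[OF assms(1)] assms(2)
    by (intro sum.mono_neutral_right) auto
  then show ?thesis by simp
qed

lemma s_cochain_path:
  assumes "f \<in> cube_faces m \<Sigma>" "l \<in> permutations_of_set (zeros m f)" "i \<in> {1..m}" "k \<le> length l"
  shows "s_cochain (real_moment_angle m \<Sigma>) i 0 (frag_of (reindex 0 (\<lambda>_. k) (path_simplex m f l))) =
    (if path_vertex f l k i > 0 then 1 else 0)"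
proof -
  have "singular_simplex 0 (real_moment_angle m \<Sigma>) (reindex 0 (\<lambda>_. k) (path_simplex m f l))"
    using singular_simplex_path[OF assms(1,2)] assms(4) by (auto intro: singular_simplex_reindex)
  moreover have "reindex 0 (\<lambda>_. k) (path_simplex m f l) (basis_point 0) i = path_vertex f l k i"
    using assms(3,4) affine_simplex_basis_point[of 0 0 i m "\<lambda>_. path_vertex f l k"]
    unfolding path_simplex_def by (subst reindex_affine_simplex) auto
  ultimately show ?thesis by (simp add: s_cochain_def to_cochain_of)
qed

lemma t_cochain_path:
  assumes f: "f \<in> cube_faces m \<Sigma>" and l: "[a] \<in> permutations_of_set (zeros m f)" and i: "i \<in> {1..m}"
  shows "gen_cochain (real_moment_angle m \<Sigma>) (TGen i) 1 (frag_of (path_simplex m f [a])) = (if a = i then 1 else 0)"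
proof -
  let ?X = "real_moment_angle m \<Sigma>" and ?x = "path_simplex m f [a]"
  have x: "singular_simplex (Suc 0) ?X ?x"
    using singular_simplex_path[OF f l] by simp
  have "singular_face (Suc 0) 0 ?x = reindex 0 (\<lambda>_. 1) ?x" "singular_face (Suc 0) (Suc 0) ?x = reindex 0 (\<lambda>_. 0) ?x"
    by (auto simp: singular_face_eq_reindex skip_def intro!: reindex_cong)
  then have "gen_cochain ?X (TGen i) 1 (frag_of ?x) =
     (if path_vertex f [a] 1 i > 0 then 1 else 0) - (if path_vertex f [a] 0 i > 0 then 1 else 0)"
    using s_cochain_path[OF f l i, of 0] s_cochain_path[OF f l i, of 1]
      cochain_diff_of[where f = "s_cochain ?X i", OF cochain_componentD(1)[OF s_cochain_component] x]
    by (simp add: face_sum_def)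
  then show ?thesis by (auto simp: path_vertex_def)
qed

lemma word_cochain_path:
  assumes \<Sigma>: "simplicial_complex_on m \<Sigma>"
  shows "\<lbrakk>w \<in> lists (B_gens m); f \<in> cube_faces m \<Sigma>; l \<in> permutations_of_set (zeros m f)\<rbrakk> \<Longrightarrow>
    word_cochain (real_moment_angle m \<Sigma>) w (length l) (frag_of (path_simplex m f l)) = word_value w f l"
proof (induction w arbitrary: f l)
  case Nil
  then show ?case
    using singular_simplex_path[OF Nil(2,3)] by (simp add: cochain_one_eq to_cochain_of)
next
  case (Cons g w)
  let ?X = "real_moment_angle m \<Sigma>" and ?n = "length l" and ?x = "path_simplex m f l"
  note x = singular_simplex_path[OF Cons.prems(2,3)]
  have l: "distinct l" "set l = zeros m f" using Cons.prems(3) by (auto dest: permutations_of_setD)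
  show ?case
  proof (cases g)
    case (SGen i)
    have i: "i \<in> {1..m}" using Cons.prems(1) SGen by (auto simp: B_gens_def)
    have "singular_interval ?x 0 0 = reindex 0 (\<lambda>_. 0) ?x"
      unfolding singular_interval_eq_reindex by (rule reindex_cong) simp
    then have "s_cochain ?X i 0 (frag_of (singular_interval ?x 0 0)) = (if i \<notin> set l \<and> f i > 0 then 1 else 0)"
      using s_cochain_path[OF Cons.prems(2,3) i, of 0] by (simp add: path_vertex_def)
    then show ?thesis
      using Cons.IH[OF _ Cons.prems(2,3)] Cons.prems(1) x
      by (simp add: SGen cochain_mult_of cup_value_component_left[OF s_cochain_component] singular_interval_id)
  next
    case (TGen i)
    have i: "i \<in> {1..m}" using Cons.prems(1) TGen by (auto simp: B_gens_def)
    note t = gen_cochain_component[of ?X "TGen i", simplified gen_degree.simps]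
    show ?thesis
    proof (cases l)
      case Nil
      have "gen_cochain ?X (TGen i) 0 = (\<lambda>c. 0)" using cochain_componentD(2)[OF t, of 0] by simp
      then show ?thesis using x Nil by (simp add: TGen cochain_mult_of cup_value_def del: gen_cochain.simps)
    next
      case (Cons a l')
      have a: "a \<in> zeros m f" "a \<notin> set l'" "set l' = zeros m f - {a}" "distinct l'" using l Cons by auto
      have f': "fix_coords {a} 1 f \<in> cube_faces m \<Sigma>" and f'': "fix_coords (set l') (-1) f \<in> cube_faces m \<Sigma>"
        using a by (auto intro!: fix_coords_cube_faces[OF \<Sigma> \<open>f \<in> cube_faces m \<Sigma>\<close>])
      have l': "l' \<in> permutations_of_set (zeros m (fix_coords {a} 1 f))"
        "[a] \<in> permutations_of_set (zeros m (fix_coords (set l') (-1) f))"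
        using a by (auto simp: permutations_of_set_def zeros_fix_coords)
      have "singular_interval ?x 0 1 = path_simplex m (fix_coords (set l') (-1) f) [a]"
        "singular_interval ?x 1 (length l') = path_simplex m (fix_coords {a} 1 f) l'"
        using singular_interval_path_left[of "[a]" l' m f] singular_interval_path_right[of "[a]" l' m f] l Cons by auto
      then have "cup_value (gen_cochain ?X (TGen i)) (word_cochain ?X w) ?n ?x =
          (-1) ^ length l' * (if a = i then 1 else 0) * word_value w (fix_coords {a} 1 f) l'"
        using cup_value_component_left[OF t, of ?n "word_cochain ?X w" ?x] t_cochain_path[OF f'' l'(2) i]
          Cons.IH[OF _ f' l'(1)] Cons.prems(1) Cons by (simp del: gen_cochain.simps)
      then show ?thesis using x Cons by (simp add: TGen cochain_mult_of del: gen_cochain.simps)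
    qed
  qed
qed

lemma cube_eval_free_cochain:
  assumes \<Sigma>: "simplicial_complex_on m \<Sigma>" and a: "a \<in> carrier (free_ring m)" and f: "f \<in> cube_faces m \<Sigma>"
  shows "cube_eval m (free_cochain (real_moment_angle m \<Sigma>) a) f = face_value m a f"
proof -
  have "free_cochain (real_moment_angle m \<Sigma>) a (length l) (frag_of (path_simplex m f l)) = path_value a f l"
    if "l \<in> permutations_of_set (zeros m f)" for l
    unfolding free_cochain_def path_value_def
    using a unfolding free_ring_simps by (intro frag_eval_cong word_cochain_path[OF \<Sigma> _ f that]) blast
  then show ?thesis
    by (simp add: cube_eval_sum[OF f free_cochain_normalized] face_value_def)
qed

lemma path_value_simps:
  "path_value 0 f l = 0" "path_value (a + b) f l = path_value a f l + path_value b f l"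
  "path_value (a - b) f l = path_value a f l - path_value b f l" "path_value (- a) f l = - path_value a f l"
  "path_value (frag_cmul k a) f l = k * path_value a f l" "path_value (frag_of w) f l = word_value w f l"
  by (simp_all add: path_value_def frag_eval_add frag_eval_diff frag_eval_cmul frag_eval_minus)

lemma face_value_simps:
  "face_value m 0 f = 0" "face_value m (a + b) f = face_value m a f + face_value m b f"
  "face_value m (a - b) f = face_value m a f - face_value m b f" "face_value m (- a) f = - face_value m a f"
  "face_value m (frag_cmul k a) f = k * face_value m a f"
  by (simp_all add: face_value_def path_value_simps algebra_simps sum.distrib sum_subtractf sum_negf sum_distrib_left)

lemma face_value_extend: "face_value m (frag_extend F c) f = frag_eval (\<lambda>x. face_value m (F x) f) c"
  by (simp add: face_value_def path_value_def frag_eval_extend)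
    (simp add: frag_eval_def sum_distrib_left sum_distrib_right mult_ac sum.swap[of _ "permutations_of_set _"])

definition vanishing_ideal :: "nat \<Rightarrow> nat set set \<Rightarrow> (B_gen list \<Rightarrow>\<^sub>0 int) set" where
  "vanishing_ideal m \<Sigma> = {a \<in> carrier (free_ring m). \<forall>f\<in>cube_faces m \<Sigma>. face_value m a f = 0}"

text \<open>By \<open>cube_eval_mult\<close> each summand of the value of a product contains a value
  of the given factor on a face contained in \<open>f\<close>, hence again a face of the
  complex.\<close>

lemma ideal_vanishing_ideal:
  assumes \<Sigma>: "simplicial_complex_on m \<Sigma>"
  shows "ideal (vanishing_ideal m \<Sigma>) (free_ring m)"
proof (rule idealI)
  let ?J = "vanishing_ideal m \<Sigma>" and ?X = "real_moment_angle m \<Sigma>"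
  show "ring (free_ring m)" by (rule ring_free_ring)
  show "subgroup ?J (add_monoid (free_ring m))"
  proof
    fix a assume a: "a \<in> ?J"
    then have "- a \<in> ?J" by (simp add: vanishing_ideal_def free_carrier_unary face_value_simps)
    then show "inv\<^bsub>add_monoid (free_ring m)\<^esub> a \<in> ?J"
      using free_ring_minus[of a m] a by (simp add: a_inv_def vanishing_ideal_def)
  qed (auto simp: vanishing_ideal_def free_ring_simps(4,5) free_carrier_closed free_carrier_unary free_carrier_0 face_value_simps)
  fix a x assume a: "a \<in> ?J" and x: "x \<in> carrier (free_ring m)"
  then have a': "a \<in> carrier (free_ring m)" by (simp add: vanishing_ideal_def)
  have 0: "cube_eval m (free_cochain ?X a) g = 0" if "g \<in> cube_faces m \<Sigma>" for g
    using a that cube_eval_free_cochain[OF \<Sigma> a' that] by (simp add: vanishing_ideal_def)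
  have "face_value m (x \<star> a) f = 0 \<and> face_value m (a \<star> x) f = 0" if f: "f \<in> cube_faces m \<Sigma>" for f
  proof -
    note e = cube_eval_mult[OF \<Sigma> f free_cochain_normalized free_cochain_normalized]
    have "cube_eval m (free_cochain ?X a) (fix_coords A 1 f) = 0"
      "cube_eval m (free_cochain ?X a) (fix_coords (zeros m f - A) (-1) f) = 0" if "A \<in> Pow (zeros m f)" for A
      using that by (auto intro!: 0 fix_coords_cube_faces[OF \<Sigma> f])
    then show ?thesis
      using cube_eval_free_cochain[OF \<Sigma> free_carrier_closed(3)[OF x a'] f]
        cube_eval_free_cochain[OF \<Sigma> free_carrier_closed(3)[OF a' x] f]
      by (simp add: free_cochain_mult e)
  qed
  then show "x \<otimes>\<^bsub>free_ring m\<^esub> a \<in> ?J" "a \<otimes>\<^bsub>free_ring m\<^esub> x \<in> ?J"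
    using a' x by (auto simp: vanishing_ideal_def free_ring_simps(2) free_carrier_closed)
qed

text \<open>Each \<open>t\<close> consumes the head of the list, so only the path in the order of
  the word survives. A product over a nonface thus sees only a face that is missing from the
  complex.\<close>

lemma word_value_TGens: "word_value (map TGen js) f l \<noteq> 0 \<Longrightarrow> l = js"
  by (induction js arbitrary: f l) (auto split: if_splits, (case_tac l; auto split: if_splits)+)

lemma B_relations_vanish:
  assumes "simplicial_complex_on m \<Sigma>" "a \<in> B_relations m \<Sigma>"
  shows "a \<in> vanishing_ideal m \<Sigma>"
proof -
  have gens: "SGen i \<in> B_gens m" "TGen i \<in> B_gens m" if "i \<in> {1..m}" for i
    using that by (auto simp: B_gens_def)
  consider (1) i where "i \<in> {1..m}" "a \<in> {frag_of [SGen i, SGen i] - frag_of [SGen i],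
      frag_of [TGen i, SGen i] - frag_of [TGen i], frag_of [SGen i, TGen i], frag_of [TGen i, TGen i]}"
    | (2) g h where "a = frag_of [g, h] - frag_cmul ((-1) ^ (gen_degree g * gen_degree h)) (frag_of [h, g])"
        "g \<in> B_gens m" "h \<in> B_gens m" "subscript g \<noteq> subscript h"
    | (3) \<sigma> where "a = frag_of (map TGen (sorted_list_of_set \<sigma>))" "\<sigma> \<subseteq> {1..m}" "\<sigma> \<notin> \<Sigma>"
    using assms(2) unfolding B_relations_def Let_def by auto
  then show ?thesis
  proof cases
    case 1
    \<comment> \<open>These relations hold path by path. Distinctness of \<open>l\<close> kills
      \<open>t_i t_i\<close>; the asymmetry of \<open>t_i s_i\<close> and \<open>s_i t_i\<close>
      reflects that the coordinate is \<open>1\<close> after its step and \<open>-1\<close> before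
      it.\<close>
    have v: "path_value a f l = 0" if "distinct l" for f l
      using that 1(2)
      by (cases l; cases "tl l") (auto simp: path_value_simps fix_coords_def)
    have "a \<in> carrier (free_ring m)"
      using 1 gens by (auto intro!: free_carrier_closed simp: free_carrier_of)
    then show ?thesis
      using v by (auto simp: vanishing_ideal_def face_value_def permutations_of_set_def intro!: sum.neutral)
  next
    case 2
    have c: "a \<in> carrier (free_ring m)"
      unfolding 2(1) using 2(2,3) by (intro free_carrier_closed free_carrier_unary) (auto simp: free_carrier_of)
    \<comment> \<open>For two letters \<open>t\<close> the relation has value \<open>-1\<close> on
      each of the paths \<open>[i, j]\<close> and \<open>[j, i]\<close>, and it vanishes only in the
      signed sum over both. In all other cases it vanishes on every path.\<close>
    have "face_value m a f = 0" for f
    proof (cases "\<exists>i j. g = TGen i \<and> h = TGen j")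
      case False
      have "path_value a f l = 0" for l
        using 2(4) False unfolding 2(1)
        by (cases g; cases h; cases l; cases "tl l") (auto simp: path_value_simps fix_coords_def)
      then show ?thesis by (simp add: face_value_def)
    next
      case True
      then obtain i j where ij: "g = TGen i" "h = TGen j" "i \<noteq> j" using 2(4) by auto
      have v: "path_value a f l = (if l = [i, j] then -1 else 0) + (if l = [j, i] then -1 else 0)" for l
        unfolding 2(1) ij
        by (cases l; cases "tl l"; cases "tl (tl l)") (use ij(3) in \<open>auto simp: path_value_simps\<close>)
      show ?thesis
      proof (cases "zeros m f = {i, j}")
        case True
        have "permutations_of_set {i, j} = {[i, j], [j, i]}"
          using ij(3) by (rule permutations_of_set_doubleton)
        moreover have "{b. b = j \<and> b < i} = (if j < i then {j} else {})" "{b. b = i \<and> b < j} = (if i < j then {i} else {})"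
          by auto
        ultimately show ?thesis
          using ij(3) by (auto simp: face_value_def True v)
      next
        case False
        then have "l \<noteq> [i, j] \<and> l \<noteq> [j, i]" if "l \<in> permutations_of_set (zeros m f)" for l
          using permutations_of_setD(1)[OF that] by auto
        then show ?thesis by (simp add: face_value_def v)
      qed
    qed
    then show ?thesis using c by (simp add: vanishing_ideal_def)
  next
    case 3
    have fin: "finite \<sigma>" using 3(2) finite_subset by blast
    have "face_value m a f = 0" if f: "f \<in> cube_faces m \<Sigma>" for f
      unfolding face_value_def
    proof (intro sum.neutral ballI)
      fix l assume l: "l \<in> permutations_of_set (zeros m f)"
      have "l \<noteq> sorted_list_of_set \<sigma>"
        using permutations_of_setD(1)[OF l] f 3(3) fin by (auto simp: cube_faces_def)
      then show "perm_sign l * path_value a f l = 0"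
        using word_value_TGens[of "sorted_list_of_set \<sigma>" f l] unfolding 3(1) by (auto simp: path_value_simps)
    qed
    moreover have "a \<in> carrier (free_ring m)"
      unfolding 3(1) free_carrier_of using subsetD[OF 3(2)] gens(2) fin by auto
    ultimately show ?thesis by (simp add: vanishing_ideal_def)
  qed
qed

lemma B_relations_carrier: "B_relations m \<Sigma> \<subseteq> carrier (free_ring m)"
proof -
  have "SGen i \<in> B_gens m" "TGen i \<in> B_gens m" if "i \<in> {1..m}" for i
    using that by (auto simp: B_gens_def)
  moreover have "TGen i \<in> B_gens m" if "i \<in> set (sorted_list_of_set \<sigma>)" "\<sigma> \<subseteq> {1..m}" for i \<sigma>
    using that finite_subset[OF that(2)] by (auto simp: B_gens_def)
  ultimately show ?thesis
    unfolding B_relations_def Let_def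
    by (auto intro!: free_carrier_closed free_carrier_unary simp: free_carrier_of minus_frag_cmul[symmetric] simp del: minus_frag_cmul)
qed

lemma ideal_B_ideal: "ideal (B_ideal m \<Sigma>) (free_ring m)"
  unfolding B_ideal_def by (rule ring.genideal_ideal[OF ring_free_ring B_relations_carrier])

lemma B_ideal_subset_vanishing: "simplicial_complex_on m \<Sigma> \<Longrightarrow> B_ideal m \<Sigma> \<subseteq> vanishing_ideal m \<Sigma>"
  unfolding B_ideal_def using B_relations_vanish
  by (intro ring.genideal_minimal[OF ring_free_ring ideal_vanishing_ideal]) auto

section \<open>A basis of \<open>B(\<Sigma>)\<close> indexed by the faces\<close>

text \<open>The letters are chosen so that \<open>face_element\<close> is, up to sign, the indicator function of a single face.\<close>

definition face_letter :: "(nat \<Rightarrow> real) \<Rightarrow> nat \<Rightarrow> B_gen list \<Rightarrow>\<^sub>0 int" where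
  "face_letter f i = (if f i = 0 then frag_of [TGen i] else if f i = 1 then frag_of [SGen i]
     else frag_of [] - frag_of [SGen i])"

fun face_element :: "nat list \<Rightarrow> (nat \<Rightarrow> real) \<Rightarrow> B_gen list \<Rightarrow>\<^sub>0 int" where
  "face_element [] f = frag_of []"
| "face_element (i # js) f = face_letter f i \<star> face_element js f"

lemma face_letter_carrier: "i \<in> {1..m} \<Longrightarrow> face_letter f i \<in> carrier (free_ring m)"
  by (auto simp: face_letter_def free_carrier_of B_gens_def intro!: free_carrier_closed)

lemma face_element_carrier: "set js \<subseteq> {1..m} \<Longrightarrow> face_element js f \<in> carrier (free_ring m)"
  by (induction js) (auto simp: free_carrier_of intro!: free_carrier_closed face_letter_carrier)

lemma face_element_cong: "(\<And>i. i \<in> set js \<Longrightarrow> f i = g i) \<Longrightarrow> face_element js f = face_element js g"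
  by (induction js) (auto simp: face_letter_def)

lemma path_value_gen_mult:
  "path_value (frag_of [SGen i] \<star> a) f l = (if i \<notin> set l \<and> f i > 0 then path_value a f l else 0)"
  "path_value (frag_of [TGen i] \<star> a) f l = (if l \<noteq> [] \<and> hd l = i
     then (-1) ^ length (tl l) * path_value a (fix_coords {i} 1 f) (tl l) else 0)"
  by (auto simp: word_mult_def path_value_def frag_eval_extend)
     (cases l; auto simp: frag_eval_mult)+

text \<open>The sign is chosen before \<open>g\<close> and \<open>l\<close> because the induction
  passes to another face and a shorter list. The requirement that zeros of \<open>g\<close> occur in
  \<open>l\<close> makes coordinates outside \<open>l\<close> equal to \<open>1\<close> or
  \<open>-1\<close>, so that \<open>1 - s_i\<close> acts as the indicator of \<open>-1\<close>
  there.\<close>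

lemma path_value_face_element:
  fixes f :: "nat \<Rightarrow> real"
  assumes "distinct js" and f: "\<And>i. i \<in> set js \<Longrightarrow> f i \<in> {-1, 0, 1}"
  shows "\<exists>s\<in>{1, -1}. \<forall>(g :: nat \<Rightarrow> real) l. (\<forall>i\<in>set js. g i \<in> {-1, 0, 1} \<and> (g i = 0 \<longrightarrow> i \<in> set l)) \<longrightarrow>
    path_value (face_element js f) g l =
      (if l = filter (\<lambda>i. f i = 0) js \<and> (\<forall>i\<in>set js. f i \<noteq> 0 \<longrightarrow> f i = g i) then s else 0)"
  using assms
proof (induction js)
  case Nil
  then show ?case by (intro bexI[of _ 1]) (auto simp: path_value_simps)
next
  case (Cons j js)
  then obtain s where s: "s \<in> {1, -1}" and IH: "\<And>(g :: nat \<Rightarrow> real) l. (\<forall>i\<in>set js. g i \<in> {-1, 0, 1} \<and> (g i = 0 \<longrightarrow> i \<in> set l)) \<Longrightarrow>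
    path_value (face_element js f) g l =
      (if l = filter (\<lambda>i. f i = 0) js \<and> (\<forall>i\<in>set js. f i \<noteq> 0 \<longrightarrow> f i = g i) then s else 0)"
    by auto
  have j: "j \<notin> set js" "f j \<in> {-1, 0, 1}" using Cons.prems by auto
  show ?case
  proof (cases "f j = 0")
    case False
    show ?thesis
    proof (intro bexI[of _ s] allI impI)
      fix g :: "nat \<Rightarrow> real" and l assume g: "\<forall>i\<in>set (j # js). g i \<in> {-1, 0, 1} \<and> (g i = 0 \<longrightarrow> i \<in> set l)"
      then have IH': "path_value (face_element js f) g l =
        (if l = filter (\<lambda>i. f i = 0) js \<and> (\<forall>i\<in>set js. f i \<noteq> 0 \<longrightarrow> f i = g i) then s else 0)"
        by (intro IH) auto
      have gj: "g j = -1 \<or> g j = 1" if "j \<notin> set l" using g that by auto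
      consider "f j = 1" | "f j = -1" using j False by auto
      then show "path_value (face_element (j # js) f) g l =
        (if l = filter (\<lambda>i. f i = 0) (j # js) \<and> (\<forall>i\<in>set (j # js). f i \<noteq> 0 \<longrightarrow> f i = g i) then s else 0)"
      proof cases
        case 1
        then have "path_value (face_element (j # js) f) g l =
            (if j \<notin> set l \<and> g j > 0 then path_value (face_element js f) g l else 0)"
          by (simp add: face_letter_def path_value_gen_mult)
        then show ?thesis unfolding IH' using 1 j gj by auto
      next
        case 2
        then have "path_value (face_element (j # js) f) g l = path_value (face_element js f) g l -
            (if j \<notin> set l \<and> g j > 0 then path_value (face_element js f) g l else 0)"
          by (simp add: face_letter_def path_value_gen_mult word_mult_diff_left word_mult_one_left path_value_simps)
        then show ?thesis unfolding IH' using 2 j gj by auto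
      qed
    qed (rule s)
  next
    case True
    let ?e = "(-1) ^ length (filter (\<lambda>i. f i = 0) js) :: int"
    show ?thesis
    proof (intro bexI[of _ "?e * s"] allI impI)
      fix g :: "nat \<Rightarrow> real" and l assume g: "\<forall>i\<in>set (j # js). g i \<in> {-1, 0, 1} \<and> (g i = 0 \<longrightarrow> i \<in> set l)"
      have v: "path_value (face_element (j # js) f) g l = (if l \<noteq> [] \<and> hd l = j
         then (-1) ^ length (tl l) * path_value (face_element js f) (fix_coords {j} 1 g) (tl l) else 0)"
        using True by (simp add: face_letter_def path_value_gen_mult)
      show "path_value (face_element (j # js) f) g l =
        (if l = filter (\<lambda>i. f i = 0) (j # js) \<and> (\<forall>i\<in>set (j # js). f i \<noteq> 0 \<longrightarrow> f i = g i) then ?e * s else 0)"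
      proof (cases "l \<noteq> [] \<and> hd l = j")
        case False
        then show ?thesis using True v by auto
      next
        case l: True
        then obtain l' where l': "l = j # l'" by (cases l) auto
        have "path_value (face_element js f) (fix_coords {j} 1 g) l' =
          (if l' = filter (\<lambda>i. f i = 0) js \<and> (\<forall>i\<in>set js. f i \<noteq> 0 \<longrightarrow> f i = fix_coords {j} 1 g i) then s else 0)"
          using g j l' by (intro IH) (auto simp: fix_coords_def)
        moreover have "fix_coords {j} 1 g i = g i" if "i \<in> set js" for i
          using that j by (auto simp: fix_coords_def)
        ultimately show ?thesis using True v l' by auto
      qed
    qed (use s in \<open>auto simp: minus_one_power_iff\<close>)
  qed
qed

definition full_face_element :: "nat \<Rightarrow> (nat \<Rightarrow> real) \<Rightarrow> B_gen list \<Rightarrow>\<^sub>0 int" where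
  "full_face_element m = face_element [1..<Suc m]"

lemma set_upt_Suc: "set [1..<Suc m] = {1..m}"
  by auto

lemma full_face_element_carrier: "full_face_element m f \<in> carrier (free_ring m)"
  unfolding full_face_element_def by (rule face_element_carrier) auto

lemma full_face_element_cong:
  "(\<And>i. i \<in> {1..m} \<Longrightarrow> f i = g i) \<Longrightarrow> full_face_element m f = full_face_element m g"
  unfolding full_face_element_def by (rule face_element_cong) auto

lemma face_value_face_element:
  assumes f: "f \<in> {1..m} \<rightarrow>\<^sub>E {-1, 0, 1}"
  obtains s where "s = 1 \<or> s = (-1::int)"
    "\<And>g. g \<in> {1..m} \<rightarrow>\<^sub>E {-1, 0, 1} \<Longrightarrow> face_value m (full_face_element m f) g = (if f = g then s else 0)"
proof -
  have "distinct [1..<Suc m]" "\<And>i. i \<in> set [1..<Suc m] \<Longrightarrow> f i \<in> {-1, 0, 1}"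
    using f unfolding set_upt_Suc by auto
  from path_value_face_element[OF this, unfolded set_upt_Suc, folded full_face_element_def]
  obtain s where s: "s \<in> {1, -1::int}" and v: "\<forall>(g :: nat \<Rightarrow> real) l. (\<forall>i\<in>{1..m}. g i \<in> {-1, 0, 1} \<and> (g i = 0 \<longrightarrow> i \<in> set l)) \<longrightarrow>
    path_value (full_face_element m f) g l =
      (if l = filter (\<lambda>i. f i = 0) [1..<Suc m] \<and> (\<forall>i\<in>{1..m}. f i \<noteq> 0 \<longrightarrow> f i = g i) then s else 0)"
    by (rule bexE)
  let ?l = "filter (\<lambda>i. f i = 0) [1..<Suc m]"
  have l: "?l \<in> permutations_of_set (zeros m f)"
    by (auto simp: permutations_of_set_def zeros_def)
  have "face_value m (full_face_element m f) g = (if f = g then perm_sign ?l * s else 0)"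
    if g: "g \<in> {1..m} \<rightarrow>\<^sub>E {-1, 0, 1}" for g
  proof -
    have val: "path_value (full_face_element m f) g l =
      (if l = ?l \<and> (\<forall>i\<in>{1..m}. f i \<noteq> 0 \<longrightarrow> f i = g i) then s else 0)" if "l \<in> permutations_of_set (zeros m g)" for l
      using g permutations_of_setD(1)[OF that] by (intro v[rule_format]) (auto simp: zeros_def)
    show ?thesis
    proof (cases "f = g")
      case True
      have "face_value m (full_face_element m f) g = (\<Sum>l\<in>permutations_of_set (zeros m f). if l = ?l then perm_sign ?l * s else 0)"
        unfolding face_value_def using val True by (intro sum.cong) auto
      then show ?thesis using l True by (simp del: upt_Suc)
    next
      case False
      have "path_value (full_face_element m f) g l = 0" if "l \<in> permutations_of_set (zeros m g)" for l
      proof (rule ccontr)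
        assume "path_value (full_face_element m f) g l \<noteq> 0"
        then have "l = ?l" "\<forall>i\<in>{1..m}. f i \<noteq> 0 \<longrightarrow> f i = g i" using val[OF that] by (auto split: if_splits)
        then have "zeros m f = zeros m g" "\<forall>i\<in>{1..m}. f i \<noteq> 0 \<longrightarrow> f i = g i"
          using permutations_of_setD(1)[OF that] permutations_of_setD(1)[OF l] by auto
        then have "f i = g i" if "i \<in> {1..m}" for i
          using that by (cases "f i = 0") (auto simp: zeros_def)
        then show False using False f g by (metis PiE_ext)
      qed
      then show ?thesis using False by (simp add: face_value_def)
    qed
  qed
  then show thesis using s perm_sign_nonzero[of ?l] by (intro that[of "perm_sign ?l * s"]) (auto simp del: upt_Suc)
qed

lemma B_idealI: "a \<in> B_relations m \<Sigma> \<Longrightarrow> a \<in> B_ideal m \<Sigma>"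
  unfolding B_ideal_def using ring.genideal_self[OF ring_free_ring B_relations_carrier] by blast

lemma B_ideal_carrier: "a \<in> B_ideal m \<Sigma> \<Longrightarrow> a \<in> carrier (free_ring m)"
  using ideal.Icarr[OF ideal_B_ideal] .

lemma B_ideal_closed:
  "0 \<in> B_ideal m \<Sigma>"
  "\<lbrakk>a \<in> B_ideal m \<Sigma>; b \<in> B_ideal m \<Sigma>\<rbrakk> \<Longrightarrow> a + b \<in> B_ideal m \<Sigma>"
  "a \<in> B_ideal m \<Sigma> \<Longrightarrow> - a \<in> B_ideal m \<Sigma>"
  "\<lbrakk>a \<in> B_ideal m \<Sigma>; x \<in> carrier (free_ring m)\<rbrakk> \<Longrightarrow> x \<star> a \<in> B_ideal m \<Sigma>"
  "\<lbrakk>a \<in> B_ideal m \<Sigma>; x \<in> carrier (free_ring m)\<rbrakk> \<Longrightarrow> a \<star> x \<in> B_ideal m \<Sigma>"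
proof -
  interpret ideal "B_ideal m \<Sigma>" "free_ring m" by (rule ideal_B_ideal)
  show "0 \<in> B_ideal m \<Sigma>" using additive_subgroup.zero_closed[OF is_additive_subgroup] by (simp add: free_ring_simps)
  show "\<lbrakk>a \<in> B_ideal m \<Sigma>; b \<in> B_ideal m \<Sigma>\<rbrakk> \<Longrightarrow> a + b \<in> B_ideal m \<Sigma>" using additive_subgroup.a_closed[OF is_additive_subgroup] by (simp add: free_ring_simps)
  show "a \<in> B_ideal m \<Sigma> \<Longrightarrow> - a \<in> B_ideal m \<Sigma>"
    using additive_subgroup.a_inv_closed[OF is_additive_subgroup] free_ring_minus[OF B_ideal_carrier, of a m \<Sigma>] by metis
  show "\<lbrakk>a \<in> B_ideal m \<Sigma>; x \<in> carrier (free_ring m)\<rbrakk> \<Longrightarrow> x \<star> a \<in> B_ideal m \<Sigma>" using I_l_closed by (simp add: free_ring_simps)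
  show "\<lbrakk>a \<in> B_ideal m \<Sigma>; x \<in> carrier (free_ring m)\<rbrakk> \<Longrightarrow> a \<star> x \<in> B_ideal m \<Sigma>" using I_r_closed by (simp add: free_ring_simps)
qed

lemma B_ideal_diff: "\<lbrakk>a \<in> B_ideal m \<Sigma>; b \<in> B_ideal m \<Sigma>\<rbrakk> \<Longrightarrow> a - b \<in> B_ideal m \<Sigma>"
  using B_ideal_closed(2)[of a m \<Sigma> "- b"] B_ideal_closed(3)[of b m \<Sigma>] by simp

lemma B_ideal_cmul: "a \<in> B_ideal m \<Sigma> \<Longrightarrow> frag_cmul k a \<in> B_ideal m \<Sigma>"
  by (rule frag_closure_minus_cmul[where P = "\<lambda>x. x \<in> B_ideal m \<Sigma>"]) (auto simp: B_ideal_closed B_ideal_diff)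

text \<open>Modulo the ideal the generator moves, up to sign, past the letters of other coordinates
  and is then merged with the letter of its own coordinate. The unit coefficient for a
  \<open>t\<close> meeting an \<open>s\<close> is recorded because it later shows that the elements
  of nonfaces lie in the ideal, over the integers.\<close>

lemma gen_mult_face_element:
  assumes g: "g \<in> B_gens m" and i: "i = subscript g" "i \<in> set js" and js: "distinct js" "set js \<subseteq> {1..m}"
    and f: "f i \<in> {-1, 0, 1}"
  shows "\<exists>k. frag_of [g] \<star> face_element js f - frag_cmul k (face_element js (if gen_degree g = 0 then f else f(i := 0)))
      \<in> B_ideal m \<Sigma> \<and> (gen_degree g = 1 \<and> f i = 1 \<longrightarrow> k = 1 \<or> k = -1)"
    (is "\<exists>k. ?P k js")
  using i(2) js
proof (induction js)
  case (Cons j js)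
  let ?f = "if gen_degree g = 0 then f else f(i := 0)"
  have im: "i \<in> {1..m}" using g i(1) by (auto simp: B_gens_def)
  have W: "face_element js f \<in> carrier (free_ring m)" using Cons.prems(3) by (intro face_element_carrier) auto
  show ?case
  proof (cases "i = j")
    case True
    have same: "face_element js ?f = face_element js f"
      using Cons.prems(2) True by (intro face_element_cong) auto
    have rel: "frag_of [SGen i, SGen i] - frag_of [SGen i] \<in> B_ideal m \<Sigma>"
        "frag_of [TGen i, SGen i] - frag_of [TGen i] \<in> B_ideal m \<Sigma>"
        "frag_of [SGen i, TGen i] \<in> B_ideal m \<Sigma>" "frag_of [TGen i, TGen i] \<in> B_ideal m \<Sigma>"
      using im by (intro B_idealI, unfold B_relations_def Let_def word_mult_of append_Cons append_Nil, blast)+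
    \<comment> \<open>Among the products with the letter of the same coordinate only
      \<open>s_i s_i = s_i\<close> and \<open>t_i s_i = t_i\<close> survive; those with
      \<open>t_i\<close> or \<open>1 - s_i\<close> on the right vanish. This is the witness
      \<open>k\<close> in both cases.\<close>
    have "\<exists>k. frag_of [g] \<star> face_letter f i - frag_cmul k (face_letter ?f i) \<in> B_ideal m \<Sigma>
       \<and> (gen_degree g = 1 \<and> f i = 1 \<longrightarrow> k = 1 \<or> k = -1)"
    proof (cases g)
      case (SGen i')
      then have g': "g = SGen i" using i(1) by simp
      have "frag_of [SGen i] - frag_of [SGen i, SGen i] \<in> B_ideal m \<Sigma>"
        using B_ideal_closed(3)[OF rel(1)] by simp
      then show ?thesis
        using rel f unfolding g' face_letter_def
        by (intro exI[of _ "if f i = 1 then 1 else 0"]) (auto simp: word_mult_diff_right)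
    next
      case (TGen i')
      then have g': "g = TGen i" using i(1) by simp
      have "frag_of [TGen i] - frag_of [TGen i, SGen i] \<in> B_ideal m \<Sigma>"
        using B_ideal_closed(3)[OF rel(2)] by simp
      then show ?thesis
        using rel f unfolding g' face_letter_def
        by (intro exI[of _ "if f i = 1 then 1 else 0"]) (auto simp: word_mult_diff_right)
    qed
    then obtain k where k: "frag_of [g] \<star> face_letter f i - frag_cmul k (face_letter ?f i) \<in> B_ideal m \<Sigma>"
       "gen_degree g = 1 \<and> f i = 1 \<longrightarrow> k = 1 \<or> k = -1" by blast
    have "(frag_of [g] \<star> face_letter f i - frag_cmul k (face_letter ?f i)) \<star> face_element js f \<in> B_ideal m \<Sigma>"
      by (rule B_ideal_closed(5)[OF k(1) W])
    then have "frag_of [g] \<star> face_element (j # js) f - frag_cmul k (face_element (j # js) ?f) \<in> B_ideal m \<Sigma>"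
      using same True by (simp add: word_mult_diff_left word_mult_cmul_left word_mult_assoc)
    then show ?thesis using k(2) by blast
  next
    case False
    then obtain k where k: "?P k js" using Cons by auto
    have j: "j \<in> {1..m}" using Cons.prems(3) by simp
    have letter: "face_letter ?f j = face_letter f j" using False by (simp add: face_letter_def)
    have com: "frag_of [g, h] - frag_cmul ((-1) ^ (gen_degree g * gen_degree h)) (frag_of [h, g]) \<in> B_ideal m \<Sigma>"
      if "h \<in> B_gens m" "subscript h = j" for h
    proof (rule B_idealI)
      have "subscript g \<noteq> subscript h" using that False i(1) by auto
      then show "frag_of [g, h] - frag_cmul ((-1) ^ (gen_degree g * gen_degree h)) (frag_of [h, g]) \<in> B_relations m \<Sigma>"
        using g that(1) unfolding B_relations_def word_mult_of append_Cons append_Nil by blast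
    qed
    have gens: "SGen j \<in> B_gens m" "TGen j \<in> B_gens m" using j by (auto simp: B_gens_def)
    obtain e where e: "e = 1 \<or> e = (-1::int)"
      "frag_of [g] \<star> face_letter f j - frag_cmul e (face_letter f j \<star> frag_of [g]) \<in> B_ideal m \<Sigma>"
    proof (cases "f j = 0")
      case True
      then show thesis using com[OF gens(2)] by (intro that[of "(-1) ^ gen_degree g"]) (auto simp: face_letter_def minus_one_power_iff)
    next
      case False
      have "frag_of [g, SGen j] - frag_of [SGen j, g] \<in> B_ideal m \<Sigma>"
        using com[OF gens(1)] by simp
      then show thesis
        using False B_ideal_closed(3)[OF \<open>frag_of [g, SGen j] - frag_of [SGen j, g] \<in> B_ideal m \<Sigma>\<close>]
        by (intro that[of 1]) (auto simp: face_letter_def word_mult_diff_left word_mult_diff_right word_mult_one_left word_mult_one_right)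
    qed
    let ?W = "face_element js f" and ?W' = "face_element js ?f" and ?L = "face_letter f j"
    have 1: "(frag_of [g] \<star> ?L - frag_cmul e (?L \<star> frag_of [g])) \<star> ?W \<in> B_ideal m \<Sigma>"
      by (rule B_ideal_closed(5)[OF e(2) W])
    have 2: "frag_cmul e (?L \<star> (frag_of [g] \<star> ?W - frag_cmul k ?W')) \<in> B_ideal m \<Sigma>"
      using k j by (intro B_ideal_cmul B_ideal_closed(4) face_letter_carrier) auto
    have "(frag_of [g] \<star> ?L - frag_cmul e (?L \<star> frag_of [g])) \<star> ?W + frag_cmul e (?L \<star> (frag_of [g] \<star> ?W - frag_cmul k ?W'))
      = frag_of [g] \<star> face_element (j # js) f - frag_cmul (e * k) (face_element (j # js) ?f)"
      by (simp add: letter word_mult_diff_left word_mult_diff_right word_mult_cmul_left word_mult_cmul_right word_mult_assoc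
        frag_cmul_diff2 del: minus_frag_cmul)
    then have "frag_of [g] \<star> face_element (j # js) f - frag_cmul (e * k) (face_element (j # js) ?f) \<in> B_ideal m \<Sigma>"
      using B_ideal_closed(2)[OF 1 2] by simp
    then show ?thesis using k e(1) by (intro exI[of _ "e * k"]) auto
  qed
qed simp

lemma gen_mult_full_face_element:
  assumes "g \<in> B_gens m" "f \<in> {1..m} \<rightarrow>\<^sub>E {-1, 0, 1}"
  shows "\<exists>k. frag_of [g] \<star> full_face_element m f -
        frag_cmul k (full_face_element m (if gen_degree g = 0 then f else f(subscript g := 0))) \<in> B_ideal m \<Sigma> \<and>
      (gen_degree g = 1 \<and> f (subscript g) = 1 \<longrightarrow> k = 1 \<or> k = -1)"
proof -
  have "subscript g \<in> {1..m}" using assms(1) by (auto simp: B_gens_def)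
  then show ?thesis
    unfolding full_face_element_def using assms
    by (intro gen_mult_face_element) (auto simp: PiE_iff simp del: upt_Suc)
qed

lemma frag_extend_extend: "frag_extend F (frag_extend G c) = frag_extend (\<lambda>x. frag_extend F (G x)) c"
  using subset_UNIV[of "Poly_Mapping.keys c"]
  by (induction c rule: frag_induction) (auto simp: frag_extend_diff)

lemma word_mult_extend_right: "a \<star> frag_extend F c = frag_extend (\<lambda>x. a \<star> F x) c"
  using subset_UNIV[of "Poly_Mapping.keys c"]
  by (induction c rule: frag_induction) (auto simp: frag_extend_diff word_mult_diff_right)

lemma frag_cmul_minus_distrib: "frag_cmul k (a - b) = frag_cmul k a - frag_cmul k b"
  by (rule poly_mapping_eqI) (simp add: lookup_minus algebra_simps)

abbreviation all_faces :: "nat \<Rightarrow> (nat \<Rightarrow> real) set" where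
  "all_faces m \<equiv> {1..m} \<rightarrow>\<^sub>E {-1, 0, 1}"

text \<open>Multiply out \<open>1 = s_j + (1 - s_j)\<close> over the coordinates in the
  list.\<close>

lemma one_as_face_elements:
  assumes "distinct js" "set js \<subseteq> {1..m}"
  shows "\<exists>c. Poly_Mapping.keys c \<subseteq> all_faces m \<and> frag_extend (face_element js) c = frag_of []"
  using assms
proof (induction js)
  case Nil
  show ?case by (intro exI[of _ "frag_of (\<lambda>i\<in>{1..m}. 1)"]) auto
next
  case (Cons j js)
  then obtain c where c: "Poly_Mapping.keys c \<subseteq> all_faces m" "frag_extend (face_element js) c = frag_of []"
    by auto
  let ?c = "frag_extend (\<lambda>f. frag_of (f(j := 1)) + frag_of (f(j := -1))) c"
  have j: "j \<notin> set js" "j \<in> {1..m}" using Cons.prems by auto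
  have "Poly_Mapping.keys ?c \<subseteq> (\<Union>f\<in>Poly_Mapping.keys c. Poly_Mapping.keys (frag_of (f(j := 1)) + frag_of (f(j := -1))))"
    by (rule keys_frag_extend)
  also have "\<dots> \<subseteq> (\<Union>f\<in>Poly_Mapping.keys c. {f(j := 1), f(j := -1)})"
    using keys_add by fastforce
  also have "\<dots> \<subseteq> all_faces m"
    using c(1) j(2) by (fastforce simp: PiE_iff extensional_def)
  finally have "Poly_Mapping.keys ?c \<subseteq> all_faces m" .
  moreover have "frag_extend (face_element (j # js)) ?c = frag_of []"
  proof -
    have "face_element js (f(j := x)) = face_element js f" for f x
      using j(1) by (intro face_element_cong) auto
    then have "face_element (j # js) (f(j := 1)) + face_element (j # js) (f(j := -1)) = face_element js f" for f
      by (simp add: face_letter_def word_mult_diff_left word_mult_one_left)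
    then show ?thesis
      by (simp add: frag_extend_extend frag_extend_add c(2) del: face_element.simps)
  qed
  ultimately show ?case by blast
qed

lemma B_ideal_trans:
  "\<lbrakk>a - b \<in> B_ideal m \<Sigma>; b - c \<in> B_ideal m \<Sigma>\<rbrakk> \<Longrightarrow> a - c \<in> B_ideal m \<Sigma>"
  using B_ideal_closed(2)[of "a - b" m \<Sigma> "b - c"] by simp

lemma B_ideal_sum: "(\<And>i. i \<in> I \<Longrightarrow> F i \<in> B_ideal m \<Sigma>) \<Longrightarrow> sum F I \<in> B_ideal m \<Sigma>"
  by (induction I rule: infinite_finite_induct) (auto simp: B_ideal_closed)

lemma B_ideal_extend:
  "(\<And>x. x \<in> Poly_Mapping.keys c \<Longrightarrow> F x \<in> B_ideal m \<Sigma>) \<Longrightarrow> frag_extend F c \<in> B_ideal m \<Sigma>"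
  unfolding frag_extend_def by (intro B_ideal_sum B_ideal_cmul)

lemma t_word_mult_face_element:
  assumes "distinct ks" "set ks \<subseteq> {1..m}" "g \<in> all_faces m" "\<And>i. i \<in> set ks \<Longrightarrow> g i = 1"
  shows "\<exists>k. (k = 1 \<or> k = -1) \<and> frag_of (map TGen ks) \<star> full_face_element m g
     - frag_cmul k (full_face_element m (fix_coords (set ks) 0 g)) \<in> B_ideal m \<Sigma>"
  using assms
proof (induction ks)
  case Nil
  have "fix_coords {} 0 g = g" by (simp add: fix_coords_def)
  then show ?case by (intro exI[of _ 1]) (simp add: word_mult_one_left B_ideal_closed)
next
  case (Cons a ks)
  then obtain k where k: "k = 1 \<or> k = -1" "frag_of (map TGen ks) \<star> full_face_element m g
     - frag_cmul k (full_face_element m (fix_coords (set ks) 0 g)) \<in> B_ideal m \<Sigma>" by auto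
  let ?g = "fix_coords (set ks) 0 g" and ?t = "frag_of [TGen a]"
  have a: "a \<in> {1..m}" "?g a = 1" "TGen a \<in> B_gens m" using Cons.prems by (auto simp: fix_coords_def B_gens_def)
  have ga: "?g \<in> all_faces m" using Cons.prems by (fastforce simp: fix_coords_def PiE_iff extensional_def)
  obtain k' where k': "k' = 1 \<or> k' = -1"
    "?t \<star> full_face_element m ?g - frag_cmul k' (full_face_element m (?g(a := 0))) \<in> B_ideal m \<Sigma>"
    using gen_mult_full_face_element[OF a(3) ga, of \<Sigma>] a(2) by auto
  have g: "?g(a := 0) = fix_coords (set (a # ks)) 0 g" by (auto simp: fix_coords_def)
  have "?t \<star> (frag_of (map TGen ks) \<star> full_face_element m g - frag_cmul k (full_face_element m ?g)) \<in> B_ideal m \<Sigma>"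
    using k(2) a(3) by (intro B_ideal_closed(4)) (auto simp: free_carrier_of)
  then have 1: "frag_of (map TGen (a # ks)) \<star> full_face_element m g - frag_cmul k (?t \<star> full_face_element m ?g) \<in> B_ideal m \<Sigma>"
    by (simp add: word_mult_diff_right word_mult_cmul_right flip: word_mult_assoc del: upt_Suc)
  have "frag_cmul k (?t \<star> full_face_element m ?g - frag_cmul k' (full_face_element m (?g(a := 0)))) \<in> B_ideal m \<Sigma>"
    by (rule B_ideal_cmul[OF k'(2)])
  then have 2: "frag_cmul k (?t \<star> full_face_element m ?g) - frag_cmul (k * k') (full_face_element m (fix_coords (set (a # ks)) 0 g)) \<in> B_ideal m \<Sigma>"
    unfolding g by (simp add: frag_cmul_minus_distrib)
  show ?case
    using B_ideal_trans[OF 1 2] k(1) k'(1) g by (intro exI[of _ "k * k'"]) auto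
qed

text \<open>Turn the free directions into letters \<open>s\<close>. Multiplying this element by the
  monomial of the nonface, which is a relation, restores the original one up to a sign, and
  multiplying by that sign once more removes it.\<close>

lemma face_element_nonface:
  assumes f: "f \<in> all_faces m" and "zeros m f \<notin> \<Sigma>"
  shows "full_face_element m f \<in> B_ideal m \<Sigma>"
proof -
  let ?ks = "sorted_list_of_set (zeros m f)" and ?g = "fix_coords (zeros m f) 1 f"
  have ks: "distinct ?ks" "set ?ks = zeros m f" by auto
  have g: "?g \<in> all_faces m" using f by (auto simp: fix_coords_def zeros_def PiE_iff extensional_def)
  have "frag_of (map TGen ?ks) \<in> B_ideal m \<Sigma>"
    using assms(2) zeros_subset by (intro B_idealI) (auto simp: B_relations_def)
  then have 1: "frag_of (map TGen ?ks) \<star> full_face_element m ?g \<in> B_ideal m \<Sigma>"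
    by (rule B_ideal_closed(5)[OF _ full_face_element_carrier])
  obtain k where k: "k = 1 \<or> k = -1" "frag_of (map TGen ?ks) \<star> full_face_element m ?g
     - frag_cmul k (full_face_element m (fix_coords (set ?ks) 0 ?g)) \<in> B_ideal m \<Sigma>"
    using t_word_mult_face_element[OF ks(1) _ g, of \<Sigma>] ks(2) zeros_subset[of m f] unfolding fix_coords_def by auto
  have "full_face_element m (fix_coords (set ?ks) 0 ?g) = full_face_element m f"
    by (rule full_face_element_cong) (auto simp: fix_coords_def zeros_def)
  then have "frag_cmul k (full_face_element m f) \<in> B_ideal m \<Sigma>"
    using B_ideal_diff[OF 1 k(2)] by simp
  then have "frag_cmul k (frag_cmul k (full_face_element m f)) \<in> B_ideal m \<Sigma>" by (rule B_ideal_cmul)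
  then show ?thesis using k(1) by auto
qed

text \<open>Modulo the ideal the span contains the unit and is stable under left multiplication by
  generators, hence contains all words.\<close>

lemma face_elements_span:
  assumes "a \<in> carrier (free_ring m)"
  shows "\<exists>c. Poly_Mapping.keys c \<subseteq> all_faces m \<and> a - frag_extend (full_face_element m) c \<in> B_ideal m \<Sigma>"
    (is "\<exists>c. ?P c a")
proof -
  have word: "\<exists>c. ?P c (frag_of w)" if "w \<in> lists (B_gens m)" for w
    using that
  proof (induction w)
    case Nil
    obtain c where "Poly_Mapping.keys c \<subseteq> all_faces m" "frag_extend (full_face_element m) c = frag_of []"
      using one_as_face_elements[of "[1..<Suc m]" m] unfolding set_upt_Suc full_face_element_def by (auto simp del: upt_Suc)
    then show ?case using B_ideal_closed(1) by (intro exI[of _ c]) simp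
  next
    case (Cons g w)
    then obtain c where c: "?P c (frag_of w)" by auto
    define r where "r f = (if gen_degree g = 0 then f else f(subscript g := 0))" for f :: "nat \<Rightarrow> real"
    have i: "subscript g \<in> {1..m}" using Cons.hyps by (auto simp: B_gens_def)
    have "\<exists>k. frag_of [g] \<star> full_face_element m f - frag_cmul k (full_face_element m (r f)) \<in> B_ideal m \<Sigma>"
      if "f \<in> all_faces m" for f
      using gen_mult_full_face_element[OF Cons.hyps(1) that, of \<Sigma>] unfolding r_def by blast
    then obtain k where k: "\<And>f. f \<in> all_faces m \<Longrightarrow>
        frag_of [g] \<star> full_face_element m f - frag_cmul (k f) (full_face_element m (r f)) \<in> B_ideal m \<Sigma>"
      by metis
    let ?c = "frag_extend (\<lambda>f. frag_cmul (k f) (frag_of (r f))) c"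
    have "Poly_Mapping.keys ?c \<subseteq> (\<Union>f\<in>Poly_Mapping.keys c. Poly_Mapping.keys (frag_cmul (k f) (frag_of (r f))))"
      by (rule keys_frag_extend)
    also have "\<dots> \<subseteq> all_faces m"
      using c i by (fastforce simp: r_def PiE_iff extensional_def split: if_splits)
    finally have 1: "Poly_Mapping.keys ?c \<subseteq> all_faces m" .
    have "frag_of [g] \<star> (frag_of w - frag_extend (full_face_element m) c) \<in> B_ideal m \<Sigma>"
      using c Cons.hyps by (intro B_ideal_closed(4)) (auto simp: free_carrier_of)
    then have 2: "frag_of (g # w) - frag_extend (\<lambda>f. frag_of [g] \<star> full_face_element m f) c \<in> B_ideal m \<Sigma>"
      by (simp add: word_mult_diff_right word_mult_extend_right del: upt_Suc)
    have "frag_extend (\<lambda>f. frag_of [g] \<star> full_face_element m f - frag_cmul (k f) (full_face_element m (r f))) c \<in> B_ideal m \<Sigma>"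
      using c k by (intro B_ideal_extend) auto
    then have 3: "frag_extend (\<lambda>f. frag_of [g] \<star> full_face_element m f) c - frag_extend (full_face_element m) ?c \<in> B_ideal m \<Sigma>"
      by (simp add: frag_extend_fun_diff frag_extend_extend frag_extend_cmul del: upt_Suc)
    show ?case using 1 B_ideal_trans[OF 2 3] by blast
  qed
  have "Poly_Mapping.keys a \<subseteq> lists (B_gens m)" using assms by (simp add: free_ring_simps)
  then show ?thesis
  proof (induction a rule: frag_induction)
    case zero
    show ?case using B_ideal_closed(1) by (intro exI[of _ 0]) simp
  next
    case (diff a b)
    then obtain c d where c: "?P c a" and d: "?P d b" by blast
    have "a - b - frag_extend (full_face_element m) (c - d) \<in> B_ideal m \<Sigma>"
      using B_ideal_diff[OF conjunct2[OF c] conjunct2[OF d]] by (simp add: frag_extend_diff algebra_simps del: upt_Suc)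
    moreover have "Poly_Mapping.keys (c - d) \<subseteq> all_faces m" using c d keys_diff[of c d] by blast
    ultimately show ?case by blast
  qed (rule word)
qed

text \<open>Reduce an element with vanishing values to a combination of face elements. Their values
  form an identity matrix up to signs, so the coefficients at faces of the complex are zero; the
  elements of the remaining faces lie in the ideal.\<close>

lemma vanishing_ideal_eq:
  assumes \<Sigma>: "simplicial_complex_on m \<Sigma>"
  shows "vanishing_ideal m \<Sigma> = B_ideal m \<Sigma>"
proof
  show "vanishing_ideal m \<Sigma> \<subseteq> B_ideal m \<Sigma>"
  proof
    fix a assume a: "a \<in> vanishing_ideal m \<Sigma>"
    then obtain c where c: "Poly_Mapping.keys c \<subseteq> all_faces m" "a - frag_extend (full_face_element m) c \<in> B_ideal m \<Sigma>"
      using face_elements_span[of a m \<Sigma>] by (auto simp: vanishing_ideal_def)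
    have zero: "Poly_Mapping.lookup c f = 0" if f: "f \<in> cube_faces m \<Sigma>" for f
    proof -
      have fa: "f \<in> all_faces m" using f by (simp add: cube_faces_def)
      obtain s where s: "s = 1 \<or> s = (-1::int)" "\<And>g. g \<in> all_faces m \<Longrightarrow> face_value m (full_face_element m f) g = (if f = g then s else 0)"
        using face_value_face_element[OF fa] by blast
      have *: "face_value m (full_face_element m g) f = (if g = f then s else 0)" if "g \<in> all_faces m" for g
        using face_value_face_element[OF that] fa s(2)[OF fa] by metis
      have "0 = face_value m (frag_extend (full_face_element m) c) f"
        using a f B_ideal_subset_vanishing[OF \<Sigma>] c(2) by (auto simp: vanishing_ideal_def face_value_simps)
      also have "\<dots> = frag_eval (\<lambda>g. face_value m (full_face_element m g) f) c" by (rule face_value_extend)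
      also have "\<dots> = (\<Sum>g\<in>Poly_Mapping.keys c. Poly_Mapping.lookup c g * (if g = f then s else 0))"
        unfolding frag_eval_def using * c(1) by (intro sum.cong) auto
      also have "\<dots> = Poly_Mapping.lookup c f * s"
        by (auto simp: in_keys_iff if_distrib[of "\<lambda>x. _ * x"] cong: if_cong)
      finally show ?thesis using s(1) by auto
    qed
    have "frag_extend (full_face_element m) c \<in> B_ideal m \<Sigma>"
    proof (rule B_ideal_extend)
      fix f assume "f \<in> Poly_Mapping.keys c"
      then have "f \<in> all_faces m" "f \<notin> cube_faces m \<Sigma>" using c(1) zero by (auto simp: in_keys_iff)
      then show "full_face_element m f \<in> B_ideal m \<Sigma>" by (intro face_element_nonface) (auto simp: cube_faces_def)
    qed
    from B_ideal_closed(2)[OF c(2) this] show "a \<in> B_ideal m \<Sigma>" by simp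
  qed
qed (rule B_ideal_subset_vanishing[OF \<Sigma>])

section \<open>The dga \<open>B(\<Sigma>)\<close> as functions on faces\<close>

text \<open>The coset in \<open>B_dga\<close> with prescribed face values. By
  \<open>vanishing_ideal_eq\<close> and \<open>face_value_surj\<close>, cosets correspond
  bijectively to integer functions on the faces.\<close>

definition face_fiber :: "nat \<Rightarrow> nat set set \<Rightarrow> ((nat \<Rightarrow> real) \<Rightarrow> int) \<Rightarrow> (B_gen list \<Rightarrow>\<^sub>0 int) set" where
  "face_fiber m \<Sigma> u = {a \<in> carrier (free_ring m). \<forall>f\<in>cube_faces m \<Sigma>. face_value m a f = u f}"

lemma face_fiber_cong: "(\<And>f. f \<in> cube_faces m \<Sigma> \<Longrightarrow> u f = v f) \<Longrightarrow> face_fiber m \<Sigma> u = face_fiber m \<Sigma> v"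
  by (auto simp: face_fiber_def)

lemma B_class_eq_fiber:
  assumes \<Sigma>: "simplicial_complex_on m \<Sigma>" and a: "a \<in> carrier (free_ring m)"
  shows "B_class m \<Sigma> a = face_fiber m \<Sigma> (face_value m a)"
proof -
  have B: "B_class m \<Sigma> a = {h + a | h. h \<in> B_ideal m \<Sigma>}"
    by (auto simp: B_class_def a_r_coset_def' free_ring_simps(5))
  show ?thesis
  proof (intro equalityI subsetI)
    fix b assume "b \<in> B_class m \<Sigma> a"
    then show "b \<in> face_fiber m \<Sigma> (face_value m a)"
      unfolding B vanishing_ideal_eq[OF \<Sigma>, symmetric] face_fiber_def vanishing_ideal_def
      using a by (auto simp: free_carrier_closed face_value_simps)
  next
    fix b assume "b \<in> face_fiber m \<Sigma> (face_value m a)"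
    then have "b - a \<in> B_ideal m \<Sigma>"
      unfolding vanishing_ideal_eq[OF \<Sigma>, symmetric] face_fiber_def vanishing_ideal_def
      using a by (auto simp: free_carrier_closed face_value_simps)
    then show "b \<in> B_class m \<Sigma> a" unfolding B by (auto intro!: exI[of _ "b - a"])
  qed
qed

lemma free_carrier_extend:
  "(\<And>x. x \<in> Poly_Mapping.keys c \<Longrightarrow> F x \<in> carrier (free_ring m)) \<Longrightarrow> frag_extend F c \<in> carrier (free_ring m)"
  using keys_frag_extend[of F c] unfolding free_ring_simps by blast

lemma face_value_surj: "\<exists>a\<in>carrier (free_ring m). \<forall>f\<in>cube_faces m \<Sigma>. face_value m a f = u f"
proof -
  have "\<forall>f\<in>all_faces m. \<exists>s. (s = 1 \<or> s = (-1::int)) \<and> (\<forall>g\<in>all_faces m. face_value m (full_face_element m f) g = (if f = g then s else 0))"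
  proof
    fix f assume f: "f \<in> all_faces m"
    obtain s where "s = 1 \<or> s = (-1::int)" "\<And>g. g \<in> all_faces m \<Longrightarrow> face_value m (full_face_element m f) g = (if f = g then s else 0)"
      using face_value_face_element[OF f] by blast
    then show "\<exists>s. (s = 1 \<or> s = (-1::int)) \<and> (\<forall>g\<in>all_faces m. face_value m (full_face_element m f) g = (if f = g then s else 0))"
      by blast
  qed
  from bchoice[OF this] obtain s where s0: "\<forall>f\<in>all_faces m. (s f = 1 \<or> s f = (-1::int)) \<and>
      (\<forall>g\<in>all_faces m. face_value m (full_face_element m f) g = (if f = g then s f else 0))"
    by (rule exE)
  have s: "\<And>f. f \<in> all_faces m \<Longrightarrow> s f = 1 \<or> s f = (-1::int)"
    "\<And>f g. \<lbrakk>f \<in> all_faces m; g \<in> all_faces m\<rbrakk> \<Longrightarrow> face_value m (full_face_element m f) g = (if f = g then s f else 0)"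
    using s0 by (simp, simp)
  \<comment> \<open>The factor \<open>s f\<close> compensates the sign of the face element, its
    square being 1.\<close>
  let ?a = "\<Sum>f\<in>cube_faces m \<Sigma>. frag_cmul (s f * u f) (full_face_element m f)"
  have sum: "(\<And>i. i \<in> I \<Longrightarrow> F i \<in> carrier (free_ring m)) \<Longrightarrow> sum F I \<in> carrier (free_ring m)" for F and I :: "(nat \<Rightarrow> real) set"
    by (induction I rule: infinite_finite_induct) (auto simp: free_carrier_closed free_carrier_0)
  have fs: "face_value m (sum F I) g = (\<Sum>f\<in>I. face_value m (F f) g)" for F g and I :: "(nat \<Rightarrow> real) set"
    by (induction I rule: infinite_finite_induct) (auto simp: face_value_simps)
  have "face_value m ?a g = u g" if g: "g \<in> cube_faces m \<Sigma>" for g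
  proof -
    have "face_value m ?a g = (\<Sum>f\<in>cube_faces m \<Sigma>. if f = g then s g * u g * s g else 0)"
      unfolding fs face_value_simps using s(2) g by (intro sum.cong) (auto simp: cube_faces_def simp del: upt_Suc)
    also have "\<dots> = s g * u g * s g" using g by simp
    also have "\<dots> = u g" using g s(1)[of g] by (auto simp: cube_faces_def)
    finally show ?thesis .
  qed
  moreover have "?a \<in> carrier (free_ring m)"
    by (intro sum free_carrier_unary full_face_element_carrier)
  ultimately show ?thesis by blast
qed

lemma face_fiber_eq_B_class:
  assumes \<Sigma>: "simplicial_complex_on m \<Sigma>"
  obtains a where "a \<in> carrier (free_ring m)" "\<And>f. f \<in> cube_faces m \<Sigma> \<Longrightarrow> face_value m a f = u f"
    "face_fiber m \<Sigma> u = B_class m \<Sigma> a"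
proof -
  obtain a where a: "a \<in> carrier (free_ring m)" "\<And>f. f \<in> cube_faces m \<Sigma> \<Longrightarrow> face_value m a f = u f"
    using face_value_surj[of m \<Sigma> u] by auto
  moreover have "face_fiber m \<Sigma> u = face_fiber m \<Sigma> (face_value m a)"
    using a(2) by (intro face_fiber_cong) simp
  ultimately show thesis using that B_class_eq_fiber[OF \<Sigma> a(1)] by simp
qed

lemma face_fiber_eqD:
  assumes "face_fiber m \<Sigma> u = face_fiber m \<Sigma> v" "f \<in> cube_faces m \<Sigma>"
  shows "u f = v f"
proof -
  obtain a where "a \<in> face_fiber m \<Sigma> u"
    using face_value_surj[of m \<Sigma> u] by (auto simp: face_fiber_def)
  moreover from this have "a \<in> face_fiber m \<Sigma> v" using assms(1) by simp
  ultimately show ?thesis using assms(2) by (simp add: face_fiber_def)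
qed

lemma word_value_degree: "word_value w f l \<noteq> 0 \<Longrightarrow> word_degree w = length l"
proof (induction w f l rule: word_value.induct)
  case (4 i w f a l)
  then show ?case by (auto simp: word_degree_def split: if_splits)
qed (auto simp: word_degree_def split: if_splits)

lemma face_value_component:
  assumes "a \<in> free_component m n" "card (zeros m f) \<noteq> n"
  shows "face_value m a f = 0"
  unfolding face_value_def
proof (intro sum.neutral ballI)
  fix l assume "l \<in> permutations_of_set (zeros m f)"
  then have "length l \<noteq> n" using assms(2) by (simp add: length_permutations_zeros)
  then have "path_value a f l = 0"
    unfolding path_value_def frag_eval_def using assms(1) word_value_degree
    by (intro sum.neutral) (fastforce simp: free_component_def)
  then show "perm_sign l * path_value a f l = 0" by simp
qed

definition degree_part :: "nat \<Rightarrow> (B_gen list \<Rightarrow>\<^sub>0 int) \<Rightarrow> B_gen list \<Rightarrow>\<^sub>0 int" where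
  "degree_part n a = frag_extend (\<lambda>w. if word_degree w = n then frag_of w else 0) a"

lemma degree_part_component:
  assumes "a \<in> carrier (free_ring m)"
  shows "degree_part n a \<in> free_component m n"
proof -
  have "Poly_Mapping.keys (degree_part n a) \<subseteq>
      (\<Union>w\<in>Poly_Mapping.keys a. Poly_Mapping.keys (if word_degree w = n then frag_of w else 0))"
    unfolding degree_part_def by (rule keys_frag_extend)
  also have "\<dots> \<subseteq> {w \<in> Poly_Mapping.keys a. word_degree w = n}" by (auto split: if_splits)
  finally show ?thesis
    using assms by (auto simp: free_component_def free_ring_simps)
qed

lemma face_value_degree_part:
  "face_value m (degree_part n a) f = (if card (zeros m f) = n then face_value m a f else 0)"
proof -
  have "path_value (degree_part n a) f l = (if length l = n then path_value a f l else 0)" for l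
  proof -
    have "path_value (degree_part n a) f l = frag_eval (\<lambda>w. if word_degree w = n then word_value w f l else 0) a"
      unfolding path_value_def degree_part_def frag_eval_extend by (rule frag_eval_cong) simp
    also have "\<dots> = (if length l = n then path_value a f l else 0)"
      unfolding path_value_def using word_value_degree by (auto simp: frag_eval_def intro!: sum.cong sum.neutral)
    finally show ?thesis .
  qed
  then show ?thesis
    by (auto simp: face_value_def length_permutations_zeros)
qed

lemma free_component_carrier: "free_component m n \<subseteq> carrier (free_ring m)"
  by (auto simp: free_component_def free_ring_simps)

lemma B_component_eq:
  assumes \<Sigma>: "simplicial_complex_on m \<Sigma>"
  shows "B_class m \<Sigma> ` free_component m n =
    {face_fiber m \<Sigma> u | u. \<forall>f\<in>cube_faces m \<Sigma>. card (zeros m f) \<noteq> n \<longrightarrow> u f = 0}"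
proof (intro equalityI subsetI)
  fix Y assume "Y \<in> B_class m \<Sigma> ` free_component m n"
  then obtain a where "a \<in> free_component m n" "Y = B_class m \<Sigma> a" by auto
  then show "Y \<in> {face_fiber m \<Sigma> u | u. \<forall>f\<in>cube_faces m \<Sigma>. card (zeros m f) \<noteq> n \<longrightarrow> u f = 0}"
    using B_class_eq_fiber[OF \<Sigma>] free_component_carrier face_value_component by blast
next
  fix Y assume "Y \<in> {face_fiber m \<Sigma> u | u. \<forall>f\<in>cube_faces m \<Sigma>. card (zeros m f) \<noteq> n \<longrightarrow> u f = 0}"
  then obtain u where u: "Y = face_fiber m \<Sigma> u" "\<And>f. f \<in> cube_faces m \<Sigma> \<Longrightarrow> card (zeros m f) \<noteq> n \<Longrightarrow> u f = 0" by auto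
  obtain a where a: "a \<in> carrier (free_ring m)" "\<And>f. f \<in> cube_faces m \<Sigma> \<Longrightarrow> face_value m a f = u f"
    using face_fiber_eq_B_class[OF \<Sigma>, of u] by metis
  note p = degree_part_component[OF a(1), of n]
  have "B_class m \<Sigma> (degree_part n a) = Y"
    unfolding u(1) B_class_eq_fiber[OF \<Sigma> subsetD[OF free_component_carrier p]]
    using a(2) u(2) by (intro face_fiber_cong) (simp add: face_value_degree_part)
  then show "Y \<in> B_class m \<Sigma> ` free_component m n" using p by blast
qed

lemma word_diff_carrier: "w \<in> lists (B_gens m) \<Longrightarrow> word_diff w \<in> carrier (free_ring m)"
proof (induction rule: lists.induct)
  case (Cons g w)
  have "gen_diff g \<in> carrier (free_ring m)"
    using Cons.hyps by (cases g) (auto simp: B_gens_def free_carrier_0 free_carrier_of intro!: free_carrier_unary)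
  then show ?case using Cons
    by (auto simp: free_carrier_of intro!: free_carrier_closed free_carrier_unary)
qed (simp add: free_carrier_0)

lemma free_diff_carrier: "a \<in> carrier (free_ring m) \<Longrightarrow> free_diff a \<in> carrier (free_ring m)"
  unfolding free_diff_def
  by (intro free_carrier_extend word_diff_carrier) (auto simp: free_ring_simps(1))

definition cube_coboundary :: "nat \<Rightarrow> ((nat \<Rightarrow> real) \<Rightarrow> int) \<Rightarrow> (nat \<Rightarrow> real) \<Rightarrow> int" where
  "cube_coboundary m u f = - ((-1) ^ (card (zeros m f) - 1)) * frag_eval u (cube_boundary m f)"

lemma cube_boundary_keys:
  assumes "simplicial_complex_on m \<Sigma>" "f \<in> cube_faces m \<Sigma>" "g \<in> Poly_Mapping.keys (cube_boundary m f)"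
  shows "g \<in> cube_faces m \<Sigma>" "Suc (card (zeros m g)) = card (zeros m f)"
proof -
  have "card (zeros m f) \<noteq> 0" using assms(3) by (auto simp: cube_boundary_def)
  then obtain k where k: "card (zeros m f) = Suc k" using not0_implies_Suc by blast
  then show "g \<in> cube_faces m \<Sigma>" "Suc (card (zeros m g)) = card (zeros m f)"
    using cube_chain_on_boundary[OF assms(1,2) k] assms(3) by (auto simp: cube_chain_on_def)
qed

lemma cube_coboundary_cong:
  assumes "simplicial_complex_on m \<Sigma>" "f \<in> cube_faces m \<Sigma>" "\<And>g. g \<in> cube_faces m \<Sigma> \<Longrightarrow> u g = v g"
  shows "cube_coboundary m u f = cube_coboundary m v f"
  unfolding cube_coboundary_def using assms(3) cube_boundary_keys(1)[OF assms(1,2)]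
  by (intro arg_cong2[where f = "(*)"] frag_eval_cong) auto

text \<open>The right-hand side depends on \<open>a\<close> only through its face values, so
  \<open>free_diff\<close> preserves the ideal; this is what makes the differential of
  \<open>B_dga\<close> well defined.\<close>

lemma face_value_free_diff:
  assumes \<Sigma>: "simplicial_complex_on m \<Sigma>" and a: "a \<in> carrier (free_ring m)" and f: "f \<in> cube_faces m \<Sigma>"
  shows "face_value m (free_diff a) f = cube_coboundary m (face_value m a) f"
proof -
  have "face_value m (free_diff a) f = cube_coboundary m (cube_eval m (free_cochain (real_moment_angle m \<Sigma>) a)) f"
    using cube_eval_free_cochain[OF \<Sigma> free_diff_carrier[OF a] f] cube_eval_diff[OF \<Sigma> f free_cochain_normalized]
    by (simp add: free_diff_cochain cube_coboundary_def)
  also have "\<dots> = cube_coboundary m (face_value m a) f"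
    by (rule cube_coboundary_cong[OF \<Sigma> f]) (rule cube_eval_free_cochain[OF \<Sigma> a])
  finally show ?thesis .
qed

lemma B_dga_simps:
  "carrier (B_dga m \<Sigma>) = B_class m \<Sigma> ` carrier (free_ring m)"
  "one (B_dga m \<Sigma>) = B_class m \<Sigma> (frag_of [])" "zero (B_dga m \<Sigma>) = B_class m \<Sigma> 0"
  "component (B_dga m \<Sigma>) = (\<lambda>n. B_class m \<Sigma> ` free_component m n)"
  "diff (B_dga m \<Sigma>) = (\<lambda>Y. \<Union>a\<in>Y. B_class m \<Sigma> (free_diff a))"
proof -
  interpret ideal "B_ideal m \<Sigma>" "free_ring m" by (rule ideal_B_ideal)
  have "B_class m \<Sigma> 0 = B_ideal m \<Sigma>"
    by (auto simp: B_class_def a_r_coset_def' free_ring_simps(5))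
  then show "zero (B_dga m \<Sigma>) = B_class m \<Sigma> 0"
    by (simp add: B_dga_def ring.defs dga.defs FactRing_def)
qed (auto simp: B_dga_def ring.defs dga.defs FactRing_def B_class_def free_ring_simps(3) A_RCOSETS_def'
      intro!: exI)

lemma B_dga_mult_add:
  assumes "a \<in> carrier (free_ring m)" "b \<in> carrier (free_ring m)"
  shows "B_class m \<Sigma> a \<otimes>\<^bsub>B_dga m \<Sigma>\<^esub> B_class m \<Sigma> b = B_class m \<Sigma> (a \<star> b)"
    "B_class m \<Sigma> a \<oplus>\<^bsub>B_dga m \<Sigma>\<^esub> B_class m \<Sigma> b = B_class m \<Sigma> (a + b)"
proof -
  interpret ideal "B_ideal m \<Sigma>" "free_ring m" by (rule ideal_B_ideal)
  show "B_class m \<Sigma> a \<otimes>\<^bsub>B_dga m \<Sigma>\<^esub> B_class m \<Sigma> b = B_class m \<Sigma> (a \<star> b)"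
    using rcoset_mult_add[OF assms] by (simp add: B_dga_def ring.defs FactRing_def B_class_def free_ring_simps(2))
  show "B_class m \<Sigma> a \<oplus>\<^bsub>B_dga m \<Sigma>\<^esub> B_class m \<Sigma> b = B_class m \<Sigma> (a + b)"
    using a_rcos_sum[OF assms] by (simp add: B_dga_def ring.defs FactRing_def B_class_def free_ring_simps(5))
qed

lemma ring_B_dga: "ring (B_dga m \<Sigma>)"
proof (rule ringI)
  show "abelian_group (B_dga m \<Sigma>)"
  proof (rule abelian_groupI)
    fix x assume "x \<in> carrier (B_dga m \<Sigma>)"
    then obtain a where a: "a \<in> carrier (free_ring m)" "x = B_class m \<Sigma> a" by (auto simp: B_dga_simps)
    then show "\<exists>y\<in>carrier (B_dga m \<Sigma>). y \<oplus>\<^bsub>B_dga m \<Sigma>\<^esub> x = \<zero>\<^bsub>B_dga m \<Sigma>\<^esub>"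
      using free_carrier_unary(1)[OF a(1)]
      by (intro bexI[of _ "B_class m \<Sigma> (- a)"]) (auto simp: B_dga_simps B_dga_mult_add)
  qed (auto simp: B_dga_simps B_dga_mult_add free_carrier_closed free_carrier_0 algebra_simps)
  show "monoid (B_dga m \<Sigma>)"
    by (rule monoidI) (auto simp: B_dga_simps B_dga_mult_add free_carrier_closed free_carrier_of
        word_mult_assoc word_mult_one_left word_mult_one_right)
qed (auto simp: B_dga_simps B_dga_mult_add free_carrier_closed word_mult_add_left word_mult_add_right)

lemma B_dga_minus:
  assumes "a \<in> carrier (free_ring m)"
  shows "\<ominus>\<^bsub>B_dga m \<Sigma>\<^esub> B_class m \<Sigma> a = B_class m \<Sigma> (- a)"
proof -
  interpret ring "B_dga m \<Sigma>" by (rule ring_B_dga)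
  show ?thesis
    using assms free_carrier_unary(1)[OF assms]
    by (intro minus_equality) (auto simp: B_dga_simps B_dga_mult_add)
qed

lemma B_class_eqI:
  assumes "simplicial_complex_on m \<Sigma>" "a \<in> carrier (free_ring m)" "b \<in> carrier (free_ring m)"
    "\<And>f. f \<in> cube_faces m \<Sigma> \<Longrightarrow> face_value m a f = face_value m b f"
  shows "B_class m \<Sigma> a = B_class m \<Sigma> b"
  using assms by (simp add: B_class_eq_fiber cong: face_fiber_cong)

lemma B_class_eqD:
  assumes "simplicial_complex_on m \<Sigma>" "a \<in> carrier (free_ring m)" "b \<in> carrier (free_ring m)"
    "B_class m \<Sigma> a = B_class m \<Sigma> b" "f \<in> cube_faces m \<Sigma>"
  shows "face_value m a f = face_value m b f"
  using assms(4) face_fiber_eqD[OF _ assms(5)] by (simp add: B_class_eq_fiber assms(1-3))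

lemma B_dga_diff:
  assumes \<Sigma>: "simplicial_complex_on m \<Sigma>" and a: "a \<in> carrier (free_ring m)"
  shows "diff (B_dga m \<Sigma>) (B_class m \<Sigma> a) = B_class m \<Sigma> (free_diff a)"
proof -
  have "B_class m \<Sigma> (free_diff b) = B_class m \<Sigma> (free_diff a)" if b: "b \<in> B_class m \<Sigma> a" for b
  proof -
    have b': "b \<in> carrier (free_ring m)" "\<And>f. f \<in> cube_faces m \<Sigma> \<Longrightarrow> face_value m b f = face_value m a f"
      using b unfolding B_class_eq_fiber[OF \<Sigma> a] by (auto simp: face_fiber_def)
    show ?thesis
      using a b' cube_coboundary_cong[OF \<Sigma> _ b'(2)]
      by (intro B_class_eqI[OF \<Sigma>]) (auto simp: free_diff_carrier face_value_free_diff[OF \<Sigma>])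
  qed
  moreover have "a \<in> B_class m \<Sigma> a" using a unfolding B_class_eq_fiber[OF \<Sigma> a] by (simp add: face_fiber_def)
  ultimately show ?thesis unfolding B_dga_simps(5) by blast
qed

lemma free_diff_add: "free_diff (a + b) = free_diff a + free_diff b"
  by (simp add: free_diff_def frag_extend_add)

lemma face_value_eqI:
  assumes "simplicial_complex_on m \<Sigma>" "a \<in> carrier (free_ring m)" "b \<in> carrier (free_ring m)"
    and "free_cochain (real_moment_angle m \<Sigma>) a = free_cochain (real_moment_angle m \<Sigma>) b" "f \<in> cube_faces m \<Sigma>"
  shows "face_value m a f = face_value m b f"
  using cube_eval_free_cochain[OF assms(1,2,5)] cube_eval_free_cochain[OF assms(1,3,5)] assms(4) by simp

lemma free_cochain_component: "a \<in> free_component m n \<Longrightarrow> free_cochain X a \<in> component (cochain_dga X) n"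
proof -
  assume "a \<in> free_component m n"
  then have "Poly_Mapping.keys a \<subseteq> {w \<in> lists (B_gens m). word_degree w = n}" by (simp add: free_component_def)
  then show ?thesis
  proof (induction a rule: frag_induction)
    case zero
    show ?case by (simp add: cochain_dga_simps zero_normalized_cochain)
  next
    case (one w)
    then show ?case using word_cochain_component[of X w] by simp
  next
    case (diff a b)
    then show ?case
      using lincomb_normalized_cochain[of "free_cochain X a n" n X "free_cochain X b n" 1 "-1"]
      by (simp add: free_cochain_diff cochain_dga_simps fun_eq_iff)
  qed
qed

lemma free_component_mult:
  assumes "a \<in> free_component m i" "b \<in> free_component m j"
  shows "a \<star> b \<in> free_component m (i + j)"
proof -
  have "w \<in> {w \<in> lists (B_gens m). word_degree w = i + j}" if w: "w \<in> Poly_Mapping.keys (a \<star> b)" for w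
  proof -
    obtain u v where uv: "u \<in> Poly_Mapping.keys a" "v \<in> Poly_Mapping.keys b" "w = u @ v"
      using keys_word_mult[OF w] .
    have "u \<in> {w \<in> lists (B_gens m). word_degree w = i}" "v \<in> {w \<in> lists (B_gens m). word_degree w = j}"
      using assms uv unfolding free_component_def by blast+
    then show ?thesis using uv(3) by (simp add: word_degree_def)
  qed
  then show ?thesis unfolding free_component_def by blast
qed

lemma free_leibniz_value:
  assumes \<Sigma>: "simplicial_complex_on m \<Sigma>" and a: "a \<in> free_component m i" and b: "b \<in> free_component m j"
    and f: "f \<in> cube_faces m \<Sigma>"
  shows "face_value m (free_diff (a \<star> b)) f =
    face_value m (free_diff a \<star> b + frag_cmul ((-1) ^ i) (a \<star> free_diff b)) f"
proof -
  let ?X = "real_moment_angle m \<Sigma>"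
  have c: "a \<in> carrier (free_ring m)" "b \<in> carrier (free_ring m)"
    using a b free_component_carrier by blast+
  show ?thesis
    using c cochain_leibniz[OF free_cochain_component[OF a] free_cochain_component[OF b], of ?X]
    by (intro face_value_eqI[OF \<Sigma> _ _ _ f])
      (auto simp: free_carrier_closed free_carrier_unary free_diff_carrier free_diff_cochain free_cochain_mult
         free_cochain_add free_cochain_cmul)
qed

lemma finsum_B_dga:
  assumes "finite I" "\<And>i. i \<in> I \<Longrightarrow> g i \<in> carrier (free_ring m)"
  shows "sum g I \<in> carrier (free_ring m) \<and>
    finsum (B_dga m \<Sigma>) (\<lambda>i. B_class m \<Sigma> (g i)) I = B_class m \<Sigma> (sum g I)"
proof -
  interpret ring "B_dga m \<Sigma>" by (rule ring_B_dga)
  show ?thesis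
    using assms
    by (induction I rule: finite_induct)
      (auto simp: free_carrier_0 free_carrier_closed Pi_def B_dga_simps B_dga_mult_add)
qed

lemma face_value_sum: "face_value m (sum g I) f = (\<Sum>i\<in>I. face_value m (g i) f)"
  by (induction I rule: infinite_finite_induct) (auto simp: face_value_simps)

lemma dga_B_dga:
  assumes \<Sigma>: "simplicial_complex_on m \<Sigma>"
  shows "dga (B_dga m \<Sigma>)"
proof -
  let ?B = "B_dga m \<Sigma>" and ?q = "B_class m \<Sigma>"
  interpret ring ?B by (rule ring_B_dga)
  show ?thesis
  proof (intro dga.intro ring_B_dga dga_axioms.intro)
    fix n
    show "additive_subgroup (component ?B n) ?B"
    proof
      show "component ?B n \<subseteq> carrier (add_monoid ?B)"
        using free_component_carrier by (auto simp: B_dga_simps)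
      have 0: "0 \<in> free_component m n" by (simp add: free_component_def)
      then show "\<one>\<^bsub>add_monoid ?B\<^esub> \<in> component ?B n" by (auto simp: B_dga_simps)
      fix x y assume "x \<in> component ?B n" "y \<in> component ?B n"
      then obtain a b where ab: "a \<in> free_component m n" "b \<in> free_component m n" "x = ?q a" "y = ?q b"
        by (auto simp: B_dga_simps)
      then have c: "a \<in> carrier (free_ring m)" "b \<in> carrier (free_ring m)"
        using free_component_carrier by blast+
      have "a + b \<in> free_component m n" "- a \<in> free_component m n"
        using ab(1,2) keys_add[of a b] unfolding free_component_def by (blast, simp)
      then show "x \<otimes>\<^bsub>add_monoid ?B\<^esub> y \<in> component ?B n" "inv\<^bsub>add_monoid ?B\<^esub> x \<in> component ?B n"
        using ab c by (auto simp: B_dga_mult_add B_dga_minus B_dga_simps(4) simp flip: a_inv_def)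
    qed
  next
    have "frag_of [] \<in> free_component m 0" by (simp add: free_component_def word_degree_def)
    then show "\<one>\<^bsub>?B\<^esub> \<in> component ?B 0" by (simp add: B_dga_simps)
  next
    fix x y i j assume "x \<in> component ?B i" "y \<in> component ?B j"
    then obtain a b where ab: "a \<in> free_component m i" "b \<in> free_component m j" "x = ?q a" "y = ?q b"
      by (auto simp: B_dga_simps)
    have c: "a \<in> carrier (free_ring m)" "b \<in> carrier (free_ring m)"
      using ab free_component_carrier by blast+
    show "x \<otimes>\<^bsub>?B\<^esub> y \<in> component ?B (i + j)"
      using ab c free_component_mult[OF ab(1,2)] by (simp add: B_dga_mult_add B_dga_simps(4))
    show "diff ?B (x \<otimes>\<^bsub>?B\<^esub> y) = diff ?B x \<otimes>\<^bsub>?B\<^esub> y \<oplus>\<^bsub>?B\<^esub> ((\<ominus>\<^bsub>?B\<^esub> \<one>\<^bsub>?B\<^esub>) [^]\<^bsub>?B\<^esub> i) \<otimes>\<^bsub>?B\<^esub> (x \<otimes>\<^bsub>?B\<^esub> diff ?B y)"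
    proof -
      let ?z = "a \<star> free_diff b"
      have z: "?z \<in> carrier (free_ring m)" "free_diff a \<star> b \<in> carrier (free_ring m)"
        using c by (auto intro!: free_carrier_closed free_diff_carrier)
      have "((\<ominus>\<^bsub>?B\<^esub> \<one>\<^bsub>?B\<^esub>) [^]\<^bsub>?B\<^esub> i) \<otimes>\<^bsub>?B\<^esub> ?q ?z = ?q (frag_cmul ((-1) ^ i) ?z)"
        using minus_one_power_mult[of "?q ?z" i] z by (auto simp: B_dga_simps(1) B_dga_minus minus_one_power_iff)
      moreover have "?q (free_diff (a \<star> b)) = ?q (free_diff a \<star> b + frag_cmul ((-1) ^ i) ?z)"
        using c z free_leibniz_value[OF \<Sigma> ab(1,2)]
        by (intro B_class_eqI[OF \<Sigma>]) (auto simp: free_carrier_closed free_carrier_unary free_diff_carrier)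
      ultimately show ?thesis
        using c z by (simp add: ab B_dga_mult_add B_dga_diff[OF \<Sigma>] free_carrier_closed free_carrier_unary free_diff_carrier)
    qed
  next
    fix x assume "x \<in> carrier ?B"
    then obtain a where a: "a \<in> carrier (free_ring m)" "x = ?q a" by (auto simp: B_dga_simps)
    have "face_value m (free_diff (free_diff a)) f = face_value m 0 f" if "f \<in> cube_faces m \<Sigma>" for f
      using a that by (intro face_value_eqI[OF \<Sigma>])
        (auto simp: free_diff_carrier free_carrier_0 free_diff_cochain cochain_diff_diff free_cochain_normalized)
    then have "?q (free_diff (free_diff a)) = ?q 0"
      using a by (intro B_class_eqI[OF \<Sigma>]) (auto simp: free_diff_carrier free_carrier_0)
    then show "diff ?B (diff ?B x) = \<zero>\<^bsub>?B\<^esub>"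
      using a by (simp add: B_dga_diff[OF \<Sigma>] free_diff_carrier B_dga_simps(3))
    define h where "h n = ?q (degree_part n a)" for n
    have pc: "degree_part n a \<in> carrier (free_ring m)" for n
      using degree_part_component[OF a(1)] free_component_carrier by blast
    \<comment> \<open>Degree \<open>n\<close> is supported on faces of dimension \<open>n\<close>,
      so at \<open>f\<close> a single summand counts. If the class of that summand is zero it is
      left out of the sum, but then its value at \<open>f\<close> is zero too.\<close>
    have sum_value: "face_value m (\<Sum>n\<in>{n. k n \<noteq> \<zero>\<^bsub>?B\<^esub>}. b n) f = face_value m (b (card (zeros m f))) f"
      if b: "\<And>n. b n \<in> free_component m n" "\<And>n. k n = ?q (b n)" "finite {n. k n \<noteq> \<zero>\<^bsub>?B\<^esub>}"
        and f: "f \<in> cube_faces m \<Sigma>" for b k f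
    proof -
      let ?n = "card (zeros m f)"
      have "face_value m (b ?n) f = 0" if "k ?n = \<zero>\<^bsub>?B\<^esub>"
        using B_class_eqD[OF \<Sigma> _ free_carrier_0 _ f, of "b ?n"] that b(1)[of ?n] free_component_carrier
        by (auto simp: B_dga_simps(3) b(2) face_value_simps)
      moreover have "(\<Sum>n\<in>{n. k n \<noteq> \<zero>\<^bsub>?B\<^esub>}. face_value m (b n) f) = (\<Sum>n\<in>{n. k n \<noteq> \<zero>\<^bsub>?B\<^esub>}. if n = ?n then face_value m (b ?n) f else 0)"
        using face_value_component[OF b(1)] by (intro sum.cong) auto
      ultimately show ?thesis using b(3) by (auto simp: face_value_sum)
    qed
    show "\<exists>!h. (\<forall>n. h n \<in> component ?B n) \<and> finite {n. h n \<noteq> \<zero>\<^bsub>?B\<^esub>} \<and> x = finsum ?B h {n. h n \<noteq> \<zero>\<^bsub>?B\<^esub>}"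
    proof (rule ex1I[of _ h])
      have "{n. h n \<noteq> \<zero>\<^bsub>?B\<^esub>} \<subseteq> word_degree ` Poly_Mapping.keys a"
      proof
        fix n assume "n \<in> {n. h n \<noteq> \<zero>\<^bsub>?B\<^esub>}"
        then have "degree_part n a \<noteq> 0" by (auto simp: h_def B_dga_simps(3))
        moreover have "degree_part n a = 0" if "n \<notin> word_degree ` Poly_Mapping.keys a"
          unfolding degree_part_def using that by (intro frag_extend_eq_0) auto
        ultimately show "n \<in> word_degree ` Poly_Mapping.keys a" by blast
      qed
      then have fin: "finite {n. h n \<noteq> \<zero>\<^bsub>?B\<^esub>}" by (rule finite_subset) simp
      have hc: "\<And>n. h n \<in> component ?B n"
        using degree_part_component[OF a(1)] by (auto simp: h_def B_dga_simps(4))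
      have fs: "finsum ?B h {n. h n \<noteq> \<zero>\<^bsub>?B\<^esub>} = ?q (\<Sum>n\<in>{n. h n \<noteq> \<zero>\<^bsub>?B\<^esub>}. degree_part n a)"
        using finsum_B_dga[where g = "\<lambda>n. degree_part n a" and \<Sigma> = \<Sigma>, OF fin pc] unfolding h_def by simp
      have sc: "(\<Sum>n\<in>{n. h n \<noteq> \<zero>\<^bsub>?B\<^esub>}. degree_part n a) \<in> carrier (free_ring m)"
        using finsum_B_dga[where g = "\<lambda>n. degree_part n a" and \<Sigma> = \<Sigma>, OF fin pc] by simp
      have "face_value m (\<Sum>n\<in>{n. h n \<noteq> \<zero>\<^bsub>?B\<^esub>}. degree_part n a) f = face_value m a f" if "f \<in> cube_faces m \<Sigma>" for f
        using sum_value[of "\<lambda>n. degree_part n a" h f] degree_part_component[OF a(1)] fin that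
        by (simp add: h_def face_value_degree_part)
      from B_class_eqI[OF \<Sigma> sc a(1) this] have "x = finsum ?B h {n. h n \<noteq> \<zero>\<^bsub>?B\<^esub>}"
        unfolding fs a(2) by (rule sym)
      then show "(\<forall>n. h n \<in> component ?B n) \<and> finite {n. h n \<noteq> \<zero>\<^bsub>?B\<^esub>} \<and> x = finsum ?B h {n. h n \<noteq> \<zero>\<^bsub>?B\<^esub>}"
        using hc fin by blast
    next
      fix k assume k: "(\<forall>n. k n \<in> component ?B n) \<and> finite {n. k n \<noteq> \<zero>\<^bsub>?B\<^esub>} \<and> x = finsum ?B k {n. k n \<noteq> \<zero>\<^bsub>?B\<^esub>}"
      have "\<forall>n. \<exists>b. b \<in> free_component m n \<and> k n = ?q b" using k by (auto simp: B_dga_simps(4))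
      from choice[OF this] obtain b where "\<forall>n. b n \<in> free_component m n \<and> k n = ?q (b n)" by (rule exE)
      then have b: "\<And>n. b n \<in> free_component m n" "\<And>n. k n = ?q (b n)" by auto
      have bc: "b n \<in> carrier (free_ring m)" for n using b(1) free_component_carrier by blast
      have fin: "finite {n. k n \<noteq> \<zero>\<^bsub>?B\<^esub>}" using k by blast
      have s: "(\<Sum>n\<in>{n. k n \<noteq> \<zero>\<^bsub>?B\<^esub>}. b n) \<in> carrier (free_ring m)" "x = ?q (\<Sum>n\<in>{n. k n \<noteq> \<zero>\<^bsub>?B\<^esub>}. b n)"
      proof -
        have "k = (\<lambda>n. ?q (b n))" using b(2) by (intro ext)
        then show "(\<Sum>n\<in>{n. k n \<noteq> \<zero>\<^bsub>?B\<^esub>}. b n) \<in> carrier (free_ring m)" "x = ?q (\<Sum>n\<in>{n. k n \<noteq> \<zero>\<^bsub>?B\<^esub>}. b n)"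
          using finsum_B_dga[where g = b and \<Sigma> = \<Sigma>, OF fin bc] k by simp_all
      qed
      have v: "face_value m (b (card (zeros m f))) f = face_value m a f" if f: "f \<in> cube_faces m \<Sigma>" for f
        using B_class_eqD[OF \<Sigma> s(1) a(1) _ f] sum_value[OF b fin f] s(2) a(2) by simp
      show "k = h"
      proof
        fix n
        have "face_value m (b n) f = face_value m (degree_part n a) f" if "f \<in> cube_faces m \<Sigma>" for f
          using v[OF that] face_value_component[OF b(1)[of n], of f] by (auto simp: face_value_degree_part)
        then show "k n = h n"
          unfolding b(2) h_def by (intro B_class_eqI[OF \<Sigma> bc pc])
      qed
    qed
  next
    fix x n assume "x \<in> component ?B n"
    then obtain a where a: "a \<in> free_component m n" "x = ?q a" by (auto simp: B_dga_simps)
    then have c: "a \<in> carrier (free_ring m)" using free_component_carrier by blast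
    have "face_value m (free_diff a) f = 0" if f: "f \<in> cube_faces m \<Sigma>" "card (zeros m f) \<noteq> Suc n" for f
    proof -
      have "frag_eval (face_value m a) (cube_boundary m f) = 0"
        unfolding frag_eval_def using cube_boundary_keys[OF \<Sigma> f(1)] f(2) face_value_component[OF a(1)]
        by (intro sum.neutral) force
      then show ?thesis using face_value_free_diff[OF \<Sigma> c f(1)] by (simp add: cube_coboundary_def)
    qed
    then show "diff ?B x \<in> component ?B (Suc n)"
      unfolding a(2) B_dga_diff[OF \<Sigma> c] B_dga_simps(4) B_component_eq[OF \<Sigma>] B_class_eq_fiber[OF \<Sigma> free_diff_carrier[OF c]]
      by blast
  next
    fix x y assume "x \<in> carrier ?B" "y \<in> carrier ?B"
    then show "diff ?B (x \<oplus>\<^bsub>?B\<^esub> y) = diff ?B x \<oplus>\<^bsub>?B\<^esub> diff ?B y"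
      by (auto simp: B_dga_simps(1) B_dga_mult_add B_dga_diff[OF \<Sigma>] free_carrier_closed free_diff_carrier free_diff_add)
  qed
qed

section \<open>The evaluation map as a natural surjection of dgas\<close>

definition face_map :: "nat \<Rightarrow> nat set set \<Rightarrow> (nat \<Rightarrow> real) cochain \<Rightarrow> (B_gen list \<Rightarrow>\<^sub>0 int) set" where
  "face_map m \<Sigma> \<gamma> = face_fiber m \<Sigma> (cube_eval m \<gamma>)"

lemma face_map_eq_B_class:
  assumes "simplicial_complex_on m \<Sigma>"
  obtains a where "a \<in> carrier (free_ring m)" "\<And>f. f \<in> cube_faces m \<Sigma> \<Longrightarrow> face_value m a f = cube_eval m \<gamma> f"
    "face_map m \<Sigma> \<gamma> = B_class m \<Sigma> a"
  using face_fiber_eq_B_class[OF assms] unfolding face_map_def by blast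

lemma face_map_free_cochain:
  assumes "simplicial_complex_on m \<Sigma>" "a \<in> carrier (free_ring m)"
  shows "face_map m \<Sigma> (free_cochain (real_moment_angle m \<Sigma>) a) = B_class m \<Sigma> a"
  unfolding face_map_def B_class_eq_fiber[OF assms]
  by (rule face_fiber_cong) (rule cube_eval_free_cochain[OF assms])

lemma face_map_in_dga_hom:
  assumes \<Sigma>: "simplicial_complex_on m \<Sigma>"
  shows "face_map m \<Sigma> \<in> dga_hom (cochain_dga (real_moment_angle m \<Sigma>)) (B_dga m \<Sigma>)"
proof -
  let ?X = "real_moment_angle m \<Sigma>"
  let ?C = "cochain_dga ?X" and ?B = "B_dga m \<Sigma>" and ?\<phi> = "face_map m \<Sigma>"
  have "?\<phi> \<in> ring_hom ?C ?B"
  proof (rule ring_hom_memI)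
    fix \<gamma> assume "\<gamma> \<in> carrier ?C"
    show "?\<phi> \<gamma> \<in> carrier ?B"
      by (rule face_map_eq_B_class[OF \<Sigma>, of \<gamma>]) (simp add: B_dga_simps(1))
  next
    fix \<gamma> \<delta> assume \<gamma>\<delta>: "\<gamma> \<in> carrier ?C" "\<delta> \<in> carrier ?C"
    obtain a where a: "a \<in> carrier (free_ring m)" "\<And>f. f \<in> cube_faces m \<Sigma> \<Longrightarrow> face_value m a f = cube_eval m \<gamma> f"
        "?\<phi> \<gamma> = B_class m \<Sigma> a"
      using face_map_eq_B_class[OF \<Sigma>, of \<gamma>] by metis
    obtain b where b: "b \<in> carrier (free_ring m)" "\<And>f. f \<in> cube_faces m \<Sigma> \<Longrightarrow> face_value m b f = cube_eval m \<delta> f"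
        "?\<phi> \<delta> = B_class m \<Sigma> b"
      using face_map_eq_B_class[OF \<Sigma>, of \<delta>] by metis
    have "cube_eval m (cochain_mult ?X \<gamma> \<delta>) f = face_value m (a \<star> b) f" if f: "f \<in> cube_faces m \<Sigma>" for f
    proof -
      \<comment> \<open>Both factors may be replaced by cochains of words with the same face values,
        because the value of a product depends on nothing else.\<close>
      have "cube_eval m (cochain_mult ?X \<gamma> \<delta>) f = cube_eval m (cochain_mult ?X (free_cochain ?X a) (free_cochain ?X b)) f"
        unfolding cube_eval_mult[OF \<Sigma> f cochain_carrierD[OF \<gamma>\<delta>(1)] cochain_carrierD[OF \<gamma>\<delta>(2)]]
          cube_eval_mult[OF \<Sigma> f free_cochain_normalized free_cochain_normalized]
      proof (intro sum.cong refl arg_cong2[where f = "(*)"])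
        fix A assume "A \<in> Pow (zeros m f)"
        then have "fix_coords (zeros m f - A) (-1) f \<in> cube_faces m \<Sigma>" "fix_coords A 1 f \<in> cube_faces m \<Sigma>"
          by (auto intro!: fix_coords_cube_faces[OF \<Sigma> f])
        then show "cube_eval m \<gamma> (fix_coords (zeros m f - A) (-1) f) = cube_eval m (free_cochain ?X a) (fix_coords (zeros m f - A) (-1) f)"
          "cube_eval m \<delta> (fix_coords A 1 f) = cube_eval m (free_cochain ?X b) (fix_coords A 1 f)"
          using a b by (simp_all add: cube_eval_free_cochain[OF \<Sigma>])
      qed
      then show ?thesis
        using cube_eval_free_cochain[OF \<Sigma> free_carrier_closed(3)[OF a(1) b(1)] f] by (simp add: free_cochain_mult)
    qed
    then have "?\<phi> (cochain_mult ?X \<gamma> \<delta>) = B_class m \<Sigma> (a \<star> b)"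
      unfolding face_map_def B_class_eq_fiber[OF \<Sigma> free_carrier_closed(3)[OF a(1) b(1)]] by (rule face_fiber_cong)
    then show "?\<phi> (\<gamma> \<otimes>\<^bsub>?C\<^esub> \<delta>) = ?\<phi> \<gamma> \<otimes>\<^bsub>?B\<^esub> ?\<phi> \<delta>"
      by (simp add: cochain_dga_simps(2) a b B_dga_mult_add)
    have "?\<phi> (\<lambda>n c. \<gamma> n c + \<delta> n c) = B_class m \<Sigma> (a + b)"
      unfolding face_map_def B_class_eq_fiber[OF \<Sigma> free_carrier_closed(1)[OF a(1) b(1)]]
      using a(2) b(2) by (intro face_fiber_cong) (simp add: face_value_simps cube_eval_def)
    then show "?\<phi> (\<gamma> \<oplus>\<^bsub>?C\<^esub> \<delta>) = ?\<phi> \<gamma> \<oplus>\<^bsub>?B\<^esub> ?\<phi> \<delta>"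
      by (simp add: cochain_dga_simps(5) a b B_dga_mult_add)
  next
    show "?\<phi> \<one>\<^bsub>?C\<^esub> = \<one>\<^bsub>?B\<^esub>"
      using face_map_free_cochain[OF \<Sigma>, of "frag_of []"] by (simp add: free_carrier_of cochain_dga_simps(3) B_dga_simps(2))
  qed
  moreover have "?\<phi> ` component ?C n \<subseteq> component ?B n" for n
  proof
    fix Y assume "Y \<in> ?\<phi> ` component ?C n"
    then obtain \<gamma> where \<gamma>: "\<gamma> \<in> component ?C n" "Y = ?\<phi> \<gamma>" by auto
    have "cube_eval m \<gamma> f = 0" if "card (zeros m f) \<noteq> n" for f
      using cochain_componentD(2)[OF \<gamma>(1) that] by (simp add: cube_eval_def)
    then show "Y \<in> component ?B n"
      unfolding B_dga_simps(4) B_component_eq[OF \<Sigma>] \<gamma>(2) face_map_def by blast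
  qed
  moreover have "?\<phi> (diff ?C \<gamma>) = diff ?B (?\<phi> \<gamma>)" if \<gamma>: "\<gamma> \<in> carrier ?C" for \<gamma>
  proof -
    obtain a where a: "a \<in> carrier (free_ring m)" "\<And>f. f \<in> cube_faces m \<Sigma> \<Longrightarrow> face_value m a f = cube_eval m \<gamma> f"
        "?\<phi> \<gamma> = B_class m \<Sigma> a"
      using face_map_eq_B_class[OF \<Sigma>, of \<gamma>] by metis
    have "cube_eval m (cochain_diff ?X \<gamma>) f = face_value m (free_diff a) f" if f: "f \<in> cube_faces m \<Sigma>" for f
      using cube_eval_diff[OF \<Sigma> f cochain_carrierD[OF \<gamma>]] face_value_free_diff[OF \<Sigma> a(1) f]
        cube_coboundary_cong[OF \<Sigma> f a(2)] by (simp add: cube_coboundary_def)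
    then have "?\<phi> (cochain_diff ?X \<gamma>) = B_class m \<Sigma> (free_diff a)"
      unfolding face_map_def B_class_eq_fiber[OF \<Sigma> free_diff_carrier[OF a(1)]] by (rule face_fiber_cong)
    then show ?thesis by (simp add: cochain_dga_simps(7) a(3) B_dga_diff[OF \<Sigma> a(1)])
  qed
  ultimately show ?thesis by (simp add: dga_hom_def)
qed

lemma face_map_surj:
  assumes \<Sigma>: "simplicial_complex_on m \<Sigma>" and Y: "Y \<in> component (B_dga m \<Sigma>) n"
  shows "\<exists>\<gamma>\<in>component (cochain_dga (real_moment_angle m \<Sigma>)) n. face_map m \<Sigma> \<gamma> = Y"
proof -
  obtain a where a: "a \<in> free_component m n" "Y = B_class m \<Sigma> a"
    using Y by (auto simp: B_dga_simps(4))
  then have "a \<in> carrier (free_ring m)" using free_component_carrier by blast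
  then show ?thesis
    using face_map_free_cochain[OF \<Sigma>] free_cochain_component[OF a(1)] a(2) by blast
qed

lemma face_map_eq_zero:
  assumes \<Sigma>: "simplicial_complex_on m \<Sigma>"
  shows "face_map m \<Sigma> \<gamma> = \<zero>\<^bsub>B_dga m \<Sigma>\<^esub> \<longleftrightarrow> (\<forall>f\<in>cube_faces m \<Sigma>. cube_eval m \<gamma> f = 0)"
proof -
  have "\<zero>\<^bsub>B_dga m \<Sigma>\<^esub> = face_fiber m \<Sigma> (\<lambda>f. 0)"
    unfolding B_dga_simps(3) B_class_eq_fiber[OF \<Sigma> free_carrier_0] by (rule face_fiber_cong) (simp add: face_value_simps)
  then show ?thesis
    unfolding face_map_def using face_fiber_eqD[of m \<Sigma> "cube_eval m \<gamma>" "\<lambda>f. 0"] face_fiber_cong[of m \<Sigma> "cube_eval m \<gamma>" "\<lambda>f. 0"]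
    by auto
qed

text \<open>A face has the same triangulation in every subcomplex that contains it. Restriction
  therefore keeps its value, and the projection forgets the values on the other faces.\<close>

lemma face_map_restriction:
  assumes \<Sigma>': "simplicial_complex_on m \<Sigma>'" and sub: "\<Sigma>' \<subseteq> \<Sigma>"
  shows "face_map m \<Sigma>' (cochain_restriction (real_moment_angle m \<Sigma>') \<gamma>) = B_projection m \<Sigma>' (face_map m \<Sigma> \<gamma>)"
proof -
  have faces: "cube_faces m \<Sigma>' \<subseteq> cube_faces m \<Sigma>" using sub by (auto simp: cube_faces_def)
  have "face_map m \<Sigma>' (cochain_restriction (real_moment_angle m \<Sigma>') \<gamma>) = face_fiber m \<Sigma>' (cube_eval m \<gamma>)"
    unfolding face_map_def using singular_chain_cube_chain[of _ m \<Sigma>']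
    by (intro face_fiber_cong) (simp add: cube_eval_def cochain_restriction_def)
  moreover have "B_class m \<Sigma>' a = face_fiber m \<Sigma>' (cube_eval m \<gamma>)" if "a \<in> face_map m \<Sigma> \<gamma>" for a
  proof -
    have a: "a \<in> carrier (free_ring m)" "\<And>f. f \<in> cube_faces m \<Sigma> \<Longrightarrow> face_value m a f = cube_eval m \<gamma> f"
      using that by (auto simp: face_map_def face_fiber_def)
    show ?thesis
      unfolding B_class_eq_fiber[OF \<Sigma>' a(1)] using a(2) faces by (intro face_fiber_cong) auto
  qed
  moreover have "face_map m \<Sigma> \<gamma> \<noteq> {}"
    using face_value_surj[of m \<Sigma> "cube_eval m \<gamma>"] by (auto simp: face_map_def face_fiber_def)
  ultimately show ?thesis unfolding B_projection_def by auto
qed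

section \<open>The degenerate chains form an acyclic complex\<close>

text \<open>The degenerate chains are filtered by the least repeated vertex; repeating the
  \<open>k\<close>-th vertex contracts the \<open>k\<close>-th quotient of this filtration up to sign.\<close>

definition low_degenerate :: "nat \<Rightarrow> nat \<Rightarrow> 'a topology \<Rightarrow> ((nat \<Rightarrow> real) \<Rightarrow> 'a) \<Rightarrow> bool" where
  "low_degenerate k n X x \<longleftrightarrow> (\<exists>j y. j < k \<and> j < n \<and> singular_simplex (n - 1) X y \<and> x = reindex n (squash j) y)"

definition low_chains :: "nat \<Rightarrow> nat \<Rightarrow> 'a topology \<Rightarrow> 'a chain set" where
  "low_chains k n X = {c. Poly_Mapping.keys c \<subseteq> Collect (low_degenerate k n X)}"

lemma degenerate_chains_eq_low: "degenerate_chains n X = low_chains n n X"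
proof -
  have "low_degenerate n n X = degenerate_simplex n X"
    by (auto simp: low_degenerate_def degenerate_simplex_iff fun_eq_iff)
  then show ?thesis by (simp add: degenerate_chains_def low_chains_def)
qed

lemma low_chainsE:
  assumes "c \<in> low_chains k n X" "x \<in> Poly_Mapping.keys c"
  obtains j y where "j < k" "j < n" "singular_simplex (n - 1) X y" "x = reindex n (squash j) y"
  using assms unfolding low_chains_def low_degenerate_def by blast

lemma low_degenerateI:
  "\<lbrakk>j < k; j \<le> n; singular_simplex n X y; x = reindex (Suc n) (squash j) y\<rbrakk> \<Longrightarrow> low_degenerate k (Suc n) X x"
  unfolding low_degenerate_def by auto

lemma low_chains_closed:
  "0 \<in> low_chains k n X"
  "\<lbrakk>a \<in> low_chains k n X; b \<in> low_chains k n X\<rbrakk> \<Longrightarrow> a + b \<in> low_chains k n X"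
  "\<lbrakk>a \<in> low_chains k n X; b \<in> low_chains k n X\<rbrakk> \<Longrightarrow> a - b \<in> low_chains k n X"
  "a \<in> low_chains k n X \<Longrightarrow> - a \<in> low_chains k n X"
  "a \<in> low_chains k n X \<Longrightarrow> frag_cmul t a \<in> low_chains k n X"
  "frag_of x \<in> low_chains k n X \<longleftrightarrow> low_degenerate k n X x"
  using keys_add[of a b] keys_diff[of a b] keys_cmul[of t a] by (auto simp: low_chains_def)

lemma low_chains_sum: "(\<And>i. i \<in> I \<Longrightarrow> F i \<in> low_chains k n X) \<Longrightarrow> sum F I \<in> low_chains k n X"
  by (induction I rule: infinite_finite_induct) (auto simp: low_chains_closed)

lemma low_chains_extend:
  "(\<And>x. x \<in> Poly_Mapping.keys c \<Longrightarrow> F x \<in> low_chains k n X) \<Longrightarrow> frag_extend F c \<in> low_chains k n X"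
  unfolding frag_extend_def by (intro low_chains_sum low_chains_closed(5))

lemma low_chains_singular: "c \<in> low_chains k n X \<Longrightarrow> singular_chain n X c"
  unfolding singular_chain_def
  by (auto simp: squash_def elim!: low_chainsE intro!: singular_simplex_reindex)

definition degen_chain :: "nat \<Rightarrow> nat \<Rightarrow> 'a chain \<Rightarrow> 'a chain" where
  "degen_chain n k = frag_extend (\<lambda>x. frag_of (reindex (Suc n) (squash k) x))"

lemma degen_chain_simps:
  "degen_chain n k 0 = 0" "degen_chain n k (a + b) = degen_chain n k a + degen_chain n k b"
  "degen_chain n k (a - b) = degen_chain n k a - degen_chain n k b" "degen_chain n k (- a) = - degen_chain n k a"
  "degen_chain n k (frag_cmul t a) = frag_cmul t (degen_chain n k a)"
  "degen_chain n k (frag_of x) = frag_of (reindex (Suc n) (squash k) x)"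
  by (simp_all add: degen_chain_def frag_extend_add frag_extend_diff frag_extend_cmul frag_extend_minus)

lemma degen_chain_sum: "degen_chain n k (sum F I) = (\<Sum>i\<in>I. degen_chain n k (F i))"
  by (induction I rule: infinite_finite_induct) (auto simp: degen_chain_simps)

lemma singular_simplex_degen:
  "singular_simplex n X x \<Longrightarrow> k \<le> n \<Longrightarrow> singular_simplex (Suc n) X (reindex (Suc n) (squash k) x)"
  by (rule singular_simplex_reindex) (auto simp: squash_def)

lemma degen_chain_low:
  assumes "singular_chain n X c" "k \<le> n" "k < l"
  shows "degen_chain n k c \<in> low_chains l (Suc n) X"
  unfolding degen_chain_def using assms
  by (intro low_chains_extend) (auto simp: low_chains_closed singular_chain_def intro!: low_degenerateI[of k])

text \<open>The simplicial identity \<open>s_k s_j = s_j s_(k-1)\<close> for \<open>j < k\<close>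
  moves the low degeneracy to the outside.\<close>

lemma degen_chain_preserves_low:
  assumes "c \<in> low_chains k n X" "k \<le> n"
  shows "degen_chain n k c \<in> low_chains k (Suc n) X"
  unfolding degen_chain_def
proof (rule low_chains_extend)
  fix x assume "x \<in> Poly_Mapping.keys c"
  then obtain j y where j: "j < k" "j < n" "singular_simplex (n - 1) X y" "x = reindex n (squash j) y"
    using low_chainsE[OF assms(1)] by metis
  have "reindex (Suc n) (squash k) x = reindex (Suc n) (squash j) (reindex n (squash (k - 1)) y)"
    unfolding j(4) using j(1,2) assms(2)
    by (subst (1 2) reindex_reindex) (auto simp: squash_def intro!: reindex_cong)
  moreover have "singular_simplex n X (reindex n (squash (k - 1)) y)"
    using j assms(2) by (intro singular_simplex_reindex[OF j(3)]) (auto simp: squash_def)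
  ultimately show "frag_of (reindex (Suc n) (squash k) x) \<in> low_chains k (Suc n) X"
    using j(1,2) by (auto simp: low_chains_closed low_degenerate_def)
qed

lemma face_degen_below:
  assumes "singular_simplex n X y" "i < j" "j \<le> n"
  shows "singular_face (Suc n) i (reindex (Suc n) (squash j) y) = reindex n (squash (j - 1)) (singular_face n i y)"
proof -
  obtain n' where n: "n = Suc n'" using assms by (cases n) auto
  show ?thesis
    using assms unfolding n
    by (simp add: singular_face_eq_reindex, subst (1 2) reindex_reindex)
      (auto simp: squash_def skip_def intro!: reindex_cong)
qed

lemma face_degen_above:
  assumes "singular_simplex n X y" "Suc j < i" "i \<le> Suc n"
  shows "singular_face (Suc n) i (reindex (Suc n) (squash j) y) = reindex n (squash j) (singular_face n (i - 1) y)"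
proof -
  obtain n' where n: "n = Suc n'" using assms by (cases n) auto
  show ?thesis
    using assms unfolding n
    by (simp add: singular_face_eq_reindex, subst (1 2) reindex_reindex)
      (auto simp: squash_def skip_def intro!: reindex_cong)
qed

lemma face_degen_middle:
  assumes "singular_simplex n X y" "i = j \<or> i = Suc j" "j \<le> n"
  shows "singular_face (Suc n) i (reindex (Suc n) (squash j) y) = y"
proof -
  have le: "i \<le> Suc n" using assms(2,3) by auto
  have "singular_face (Suc n) i (reindex (Suc n) (squash j) y) = reindex n (\<lambda>k. k) y"
    unfolding singular_face_eq_reindex[OF le]
    using assms(2,3) by (subst reindex_reindex) (auto simp: squash_def skip_def intro!: reindex_cong)
  then show ?thesis using reindex_id[OF assms(1)] by simp
qed

text \<open>Of the faces of \<open>s_j y\<close>, those numbered \<open>j\<close> and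
  \<open>Suc j\<close> cancel; the others remain degenerate, at \<open>j - 1\<close> or at
  \<open>j\<close>.\<close>

lemma chain_boundary_low:
  assumes "c \<in> low_chains k n X"
  shows "chain_boundary n c \<in> low_chains k (n - 1) X"
proof (cases n)
  case 0
  then show ?thesis by (simp add: chain_boundary_def low_chains_closed)
next
  case (Suc n')
  have "(\<Sum>i\<le>Suc n'. frag_cmul ((-1) ^ i) (frag_of (singular_face (Suc n') i x))) \<in> low_chains k n' X"
    if "x \<in> Poly_Mapping.keys c" for x
  proof -
    obtain j y where j: "j < k" "j \<le> n'" "singular_simplex n' X y" "x = reindex (Suc n') (squash j) y"
      using low_chainsE[OF assms \<open>x \<in> Poly_Mapping.keys c\<close>] unfolding Suc by (metis diff_Suc_1 less_Suc_eq_le)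
    let ?F = "\<lambda>i. frag_cmul ((-1) ^ i) (frag_of (singular_face (Suc n') i x))"
    have "(\<Sum>i\<le>Suc n'. ?F i) = (\<Sum>i\<in>{..Suc n'} - {j, Suc j}. ?F i) + (\<Sum>i\<in>{j, Suc j}. ?F i)"
      using j(2) by (intro sum.subset_diff) auto
    also have "(\<Sum>i\<in>{j, Suc j}. ?F i) = 0"
      using face_degen_middle[OF j(3) _ j(2)] by (simp add: j(4) flip: frag_cmul_distrib)
    finally have "(\<Sum>i\<le>Suc n'. ?F i) = (\<Sum>i\<in>{..Suc n'} - {j, Suc j}. ?F i)" by simp
    moreover have "(\<Sum>i\<in>{..Suc n'} - {j, Suc j}. ?F i) \<in> low_chains k n' X"
    proof (intro low_chains_sum low_chains_closed(5))
      fix i assume i: "i \<in> {..Suc n'} - {j, Suc j}"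
      show "frag_of (singular_face (Suc n') i x) \<in> low_chains k n' X"
      proof (cases "i < j")
        case True
        then show ?thesis
          using face_degen_below[OF j(3) True j(2)] singular_simplex_singular_face[OF j(3), of i] j
          by (auto simp: low_chains_closed(6) low_degenerate_def intro!: exI[of _ "j - 1"])
      next
        case False
        then have "Suc j < i" "i \<le> Suc n'" using i by auto
        moreover from this obtain n'' where n'': "n' = Suc n''" using j(2) by (cases n') auto
        ultimately show ?thesis
          using face_degen_above[OF j(3)] singular_simplex_singular_face[OF j(3), of "i - 1"] j
          by (auto simp: low_chains_closed(6) n'' intro!: low_degenerateI[of j k n'' X "singular_face n' (i - 1) y"])
      qed
    qed
    ultimately show ?thesis by simp
  qed
  then show ?thesis
    unfolding Suc chain_boundary_def by (auto intro!: low_chains_extend simp del: sum.atMost_Suc)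
qed

text \<open>In the first summand faces \<open>k\<close> and \<open>Suc k\<close> cancel, and its
  higher faces cancel against those of the second summand. Faces below \<open>k\<close> fall into
  the lower layer. What survives is face \<open>k\<close> in the second summand, with sign
  \<open>(-1) ^ k\<close>.\<close>

lemma degen_homotopy_simplex:
  assumes y: "singular_simplex n X y" and k: "k \<le> n"
  shows "chain_boundary (Suc (Suc n)) (degen_chain (Suc n) k (degen_chain n k (frag_of y)))
    + degen_chain n k (chain_boundary (Suc n) (degen_chain n k (frag_of y)))
    - frag_cmul ((-1) ^ k) (degen_chain n k (frag_of y)) \<in> low_chains k (Suc n) X"
proof -
  let ?s = "reindex (Suc n) (squash k) y" and ?ss = "reindex (Suc (Suc n)) (squash k) (reindex (Suc n) (squash k) y)"
  note s = singular_simplex_degen[OF y k]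
  define F where "F i = frag_cmul ((-1) ^ i) (frag_of (singular_face (Suc (Suc n)) i ?ss))" for i
  define G where "G i = frag_cmul ((-1) ^ i) (frag_of (reindex (Suc n) (squash k) (singular_face (Suc n) i ?s)))" for i
  have FG: "F (Suc i) = - G i" if "Suc k \<le> i" "i \<le> Suc n" for i
    using face_degen_above[OF s, of k "Suc i"] that by (simp add: F_def G_def)
  have Flow: "F i \<in> low_chains k (Suc n) X" if "i < k" for i
    using face_degen_below[OF s that] singular_simplex_singular_face[OF s, of i] that k
    unfolding F_def by (intro low_chains_closed(5)) (auto simp: low_chains_closed(6) low_degenerate_def intro!: exI[of _ "k - 1"])
  have Glow: "G i \<in> low_chains k (Suc n) X" if ik: "i < k" for i
  proof -
    obtain n' where n: "n = Suc n'" using ik k by (cases n) auto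
    have d: "singular_simplex n' X (singular_face n i y)"
      using singular_simplex_singular_face[OF y, of i] that k n by simp
    have "reindex (Suc n) (squash k) (singular_face (Suc n) i ?s) =
        reindex (Suc n) (squash (k - 1)) (reindex n (squash (k - 1)) (singular_face n i y))"
      using ik k n
      by (subst face_degen_below[OF y ik k], subst (1 2) reindex_reindex)
        (auto simp: squash_def intro!: reindex_cong)
    moreover have "singular_simplex n X (reindex n (squash (k - 1)) (singular_face n i y))"
      unfolding n using that k n by (intro singular_simplex_degen d[unfolded n]) auto
    ultimately show ?thesis
      using that k unfolding G_def
      by (intro low_chains_closed(5)) (auto simp: low_chains_closed(6) low_degenerate_def intro!: exI[of _ "k - 1"])
  qed
  have Fk: "F k = frag_cmul ((-1) ^ k) (frag_of ?s)" "F (Suc k) = - frag_cmul ((-1) ^ k) (frag_of ?s)"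
    using face_degen_middle[OF s, of _ k] k by (simp_all add: F_def)
  have Gk: "G k = frag_cmul ((-1) ^ k) (frag_of ?s)"
    using face_degen_middle[OF y, of k k] k by (simp add: G_def)
  have "chain_boundary (Suc (Suc n)) (degen_chain (Suc n) k (degen_chain n k (frag_of y))) = sum F {..Suc (Suc n)}"
    by (simp add: degen_chain_simps chain_boundary_of F_def del: sum.atMost_Suc)
  also have "\<dots> = sum F {..<k} + (F k + F (Suc k)) + sum F {Suc (Suc k)..Suc (Suc n)}"
  proof -
    have "{..Suc (Suc n)} = ({..<k} \<union> {k, Suc k}) \<union> {Suc (Suc k)..Suc (Suc n)}" using k by auto
    then show ?thesis by (simp only:) (subst sum.union_disjoint, simp_all, auto simp: sum.union_disjoint)
  qed
  also have "sum F {Suc (Suc k)..Suc (Suc n)} = - sum G {Suc k..Suc n}"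
    using FG by (simp add: sum.atLeast_Suc_atMost_Suc_shift sum_negf[symmetric] del: sum.cl_ivl_Suc)
  finally have 1: "chain_boundary (Suc (Suc n)) (degen_chain (Suc n) k (degen_chain n k (frag_of y))) =
     sum F {..<k} + (F k + F (Suc k)) - sum G {Suc k..Suc n}" by simp
  have "degen_chain n k (chain_boundary (Suc n) (degen_chain n k (frag_of y))) = sum G {..Suc n}"
    by (simp add: degen_chain_simps chain_boundary_of degen_chain_sum G_def del: sum.atMost_Suc)
  also have "\<dots> = sum G {..<k} + G k + sum G {Suc k..Suc n}"
  proof -
    have "{..Suc n} = ({..<k} \<union> {k}) \<union> {Suc k..Suc n}" using k by auto
    then show ?thesis by (simp only:) (subst sum.union_disjoint, simp_all, auto simp: sum.union_disjoint)
  qed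
  finally have 2: "degen_chain n k (chain_boundary (Suc n) (degen_chain n k (frag_of y))) = sum G {..<k} + G k + sum G {Suc k..Suc n}" .
  have "chain_boundary (Suc (Suc n)) (degen_chain (Suc n) k (degen_chain n k (frag_of y)))
    + degen_chain n k (chain_boundary (Suc n) (degen_chain n k (frag_of y)))
    - frag_cmul ((-1) ^ k) (degen_chain n k (frag_of y)) = sum F {..<k} + sum G {..<k}"
    unfolding 1 2 Fk Gk by (simp add: degen_chain_simps flip: frag_cmul_distrib)
  then show ?thesis
    using Flow Glow by (auto intro!: low_chains_closed low_chains_sum)
qed

lemma degen_homotopy:
  assumes "singular_chain n X b" "k \<le> n"
  shows "chain_boundary (Suc (Suc n)) (degen_chain (Suc n) k (degen_chain n k b))
    + degen_chain n k (chain_boundary (Suc n) (degen_chain n k b))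
    - frag_cmul ((-1) ^ k) (degen_chain n k b) \<in> low_chains k (Suc n) X"
  using assms(1)[unfolded singular_chain_def]
proof (induction b rule: frag_induction)
  case (diff a b)
  have m: "frag_cmul ((-1) ^ k) (u - v) = frag_cmul ((-1) ^ k) u - frag_cmul ((-1) ^ k) v" for u v :: "'a chain"
    by (rule poly_mapping_eqI) (simp add: lookup_minus algebra_simps)
  have "(p - q) + (r - t) - (u - v) = (p + r - u) - (q + t - v)" for p q r t u v :: "'a chain" by simp
  then show ?case
    using low_chains_closed(3)[OF diff] by (simp only: degen_chain_simps chain_boundary_diff m)
qed (use degen_homotopy_simplex assms(2) in \<open>auto simp: degen_chain_simps low_chains_closed\<close>)

lemma low_chains_step:
  assumes c: "c \<in> low_chains (Suc k) n X" and k: "k < n" and cyc: "chain_boundary n c = 0"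
  shows "\<exists>b\<in>low_chains (Suc n) (Suc n) X. c - chain_boundary (Suc n) b \<in> low_chains k n X"
proof -
  obtain n' where n: "n = Suc n'" using k by (cases n) auto
  have "\<exists>y. singular_simplex n' X y \<and> x = reindex n (squash k) y"
    if "x \<in> Poly_Mapping.keys c" "\<not> low_degenerate k n X x" for x
  proof -
    have "low_degenerate (Suc k) n X x" using c that(1) by (auto simp: low_chains_def)
    then obtain j y where "j < Suc k" "j < n" "singular_simplex (n - 1) X y" "x = reindex n (squash j) y"
      unfolding low_degenerate_def by auto
    moreover have "j = k" using calculation that(2) unfolding low_degenerate_def by (metis less_antisym)
    ultimately show ?thesis using n by auto
  qed
  then obtain Y where Y: "\<And>x. \<lbrakk>x \<in> Poly_Mapping.keys c; \<not> low_degenerate k n X x\<rbrakk> \<Longrightarrow> singular_simplex n' X (Y x) \<and> x = reindex n (squash k) (Y x)"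
    by metis
  \<comment> \<open>\<open>c'\<close> collects the simplices already in the lower layer; each of the
    others is the \<open>k\<close>-th degeneracy of a chosen simplex.\<close>
  define c' where "c' = frag_extend (\<lambda>x. if low_degenerate k n X x then frag_of x else 0) c"
  define b where "b = frag_extend (\<lambda>x. if low_degenerate k n X x then 0 else frag_of (Y x)) c"
  have c': "c' \<in> low_chains k n X"
    unfolding c'_def by (intro low_chains_extend) (auto simp: low_chains_closed)
  have b: "singular_chain n' X b"
    unfolding b_def using Y by (intro singular_chain_extend) (auto simp: singular_chain_of)
  have cb: "c = c' + degen_chain n' k b"
  proof -
    have "degen_chain n' k b = frag_extend (\<lambda>x. if low_degenerate k n X x then 0 else frag_of x) c"
    proof -
      have "degen_chain n' k b = (\<Sum>x\<in>Poly_Mapping.keys c. degen_chain n' k (frag_cmul (Poly_Mapping.lookup c x) (if low_degenerate k n X x then 0 else frag_of (Y x))))"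
        unfolding b_def frag_extend_def degen_chain_sum ..
      also have "\<dots> = (\<Sum>x\<in>Poly_Mapping.keys c. frag_cmul (Poly_Mapping.lookup c x) (if low_degenerate k n X x then 0 else frag_of x))"
      proof (rule sum.cong)
        fix x assume "x \<in> Poly_Mapping.keys c"
        then have "degen_chain n' k (if low_degenerate k n X x then 0 else frag_of (Y x)) = (if low_degenerate k n X x then 0 else frag_of x)"
          using Y[of x] n by (simp add: degen_chain_simps)
        then show "degen_chain n' k (frag_cmul (Poly_Mapping.lookup c x) (if low_degenerate k n X x then 0 else frag_of (Y x))) =
           frag_cmul (Poly_Mapping.lookup c x) (if low_degenerate k n X x then 0 else frag_of x)"
          by (simp only: degen_chain_simps(5))
      qed simp
      finally show ?thesis unfolding frag_extend_def .
    qed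
    moreover have "frag_extend (\<lambda>x. F x + G x) c = frag_extend F c + frag_extend G c" for F G :: "((nat \<Rightarrow> real) \<Rightarrow> 'a) \<Rightarrow> 'a chain"
      by (simp add: frag_extend_def frag_cmul_distrib2 sum.distrib)
    moreover have "frag_extend (\<lambda>x. (if low_degenerate k n X x then frag_of x else 0) + (if low_degenerate k n X x then 0 else frag_of x)) c = frag_extend frag_of c"
      by (rule frag_extend_eq) simp
    ultimately show ?thesis by (simp add: c'_def flip: frag_expansion)
  qed
  define e where "e = frag_cmul ((-1) ^ k) (degen_chain (Suc n') k (degen_chain n' k b))"
  have sb: "singular_chain (Suc n') X (degen_chain n' k b)"
    using low_chains_singular[OF degen_chain_low[OF b, of k "Suc k"]] k n by simp
  have e: "e \<in> low_chains (Suc n) (Suc n) X"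
    unfolding e_def n using k n by (intro low_chains_closed(5) degen_chain_low[OF sb]) auto
  \<comment> \<open>As \<open>c\<close> is a cycle, the boundary of its top part equals, up to sign,
    that of \<open>c'\<close> and lies in the lower layer. The second term of the homotopy formula
    is thus negligible, and \<open>e\<close> fills the top part.\<close>
  have "chain_boundary n (degen_chain n' k b) = - chain_boundary n c'"
    using cyc unfolding cb by (simp add: chain_boundary_add eq_neg_iff_add_eq_0 add.commute)
  moreover have "degen_chain n' k (chain_boundary n c') \<in> low_chains k n X"
    using degen_chain_preserves_low[OF chain_boundary_low[OF c']] k n by simp
  ultimately have 2: "degen_chain n' k (chain_boundary n (degen_chain n' k b)) \<in> low_chains k n X"
    by (simp add: degen_chain_simps low_chains_closed)
  have "chain_boundary (Suc n) (degen_chain n k (degen_chain n' k b)) + degen_chain n' k (chain_boundary n (degen_chain n' k b))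
     - frag_cmul ((-1) ^ k) (degen_chain n' k b) \<in> low_chains k n X"
    using degen_homotopy[OF b, of k] k n by simp
  from low_chains_closed(3)[OF this 2]
  have "chain_boundary (Suc n) (degen_chain n k (degen_chain n' k b)) - frag_cmul ((-1) ^ k) (degen_chain n' k b) \<in> low_chains k n X"
    by (simp add: algebra_simps)
  then have "frag_cmul ((-1) ^ k) (chain_boundary (Suc n) (degen_chain n k (degen_chain n' k b)) - frag_cmul ((-1) ^ k) (degen_chain n' k b)) \<in> low_chains k n X"
    by (rule low_chains_closed(5))
  moreover have "frag_cmul ((-1) ^ k) (u - frag_cmul ((-1) ^ k) v) = frag_cmul ((-1) ^ k) u - v" for u v :: "'a chain"
    by (rule poly_mapping_eqI) (simp add: lookup_minus algebra_simps flip: power_add mult.assoc)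
  ultimately have "chain_boundary (Suc n) e - degen_chain n' k b \<in> low_chains k n X"
    by (simp add: e_def chain_boundary_cmul n)
  then have "c' - (chain_boundary (Suc n) e - degen_chain n' k b) \<in> low_chains k n X"
    by (rule low_chains_closed(3)[OF c'])
  moreover have "c' - (chain_boundary (Suc n) e - degen_chain n' k b) = c - chain_boundary (Suc n) e"
    unfolding cb by simp
  ultimately show ?thesis using e by auto
qed

text \<open>Descend from layer \<open>n\<close>, which contains all degenerate chains, to layer
  \<open>0\<close>, which is trivial, subtracting the boundary of a degenerate chain each
  time.\<close>

lemma degenerate_acyclic:
  assumes "c \<in> degenerate_chains n X" "chain_boundary n c = 0"
  shows "\<exists>b\<in>degenerate_chains (Suc n) X. chain_boundary (Suc n) b = c"
proof -
  have "\<exists>b\<in>low_chains (Suc n) (Suc n) X. chain_boundary (Suc n) b = c"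
    if "k \<le> n" "c \<in> low_chains k n X" "chain_boundary n c = 0" for k c
    using that
  proof (induction k arbitrary: c)
    case 0
    then have "c = 0" unfolding low_chains_def low_degenerate_def by simp
    then show ?case using low_chains_closed(1) by (intro bexI[of _ 0]) auto
  next
    case (Suc k)
    obtain b where b: "b \<in> low_chains (Suc n) (Suc n) X" "c - chain_boundary (Suc n) b \<in> low_chains k n X"
      using low_chains_step[OF Suc.prems(2) _ Suc.prems(3)] Suc.prems(1) by auto
    have "chain_boundary n (c - chain_boundary (Suc n) b) = 0"
      using chain_boundary_boundary_alt[OF low_chains_singular[OF b(1)]] Suc.prems(3) by (simp add: chain_boundary_diff)
    then obtain b' where b': "b' \<in> low_chains (Suc n) (Suc n) X" "chain_boundary (Suc n) b' = c - chain_boundary (Suc n) b"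
      using Suc.IH[OF _ b(2)] Suc.prems(1) by auto
    then have "chain_boundary (Suc n) (b' + b) = c" by (simp add: chain_boundary_add)
    then show ?case using low_chains_closed(2)[OF b'(1) b(1)] by blast
  qed
  from this[of n c] show ?thesis using assms by (simp add: degenerate_chains_eq_low)
qed

section \<open>Rounding singular simplices to cubical chains\<close>

text \<open>For ends of the interval, the coefficient of the oriented edge from \<open>-1\<close> to
  \<open>1\<close> in the edge from \<open>a\<close> to \<open>b\<close>.\<close>

definition jump :: "real \<Rightarrow> real \<Rightarrow> int" where
  "jump a b = (if a < b then 1 else if b < a then -1 else 0)"

definition set_coord :: "nat \<Rightarrow> real \<Rightarrow> ((nat \<Rightarrow> real) \<Rightarrow>\<^sub>0 int) \<Rightarrow> (nat \<Rightarrow> real) \<Rightarrow>\<^sub>0 int" where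
  "set_coord j c = frag_extend (\<lambda>f. frag_of (f(j := c)))"

text \<open>Since an interval has no nondegenerate simplices above dimension 1, the Alexander--Whitney
  diagonal of a simplex with vertices in \<open>{-1, 1}\<^sup>m\<close>, projected to the \<open>m\<close> factors, gives the
  following recursion on the number of coordinates.\<close>

fun round_chain :: "nat \<Rightarrow> nat \<Rightarrow> nat \<Rightarrow> (nat \<Rightarrow> nat \<Rightarrow> real) \<Rightarrow> (nat \<Rightarrow> real) \<Rightarrow>\<^sub>0 int" where
  "round_chain m 0 n V = (if n = 0 then frag_of (\<lambda>i\<in>{1..m}. 1) else 0)"
| "round_chain m (Suc j) n V = set_coord (Suc j) (V n (Suc j)) (round_chain m j n V) +
    (if n = 0 then 0 else
     frag_cmul (jump (V (n - 1) (Suc j)) (V n (Suc j))) (set_coord (Suc j) 0 (round_chain m j (n - 1) V)))"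

lemma set_coord_simps:
  "set_coord j c 0 = 0" "set_coord j c (a + b) = set_coord j c a + set_coord j c b"
  "set_coord j c (a - b) = set_coord j c a - set_coord j c b"
  "set_coord j c (frag_cmul t a) = frag_cmul t (set_coord j c a)" "set_coord j c (frag_of f) = frag_of (f(j := c))"
  by (simp_all add: set_coord_def frag_extend_add frag_extend_diff frag_extend_cmul)

lemma set_coord_sum: "set_coord j c (sum F I) = (\<Sum>i\<in>I. set_coord j c (F i))"
  by (induction I rule: infinite_finite_induct) (auto simp: set_coord_simps)

lemma keys_set_coord: "Poly_Mapping.keys (set_coord j c a) \<subseteq> (\<lambda>f. f(j := c)) ` Poly_Mapping.keys a"
  unfolding set_coord_def using keys_frag_extend[of "\<lambda>f. frag_of (f(j := c))" a] by auto

lemma round_chain_cong: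
  "(\<And>k. k \<le> n \<Longrightarrow> V k = W k) \<Longrightarrow> round_chain m j n V = round_chain m j n W"
proof (induction j arbitrary: n)
  case (Suc j)
  have "round_chain m j n V = round_chain m j n W" "round_chain m j (n - 1) V = round_chain m j (n - 1) W"
    using Suc.prems by (auto intro!: Suc.IH)
  then show ?case using Suc.prems by simp
qed simp

definition signs :: "(nat \<Rightarrow> nat \<Rightarrow> real) \<Rightarrow> bool" where
  "signs V \<longleftrightarrow> (\<forall>k i. V k i = 1 \<or> V k i = -1)"

text \<open>The placeholder \<open>1\<close> beyond coordinate \<open>j\<close> ensures that freeing
  coordinate \<open>Suc j\<close> raises the dimension by exactly one. The last two properties
  confine the rounding to faces spanned by the given vertices, which is needed for membership in the
  complex and in the carriers.\<close>

lemma round_chain_keys: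
  assumes "signs V" "j \<le> m" "f \<in> Poly_Mapping.keys (round_chain m j n V)"
  shows "f \<in> {1..m} \<rightarrow>\<^sub>E {-1, 0, 1} \<and> (\<forall>i\<in>{1..m}. j < i \<longrightarrow> f i = 1) \<and> card (zeros m f) = n \<and>
    (\<forall>i\<in>{1..j}. f i = 0 \<longrightarrow> (\<exists>k<n. V k i \<noteq> V (Suc k) i)) \<and> (\<forall>i\<in>{1..j}. f i \<noteq> 0 \<longrightarrow> (\<exists>k\<le>n. f i = V k i))"
  using assms(2,3)
proof (induction j arbitrary: n f)
  case 0
  then have "n = 0" "f = (\<lambda>i\<in>{1..m}. 1)" by (auto split: if_splits)
  then show ?case by (auto simp: zeros_def)
next
  case (Suc j)
  have jm: "j \<le> m" "Suc j \<in> {1..m}" using Suc.prems(1) by auto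
  let ?A = "set_coord (Suc j) (V n (Suc j)) (round_chain m j n V)"
  let ?B = "frag_cmul (jump (V (n - 1) (Suc j)) (V n (Suc j))) (set_coord (Suc j) 0 (round_chain m j (n - 1) V))"
  have "f \<in> Poly_Mapping.keys ?A \<or> (n \<noteq> 0 \<and> f \<in> Poly_Mapping.keys ?B)"
    using Suc.prems(2) keys_add[of ?A ?B] by (auto split: if_splits)
  moreover have "\<exists>g. g \<in> Poly_Mapping.keys (round_chain m j n V) \<and> f = g(Suc j := V n (Suc j))"
    if "f \<in> Poly_Mapping.keys ?A"
    using subsetD[OF keys_set_coord that] by auto
  moreover have "\<exists>g. V (n - 1) (Suc j) \<noteq> V n (Suc j) \<and> g \<in> Poly_Mapping.keys (round_chain m j (n - 1) V) \<and> f = g(Suc j := 0)"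
    if f: "f \<in> Poly_Mapping.keys ?B"
  proof -
    have "f \<in> Poly_Mapping.keys (set_coord (Suc j) 0 (round_chain m j (n - 1) V))" "jump (V (n - 1) (Suc j)) (V n (Suc j)) \<noteq> 0"
      using f unfolding keys_cmul_iff by blast+
    moreover from subsetD[OF keys_set_coord this(1)] obtain g where "g \<in> Poly_Mapping.keys (round_chain m j (n - 1) V)" "f = g(Suc j := 0)"
      by auto
    ultimately show ?thesis by (auto simp: jump_def)
  qed
  ultimately consider g where "g \<in> Poly_Mapping.keys (round_chain m j n V)" "f = g(Suc j := V n (Suc j))"
    | g where "n \<noteq> 0" "V (n - 1) (Suc j) \<noteq> V n (Suc j)" "g \<in> Poly_Mapping.keys (round_chain m j (n - 1) V)" "f = g(Suc j := 0)"
    by blast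
  then show ?case
  proof cases
    case 1
    note IH = Suc.IH[OF jm(1) 1(1)]
    have v: "V n (Suc j) = 1 \<or> V n (Suc j) = -1" using assms(1) by (simp add: signs_def)
    have gS: "g (Suc j) = 1" using IH jm by simp
    have zz: "zeros m f = zeros m g" unfolding 1(2) zeros_def using v gS by auto
    have "f \<in> {1..m} \<rightarrow>\<^sub>E {-1, 0, 1}"
      using IH jm v unfolding 1(2) by (auto simp: PiE_iff extensional_def)
    moreover have "\<exists>k<n. V k i \<noteq> V (Suc k) i" if "i \<in> {1..Suc j}" "f i = 0" for i
    proof -
      have "i \<noteq> Suc j" using that(2) v unfolding 1(2) by auto
      then show ?thesis using IH that unfolding 1(2) by auto
    qed
    moreover have "\<exists>k\<le>n. f i = V k i" if "i \<in> {1..Suc j}" "f i \<noteq> 0" for i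
    proof (cases "i = Suc j")
      case True
      then show ?thesis unfolding 1(2) by auto
    next
      case False
      then show ?thesis using IH that unfolding 1(2) by auto
    qed
    moreover have "f i = 1" if "i \<in> {1..m}" "Suc j < i" for i
      using IH that unfolding 1(2) by simp
    moreover have "card (zeros m f) = n" using IH zz by simp
    ultimately show ?thesis by blast
  next
    case 2
    note IH = Suc.IH[OF jm(1) 2(3)]
    have "zeros m f = insert (Suc j) (zeros m g)" "Suc j \<notin> zeros m g"
      using IH jm unfolding 2(4) zeros_def by auto
    then have "card (zeros m f) = n" using IH 2(1) by simp
    moreover have "f \<in> {1..m} \<rightarrow>\<^sub>E {-1, 0, 1}"
      using IH jm unfolding 2(4) by (auto simp: PiE_iff extensional_def)
    moreover have "\<exists>k<n. V k i \<noteq> V (Suc k) i" if i: "i \<in> {1..Suc j}" "f i = 0" for i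
    proof (cases "i = Suc j")
      case True
      then show ?thesis using 2(1,2) by (intro exI[of _ "n - 1"]) auto
    next
      case False
      then have "i \<in> {1..j}" "g i = 0" using i unfolding 2(4) by auto
      then obtain k where "k < n - 1" "V k i \<noteq> V (Suc k) i" using IH by blast
      then show ?thesis by (intro exI[of _ k]) auto
    qed
    moreover have "\<exists>k\<le>n. f i = V k i" if "i \<in> {1..Suc j}" "f i \<noteq> 0" for i
    proof -
      have "i \<noteq> Suc j" using that(2) unfolding 2(4) by auto
      then have "i \<in> {1..j}" "g i \<noteq> 0" "f i = g i" using that unfolding 2(4) by auto
      then obtain k where "k \<le> n - 1" "f i = V k i" using IH by metis
      then show ?thesis by (intro exI[of _ k]) auto
    qed
    moreover have "f i = 1" if "i \<in> {1..m}" "Suc j < i" for i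
      using IH that unfolding 2(4) by simp
    ultimately show ?thesis by blast
  qed
qed

text \<open>Coordinate \<open>Suc j\<close> comes after all free coordinates of \<open>f\<close>.
  Freeing it leaves the existing boundary signs alone, and its own sign counts all of
  \<open>zeros m f\<close>.\<close>

lemma cube_boundary_update:
  assumes f: "\<And>i. \<lbrakk>i \<in> {1..m}; j < i\<rbrakk> \<Longrightarrow> f i = 1" and j: "Suc j \<le> m"
  shows "c \<noteq> 0 \<Longrightarrow> cube_boundary m (f(Suc j := c)) = set_coord (Suc j) c (cube_boundary m f)"
    "cube_boundary m (f(Suc j := 0)) = set_coord (Suc j) 0 (cube_boundary m f) +
      frag_cmul ((-1) ^ card (zeros m f)) (frag_of (f(Suc j := 1)) - frag_of (f(Suc j := -1)))"
proof -
  have less: "a < Suc j" if "a \<in> zeros m f" for a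
    using f[of a] that by (force simp: zeros_def)
  have notin: "Suc j \<notin> zeros m f" using less by blast
  have upd: "fix_coords {a} x (f(Suc j := c)) = (fix_coords {a} x f)(Suc j := c)" if "a \<in> zeros m f" for a x c
    using less[OF that] by (auto simp: fix_coords_def)
  have sc: "set_coord (Suc j) c (cube_boundary m f) = (\<Sum>a\<in>zeros m f. frag_cmul ((-1) ^ card {b \<in> zeros m f. b < a})
     (frag_of (fix_coords {a} 1 (f(Suc j := c))) - frag_of (fix_coords {a} (-1) (f(Suc j := c)))))" for c
    unfolding cube_boundary_def set_coord_sum using upd by (intro sum.cong) (simp_all add: set_coord_simps)
  show "cube_boundary m (f(Suc j := c)) = set_coord (Suc j) c (cube_boundary m f)" if "c \<noteq> 0"
  proof -
    have "zeros m (f(Suc j := c)) = zeros m f" using that notin by (auto simp: zeros_def)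
    then show ?thesis unfolding sc by (simp add: cube_boundary_def)
  qed
  have z: "zeros m (f(Suc j := 0)) = insert (Suc j) (zeros m f)" using j by (auto simp: zeros_def)
  have c1: "{b \<in> insert (Suc j) (zeros m f). b < a} = {b \<in> zeros m f. b < a}" if "a \<in> zeros m f" for a
    using less[OF that] by auto
  have c2: "{b \<in> insert (Suc j) (zeros m f). b < Suc j} = zeros m f"
    using less by auto
  have "cube_boundary m (f(Suc j := 0)) = frag_cmul ((-1) ^ card (zeros m f))
      (frag_of (fix_coords {Suc j} 1 (f(Suc j := 0))) - frag_of (fix_coords {Suc j} (-1) (f(Suc j := 0)))) +
      set_coord (Suc j) 0 (cube_boundary m f)"
    unfolding sc cube_boundary_def[of m "f(Suc j := 0)"] z
    using notin c1 c2 by (simp add: sum.insert)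
  moreover have "fix_coords {Suc j} x (f(Suc j := 0)) = f(Suc j := x)" for x
    by (auto simp: fix_coords_def)
  ultimately show "cube_boundary m (f(Suc j := 0)) = set_coord (Suc j) 0 (cube_boundary m f) +
      frag_cmul ((-1) ^ card (zeros m f)) (frag_of (f(Suc j := 1)) - frag_of (f(Suc j := -1)))"
    by (simp add: add.commute)
qed

lemma extend_boundary_set_coord:
  assumes "\<And>f. f \<in> Poly_Mapping.keys c \<Longrightarrow> (\<forall>i\<in>{1..m}. j < i \<longrightarrow> f i = 1) \<and> card (zeros m f) = n" and j: "Suc j \<le> m"
  shows "e \<noteq> 0 \<Longrightarrow> frag_extend (cube_boundary m) (set_coord (Suc j) e c) = set_coord (Suc j) e (frag_extend (cube_boundary m) c)"
    "frag_extend (cube_boundary m) (set_coord (Suc j) 0 c) = set_coord (Suc j) 0 (frag_extend (cube_boundary m) c) +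
      frag_cmul ((-1) ^ n) (set_coord (Suc j) 1 c - set_coord (Suc j) (-1) c)"
proof -
  have "Poly_Mapping.keys c \<subseteq> {f. (\<forall>i\<in>{1..m}. j < i \<longrightarrow> f i = 1) \<and> card (zeros m f) = n}"
    using assms(1) by blast
  then have "(e \<noteq> 0 \<longrightarrow> frag_extend (cube_boundary m) (set_coord (Suc j) e c) = set_coord (Suc j) e (frag_extend (cube_boundary m) c)) \<and>
    frag_extend (cube_boundary m) (set_coord (Suc j) 0 c) = set_coord (Suc j) 0 (frag_extend (cube_boundary m) c) +
      frag_cmul ((-1) ^ n) (set_coord (Suc j) 1 c - set_coord (Suc j) (-1) c)"
  proof (induction c rule: frag_induction)
    case (one f)
    then show ?case using cube_boundary_update[of m j f] j by (simp add: set_coord_simps)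
  next
    case (diff a b)
    have m: "frag_cmul k (u - v) = frag_cmul k u - frag_cmul k v" for k and u v :: "(nat \<Rightarrow> real) \<Rightarrow>\<^sub>0 int"
      by (rule poly_mapping_eqI) (simp add: lookup_minus algebra_simps)
    show ?case using diff by (simp add: set_coord_simps frag_extend_diff m)
  qed (simp add: set_coord_simps)
  then show "e \<noteq> 0 \<Longrightarrow> frag_extend (cube_boundary m) (set_coord (Suc j) e c) = set_coord (Suc j) e (frag_extend (cube_boundary m) c)"
    "frag_extend (cube_boundary m) (set_coord (Suc j) 0 c) = set_coord (Suc j) 0 (frag_extend (cube_boundary m) c) +
      frag_cmul ((-1) ^ n) (set_coord (Suc j) 1 c - set_coord (Suc j) (-1) c)"
    by blast+
qed

text \<open>Rounding is a chain map. In the recursion, the terms with coordinate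
  \<open>Suc j\<close> fixed and those with it free are treated separately as \<open>first\<close>
  and \<open>second\<close>.\<close>

lemma round_chain_boundary:
  assumes V: "signs V" and "j \<le> m"
  shows "(\<Sum>i\<le>Suc n. frag_cmul ((-1) ^ i) (round_chain m j n (\<lambda>k. V (skip i k)))) =
    frag_extend (cube_boundary m) (round_chain m j (Suc n) V)"
  using assms(2)
proof (induction j arbitrary: n)
  case 0
  show ?case
  proof (cases "n = 0")
    case True
    then show ?thesis by (simp flip: frag_cmul_distrib)
  qed simp
next
  case (Suc j)
  let ?A = "round_chain m j" and ?S = "set_coord (Suc j)" and ?d = "frag_extend (cube_boundary m)"
  let ?W = "\<lambda>i k. V (skip i k)"
  let ?v = "\<lambda>k. V k (Suc j)"
  have jm: "j \<le> m" "Suc j \<le> m" using Suc.prems by auto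
  have v: "?v k = 1 \<or> ?v k = -1" for k using V by (simp add: signs_def)
  have m: "frag_cmul k (u - w) = frag_cmul k u - frag_cmul k w" for k and u w :: "(nat \<Rightarrow> real) \<Rightarrow>\<^sub>0 int"
    by (rule poly_mapping_eqI) (simp add: lookup_minus algebra_simps)
  have keys: "(\<forall>i\<in>{1..m}. j < i \<longrightarrow> f i = 1) \<and> card (zeros m f) = n" if "f \<in> Poly_Mapping.keys (?A n V)" for f n
    using round_chain_keys[OF V jm(1) that] by blast
  have jump_ext: "frag_cmul (jump (?v a) (?v b)) (?S 1 c - ?S (-1) c) = ?S (?v b) c - ?S (?v a) c" for a b c
    using v[of a] v[of b] by (auto simp: jump_def)
  have last: "?A n (?W (Suc n)) = ?A n V" "?A n' (?W n) = ?A n' V" if "n' < n" for n n'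
    using that by (auto simp: skip_def intro!: round_chain_cong)
  have last0: "?A n (?W (Suc n)) = ?A n V" for n
    by (auto simp: skip_def intro!: round_chain_cong)
  \<comment> \<open>Every face but the last keeps the final vertex. Replacing the final vertex in
    the last face contributes the difference of two end values, which is the boundary of the edge
    counted by \<open>jump\<close>.\<close>
  have first: "(\<Sum>i\<le>Suc n. frag_cmul ((-1) ^ i) (?S (?v (skip i n)) (?A n (?W i)))) =
     ?S (?v (Suc n)) (?d (?A (Suc n) V)) + frag_cmul ((-1) ^ n) (?S (?v (Suc n)) (?A n V) - ?S (?v n) (?A n V))"
  proof -
    have "(\<Sum>i\<le>n. frag_cmul ((-1) ^ i) (?S (?v (skip i n)) (?A n (?W i)))) = ?S (?v (Suc n)) (\<Sum>i\<le>n. frag_cmul ((-1) ^ i) (?A n (?W i)))"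
      unfolding set_coord_sum by (intro sum.cong) (auto simp: set_coord_simps skip_def)
    also have "(\<Sum>i\<le>n. frag_cmul ((-1) ^ i) (?A n (?W i))) = ?d (?A (Suc n) V) + frag_cmul ((-1) ^ n) (?A n V)"
      unfolding Suc.IH[OF jm(1), symmetric] using last0[of n] by (simp flip: add.assoc frag_cmul_distrib)
    finally show ?thesis
      using last0[of n] by (simp add: m set_coord_simps skip_def)
  qed
  have second: "(\<Sum>i\<le>Suc n. frag_cmul ((-1) ^ i) (frag_cmul (jump (?v (skip i (n - 1))) (?v (skip i n))) (?S 0 (?A (n - 1) (?W i))))) =
     frag_cmul (jump (?v n) (?v (Suc n))) (?S 0 (?d (?A n V)))" if n0: "n \<noteq> 0"
  proof -
    obtain n' where n: "n = Suc n'" using n0 by (cases n) auto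
    \<comment> \<open>Omitting vertex \<open>n\<close> merges the last two edges. By additivity of
      \<open>jump\<close>, combining this face with the last one leaves only the edge from
      \<open>n\<close> to \<open>Suc n\<close>.\<close>
    have jj: "jump (?v n') (?v (Suc n)) = jump (?v n') (?v n) + jump (?v n) (?v (Suc n))"
      using v[of n'] v[of n] v[of "Suc n"] by (auto simp: jump_def)
    have "(\<Sum>i\<le>n'. frag_cmul ((-1) ^ i) (frag_cmul (jump (?v (skip i n')) (?v (skip i n))) (?S 0 (?A n' (?W i))))) =
       frag_cmul (jump (?v n) (?v (Suc n))) (?S 0 (\<Sum>i\<le>n'. frag_cmul ((-1) ^ i) (?A n' (?W i))))"
      unfolding set_coord_sum frag_cmul_sum
      by (intro sum.cong) (auto simp: set_coord_simps skip_def n mult.commute)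
    moreover have "?d (?A n V) = (\<Sum>i\<le>n'. frag_cmul ((-1) ^ i) (?A n' (?W i))) + frag_cmul ((-1) ^ n) (?A n' V)"
      using Suc.IH[OF jm(1), of n'] last0[of n'] n by simp
    moreover have "?A n' (?W n) = ?A n' V" "?A n' (?W (Suc n)) = ?A n' V"
      using n by (auto simp: skip_def intro!: round_chain_cong)
    moreover have "skip n n' = n'" "skip n n = Suc n" "skip (Suc n) n' = n'" "skip (Suc n) n = n"
      by (auto simp: skip_def n)
    ultimately show ?thesis
      unfolding n diff_Suc_1 sum.atMost_Suc[of _ "Suc n'"] sum.atMost_Suc[of _ n']
      by (simp add: n[symmetric] set_coord_simps frag_cmul_distrib2 jj[folded n])
        (simp add: n algebra_simps flip: frag_cmul_distrib)
  qed
  have "(\<Sum>i\<le>Suc n. frag_cmul ((-1) ^ i) (round_chain m (Suc j) n (?W i))) =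
     (\<Sum>i\<le>Suc n. frag_cmul ((-1) ^ i) (?S (?v (skip i n)) (?A n (?W i)))) +
     (if n = 0 then 0 else (\<Sum>i\<le>Suc n. frag_cmul ((-1) ^ i) (frag_cmul (jump (?v (skip i (n - 1))) (?v (skip i n))) (?S 0 (?A (n - 1) (?W i))))))"
    by (simp add: frag_cmul_distrib2 sum.distrib del: sum.atMost_Suc frag_cmul_cmul)
  also have "\<dots> = ?S (?v (Suc n)) (?d (?A (Suc n) V)) + frag_cmul ((-1) ^ n) (?S (?v (Suc n)) (?A n V) - ?S (?v n) (?A n V))
      + frag_cmul (jump (?v n) (?v (Suc n))) (?S 0 (?d (?A n V)))"
  proof (cases "n = 0")
    case True
    have "?d (?A 0 V) = 0"
    proof (rule frag_extend_eq_0)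
      fix f assume "f \<in> Poly_Mapping.keys (?A 0 V)"
      then have "zeros m f = {}" using keys by fastforce
      then show "cube_boundary m f = 0" by (simp add: cube_boundary_def)
    qed
    then show ?thesis unfolding first using True by (simp add: set_coord_simps)
  next
    case False
    then show ?thesis unfolding first second[OF False] by simp
  qed
  also have "\<dots> = ?d (round_chain m (Suc j) (Suc n) V)"
  proof -
    have "?v (Suc n) \<noteq> 0" using v[of "Suc n"] by auto
    have bd2: "?d (?S 0 (?A n V)) = ?S 0 (?d (?A n V)) + frag_cmul ((-1) ^ n) (?S 1 (?A n V) - ?S (-1) (?A n V))"
      by (rule extend_boundary_set_coord(2)[OF keys jm(2)])
    have com: "frag_cmul k (frag_cmul ((-1) ^ n) c) = frag_cmul ((-1) ^ n) (frag_cmul k c)" for k and c :: "(nat \<Rightarrow> real) \<Rightarrow>\<^sub>0 int"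
      by (simp add: mult.commute)
    have "?d (frag_cmul (jump (?v n) (?v (Suc n))) (?S 0 (?A n V))) = frag_cmul (jump (?v n) (?v (Suc n))) (?S 0 (?d (?A n V)))
       + frag_cmul ((-1) ^ n) (?S (?v (Suc n)) (?A n V) - ?S (?v n) (?A n V))"
      by (simp only: frag_extend_cmul bd2 frag_cmul_distrib2 jump_ext[symmetric] com)
    then show ?thesis
      using extend_boundary_set_coord(1)[OF keys[of _ "Suc n"] jm(2) \<open>?v (Suc n) \<noteq> 0\<close>] by (simp add: frag_extend_add)
  qed
  finally show ?case .
qed

section \<open>Rounding singular simplices at their vertices\<close>

lemma push_basis_point: "k \<le> l \<Longrightarrow> push l \<theta> (basis_point k) = basis_point (\<theta> k)"
  by (auto simp: push_def basis_point_def fun_eq_iff sum.delta')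

lemma reindex_basis_point: "k \<le> l \<Longrightarrow> reindex l \<theta> x (basis_point k) = x (basis_point (\<theta> k))"
  by (simp add: reindex_def basis_point_in push_basis_point)

text \<open>The rounding of a vertex, with \<open>0\<close> sent to \<open>-1\<close>, depends on
  that vertex alone; hence rounding commutes with passing to faces.\<close>

definition rounded_vertices :: "((nat \<Rightarrow> real) \<Rightarrow> nat \<Rightarrow> real) \<Rightarrow> nat \<Rightarrow> nat \<Rightarrow> real" where
  "rounded_vertices x = (\<lambda>k i. if x (basis_point k) i > 0 then 1 else -1)"

definition round_simplex :: "nat \<Rightarrow> nat \<Rightarrow> ((nat \<Rightarrow> real) \<Rightarrow> nat \<Rightarrow> real) \<Rightarrow> (nat \<Rightarrow> real) \<Rightarrow>\<^sub>0 int" where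
  "round_simplex m n x = round_chain m m n (rounded_vertices x)"

abbreviation round_map :: "nat \<Rightarrow> nat \<Rightarrow> (nat \<Rightarrow> real) chain \<Rightarrow> (nat \<Rightarrow> real) \<Rightarrow>\<^sub>0 int" where
  "round_map m n \<equiv> frag_extend (round_simplex m n)"

lemma signs_rounded_vertices: "signs (rounded_vertices x)"
  by (simp add: signs_def rounded_vertices_def)

lemma round_simplex_face:
  assumes "i \<le> Suc n"
  shows "round_simplex m n (singular_face (Suc n) i x) = round_chain m m n (\<lambda>k. rounded_vertices x (skip i k))"
  unfolding round_simplex_def
  by (rule round_chain_cong)
    (simp add: rounded_vertices_def singular_face_eq_reindex[OF assms] reindex_basis_point)

lemma round_map_boundary:
  "round_map m n (chain_boundary (Suc n) c) = frag_extend (cube_boundary m) (round_map m (Suc n) c)"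
  using subset_UNIV[of "Poly_Mapping.keys c"]
proof (induction c rule: frag_induction)
  case (one x)
  have "round_map m n (chain_boundary (Suc n) (frag_of x)) =
     (\<Sum>i\<le>Suc n. frag_cmul ((-1) ^ i) (round_simplex m n (singular_face (Suc n) i x)))"
    by (simp add: chain_boundary_of frag_extend_sum frag_extend_cmul comp_def del: sum.atMost_Suc)
  also have "\<dots> = (\<Sum>i\<le>Suc n. frag_cmul ((-1) ^ i) (round_chain m m n (\<lambda>k. rounded_vertices x (skip i k))))"
    by (intro sum.cong) (auto simp: round_simplex_face)
  also have "\<dots> = frag_extend (cube_boundary m) (round_simplex m (Suc n) x)"
    unfolding round_simplex_def by (rule round_chain_boundary[OF signs_rounded_vertices order_refl])
  finally show ?case by simp
qed (auto simp: chain_boundary_diff frag_extend_diff)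

lemma round_simplex_keys:
  assumes "f \<in> Poly_Mapping.keys (round_simplex m n x)"
  shows "f \<in> {1..m} \<rightarrow>\<^sub>E {-1, 0, 1}" "card (zeros m f) = n"
    "i \<in> zeros m f \<Longrightarrow> \<exists>k<n. rounded_vertices x k i \<noteq> rounded_vertices x (Suc k) i"
    "\<lbrakk>i \<in> {1..m}; f i \<noteq> 0\<rbrakk> \<Longrightarrow> \<exists>k\<le>n. f i = rounded_vertices x k i"
  using round_chain_keys[OF signs_rounded_vertices order_refl assms[unfolded round_simplex_def]]
  by (auto simp: zeros_def)

text \<open>For simplices that are small in this sense the coordinates whose sign varies stay away from
  the endpoints, so the rounded vertices span a face of the complex.\<close>

definition small_simplex :: "nat \<Rightarrow> nat \<Rightarrow> ((nat \<Rightarrow> real) \<Rightarrow> nat \<Rightarrow> real) \<Rightarrow> bool" where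
  "small_simplex m n x \<longleftrightarrow> (\<forall>i\<in>{1..m}. \<forall>p\<in>standard_simplex n. \<forall>q\<in>standard_simplex n. \<bar>x p i - x q i\<bar> < 1)"

lemma small_simplex_reindex:
  assumes "small_simplex m n x" "\<And>k. k \<le> l \<Longrightarrow> \<theta> k \<le> n"
  shows "small_simplex m l (reindex l \<theta> x)"
  using assms(1) push_in_standard_simplex[OF assms(2)] by (auto simp: small_simplex_def reindex_def)

lemma topspace_real_moment_angle: "topspace (real_moment_angle m \<Sigma>) = real_moment_angle_set m \<Sigma>"
  by (auto simp: real_moment_angle_def real_moment_angle_set_def)

lemma singular_simplex_point:
  "\<lbrakk>singular_simplex n (real_moment_angle m \<Sigma>) x; p \<in> standard_simplex n\<rbrakk> \<Longrightarrow> x p \<in> real_moment_angle_set m \<Sigma>"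
  unfolding singular_simplex_def continuous_map_def by (auto simp: topspace_real_moment_angle)

lemma real_moment_angle_setE:
  assumes "z \<in> real_moment_angle_set m \<Sigma>"
  obtains \<sigma> where "\<sigma> \<in> \<Sigma>" "z \<in> {1..m} \<rightarrow>\<^sub>E {-1..1}" "\<And>i. \<lbrakk>i \<in> {1..m}; i \<notin> \<sigma>\<rbrakk> \<Longrightarrow> z i = -1 \<or> z i = 1"
  using assms unfolding real_moment_angle_set_def by auto

text \<open>The coordinate is nonpositive at one vertex and positive at another. Moving by less than
  1 from either keeps it strictly between \<open>-1\<close> and \<open>1\<close> at every point;
  this is the origin of the bound 1 in \<open>small_simplex\<close>.\<close>

lemma small_sign_change:
  assumes "small_simplex m n x" "i \<in> {1..m}" "k \<le> n" "l \<le> n" "rounded_vertices x k i \<noteq> rounded_vertices x l i"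
    "p \<in> standard_simplex n"
  shows "\<bar>x p i\<bar> < 1"
proof -
  have *: "\<bar>x p i - x (basis_point k) i\<bar> < 1" "\<bar>x p i - x (basis_point l) i\<bar> < 1"
    using assms basis_point_in by (auto simp: small_simplex_def)
  show ?thesis using * assms(5) by (auto simp: rounded_vertices_def split: if_splits)
qed

definition varying :: "nat \<Rightarrow> nat \<Rightarrow> ((nat \<Rightarrow> real) \<Rightarrow> nat \<Rightarrow> real) \<Rightarrow> nat set" where
  "varying m n x = {i \<in> {1..m}. \<exists>k\<le>n. \<exists>l\<le>n. rounded_vertices x k i \<noteq> rounded_vertices x l i}"

text \<open>A varying coordinate is interior to the interval everywhere, in particular at one chosen
  vertex, so it belongs to every cell containing that point. One cell thus contains all varying
  directions.\<close>

lemma varying_in_complex: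
  assumes \<Sigma>: "simplicial_complex_on m \<Sigma>" and x: "singular_simplex n (real_moment_angle m \<Sigma>) x" "small_simplex m n x"
  shows "varying m n x \<in> \<Sigma>"
proof -
  let ?p = "basis_point 0"
  have p: "?p \<in> standard_simplex n" by (rule basis_point_in) simp
  obtain \<sigma> where \<sigma>: "\<sigma> \<in> \<Sigma>" "\<And>i. \<lbrakk>i \<in> {1..m}; i \<notin> \<sigma>\<rbrakk> \<Longrightarrow> x ?p i = -1 \<or> x ?p i = 1"
    using real_moment_angle_setE[OF singular_simplex_point[OF x(1) p]] by metis
  have "varying m n x \<subseteq> \<sigma>"
  proof
    fix i assume "i \<in> varying m n x"
    then have "i \<in> {1..m}" "\<bar>x ?p i\<bar> < 1" using small_sign_change[OF x(2) _ _ _ _ p] by (auto simp: varying_def)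
    then show "i \<in> \<sigma>" using \<sigma>(2)[of i] by (cases "i \<in> \<sigma>") (auto simp del: atLeastAtMost_iff)
  qed
  then show ?thesis using \<Sigma> \<sigma>(1) by (auto simp: simplicial_complex_on_def)
qed

lemma zeros_round_subset_varying:
  "f \<in> Poly_Mapping.keys (round_simplex m n x) \<Longrightarrow> zeros m f \<subseteq> varying m n x"
  using round_simplex_keys(3)[of f m n x] zeros_subset[of m f] unfolding varying_def
  by (auto, metis Suc_leI less_imp_le_nat)

lemma cube_chain_on_round:
  assumes \<Sigma>: "simplicial_complex_on m \<Sigma>" and x: "singular_simplex n (real_moment_angle m \<Sigma>) x" "small_simplex m n x"
  shows "cube_chain_on n m \<Sigma> (round_simplex m n x)"
  unfolding cube_chain_on_def
proof
  fix f assume f: "f \<in> Poly_Mapping.keys (round_simplex m n x)"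
  have "zeros m f \<in> \<Sigma>"
    using zeros_round_subset_varying[OF f] varying_in_complex[OF \<Sigma> x] \<Sigma> by (auto simp: simplicial_complex_on_def)
  then show "f \<in> {f \<in> cube_faces m \<Sigma>. card (zeros m f) = n}"
    using round_simplex_keys(1,2)[OF f] by (auto simp: cube_faces_def)
qed

lemma small_subdivision:
  assumes c: "singular_chain n (real_moment_angle m \<Sigma>) c"
  obtains N where "\<And>x. x \<in> Poly_Mapping.keys ((singular_subdivision n ^^ N) c) \<Longrightarrow> small_simplex m n x"
proof -
  let ?X = "real_moment_angle m \<Sigma>"
  let ?C = "{U. openin ?X U \<and> (\<forall>i\<in>{1..m}. \<forall>p\<in>U. \<forall>q\<in>U. \<bar>p i - q i\<bar> < 1)}"
  have cover: "topspace ?X \<subseteq> \<Union>?C"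
  proof
    fix z assume z: "z \<in> topspace ?X"
    \<comment> \<open>Half-width \<open>1/2\<close> makes any two points of the box differ by less
      than 1 in each coordinate.\<close>
    let ?U = "{w \<in> topspace ?X. \<forall>i\<in>{1..m}. w i \<in> {z i - 1/2<..<z i + 1/2}}"
    have "openin ?X {w \<in> topspace ?X. w i \<in> {z i - 1/2<..<z i + 1/2}}" if "i \<in> {1..m}" for i
    proof (rule openin_continuous_map_preimage)
      show "continuous_map ?X euclideanreal (\<lambda>w. w i)"
        unfolding real_moment_angle_def using that
        by (intro continuous_map_from_subtopology continuous_map_product_projection)
    qed simp
    moreover have "?U = (\<Inter>i\<in>{1..m}. {w \<in> topspace ?X. w i \<in> {z i - 1/2<..<z i + 1/2}}) \<inter> topspace ?X" by auto
    ultimately have "openin ?X ?U"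
      by (cases "m = 0") (auto intro!: openin_Int openin_INT)
    moreover have "\<bar>p i - q i\<bar> < 1" if "i \<in> {1..m}" "p \<in> ?U" "q \<in> ?U" for i p q
    proof -
      have "p i \<in> {z i - 1/2<..<z i + 1/2}" "q i \<in> {z i - 1/2<..<z i + 1/2}" using that by blast+
      then show ?thesis by (auto simp: abs_if)
    qed
    ultimately have "?U \<in> ?C" by blast
    moreover have "z \<in> ?U" using z by simp
    ultimately show "z \<in> \<Union>?C" by blast
  qed
  have op: "openin ?X U" if "U \<in> ?C" for U using that by blast
  obtain N where N: "\<And>k f. \<lbrakk>N \<le> k; f \<in> Poly_Mapping.keys ((singular_subdivision n ^^ k) c)\<rbrakk>
                      \<Longrightarrow> \<exists>V \<in> ?C. f \<in> standard_simplex n \<rightarrow> V"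
    using sufficient_iterated_singular_subdivision_exists[OF op cover c] by blast
  show thesis
  proof (rule that[of N])
    fix x assume "x \<in> Poly_Mapping.keys ((singular_subdivision n ^^ N) c)"
    from N[OF order_refl this] obtain V where "V \<in> ?C" "x \<in> standard_simplex n \<rightarrow> V" by (rule bexE)
    then show "small_simplex m n x" unfolding small_simplex_def by blast
  qed
qed

lemma singular_subdivision_power_chain:
  "singular_chain n X c \<Longrightarrow> singular_chain n X ((singular_subdivision n ^^ N) c)"
  by (induction N) (auto simp: singular_chain_singular_subdivision)

lemma chain_boundary_subdivision_power:
  assumes "singular_chain (Suc n) X c"
  shows "chain_boundary (Suc n) ((singular_subdivision (Suc n) ^^ N) c) = (singular_subdivision n ^^ N) (chain_boundary (Suc n) c)"
  using singular_subdivision_power_chain[OF assms] chain_boundary_singular_subdivision[of "Suc n" X]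
  by (induction N) auto

lemma subdivision_power_zero: "singular_chain 0 X c \<Longrightarrow> (singular_subdivision 0 ^^ N) c = c"
  by (induction N) (auto simp: singular_subdivision_zero)

definition closed_face :: "nat \<Rightarrow> (nat \<Rightarrow> real) \<Rightarrow> (nat \<Rightarrow> real) set" where
  "closed_face m f = {z \<in> {1..m} \<rightarrow>\<^sub>E {-1..1}. \<forall>i\<in>{1..m}. f i \<noteq> 0 \<longrightarrow> z i = f i}"

lemma cube_chain_in_closed_face:
  assumes f: "f \<in> {1..m} \<rightarrow>\<^sub>E {-1, 0, 1}"
  shows "singular_chain (card (zeros m f)) (subtopology (powertop_real {1..m}) (closed_face m f)) (cube_chain m f)"
proof -
  have "singular_simplex (length l) (subtopology (powertop_real {1..m}) (closed_face m f)) (path_simplex m f l)"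
    if l: "l \<in> permutations_of_set (zeros m f)" for l
    unfolding path_simplex_def
  proof (rule singular_simplex_affine)
    fix t assume "t \<in> standard_simplex (length l)"
    from path_point_in[OF f permutations_of_setD(1)[OF l] this]
    show "(\<lambda>i\<in>{1..m}. \<Sum>k\<le>length l. path_vertex f l k i * t k) \<in> closed_face m f"
      by (auto simp: closed_face_def)
  qed
  then show ?thesis
    unfolding cube_chain_def
    by (intro singular_chain_sum singular_chain_cmul) (simp add: singular_chain_of length_permutations_zeros)
qed

lemma frag_single_key:
  assumes "Poly_Mapping.keys c \<subseteq> {f}"
  shows "c = frag_cmul (Poly_Mapping.lookup c f) (frag_of f)"
proof (rule poly_mapping_eqI)
  fix g show "Poly_Mapping.lookup c g = Poly_Mapping.lookup (frag_cmul (Poly_Mapping.lookup c f) (frag_of f)) g"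
    using assms by (cases "g = f") (auto simp: in_keys_iff)
qed

text \<open>The upper end in a free direction occurs exactly once, with coefficient 1 or -1.\<close>

lemma cube_boundary_nonzero:
  assumes "zeros m f \<noteq> {}"
  shows "cube_boundary m f \<noteq> 0"
proof -
  obtain a where a: "a \<in> zeros m f" using assms by blast
  have ne: "fix_coords {b} x f = fix_coords {a} 1 f \<longleftrightarrow> b = a \<and> x = 1" if "b \<in> zeros m f" "x \<noteq> 0" for b x
  proof
    assume e: "fix_coords {b} x f = fix_coords {a} 1 f"
    from fun_cong[OF e, of b] fun_cong[OF e, of a] show "b = a \<and> x = 1"
      using that a by (auto simp: fix_coords_def zeros_def split: if_splits)
  qed simp
  have "Poly_Mapping.lookup (cube_boundary m f) (fix_coords {a} 1 f) =
     (\<Sum>b\<in>zeros m f. if b = a then (-1) ^ card {c \<in> zeros m f. c < a} else 0)"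
    unfolding cube_boundary_def lookup_sum
  proof (intro sum.cong refl)
    fix b assume b: "b \<in> zeros m f"
    show "Poly_Mapping.lookup (frag_cmul ((-1) ^ card {c \<in> zeros m f. c < b}) (frag_of (fix_coords {b} 1 f) - frag_of (fix_coords {b} (-1) f))) (fix_coords {a} 1 f)
      = (if b = a then (-1) ^ card {c \<in> zeros m f. c < a} else 0)"
      using ne[OF b, of 1] ne[OF b, of "-1"] by (auto simp: lookup_minus)
  qed
  also have "\<dots> \<noteq> 0" using a by simp
  finally show ?thesis by auto
qed

text \<open>Subdivision stays inside the closed face, so for dimension reasons the rounding is some
  multiple of \<open>f\<close>. Rounding and subdivision are chain maps, so by induction this
  multiple has the boundary of \<open>f\<close>; as that boundary is nonzero and the group is
  torsion-free, the multiple is 1.\<close>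

lemma round_subdivision_cube_chain:
  assumes "f \<in> {1..m} \<rightarrow>\<^sub>E {-1, 0, 1}" "card (zeros m f) = n"
  shows "round_map m n ((singular_subdivision n ^^ N) (cube_chain m f)) = frag_of f"
  using assms
proof (induction n arbitrary: f)
  case 0
  then have z: "zeros m f = {}" by simp
  then have c: "cube_chain m f = frag_of (path_simplex m f [])" by (simp add: cube_chain_def)
  have sd: "(singular_subdivision 0 ^^ N) (cube_chain m f) = cube_chain m f"
    using cube_chain_in_closed_face[OF 0(1)] 0(2) by (intro subdivision_power_zero) simp
  have v: "rounded_vertices (path_simplex m f []) 0 i = f i" if "i \<in> {1..m}" for i
  proof -
    have "path_simplex m f [] (basis_point 0) i = f i"
      using affine_simplex_basis_point[of 0 0 i m "path_vertex f []"] that by (simp add: path_simplex_def path_vertex_def)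
    moreover have "f i = 1 \<or> f i = -1" using 0(1) z that by (auto simp: zeros_def PiE_iff)
    ultimately show ?thesis by (auto simp: rounded_vertices_def)
  qed
  have "round_chain m j 0 V = frag_of (\<lambda>i\<in>{1..m}. if i \<le> j then V 0 i else 1)" if "j \<le> m" for j V
    using that by (induction j) (auto simp: set_coord_simps fun_eq_iff restrict_def le_Suc_eq intro!: arg_cong[where f = frag_of])
  from this[OF order_refl]
  have "round_simplex m 0 (path_simplex m f []) = frag_of (\<lambda>i\<in>{1..m}. f i)"
    unfolding round_simplex_def using v by (simp cong: restrict_cong)
  moreover have "(\<lambda>i\<in>{1..m}. f i) = f" using 0(1) by (simp add: PiE_iff extensional_restrict)
  ultimately show ?case by (simp only: sd) (simp add: c)
next
  case (Suc n)
  let ?X = "subtopology (powertop_real {1..m}) (closed_face m f)"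
  have ch: "singular_chain (Suc n) ?X (cube_chain m f)" using cube_chain_in_closed_face[OF Suc.prems(1)] Suc.prems(2) by simp
  let ?r = "round_map m (Suc n) ((singular_subdivision (Suc n) ^^ N) (cube_chain m f))"
  have keys: "g = f" if y: "y \<in> Poly_Mapping.keys ((singular_subdivision (Suc n) ^^ N) (cube_chain m f))"
    and g: "g \<in> Poly_Mapping.keys (round_simplex m (Suc n) y)" for y g
  proof -
    have "singular_simplex (Suc n) ?X y"
      using singular_subdivision_power_chain[OF ch, of N] y by (auto simp: singular_chain_def)
    then have yp: "y (basis_point k) \<in> closed_face m f" if "k \<le> Suc n" for k
      using basis_point_in[OF that] by (auto simp: singular_simplex_subtopology)
    have r: "rounded_vertices y k i = f i" if "k \<le> Suc n" "i \<in> {1..m}" "f i \<noteq> 0" for k i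
    proof -
      have "y (basis_point k) i = f i" using yp[OF that(1)] that by (auto simp: closed_face_def)
      moreover have "f i = 1 \<or> f i = -1" using Suc.prems(1) that by (auto simp: PiE_iff)
      ultimately show ?thesis by (auto simp: rounded_vertices_def)
    qed
    have sub: "zeros m g \<subseteq> zeros m f"
    proof
      fix i assume i: "i \<in> zeros m g"
      then obtain k where k: "k < Suc n" "rounded_vertices y k i \<noteq> rounded_vertices y (Suc k) i"
        using round_simplex_keys(3)[OF g] by blast
      have "i \<in> {1..m}" using i by (simp add: zeros_def)
      then have "f i = 0" using r[of k i] r[of "Suc k" i] k by fastforce
      then show "i \<in> zeros m f" using \<open>i \<in> {1..m}\<close> by (simp add: zeros_def)
    qed
    then have zz: "zeros m g = zeros m f"
      using round_simplex_keys(2)[OF g] Suc.prems(2) by (intro card_subset_eq) auto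
    have "g i = f i" if i: "i \<in> {1..m}" for i
    proof (cases "f i = 0")
      case True
      then have "i \<in> zeros m g" using zz i by (simp add: zeros_def)
      then show ?thesis using True by (simp add: zeros_def)
    next
      case False
      then have "g i \<noteq> 0" using zz i by (auto simp: zeros_def)
      then obtain k where "k \<le> Suc n" "g i = rounded_vertices y k i" using round_simplex_keys(4)[OF g i] by blast
      then show ?thesis using r[OF _ i False] by simp
    qed
    then show "g = f" using round_simplex_keys(1)[OF g] Suc.prems(1) by (metis PiE_ext)
  qed
  have "Poly_Mapping.keys ?r \<subseteq> {f}"
    using keys_frag_extend[of "round_simplex m (Suc n)" "(singular_subdivision (Suc n) ^^ N) (cube_chain m f)"] keys by blast
  from frag_single_key[OF this] obtain a where a: "?r = frag_cmul a (frag_of f)" by blast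
  have "frag_extend (cube_boundary m) ?r = round_map m n ((singular_subdivision n ^^ N) (chain_boundary (Suc n) (cube_chain m f)))"
    unfolding round_map_boundary[symmetric] chain_boundary_subdivision_power[OF ch] ..
  also have "chain_boundary (Suc n) (cube_chain m f) = frag_extend (cube_chain m) (cube_boundary m f)"
    using chain_boundary_cube_chain[of m f] Suc.prems(2) by simp
  also have "round_map m n ((singular_subdivision n ^^ N) (frag_extend (cube_chain m) (cube_boundary m f))) = cube_boundary m f"
  proof -
    have sd: "(singular_subdivision n ^^ N) (u - v) = (singular_subdivision n ^^ N) u - (singular_subdivision n ^^ N) v" for u v :: "(nat \<Rightarrow> real) chain"
      by (rule singular_subdivision_power_diff)
    have "Poly_Mapping.keys (cube_boundary m f) \<subseteq> {g \<in> {1..m} \<rightarrow>\<^sub>E {-1, 0, 1}. card (zeros m g) = n}"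
    proof -
      have "simplicial_complex_on m (Pow {1..m})" by (auto simp: simplicial_complex_on_def)
      moreover have "f \<in> cube_faces m (Pow {1..m})" using Suc.prems(1) zeros_subset by (auto simp: cube_faces_def)
      ultimately show ?thesis
        using cube_chain_on_boundary[OF _ _ Suc.prems(2)] by (fastforce simp: cube_chain_on_def cube_faces_def)
    qed
    moreover have "round_map m n ((singular_subdivision n ^^ N) (frag_extend (cube_chain m) c)) = c"
      if "Poly_Mapping.keys c \<subseteq> {g \<in> {1..m} \<rightarrow>\<^sub>E {-1, 0, 1}. card (zeros m g) = n}" for c
      using that by (induction c rule: frag_induction) (auto simp: frag_extend_diff sd Suc.IH)
    ultimately show ?thesis by blast
  qed
  finally have "frag_cmul a (cube_boundary m f) = frag_cmul 1 (cube_boundary m f)"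
    unfolding a by (simp add: frag_extend_cmul)
  then have "frag_cmul (a - 1) (cube_boundary m f) = 0" by (simp add: frag_cmul_diff_distrib)
  moreover have "zeros m f \<noteq> {}" using Suc.prems(2) by auto
  ultimately have "a = 1" using cube_boundary_nonzero by auto
  then show ?case using a by simp
qed

section \<open>Acyclic carriers\<close>

lemma frag_extend_const: "frag_extend (\<lambda>x. y) c = frag_cmul (frag_eval (\<lambda>x. 1) c) y"
proof -
  have "frag_cmul (sum F I) y = (\<Sum>x\<in>I. frag_cmul (F x) y)" for F and I :: "'b set"
    by (induction I rule: infinite_finite_induct) (auto simp: frag_cmul_distrib)
  then show ?thesis by (simp add: frag_extend_def frag_eval_def)
qed

text \<open>The cycle is homologous to its image under the constant map. That image vanishes in
  degree 0, being the augmentation times a point, and bounds in positive degrees because a one-point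
  space has no homology there.\<close>

lemma contractible_acyclic:
  assumes h: "homotopic_with (\<lambda>_. True) Y Y id (\<lambda>_. a)" and a: "a \<in> topspace Y"
    and c: "singular_chain n Y c" "chain_boundary n c = 0" and n0: "n = 0 \<Longrightarrow> frag_eval (\<lambda>x. 1) c = 0"
  shows "\<exists>b. singular_chain (Suc n) Y b \<and> chain_boundary (Suc n) b = c"
proof -
  let ?d = "chain_map n (\<lambda>_. a) c"
  have cyc: "singular_relcycle n Y {} c" using c by (simp add: singular_cycle)
  have "homotopic_with (\<lambda>h. h \<in> {} \<rightarrow> {}) Y Y id (\<lambda>_. a)" using h by simp
  from homotopic_imp_homologous_rel_chain_maps[OF this cyc]
  have "singular_relboundary n Y {} (c - ?d)"
    using chain_map_ident[OF c(1)] by (simp add: homologous_rel_def)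
  moreover have "singular_relboundary n Y {} ?d"
  proof (cases "n = 0")
    case True
    have "?d = frag_extend (\<lambda>x. frag_of (restrict (\<lambda>_. a) (standard_simplex n))) c"
      unfolding chain_map_def by (rule frag_extend_eq) (simp add: simplex_map_def comp_def)
    then have "?d = 0" using n0[OF True] by (simp add: frag_extend_const)
    then show ?thesis by simp
  next
    case False
    have t: "topspace (subtopology Y {a}) = {a}" using a by auto
    have "continuous_map Y (subtopology Y {a}) (\<lambda>_. a)" using a by (simp add: continuous_map_in_subtopology)
    then have "singular_relcycle n (subtopology Y {a}) {} ?d"
      by (rule singular_relcycle_chain_map[OF cyc]) simp
    then have "singular_relboundary n (subtopology Y {a}) {} ?d"
      using singular_boundary_eq_cycle_singleton[OF t, of n] False by simp
    then have "singular_relboundary n (subtopology Y (topspace Y)) {} ?d"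
      by (rule singular_boundary_mono[rotated]) (use a in auto)
    then show ?thesis by simp
  qed
  ultimately have "singular_relboundary n Y {} ((c - ?d) + ?d)" by (rule singular_relboundary_add)
  then show ?thesis by (simp add: singular_boundary)
qed

section \<open>Contractible carriers of small simplices\<close>

lemma straight_line_homotopy:
  assumes f: "continuous_map (subtopology (powertop_real {1..m}) S) (powertop_real {1..m}) f"
    and g: "continuous_map (subtopology (powertop_real {1..m}) S) (powertop_real {1..m}) g"
    and S: "S \<subseteq> extensional {1..m}"
    and line: "\<And>z t. \<lbrakk>z \<in> S; 0 \<le> t; t \<le> 1\<rbrakk> \<Longrightarrow> (\<lambda>i\<in>{1..m}. (1 - t) * f z i + t * g z i) \<in> S"
  shows "homotopic_with (\<lambda>_. True) (subtopology (powertop_real {1..m}) S) (subtopology (powertop_real {1..m}) S) f g"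
proof -
  let ?P = "powertop_real {1..m}"
  let ?Y = "subtopology ?P S"
  let ?h = "\<lambda>(t :: real, z). \<lambda>i\<in>{1..m}. (1 - t) * f z i + t * g z i"
  have top: "topspace ?Y = S" using S by (auto simp: PiE_def)
  have coord: "continuous_map (prod_topology (top_of_set {0..1::real}) ?Y) euclideanreal (\<lambda>p. k (snd p) i)"
    if "continuous_map ?Y ?P k" "i \<in> {1..m}" for k i
  proof -
    have "continuous_map ?Y euclideanreal (\<lambda>z. k z i)"
      using that by (auto simp: continuous_map_componentwise)
    then show ?thesis
      using continuous_map_compose[OF continuous_map_snd, of ?Y euclideanreal "\<lambda>z. k z i" "top_of_set {0..1::real}"]
      by (simp add: comp_def)
  qed
  have time: "continuous_map (prod_topology (top_of_set {0..1::real}) ?Y) euclideanreal (\<lambda>p. fst p)"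
    using continuous_map_compose[OF continuous_map_fst, of "top_of_set {0..1::real}" euclideanreal id ?Y]
    by (simp add: comp_def continuous_map_from_subtopology)
  have "continuous_map (prod_topology (top_of_set {0..1::real}) ?Y) euclideanreal (\<lambda>p. (1 - fst p) * f (snd p) i + fst p * g (snd p) i)"
    if "i \<in> {1..m}" for i
    using time coord[OF f that] coord[OF g that] by (intro continuous_intros) auto
  then have "continuous_map (prod_topology (top_of_set {0..1::real}) ?Y) ?P ?h"
    by (auto simp: continuous_map_componentwise case_prod_unfold)
  then have cont: "continuous_map (prod_topology (top_of_set {0..1::real}) ?Y) ?Y ?h"
    unfolding continuous_map_in_subtopology using line top by auto
  have e: "f z \<in> extensional {1..m}" "g z \<in> extensional {1..m}" if "z \<in> S" for z
    using f g that top unfolding continuous_map_def by (auto simp: PiE_def Pi_def)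
  have "\<exists>h. continuous_map (prod_topology (top_of_set {0..1::real}) ?Y) ?Y h \<and>
     (\<forall>x\<in>topspace ?Y. h (0, x) = f x) \<and> (\<forall>x\<in>topspace ?Y. h (1, x) = g x) \<and> (\<forall>t\<in>{0..1::real}. True)"
    using cont e by (intro exI[of _ ?h]) (auto simp: top extensional_restrict)
  then show ?thesis by (subst homotopic_with) auto
qed

text \<open>With \<open>T\<close> the varying coordinates and \<open>w\<close> a rounded vertex this
  is the carrier of a small simplex. Excluding only the end opposite to \<open>w\<close> leaves room
  for the simplex and its rounding, is monotone in faces, and still permits a contraction to
  \<open>w\<close>.\<close>

definition star_set :: "nat \<Rightarrow> nat set set \<Rightarrow> nat set \<Rightarrow> (nat \<Rightarrow> real) \<Rightarrow> (nat \<Rightarrow> real) set" where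
  "star_set m \<Sigma> T w = {z \<in> real_moment_angle_set m \<Sigma>. \<forall>i\<in>{1..m}. i \<notin> T \<longrightarrow> z i \<noteq> - w i}"

text \<open>A star is contracted in two stages: first the coordinates outside \<open>T\<close> are moved to those
  of \<open>w\<close>, which does not leave any cell, and then the remaining ones inside the cell \<open>T\<close>.\<close>

lemma star_set_contractible:
  assumes \<Sigma>: "simplicial_complex_on m \<Sigma>" and T: "T \<in> \<Sigma>" and w: "\<And>i. i \<in> {1..m} \<Longrightarrow> w i = 1 \<or> w i = -1"
  shows "homotopic_with (\<lambda>_. True) (subtopology (powertop_real {1..m}) (star_set m \<Sigma> T w))
      (subtopology (powertop_real {1..m}) (star_set m \<Sigma> T w)) id (\<lambda>_. restrict w {1..m})"
    and "restrict w {1..m} \<in> star_set m \<Sigma> T w"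
proof -
  let ?S = "star_set m \<Sigma> T w" and ?P = "powertop_real {1..m}"
  let ?Y = "subtopology ?P ?S" and ?w = "restrict w {1..m}"
  let ?p = "\<lambda>z. \<lambda>i\<in>{1..m}. if i \<in> T then z i else w i"
  have SE: "?S \<subseteq> extensional {1..m}"
    unfolding star_set_def real_moment_angle_set_def by (auto simp: PiE_def)
  have proj: "continuous_map ?Y euclideanreal (\<lambda>z. z i)" if "i \<in> {1..m}" for i
    using that by (intro continuous_map_from_subtopology continuous_map_product_projection)
  have "continuous_map ?Y euclideanreal (\<lambda>z. if i \<in> T then z i else w i)" if "i \<in> {1..m}" for i
    using proj[OF that] by (cases "i \<in> T") auto
  then have cp: "continuous_map ?Y ?P ?p"
    by (auto simp: continuous_map_componentwise)
  have cid: "continuous_map ?Y ?P id"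
    by (simp add: continuous_map_from_subtopology)
  have cw: "continuous_map ?Y ?P (\<lambda>_. ?w)" by simp
  have cell: "z \<in> ?S" if "\<sigma> \<in> \<Sigma>" "z \<in> {1..m} \<rightarrow>\<^sub>E {-1..1}" "\<And>i. \<lbrakk>i \<in> {1..m}; i \<notin> \<sigma>\<rbrakk> \<Longrightarrow> z i = -1 \<or> z i = 1"
    "\<And>i. \<lbrakk>i \<in> {1..m}; i \<notin> T\<rbrakk> \<Longrightarrow> z i \<noteq> - w i" for z \<sigma>
  proof -
    have "z i \<in> {-1, 1}" if "i \<in> {1..m}" "i \<notin> \<sigma>" for i
      unfolding insert_iff using \<open>\<And>i. \<lbrakk>i \<in> {1..m}; i \<notin> \<sigma>\<rbrakk> \<Longrightarrow> z i = -1 \<or> z i = 1\<close>[OF that] by blast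
    then have "z \<in> real_moment_angle_set m \<Sigma>"
      unfolding real_moment_angle_set_def using that(1,2) by blast
    then show ?thesis
      unfolding star_set_def using that(4) by blast
  qed
  have wS: "?w \<in> ?S"
  proof (rule cell[OF T])
    show "?w \<in> {1..m} \<rightarrow>\<^sub>E {-1..1}" using w by fastforce
    show "?w i = -1 \<or> ?w i = 1" if "i \<in> {1..m}" for i using w[OF that] that by auto
    show "?w i \<noteq> - w i" if "i \<in> {1..m}" for i using w[OF that] that by auto
  qed
  then show "?w \<in> ?S" .
  have conv: "(1 - t) * a + t * b \<in> {-1..1}" if "a \<in> {-1..1}" "b \<in> {-1..1}" "0 \<le> t" "t \<le> 1" for a b t :: real
  proof -
    have "convex {-1..1::real}" by (rule convex_real_interval)
    from convexD[OF this that(1,2), of "1 - t" t] that(3,4) show ?thesis by simp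
  qed
  have "homotopic_with (\<lambda>_. True) ?Y ?Y id ?p"
  proof (rule straight_line_homotopy[OF cid cp SE])
    fix z and t :: real assume z: "z \<in> ?S" and t: "0 \<le> t" "t \<le> 1"
    then have zz: "z \<in> real_moment_angle_set m \<Sigma>" "\<And>i. \<lbrakk>i \<in> {1..m}; i \<notin> T\<rbrakk> \<Longrightarrow> z i \<noteq> - w i" by (auto simp: star_set_def)
    obtain \<sigma> where \<sigma>: "\<sigma> \<in> \<Sigma>" "z \<in> {1..m} \<rightarrow>\<^sub>E {-1..1}" "\<And>i. \<lbrakk>i \<in> {1..m}; i \<notin> \<sigma>\<rbrakk> \<Longrightarrow> z i = -1 \<or> z i = 1"
      using real_moment_angle_setE[OF zz(1)] by metis
    have zi: "z i \<in> {-1..1}" if "i \<in> {1..m}" for i using \<sigma>(2) that by auto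
    have wi: "w i \<in> {-1..1}" if "i \<in> {1..m}" for i using w[OF that] by auto
    show "(\<lambda>i\<in>{1..m}. (1 - t) * id z i + t * ?p z i) \<in> ?S"
    proof (rule cell[OF \<sigma>(1)])
      have "(1 - t) * z i + t * (if i \<in> T then z i else w i) \<in> {-1..1}" if "i \<in> {1..m}" for i
        using conv[OF zi[OF that] _ t] zi[OF that] wi[OF that] by auto
      then show "(\<lambda>i\<in>{1..m}. (1 - t) * id z i + t * ?p z i) \<in> {1..m} \<rightarrow>\<^sub>E {-1..1}" by auto
      fix i assume i: "i \<in> {1..m}"
      show "(\<lambda>i\<in>{1..m}. (1 - t) * id z i + t * ?p z i) i = -1 \<or> (\<lambda>i\<in>{1..m}. (1 - t) * id z i + t * ?p z i) i = 1" if "i \<notin> \<sigma>"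
      proof -
        \<comment> \<open>Outside \<open>\<sigma>\<close> the coordinate is an end of the interval;
          outside \<open>T\<close> it is not the end opposite to \<open>w\<close>. It therefore
          already agrees with its target and does not move.\<close>
        have "(if i \<in> T then z i else w i) = z i" using \<sigma>(3)[OF i that] zz(2)[OF i] w[OF i] by auto
        then have "(1 - t) * z i + t * (if i \<in> T then z i else w i) = z i" by (simp add: algebra_simps)
        then show ?thesis using \<sigma>(3)[OF i that] i by simp
      qed
      show "(\<lambda>i\<in>{1..m}. (1 - t) * id z i + t * ?p z i) i \<noteq> - w i" if "i \<notin> T"
      proof -
        have "\<bar>(1 - t) * (z i - w i)\<bar> < 2"
        proof -
          have "\<bar>z i - w i\<bar> < 2" using zz(2)[OF i that] zi[OF i] w[OF i] by auto
          moreover have "\<bar>(1 - t) * (z i - w i)\<bar> \<le> 1 * \<bar>z i - w i\<bar>"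
            unfolding abs_mult using t by (intro mult_right_mono) auto
          ultimately show ?thesis by simp
        qed
        moreover have "(1 - t) * z i + t * w i = w i + (1 - t) * (z i - w i)" by (simp add: algebra_simps)
        ultimately have "(1 - t) * z i + t * w i \<noteq> - w i" using w[OF i] by linarith
        then show ?thesis using i that by simp
      qed
    qed
  qed
  moreover have "homotopic_with (\<lambda>_. True) ?Y ?Y ?p (\<lambda>_. ?w)"
  proof (rule straight_line_homotopy[OF cp cw SE])
    fix z and t :: real assume z: "z \<in> ?S" and t: "0 \<le> t" "t \<le> 1"
    then have "z \<in> real_moment_angle_set m \<Sigma>" by (auto simp: star_set_def)
    then have zi: "z i \<in> {-1..1}" if "i \<in> {1..m}" for i
      using that by (auto elim!: real_moment_angle_setE)
    have wi: "w i \<in> {-1..1}" if "i \<in> {1..m}" for i using w[OF that] by auto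
    have off: "(1 - t) * w i + t * w i = w i" for i by (simp add: algebra_simps)
    show "(\<lambda>i\<in>{1..m}. (1 - t) * ?p z i + t * ?w i) \<in> ?S"
    proof (rule cell[OF T])
      have "(1 - t) * (if i \<in> T then z i else w i) + t * w i \<in> {-1..1}" if "i \<in> {1..m}" for i
        using conv[OF _ wi[OF that] t] zi[OF that] wi[OF that] by auto
      then show "(\<lambda>i\<in>{1..m}. (1 - t) * ?p z i + t * ?w i) \<in> {1..m} \<rightarrow>\<^sub>E {-1..1}" by auto
      fix i assume i: "i \<in> {1..m}" "i \<notin> T"
      have "(\<lambda>i\<in>{1..m}. (1 - t) * ?p z i + t * ?w i) i = w i" using i off by simp
      then show "(\<lambda>i\<in>{1..m}. (1 - t) * ?p z i + t * ?w i) i = -1 \<or> (\<lambda>i\<in>{1..m}. (1 - t) * ?p z i + t * ?w i) i = 1"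
        "(\<lambda>i\<in>{1..m}. (1 - t) * ?p z i + t * ?w i) i \<noteq> - w i"
        using w[OF i(1)] by auto
    qed
  qed
  ultimately show "homotopic_with (\<lambda>_. True) ?Y ?Y id (\<lambda>_. ?w)"
    by (rule homotopic_with_trans)
qed

definition carrier_space :: "nat \<Rightarrow> nat set set \<Rightarrow> nat \<Rightarrow> ((nat \<Rightarrow> real) \<Rightarrow> nat \<Rightarrow> real) \<Rightarrow> (nat \<Rightarrow> real) topology" where
  "carrier_space m \<Sigma> n x =
     subtopology (powertop_real {1..m}) (star_set m \<Sigma> (varying m n x) (rounded_vertices x 0))"

lemma carrier_space_acyclic:
  assumes \<Sigma>: "simplicial_complex_on m \<Sigma>" and x: "singular_simplex n (real_moment_angle m \<Sigma>) x" "small_simplex m n x"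
    and c: "singular_chain k (carrier_space m \<Sigma> n x) c" "chain_boundary k c = 0" "k = 0 \<Longrightarrow> frag_eval (\<lambda>x. 1) c = 0"
  shows "\<exists>b. singular_chain (Suc k) (carrier_space m \<Sigma> n x) b \<and> chain_boundary (Suc k) b = c"
proof -
  have w: "rounded_vertices x 0 i = 1 \<or> rounded_vertices x 0 i = -1" for i
    using signs_rounded_vertices by (simp add: signs_def)
  note s = star_set_contractible[OF \<Sigma> varying_in_complex[OF \<Sigma> x], of "rounded_vertices x 0", OF w]
  have "restrict (rounded_vertices x 0) {1..m} \<in> topspace (carrier_space m \<Sigma> n x)"
    unfolding carrier_space_def using s(2) by auto
  then show ?thesis
    by (rule contractible_acyclic[OF s(1)[folded carrier_space_def] _ c])
qed

lemma not_varying: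
  "\<lbrakk>i \<in> {1..m}; i \<notin> varying m n x; k \<le> n\<rbrakk> \<Longrightarrow> rounded_vertices x k i = rounded_vertices x 0 i"
  unfolding varying_def by blast

text \<open>A face has fewer varying coordinates, and where the whole simplex does not vary both
  have the same rounded vertices. The conditions defining the larger carrier are thus among those of
  the smaller one.\<close>

lemma carrier_space_face:
  assumes "i \<le> Suc n" "singular_chain k (carrier_space m \<Sigma> n (singular_face (Suc n) i x)) c"
  shows "singular_chain k (carrier_space m \<Sigma> (Suc n) x) c"
proof -
  let ?y = "singular_face (Suc n) i x"
  have r: "rounded_vertices ?y k = rounded_vertices x (skip i k)" if "k \<le> n" for k
    using that assms(1) by (simp add: rounded_vertices_def singular_face_eq_reindex[OF assms(1)] reindex_basis_point)
  have skip: "skip i k \<le> Suc n" if "k \<le> n" for k using that by (simp add: skip_def)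
  have sub: "varying m n ?y \<subseteq> varying m (Suc n) x"
  proof
    fix j assume "j \<in> varying m n ?y"
    then have j: "j \<in> {1..m}" and "\<exists>k\<le>n. \<exists>l\<le>n. rounded_vertices ?y k j \<noteq> rounded_vertices ?y l j"
      unfolding varying_def by simp_all
    then obtain k l where kl: "k \<le> n" "l \<le> n" "rounded_vertices ?y k j \<noteq> rounded_vertices ?y l j"
      by (elim exE conjE)
    have "rounded_vertices x (skip i k) j \<noteq> rounded_vertices x (skip i l) j"
      using kl(3) unfolding r[OF kl(1)] r[OF kl(2)] .
    then show "j \<in> varying m (Suc n) x"
      unfolding varying_def using j skip[OF kl(1)] skip[OF kl(2)] by blast
  qed
  have base: "rounded_vertices ?y 0 j = rounded_vertices x 0 j" if "j \<in> {1..m}" "j \<notin> varying m (Suc n) x" for j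
    unfolding r[OF le0] by (rule not_varying[OF that skip[OF le0]])
  have "z \<in> star_set m \<Sigma> (varying m (Suc n) x) (rounded_vertices x 0)"
    if "z \<in> star_set m \<Sigma> (varying m n ?y) (rounded_vertices ?y 0)" for z
  proof -
    have z: "z \<in> real_moment_angle_set m \<Sigma>" "\<forall>j\<in>{1..m}. j \<notin> varying m n ?y \<longrightarrow> z j \<noteq> - rounded_vertices ?y 0 j"
      using that unfolding star_set_def mem_Collect_eq by (rule conjunct1, rule conjunct2)
    have "z j \<noteq> - rounded_vertices x 0 j" if j: "j \<in> {1..m}" "j \<notin> varying m (Suc n) x" for j
    proof -
      have "z j \<noteq> - rounded_vertices ?y 0 j" using z(2) j contra_subsetD[OF sub j(2)] by blast
      then show ?thesis unfolding base[OF j] .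
    qed
    then show ?thesis unfolding star_set_def mem_Collect_eq using z(1) by blast
  qed
  then have "star_set m \<Sigma> (varying m n ?y) (rounded_vertices ?y 0) \<subseteq> star_set m \<Sigma> (varying m (Suc n) x) (rounded_vertices x 0)"
    by (rule subsetI)
  then show ?thesis
    using assms(2) unfolding carrier_space_def by (rule singular_chain_mono[rotated])
qed

lemma carrier_space_subspace:
  "singular_chain k (carrier_space m \<Sigma> n x) c \<Longrightarrow> singular_chain k (real_moment_angle m \<Sigma>) c"
  unfolding carrier_space_def real_moment_angle_def
  by (erule singular_chain_mono) (auto simp: star_set_def)

text \<open>An unvarying coordinate that reached the end opposite to its rounded value would have
  moved by at least 1 from vertex \<open>0\<close>.\<close>

lemma simplex_in_carrier:
  assumes x: "singular_simplex n (real_moment_angle m \<Sigma>) x" "small_simplex m n x"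
  shows "singular_chain n (carrier_space m \<Sigma> n x) (frag_of x)"
proof -
  have "x p \<in> star_set m \<Sigma> (varying m n x) (rounded_vertices x 0)" if p: "p \<in> standard_simplex n" for p
    unfolding star_set_def
  proof (intro CollectI conjI ballI impI notI)
    show "x p \<in> real_moment_angle_set m \<Sigma>" using singular_simplex_point[OF x(1) p] by simp
    fix i assume i: "i \<in> {1..m}" "i \<notin> varying m n x" "x p i = - rounded_vertices x 0 i"
    have "\<bar>x p i - x (basis_point 0) i\<bar> < 1"
      using x(2) p basis_point_in[of 0 n] i(1) by (auto simp: small_simplex_def)
    then show False using i(3) by (auto simp: rounded_vertices_def split: if_splits)
  qed
  then show ?thesis
    using x(1) unfolding carrier_space_def singular_chain_of real_moment_angle_def singular_simplex_subtopology by auto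
qed

text \<open>Outside the varying coordinates every face of the rounding is fixed at the common
  rounded value, so its closed cell avoids the opposite ends.\<close>

lemma round_in_carrier:
  assumes \<Sigma>: "simplicial_complex_on m \<Sigma>" and x: "singular_simplex n (real_moment_angle m \<Sigma>) x" "small_simplex m n x"
  shows "singular_chain n (carrier_space m \<Sigma> n x) (frag_extend (cube_chain m) (round_simplex m n x))"
proof (rule singular_chain_extend)
  fix f assume f: "f \<in> Poly_Mapping.keys (round_simplex m n x)"
  have ff: "f \<in> cube_faces m \<Sigma>" "card (zeros m f) = n"
    using cube_chain_on_round[OF \<Sigma> x] f by (auto simp: cube_chain_on_def)
  have fi: "f i = rounded_vertices x 0 i" "f i \<noteq> 0" if i: "i \<in> {1..m}" "i \<notin> varying m n x" for i
  proof -
    show "f i \<noteq> 0" using zeros_round_subset_varying[OF f] i by (auto simp: zeros_def)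
    from round_simplex_keys(4)[OF f i(1) this] obtain k where "k \<le> n" "f i = rounded_vertices x k i" by blast
    then show "f i = rounded_vertices x 0 i" using not_varying[OF i, of k] by simp
  qed
  have 1: "singular_chain n (real_moment_angle m \<Sigma>) (cube_chain m f)"
    using singular_chain_cube_chain[OF ff(1)] ff(2) by simp
  have 2: "singular_chain n (subtopology (powertop_real {1..m}) (closed_face m f)) (cube_chain m f)"
    using cube_chain_in_closed_face[of f m] ff by (simp add: cube_faces_def)
  have "z \<in> star_set m \<Sigma> (varying m n x) (rounded_vertices x 0)"
    if "z \<in> real_moment_angle_set m \<Sigma>" "z \<in> closed_face m f" for z
  proof -
    have "z i \<noteq> - rounded_vertices x 0 i" if i: "i \<in> {1..m}" "i \<notin> varying m n x" for i
    proof -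
      have "z i = f i" using \<open>z \<in> closed_face m f\<close> i(1) fi(2)[OF i] unfolding closed_face_def by blast
      then show ?thesis using fi[OF i] by linarith
    qed
    then show ?thesis using that(1) unfolding star_set_def by blast
  qed
  then show "singular_chain n (carrier_space m \<Sigma> n x) (cube_chain m f)"
    using 1 2 unfolding carrier_space_def real_moment_angle_def singular_chain_subtopology by blast
qed

section \<open>The homotopy between small chains and their roundings\<close>

definition small_chain :: "nat \<Rightarrow> nat set set \<Rightarrow> nat \<Rightarrow> (nat \<Rightarrow> real) chain \<Rightarrow> bool" where
  "small_chain m \<Sigma> n c \<longleftrightarrow> Poly_Mapping.keys c \<subseteq> {x. singular_simplex n (real_moment_angle m \<Sigma>) x \<and> small_simplex m n x}"

text \<open>The acyclic carrier recursion: in each dimension a filling is chosen inside the carrier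
  of the simplex. That such a filling exists for small simplices is proved together with its
  properties in \<open>small_homotopy_spec\<close>.\<close>

primrec small_homotopy :: "nat \<Rightarrow> nat set set \<Rightarrow> nat \<Rightarrow> ((nat \<Rightarrow> real) \<Rightarrow> nat \<Rightarrow> real) \<Rightarrow> (nat \<Rightarrow> real) chain" where
  "small_homotopy m \<Sigma> 0 = (\<lambda>x. SOME b. singular_chain 1 (carrier_space m \<Sigma> 0 x) b \<and>
     chain_boundary 1 b = frag_of x - frag_extend (cube_chain m) (round_simplex m 0 x))"
| "small_homotopy m \<Sigma> (Suc n) = (\<lambda>x. SOME b. singular_chain (Suc (Suc n)) (carrier_space m \<Sigma> (Suc n) x) b \<and>
     chain_boundary (Suc (Suc n)) b = frag_of x - frag_extend (cube_chain m) (round_simplex m (Suc n) x)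
       - frag_extend (small_homotopy m \<Sigma> n) (chain_boundary (Suc n) (frag_of x)))"

text \<open>Rounding preserves the augmentation; this supplies the extra condition for filling
  0-cycles in the carriers.\<close>

lemma frag_eval_round_0: "frag_eval (\<lambda>x. 1) (frag_extend (cube_chain m) (round_simplex m 0 x)) = 1"
proof -
  have "round_chain m j 0 V = frag_of (\<lambda>i\<in>{1..m}. if i \<le> j then V 0 i else 1)" if "j \<le> m" for j V
    using that by (induction j) (auto simp: set_coord_simps fun_eq_iff restrict_def le_Suc_eq intro!: arg_cong[where f = frag_of])
  then obtain f where f: "round_simplex m 0 x = frag_of f" unfolding round_simplex_def by blast
  then have "card (zeros m f) = 0" using round_simplex_keys(2)[of f m 0 x] by simp
  then have "zeros m f = {}" by simp
  then show ?thesis by (simp add: f cube_chain_def)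
qed

lemma small_chain_boundary:
  assumes "small_chain m \<Sigma> (Suc n) c"
  shows "small_chain m \<Sigma> n (chain_boundary (Suc n) c)"
proof -
  let ?F = "\<lambda>x. \<Sum>i\<le>Suc n. frag_cmul ((-1) ^ i) (frag_of (singular_face (Suc n) i x))"
  have "y \<in> {x. singular_simplex n (real_moment_angle m \<Sigma>) x \<and> small_simplex m n x}"
    if "y \<in> Poly_Mapping.keys (chain_boundary (Suc n) c)" for y
  proof -
    have "y \<in> (\<Union>x\<in>Poly_Mapping.keys c. Poly_Mapping.keys (?F x))"
      using that keys_frag_extend[of ?F c] unfolding chain_boundary_def by (auto simp del: sum.atMost_Suc)
    then obtain x where x: "x \<in> Poly_Mapping.keys c" "y \<in> Poly_Mapping.keys (?F x)" by blast
    then obtain i where i: "i \<le> Suc n" "y = singular_face (Suc n) i x"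
      using keys_sum[of "\<lambda>i. frag_cmul ((-1) ^ i) (frag_of (singular_face (Suc n) i x))" "{..Suc n}"] by fastforce
    have "singular_simplex (Suc n) (real_moment_angle m \<Sigma>) x" "small_simplex m (Suc n) x"
      using assms x(1) by (auto simp: small_chain_def)
    then show ?thesis
      using singular_simplex_singular_face[of "Suc n" _ x i] i
        small_simplex_reindex[of m "Suc n" x n "skip i"] by (auto simp: singular_face_eq_reindex skip_def)
  qed
  then show ?thesis unfolding small_chain_def by blast
qed

lemma small_homotopy_step:
  assumes \<Sigma>: "simplicial_complex_on m \<Sigma>"
    and spec: "\<And>x. \<lbrakk>singular_simplex n (real_moment_angle m \<Sigma>) x; small_simplex m n x\<rbrakk> \<Longrightarrow>
      chain_boundary (Suc n) (small_homotopy m \<Sigma> n x) = frag_of x - frag_extend (cube_chain m) (round_simplex m n x)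
       - (if n = 0 then 0 else frag_extend (small_homotopy m \<Sigma> (n - 1)) (chain_boundary n (frag_of x)))"
    and c: "small_chain m \<Sigma> n c"
  shows "chain_boundary (Suc n) (frag_extend (small_homotopy m \<Sigma> n) c) = c - frag_extend (cube_chain m) (round_map m n c)
     - (if n = 0 then 0 else frag_extend (small_homotopy m \<Sigma> (n - 1)) (chain_boundary n c))"
  using c[unfolded small_chain_def]
proof (induction c rule: frag_induction)
  case (one x)
  then show ?case using spec[of x] by simp
qed (auto simp: frag_extend_diff chain_boundary_diff algebra_simps)

lemma small_homotopy_spec:
  assumes \<Sigma>: "simplicial_complex_on m \<Sigma>"
  shows "\<lbrakk>singular_simplex n (real_moment_angle m \<Sigma>) x; small_simplex m n x\<rbrakk> \<Longrightarrow>
    singular_chain (Suc n) (carrier_space m \<Sigma> n x) (small_homotopy m \<Sigma> n x) \<and>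
      chain_boundary (Suc n) (small_homotopy m \<Sigma> n x) = frag_of x - frag_extend (cube_chain m) (round_simplex m n x)
       - (if n = 0 then 0 else frag_extend (small_homotopy m \<Sigma> (n - 1)) (chain_boundary n (frag_of x)))"
proof (induction n arbitrary: x)
  case 0
  let ?z = "frag_of x - frag_extend (cube_chain m) (round_simplex m 0 x)"
  have "\<exists>b. singular_chain (Suc 0) (carrier_space m \<Sigma> 0 x) b \<and> chain_boundary (Suc 0) b = ?z"
    using simplex_in_carrier[OF 0] round_in_carrier[OF \<Sigma> 0] frag_eval_round_0[of m x]
    by (intro carrier_space_acyclic[OF \<Sigma> 0])
      (auto simp: singular_chain_diff chain_boundary_def frag_eval_diff)
  from someI_ex[OF this] show ?case by simp
next
  case (Suc n)
  let ?H = "frag_extend (small_homotopy m \<Sigma> n)" and ?bx = "chain_boundary (Suc n) (frag_of x)"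
  let ?z = "frag_of x - frag_extend (cube_chain m) (round_simplex m (Suc n) x) - ?H ?bx"
  have sx: "small_chain m \<Sigma> (Suc n) (frag_of x)" using Suc.prems by (simp add: small_chain_def)
  have Hc: "singular_chain (Suc n) (carrier_space m \<Sigma> (Suc n) x) (?H ?bx)"
  proof -
    have "singular_chain (Suc n) (carrier_space m \<Sigma> (Suc n) x) (small_homotopy m \<Sigma> n (singular_face (Suc n) i x))" if "i \<le> Suc n" for i
    proof (rule carrier_space_face[OF that])
      have "singular_simplex n (real_moment_angle m \<Sigma>) (singular_face (Suc n) i x)"
        using singular_simplex_singular_face[OF Suc.prems(1), of i] that by simp
      moreover have "small_simplex m n (singular_face (Suc n) i x)"
        using small_simplex_reindex[OF Suc.prems(2), of n "skip i"] that by (auto simp: singular_face_eq_reindex skip_def)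
      ultimately show "singular_chain (Suc n) (carrier_space m \<Sigma> n (singular_face (Suc n) i x)) (small_homotopy m \<Sigma> n (singular_face (Suc n) i x))"
        using Suc.IH by blast
    qed
    then show ?thesis
      by (auto simp: chain_boundary_of frag_extend_sum frag_extend_cmul comp_def simp del: sum.atMost_Suc
        intro!: singular_chain_sum singular_chain_cmul)
  qed
  \<comment> \<open>By the inductive formula the boundary of the homotopy on \<open>?bx\<close> is
    \<open>?bx\<close> minus its rounding. The first part cancels the boundary of \<open>x\<close>,
    the second that of the rounded simplex, rounding being a chain map.\<close>
  have "chain_boundary (Suc n) ?z = 0"
  proof -
    have bb: "chain_boundary n ?bx = 0"
      using chain_boundary_boundary_alt[of n "real_moment_angle m \<Sigma>" "frag_of x"] Suc.prems(1) by (simp add: singular_chain_of)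
    have "chain_boundary (Suc n) (?H ?bx) = ?bx - frag_extend (cube_chain m) (round_map m n ?bx)
       - (if n = 0 then 0 else frag_extend (small_homotopy m \<Sigma> (n - 1)) (chain_boundary n ?bx))"
      by (rule small_homotopy_step[OF \<Sigma> _ small_chain_boundary[OF sx]]) (use Suc.IH in blast)
    then have 1: "chain_boundary (Suc n) (?H ?bx) = ?bx - frag_extend (cube_chain m) (round_map m n ?bx)" by (simp add: bb)
    have "chain_boundary (Suc n) (frag_extend (cube_chain m) (round_simplex m (Suc n) x)) =
       frag_extend (cube_chain m) (round_map m n ?bx)"
      using chain_boundary_extend_cube_chain[OF cube_chain_on_round[OF \<Sigma> Suc.prems]] round_map_boundary[of m n "frag_of x"] by simp
    then show ?thesis using 1 by (simp add: chain_boundary_diff)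
  qed
  then have "\<exists>b. singular_chain (Suc (Suc n)) (carrier_space m \<Sigma> (Suc n) x) b \<and> chain_boundary (Suc (Suc n)) b = ?z"
    using simplex_in_carrier[OF Suc.prems] round_in_carrier[OF \<Sigma> Suc.prems] Hc
    by (intro carrier_space_acyclic[OF \<Sigma> Suc.prems]) (auto simp: singular_chain_diff)
  from someI_ex[OF this] show ?case by simp
qed

lemma cycle_homologous_to_cube_chain:
  assumes \<Sigma>: "simplicial_complex_on m \<Sigma>"
    and c: "singular_chain n (real_moment_angle m \<Sigma>) c" "chain_boundary n c = 0"
  shows "\<exists>k b. cube_chain_on n m \<Sigma> k \<and> singular_chain (Suc n) (real_moment_angle m \<Sigma>) b \<and>
     c = frag_extend (cube_chain m) k + chain_boundary (Suc n) b"
proof -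
  let ?X = "real_moment_angle m \<Sigma>"
  obtain N where N: "\<And>x. x \<in> Poly_Mapping.keys ((singular_subdivision n ^^ N) c) \<Longrightarrow> small_simplex m n x"
    by (rule small_subdivision[OF c(1)]) (rule that)
  let ?s = "(singular_subdivision n ^^ N) c"
  have s: "singular_chain n ?X ?s" by (rule singular_subdivision_power_chain[OF c(1)])
  have small: "small_chain m \<Sigma> n ?s"
    using s N by (auto simp: small_chain_def singular_chain_def)
  obtain h where h: "\<And>p. h p 0 = (0 :: (nat \<Rightarrow> real) chain)"
        "\<And>p X c. singular_chain p X c \<Longrightarrow> singular_chain (Suc p) X (h p c)"
        "\<And>p X c. singular_chain p X c \<Longrightarrow> chain_boundary (Suc p) (h p c) + h (p - Suc 0) (chain_boundary p c)
                   = (singular_subdivision p ^^ N) c - c"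
    by (rule chain_homotopic_iterated_singular_subdivision[of N]) (rule that)
  have sc: "?s = c + chain_boundary (Suc n) (h n c)"
    using h(3)[OF c(1)] c(2) h(1) by simp
  have ds: "chain_boundary n ?s = 0"
    unfolding sc using c(2) chain_boundary_boundary_alt[OF h(2)[OF c(1)]] by (simp add: chain_boundary_add)
  let ?b = "frag_extend (small_homotopy m \<Sigma> n) ?s"
  have "chain_boundary (Suc n) ?b = ?s - frag_extend (cube_chain m) (round_map m n ?s)"
    using small_homotopy_step[OF \<Sigma> _ small] small_homotopy_spec[OF \<Sigma>] ds by simp
  then have "c = frag_extend (cube_chain m) (round_map m n ?s) + chain_boundary (Suc n) (?b - h n c)"
    using sc by (simp add: chain_boundary_diff algebra_simps)
  moreover have "singular_chain (Suc n) ?X (?b - h n c)"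
    using small small_homotopy_spec[OF \<Sigma>] carrier_space_subspace h(2)[OF c(1)] unfolding small_chain_def
    by (intro singular_chain_diff singular_chain_extend) blast+
  moreover have "cube_chain_on n m \<Sigma> (round_map m n ?s)"
    using small cube_chain_on_round[OF \<Sigma>] unfolding small_chain_def by (intro cube_chain_on_extend) blast
  ultimately show ?thesis by blast
qed

section \<open>Relative cycles modulo degenerate and cubical chains\<close>

lemma lookup_eq_frag_eval: "Poly_Mapping.lookup c y = frag_eval (\<lambda>x. if x = y then 1 else 0) c"
  by (auto simp: frag_eval_def in_keys_iff if_distrib[of "\<lambda>x. _ * x"] cong: if_cong)

lemma lookup_cube_chain:
  assumes f: "f \<in> {1..m} \<rightarrow>\<^sub>E {-1, 0, 1}" and l: "l \<in> permutations_of_set (zeros m f)"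
    and g: "g \<in> {1..m} \<rightarrow>\<^sub>E {-1, 0, 1}" and card: "card (zeros m g) = card (zeros m f)"
  shows "Poly_Mapping.lookup (cube_chain m g) (path_simplex m f l) = (if g = f then perm_sign l else 0)"
proof -
  have "Poly_Mapping.lookup (cube_chain m g) (path_simplex m f l) =
     (\<Sum>l'\<in>permutations_of_set (zeros m g). perm_sign l' * (if path_simplex m f l = path_simplex m g l' then 1 else 0))"
    by (simp add: cube_chain_def lookup_sum)
  also have "\<dots> = (\<Sum>l'\<in>permutations_of_set (zeros m g). if g = f \<and> l' = l then perm_sign l else 0)"
  proof (intro sum.cong refl)
    fix l' assume l': "l' \<in> permutations_of_set (zeros m g)"
    have "length l = length l'" using length_permutations_zeros[OF l] length_permutations_zeros[OF l'] card by simp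
    then have "path_simplex m f l = path_simplex m g l' \<longleftrightarrow> f = g \<and> l = l'"
      using path_simplex_inject[OF f l g l'] by blast
    then show "perm_sign l' * (if path_simplex m f l = path_simplex m g l' then 1 else 0) = (if g = f \<and> l' = l then perm_sign l else 0)"
      by auto
  qed
  also have "\<dots> = (if g = f then perm_sign l else 0)" using l by auto
  finally show ?thesis .
qed

lemma degenerate_chains_boundary:
  assumes "e \<in> degenerate_chains n X"
  shows "chain_boundary n e \<in> degenerate_chains (n - 1) X"
  using chain_boundary_low[OF assms[unfolded degenerate_chains_eq_low]]
  unfolding degenerate_chains_eq_low low_chains_def low_degenerate_def by (rule subsetD[rotated]) blast

text \<open>The increasing path of a face is nondegenerate and occurs in no other cube chain of that
  dimension. Its coefficient recovers that of the face up to sign, so cube chains are independent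
  modulo degenerate simplices.\<close>

lemma degenerate_cube_chain_eq_0:
  assumes k: "cube_chain_on n m \<Sigma> k" and deg: "frag_extend (cube_chain m) k \<in> degenerate_chains n X"
  shows "k = 0"
proof (rule poly_mapping_eqI)
  fix f
  show "Poly_Mapping.lookup k f = Poly_Mapping.lookup 0 f"
  proof (cases "f \<in> Poly_Mapping.keys k")
    case True
    have kk: "g \<in> {1..m} \<rightarrow>\<^sub>E {-1, 0, 1}" "card (zeros m g) = n" if "g \<in> Poly_Mapping.keys k" for g
      using k that by (auto simp: cube_chain_on_def cube_faces_def)
    let ?l = "sorted_list_of_set (zeros m f)"
    have l: "?l \<in> permutations_of_set (zeros m f)" by (auto simp: permutations_of_set_def)
    have len: "length ?l = n" using length_permutations_zeros[OF l] kk[OF True] by simp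
    have "\<not> degenerate_simplex n X (path_simplex m f ?l)"
      using path_simplex_nondegenerate[of ?l m X f] zeros_subset len by simp
    then have "Poly_Mapping.lookup (frag_extend (cube_chain m) k) (path_simplex m f ?l) = 0"
      using deg unfolding degenerate_chains_def by (auto simp: in_keys_iff)
    moreover have "Poly_Mapping.lookup (frag_extend (cube_chain m) k) (path_simplex m f ?l) =
        frag_eval (\<lambda>g. Poly_Mapping.lookup (cube_chain m g) (path_simplex m f ?l)) k"
      unfolding lookup_eq_frag_eval frag_eval_extend ..
    moreover have "\<dots> = frag_eval (\<lambda>g. perm_sign ?l * (if g = f then 1 else 0)) k"
      using kk lookup_cube_chain[OF kk(1)[OF True] l] True by (intro frag_eval_cong) auto
    moreover have "\<dots> = perm_sign ?l * Poly_Mapping.lookup k f"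
      unfolding frag_eval_mult lookup_eq_frag_eval ..
    ultimately show ?thesis using perm_sign_nonzero[of ?l] by auto
  qed (simp add: in_keys_iff)
qed

text \<open>Independence of the two kinds of chains makes both parts of the boundary cycles. The
  degenerate part is filled by a degenerate \<open>e'\<close>. The cubical part bounds the rounding
  of the subdivided \<open>c - e'\<close>, because rounding undoes subdivision on cube chains.
  Subtracting both fillings leaves an absolute cycle, to which
  \<open>cycle_homologous_to_cube_chain\<close> applies.\<close>

lemma relative_cycle_decomposition:
  assumes \<Sigma>: "simplicial_complex_on m \<Sigma>"
    and c: "singular_chain n (real_moment_angle m \<Sigma>) c"
    and bd: "n > 0 \<Longrightarrow> \<exists>e k. e \<in> degenerate_chains (n - 1) (real_moment_angle m \<Sigma>) \<and> cube_chain_on (n - 1) m \<Sigma> k \<and>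
       chain_boundary n c = e + frag_extend (cube_chain m) k"
  shows "\<exists>b e k. singular_chain (Suc n) (real_moment_angle m \<Sigma>) b \<and> e \<in> degenerate_chains n (real_moment_angle m \<Sigma>) \<and>
     cube_chain_on n m \<Sigma> k \<and> c = chain_boundary (Suc n) b + e + frag_extend (cube_chain m) k"
proof (cases n)
  case 0
  then have "chain_boundary n c = 0" by (simp add: chain_boundary_def)
  then obtain k b where "cube_chain_on n m \<Sigma> k" "singular_chain (Suc n) (real_moment_angle m \<Sigma>) b"
     "c = frag_extend (cube_chain m) k + chain_boundary (Suc n) b"
    using cycle_homologous_to_cube_chain[OF \<Sigma> c] by blast
  moreover have "0 \<in> degenerate_chains n (real_moment_angle m \<Sigma>)" by (simp add: degenerate_chains_def)
  ultimately show ?thesis by (metis add.commute add.right_neutral)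
next
  case (Suc n')
  let ?X = "real_moment_angle m \<Sigma>" and ?N = "frag_extend (cube_chain m)"
  obtain e k where e: "e \<in> degenerate_chains n' ?X" and k: "cube_chain_on n' m \<Sigma> k" and ek: "chain_boundary n c = e + ?N k"
    using bd Suc by auto
  have bb: "chain_boundary n' (chain_boundary n c) = 0"
    using chain_boundary_boundary_alt[of n' ?X c] c Suc by simp
  have kb: "cube_chain_on (n' - 1) m \<Sigma> (frag_extend (cube_boundary m) k)"
  proof (rule cube_chain_on_extend)
    fix f assume "f \<in> Poly_Mapping.keys k"
    then have f: "f \<in> cube_faces m \<Sigma>" "card (zeros m f) = n'" using k by (auto simp: cube_chain_on_def)
    show "cube_chain_on (n' - 1) m \<Sigma> (cube_boundary m f)"
    proof (cases n')
      case 0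
      then have "zeros m f = {}" using f(2) by simp
      then show ?thesis by (simp add: cube_boundary_def)
    next
      case (Suc p)
      then show ?thesis using cube_chain_on_boundary[OF \<Sigma> f(1), of p] f(2) by simp
    qed
  qed
  have "?N (frag_extend (cube_boundary m) k) = - chain_boundary n' e"
    using bb unfolding ek by (simp add: chain_boundary_add chain_boundary_extend_cube_chain[OF k] eq_neg_iff_add_eq_0 add.commute)
  moreover have "chain_boundary n' e \<in> degenerate_chains (n' - 1) ?X"
    by (rule degenerate_chains_boundary[OF e])
  ultimately have "?N (frag_extend (cube_boundary m) k) \<in> degenerate_chains (n' - 1) ?X"
    by (simp add: degenerate_chains_def)
  then have dk: "frag_extend (cube_boundary m) k = 0"
    by (rule degenerate_cube_chain_eq_0[OF kb])
  then have "chain_boundary n' e = 0"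
    using bb unfolding ek by (simp add: chain_boundary_add chain_boundary_extend_cube_chain[OF k])
  then obtain e' where e': "e' \<in> degenerate_chains n ?X" "chain_boundary n e' = e"
    using degenerate_acyclic[OF e] Suc by auto
  have ce: "singular_chain n ?X (c - e')" "chain_boundary n (c - e') = ?N k"
    using c e' low_chains_singular[of e' n n ?X] by (auto simp: degenerate_chains_eq_low singular_chain_diff chain_boundary_diff ek)
  obtain N where N: "\<And>x. x \<in> Poly_Mapping.keys ((singular_subdivision n ^^ N) (c - e')) \<Longrightarrow> small_simplex m n x"
    by (rule small_subdivision[OF ce(1)]) (rule that)
  let ?s = "(singular_subdivision n ^^ N) (c - e')"
  let ?k = "round_map m n ?s"
  have k': "cube_chain_on n m \<Sigma> ?k"
    using N singular_subdivision_power_chain[OF ce(1), of N] cube_chain_on_round[OF \<Sigma>]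
    unfolding singular_chain_def by (intro cube_chain_on_extend) blast
  have "frag_extend (cube_boundary m) ?k = round_map m n' ((singular_subdivision n' ^^ N) (?N k))"
    using chain_boundary_subdivision_power[of n' ?X "c - e'" N] ce Suc round_map_boundary[of m n' ?s] by simp
  also have "\<dots> = k"
  proof -
    have "Poly_Mapping.keys k \<subseteq> {f \<in> {1..m} \<rightarrow>\<^sub>E {-1, 0, 1}. card (zeros m f) = n'}"
      using k by (auto simp: cube_chain_on_def cube_faces_def)
    then show ?thesis
      by (induction k rule: frag_induction)
        (auto simp: frag_extend_diff singular_subdivision_power_diff round_subdivision_cube_chain)
  qed
  finally have dk': "frag_extend (cube_boundary m) ?k = k" .
  have "singular_chain n ?X (c - e' - ?N ?k)"
    using ce(1) singular_chain_extend_cube_chain[OF k'] by (rule singular_chain_diff)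
  moreover have "chain_boundary n (c - e' - ?N ?k) = 0"
    unfolding chain_boundary_diff[of n "c - e'"] ce(2) chain_boundary_extend_cube_chain[OF k'] dk' by simp
  ultimately obtain k'' b where b: "cube_chain_on n m \<Sigma> k''" "singular_chain (Suc n) ?X b"
     "c - e' - ?N ?k = ?N k'' + chain_boundary (Suc n) b"
    using cycle_homologous_to_cube_chain[OF \<Sigma>] by blast
  have "c = chain_boundary (Suc n) b + e' + ?N (?k + k'')"
    using b(3) by (simp add: frag_extend_add algebra_simps)
  then show ?thesis using b e'(1) cube_chain_on_add[OF k' b(1)] by blast
qed

section \<open>Contracting the singular chains modulo the cubical chains\<close>

definition cube_subcomplex :: "nat \<Rightarrow> nat set set \<Rightarrow> nat \<Rightarrow> (nat \<Rightarrow> real) chain set" where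
  "cube_subcomplex m \<Sigma> n = {e + frag_extend (cube_chain m) k | e k.
     e \<in> degenerate_chains n (real_moment_angle m \<Sigma>) \<and> cube_chain_on n m \<Sigma> k}"

lemma cube_subcomplexI:
  "\<lbrakk>e \<in> degenerate_chains n (real_moment_angle m \<Sigma>); cube_chain_on n m \<Sigma> k\<rbrakk>
    \<Longrightarrow> e + frag_extend (cube_chain m) k \<in> cube_subcomplex m \<Sigma> n"
  unfolding cube_subcomplex_def by blast

lemma cube_subcomplexE:
  assumes "c \<in> cube_subcomplex m \<Sigma> n"
  obtains e k where "e \<in> degenerate_chains n (real_moment_angle m \<Sigma>)" "cube_chain_on n m \<Sigma> k"
    "c = e + frag_extend (cube_chain m) k"
  using assms unfolding cube_subcomplex_def by blast

lemma degenerate_in_cube_subcomplex: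
  "e \<in> degenerate_chains n (real_moment_angle m \<Sigma>) \<Longrightarrow> e \<in> cube_subcomplex m \<Sigma> n"
  using cube_subcomplexI[of e n m \<Sigma> 0] by simp

lemma cube_chain_in_cube_subcomplex:
  "\<lbrakk>f \<in> cube_faces m \<Sigma>; card (zeros m f) = n\<rbrakk> \<Longrightarrow> cube_chain m f \<in> cube_subcomplex m \<Sigma> n"
  using cube_subcomplexI[of 0 n m \<Sigma> "frag_of f"] by (simp add: degenerate_chains_def cube_chain_on_of)

lemma cube_subcomplex_0 [simp]: "0 \<in> cube_subcomplex m \<Sigma> n"
  by (rule degenerate_in_cube_subcomplex) (simp add: degenerate_chains_def)

lemma cube_subcomplex_add:
  assumes "a \<in> cube_subcomplex m \<Sigma> n" "b \<in> cube_subcomplex m \<Sigma> n"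
  shows "a + b \<in> cube_subcomplex m \<Sigma> n"
proof -
  obtain e k where a: "e \<in> degenerate_chains n (real_moment_angle m \<Sigma>)" "cube_chain_on n m \<Sigma> k"
    "a = e + frag_extend (cube_chain m) k"
    using assms(1) by (rule cube_subcomplexE)
  obtain e' k' where b: "e' \<in> degenerate_chains n (real_moment_angle m \<Sigma>)" "cube_chain_on n m \<Sigma> k'"
    "b = e' + frag_extend (cube_chain m) k'"
    using assms(2) by (rule cube_subcomplexE)
  have "e + e' \<in> degenerate_chains n (real_moment_angle m \<Sigma>)"
    using a(1) b(1) unfolding degenerate_chains_eq_low by (rule low_chains_closed)
  from cube_subcomplexI[OF this cube_chain_on_add[OF a(2) b(2)]] show ?thesis
    by (simp add: a(3) b(3) frag_extend_add algebra_simps)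
qed

lemma cube_subcomplex_cmul:
  assumes "a \<in> cube_subcomplex m \<Sigma> n"
  shows "frag_cmul t a \<in> cube_subcomplex m \<Sigma> n"
proof -
  obtain e k where a: "e \<in> degenerate_chains n (real_moment_angle m \<Sigma>)" "cube_chain_on n m \<Sigma> k"
    "a = e + frag_extend (cube_chain m) k"
    using assms by (rule cube_subcomplexE)
  have "frag_cmul t e \<in> degenerate_chains n (real_moment_angle m \<Sigma>)"
    using a(1) unfolding degenerate_chains_eq_low by (rule low_chains_closed)
  from cube_subcomplexI[OF this cube_chain_on_cmul[OF a(2)]] show ?thesis
    by (simp add: a(3) frag_extend_cmul frag_cmul_distrib2)
qed

lemma cube_subcomplex_sum:
  "(\<And>i. i \<in> I \<Longrightarrow> a i \<in> cube_subcomplex m \<Sigma> n) \<Longrightarrow> sum a I \<in> cube_subcomplex m \<Sigma> n"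
  by (induction I rule: infinite_finite_induct) (auto simp: cube_subcomplex_add)

lemma cube_subcomplex_extend:
  "(\<And>x. x \<in> Poly_Mapping.keys c \<Longrightarrow> F x \<in> cube_subcomplex m \<Sigma> n) \<Longrightarrow> frag_extend F c \<in> cube_subcomplex m \<Sigma> n"
  unfolding frag_extend_def by (intro cube_subcomplex_sum cube_subcomplex_cmul)

lemma cube_subcomplex_singular:
  assumes "c \<in> cube_subcomplex m \<Sigma> n"
  shows "singular_chain n (real_moment_angle m \<Sigma>) c"
proof -
  obtain e k where c: "e \<in> degenerate_chains n (real_moment_angle m \<Sigma>)" "cube_chain_on n m \<Sigma> k"
    "c = e + frag_extend (cube_chain m) k"
    using assms by (rule cube_subcomplexE)
  show ?thesis
    unfolding c(3) using low_chains_singular[OF c(1)[unfolded degenerate_chains_eq_low]]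
      singular_chain_extend_cube_chain[OF c(2)] by (rule singular_chain_add)
qed

lemma cube_subcomplex_boundary:
  assumes \<Sigma>: "simplicial_complex_on m \<Sigma>" and c: "c \<in> cube_subcomplex m \<Sigma> n"
  shows "chain_boundary n c \<in> cube_subcomplex m \<Sigma> (n - 1)"
proof (cases n)
  case 0
  then show ?thesis by (simp add: chain_boundary_def)
next
  case (Suc p)
  obtain e k where ek: "e \<in> degenerate_chains n (real_moment_angle m \<Sigma>)" "cube_chain_on n m \<Sigma> k"
    "c = e + frag_extend (cube_chain m) k"
    using c by (rule cube_subcomplexE)
  have "cube_chain_on p m \<Sigma> (frag_extend (cube_boundary m) k)"
    using ek(2) by (intro cube_chain_on_extend cube_chain_on_boundary[OF \<Sigma>]) (auto simp: cube_chain_on_def Suc)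
  then show ?thesis
    using cube_subcomplexI[OF degenerate_chains_boundary[OF ek(1)], of "frag_extend (cube_boundary m) k"] Suc
    by (simp add: ek(3) chain_boundary_add chain_boundary_extend_cube_chain[OF ek(2)[unfolded Suc]])
qed

text \<open>Thus the kernel of the evaluation map consists of cochains on the quotient of the
  singular chains by \<open>cube_subcomplex\<close>.\<close>

lemma cochain_cube_subcomplex:
  assumes g: "\<gamma> n \<in> normalized_cochains n (real_moment_angle m \<Sigma>)"
    and 0: "\<And>f. f \<in> cube_faces m \<Sigma> \<Longrightarrow> cube_eval m \<gamma> f = 0" and c: "c \<in> cube_subcomplex m \<Sigma> n"
  shows "\<gamma> n c = 0"
proof -
  let ?X = "real_moment_angle m \<Sigma>"
  obtain e k where ek: "e \<in> degenerate_chains n ?X" "cube_chain_on n m \<Sigma> k" "c = e + frag_extend (cube_chain m) k"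
    using c by (rule cube_subcomplexE)
  have e: "singular_chain n ?X e" by (rule low_chains_singular[OF ek(1)[unfolded degenerate_chains_eq_low]])
  have "\<gamma> n e = frag_eval (\<lambda>x. \<gamma> n (frag_of x)) e" by (rule normalized_cochain_eval[OF g e])
  also have "\<dots> = frag_eval (\<lambda>x. 0) e"
    using ek(1) normalized_cochain_degenerate[OF g] by (intro frag_eval_cong) (auto simp: degenerate_chains_def)
  finally have "\<gamma> n e = 0" by (simp add: frag_eval_def)
  moreover have "\<gamma> n (frag_extend (cube_chain m) k) = frag_eval (\<lambda>f. 0) k"
    unfolding cochain_extend_cube_chain[where \<gamma> = \<gamma>, OF g ek(2)]
    using ek(2) 0 by (intro frag_eval_cong) (auto simp: cube_chain_on_def)
  ultimately show ?thesis
    unfolding ek(3) using normalized_cochain_add[OF g e singular_chain_extend_cube_chain[OF ek(2)]]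
    by (simp add: frag_eval_def)
qed

text \<open>The simplices for increasing paths are eliminated by means of the cube chains; the remaining
  nondegenerate simplices form a basis of the quotient by \<open>cube_subcomplex\<close>.\<close>

definition cube_retract :: "nat \<Rightarrow> nat set set \<Rightarrow> nat \<Rightarrow> ((nat \<Rightarrow> real) \<Rightarrow> nat \<Rightarrow> real) \<Rightarrow> (nat \<Rightarrow> real) chain" where
  "cube_retract m \<Sigma> n x = (if degenerate_simplex n (real_moment_angle m \<Sigma>) x then 0 else
     frag_of x - (\<Sum>f | f \<in> cube_faces m \<Sigma> \<and> card (zeros m f) = n \<and>
         x = path_simplex m f (sorted_list_of_set (zeros m f)).
       frag_cmul (perm_sign (sorted_list_of_set (zeros m f))) (cube_chain m f)))"

lemma cube_retract_diff:
  "singular_simplex n (real_moment_angle m \<Sigma>) x \<Longrightarrow> frag_of x - cube_retract m \<Sigma> n x \<in> cube_subcomplex m \<Sigma> n"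
  using degenerate_in_cube_subcomplex[of "frag_of x" n m \<Sigma>]
  by (auto simp: cube_retract_def degenerate_chains_def
      intro!: cube_subcomplex_sum cube_subcomplex_cmul cube_chain_in_cube_subcomplex)

lemma cube_retract_path:
  assumes f: "f \<in> cube_faces m \<Sigma>" and l: "l \<in> permutations_of_set (zeros m f)"
  shows "cube_retract m \<Sigma> (card (zeros m f)) (path_simplex m f l) = frag_of (path_simplex m f l) -
    (if l = sorted_list_of_set (zeros m f) then frag_cmul (perm_sign l) (cube_chain m f) else 0)"
proof -
  let ?s = "\<lambda>f. sorted_list_of_set (zeros m f)"
  have s: "?s g \<in> permutations_of_set (zeros m g)" for g by (auto simp: permutations_of_set_def)
  have E: "g \<in> {1..m} \<rightarrow>\<^sub>E {-1, 0, 1}" if "g \<in> cube_faces m \<Sigma>" for g using that by (simp add: cube_faces_def)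
  note len = length_permutations_zeros[OF l]
  have "{g \<in> cube_faces m \<Sigma>. card (zeros m g) = card (zeros m f) \<and> path_simplex m f l = path_simplex m g (?s g)} =
      (if l = ?s f then {f} else {})" (is "?A = _")
  proof -
    have A: "f = g \<and> l = ?s g" if "g \<in> ?A" for g
    proof (rule path_simplex_inject[OF E[OF f] l E s])
      show "g \<in> cube_faces m \<Sigma>" "path_simplex m f l = path_simplex m g (?s g)" using that by blast+
      show "length l = length (?s g)" using that len by simp
    qed
    show ?thesis
    proof (cases "l = ?s f")
      case True
      have "f \<in> ?A" unfolding mem_Collect_eq using f True by simp
      moreover have "g = f" if "g \<in> ?A" for g using A[OF that] by (rule conjE) (rule sym)
      ultimately have "?A = {f}" by (intro equalityI subsetI) (simp_all only: singleton_iff)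
      then show ?thesis unfolding if_P[OF True] .
    next
      case False
      have "?A = {}"
      proof (rule equals0I)
        fix g assume "g \<in> ?A"
        from A[OF this] show False using False by (elim conjE) simp
      qed
      then show ?thesis unfolding if_not_P[OF False] .
    qed
  qed
  moreover have "\<not> degenerate_simplex (card (zeros m f)) (real_moment_angle m \<Sigma>) (path_simplex m f l)"
    using path_simplex_nondegenerate[of l m "real_moment_angle m \<Sigma>" f] permutations_of_setD[OF l] zeros_subset[of m f] len by simp
  ultimately show ?thesis by (simp add: cube_retract_def)
qed

text \<open>On a cube chain the only correction comes from its increasing path, and it amounts to
  the whole cube chain because the sign of that path enters squared.\<close>

lemma cube_retract_cube_subcomplex:
  assumes "c \<in> cube_subcomplex m \<Sigma> n"
  shows "frag_extend (cube_retract m \<Sigma> n) c = 0"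
proof -
  let ?X = "real_moment_angle m \<Sigma>"
  obtain e k where ek: "e \<in> degenerate_chains n ?X" "cube_chain_on n m \<Sigma> k" "c = e + frag_extend (cube_chain m) k"
    using assms by (rule cube_subcomplexE)
  have "frag_extend (cube_retract m \<Sigma> n) e = 0"
    using ek(1) by (intro frag_extend_eq_0) (auto simp: degenerate_chains_def cube_retract_def)
  moreover
  have "frag_extend (cube_retract m \<Sigma> n) (cube_chain m f) = 0"
    if f: "f \<in> cube_faces m \<Sigma>" "card (zeros m f) = n" for f
  proof -
    let ?P = "permutations_of_set (zeros m f)" and ?s = "sorted_list_of_set (zeros m f)"
    have s: "?s \<in> ?P" by (auto simp: permutations_of_set_def)
    have "frag_extend (cube_retract m \<Sigma> n) (cube_chain m f) =
       (\<Sum>l\<in>?P. frag_cmul (perm_sign l) (cube_retract m \<Sigma> n (path_simplex m f l)))"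
      by (simp add: cube_chain_def frag_extend_sum frag_extend_cmul comp_def)
    also have "\<dots> = (\<Sum>l\<in>?P. frag_cmul (perm_sign l) (frag_of (path_simplex m f l)) -
        (if l = ?s then frag_cmul (perm_sign l) (frag_cmul (perm_sign l) (cube_chain m f)) else 0))"
      using cube_retract_path[OF f(1)] f(2) by (intro sum.cong refl) (auto simp: frag_cmul_diff2)
    also have "\<dots> = cube_chain m f - frag_cmul (perm_sign ?s) (frag_cmul (perm_sign ?s) (cube_chain m f))"
      using s by (simp add: sum_subtractf cube_chain_def)
    also have "\<dots> = 0" using perm_sign_nonzero[of ?s] by auto
    finally show ?thesis .
  qed
  note cube = this
  have "frag_extend (cube_retract m \<Sigma> n) (frag_extend (cube_chain m) k) = 0"
    using ek(2)[unfolded cube_chain_on_def] by (rule frag_induction) (simp_all add: frag_extend_diff cube)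
  ultimately show ?thesis by (simp add: ek(3) frag_extend_add)
qed

text \<open>A contraction of the quotient by \<open>cube_subcomplex\<close>, which exists because that quotient is
  free and acyclic.\<close>

primrec cube_contraction :: "nat \<Rightarrow> nat set set \<Rightarrow> nat \<Rightarrow> ((nat \<Rightarrow> real) \<Rightarrow> nat \<Rightarrow> real) \<Rightarrow> (nat \<Rightarrow> real) chain" where
  "cube_contraction m \<Sigma> 0 = (\<lambda>x. SOME b. singular_chain 1 (real_moment_angle m \<Sigma>) b \<and>
     frag_of x - chain_boundary 1 b \<in> cube_subcomplex m \<Sigma> 0)"
| "cube_contraction m \<Sigma> (Suc n) = (\<lambda>x. SOME b. singular_chain (Suc (Suc n)) (real_moment_angle m \<Sigma>) b \<and>
     frag_of x - frag_extend (cube_contraction m \<Sigma> n) (frag_extend (cube_retract m \<Sigma> n) (chain_boundary (Suc n) (frag_of x)))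
       - chain_boundary (Suc (Suc n)) b \<in> cube_subcomplex m \<Sigma> (Suc n))"

text \<open>Applying the retraction first makes the map vanish on \<open>cube_subcomplex\<close>, so
  it is defined on the quotient and composing a cochain with it gives an element of the
  kernel.\<close>

definition contract_chain :: "nat \<Rightarrow> nat set set \<Rightarrow> nat \<Rightarrow> (nat \<Rightarrow> real) chain \<Rightarrow> (nat \<Rightarrow> real) chain" where
  "contract_chain m \<Sigma> n c = frag_extend (cube_contraction m \<Sigma> n) (frag_extend (cube_retract m \<Sigma> n) c)"

lemma contract_chain_simps:
  "contract_chain m \<Sigma> n 0 = 0"
  "contract_chain m \<Sigma> n (a + b) = contract_chain m \<Sigma> n a + contract_chain m \<Sigma> n b"
  "contract_chain m \<Sigma> n (a - b) = contract_chain m \<Sigma> n a - contract_chain m \<Sigma> n b"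
  "contract_chain m \<Sigma> n (frag_cmul k a) = frag_cmul k (contract_chain m \<Sigma> n a)"
  by (simp_all add: contract_chain_def frag_extend_add frag_extend_diff frag_extend_cmul)

lemma contract_chain_cube_subcomplex: "c \<in> cube_subcomplex m \<Sigma> n \<Longrightarrow> contract_chain m \<Sigma> n c = 0"
  by (simp add: contract_chain_def cube_retract_cube_subcomplex)

lemma singular_chain_cube_retract:
  assumes c: "singular_chain n (real_moment_angle m \<Sigma>) c"
  shows "singular_chain n (real_moment_angle m \<Sigma>) (frag_extend (cube_retract m \<Sigma> n) c)"
    "c - frag_extend (cube_retract m \<Sigma> n) c \<in> cube_subcomplex m \<Sigma> n"
proof -
  have "c - frag_extend (cube_retract m \<Sigma> n) c = frag_extend (\<lambda>x. frag_of x - cube_retract m \<Sigma> n x) c"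
    by (induction c rule: frag_induction[OF subset_UNIV]) (simp_all add: frag_extend_diff algebra_simps)
  moreover have "\<dots> \<in> cube_subcomplex m \<Sigma> n"
    using c unfolding singular_chain_def by (intro cube_subcomplex_extend cube_retract_diff) blast
  ultimately show 1: "c - frag_extend (cube_retract m \<Sigma> n) c \<in> cube_subcomplex m \<Sigma> n" by simp
  show "singular_chain n (real_moment_angle m \<Sigma>) (frag_extend (cube_retract m \<Sigma> n) c)"
    using singular_chain_diff[OF c cube_subcomplex_singular[OF 1]] by simp
qed

text \<open>The formula holds on simplices by the choice of the contraction, hence by linearity on
  the retract of \<open>c\<close>; passing from there to \<open>c\<close> changes it only within
  \<open>cube_subcomplex\<close>. In degree 0 the term with \<open>n - 1\<close> is zero, as
  0-chains have boundary 0.\<close>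

lemma contract_chain_step:
  assumes \<Sigma>: "simplicial_complex_on m \<Sigma>"
    and spec: "\<And>x. singular_simplex n (real_moment_angle m \<Sigma>) x \<Longrightarrow>
      singular_chain (Suc n) (real_moment_angle m \<Sigma>) (cube_contraction m \<Sigma> n x) \<and>
      frag_of x - contract_chain m \<Sigma> (n - 1) (chain_boundary n (frag_of x)) - chain_boundary (Suc n) (cube_contraction m \<Sigma> n x)
        \<in> cube_subcomplex m \<Sigma> n"
    and c: "singular_chain n (real_moment_angle m \<Sigma>) c"
  shows "singular_chain (Suc n) (real_moment_angle m \<Sigma>) (contract_chain m \<Sigma> n c)"
    and "c - contract_chain m \<Sigma> (n - 1) (chain_boundary n c) - chain_boundary (Suc n) (contract_chain m \<Sigma> n c)
       \<in> cube_subcomplex m \<Sigma> n"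
proof -
  let ?r = "frag_extend (cube_retract m \<Sigma> n) c"
  note r = singular_chain_cube_retract[OF c]
  show "singular_chain (Suc n) (real_moment_angle m \<Sigma>) (contract_chain m \<Sigma> n c)"
    unfolding contract_chain_def using r(1) spec by (intro singular_chain_extend) (auto simp: singular_chain_def)
  let ?F = "\<lambda>b. b - contract_chain m \<Sigma> (n - 1) (chain_boundary n b) - chain_boundary (Suc n) (frag_extend (cube_contraction m \<Sigma> n) b)"
  have "?F b = frag_extend (\<lambda>x. ?F (frag_of x)) b" for b
    by (induction b rule: frag_induction[OF subset_UNIV])
      (simp_all add: frag_extend_diff contract_chain_simps chain_boundary_diff algebra_simps)
  then have "?F ?r = frag_extend (\<lambda>x. ?F (frag_of x)) ?r" .
  also have "\<dots> \<in> cube_subcomplex m \<Sigma> n"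
    using r(1) spec unfolding singular_chain_def by (intro cube_subcomplex_extend) auto
  finally have "?F ?r \<in> cube_subcomplex m \<Sigma> n" .
  moreover have "contract_chain m \<Sigma> (n - 1) (chain_boundary n ?r) = contract_chain m \<Sigma> (n - 1) (chain_boundary n c)"
    using contract_chain_cube_subcomplex[OF cube_subcomplex_boundary[OF \<Sigma> r(2)]]
    by (simp add: chain_boundary_diff contract_chain_simps)
  ultimately have "?r - contract_chain m \<Sigma> (n - 1) (chain_boundary n c) - chain_boundary (Suc n) (contract_chain m \<Sigma> n c) \<in> cube_subcomplex m \<Sigma> n"
    by (simp add: contract_chain_def)
  from cube_subcomplex_add[OF this r(2)]
  show "c - contract_chain m \<Sigma> (n - 1) (chain_boundary n c) - chain_boundary (Suc n) (contract_chain m \<Sigma> n c)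
       \<in> cube_subcomplex m \<Sigma> n"
    by (simp add: algebra_simps)
qed

lemma cube_contraction_exists:
  assumes \<Sigma>: "simplicial_complex_on m \<Sigma>" and c: "singular_chain n (real_moment_angle m \<Sigma>) c"
    and bd: "n > 0 \<Longrightarrow> chain_boundary n c \<in> cube_subcomplex m \<Sigma> (n - 1)"
  shows "\<exists>b. singular_chain (Suc n) (real_moment_angle m \<Sigma>) b \<and> c - chain_boundary (Suc n) b \<in> cube_subcomplex m \<Sigma> n"
proof -
  have "\<exists>b e k. singular_chain (Suc n) (real_moment_angle m \<Sigma>) b \<and> e \<in> degenerate_chains n (real_moment_angle m \<Sigma>) \<and>
     cube_chain_on n m \<Sigma> k \<and> c = chain_boundary (Suc n) b + e + frag_extend (cube_chain m) k"
    using bd unfolding cube_subcomplex_def by (intro relative_cycle_decomposition[OF \<Sigma> c]) blast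
  then obtain b e k where b: "singular_chain (Suc n) (real_moment_angle m \<Sigma>) b" and e: "e \<in> degenerate_chains n (real_moment_angle m \<Sigma>)"
    "cube_chain_on n m \<Sigma> k" and c: "c = chain_boundary (Suc n) b + e + frag_extend (cube_chain m) k"
    by (elim exE conjE)
  have "c - chain_boundary (Suc n) b = e + frag_extend (cube_chain m) k" by (simp add: c)
  then show ?thesis using b cube_subcomplexI[OF e] by metis
qed

lemma cube_contraction_spec:
  assumes \<Sigma>: "simplicial_complex_on m \<Sigma>"
  shows "singular_simplex n (real_moment_angle m \<Sigma>) x \<Longrightarrow>
    singular_chain (Suc n) (real_moment_angle m \<Sigma>) (cube_contraction m \<Sigma> n x) \<and>
    frag_of x - contract_chain m \<Sigma> (n - 1) (chain_boundary n (frag_of x)) - chain_boundary (Suc n) (cube_contraction m \<Sigma> n x)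
        \<in> cube_subcomplex m \<Sigma> n"
proof (induction n arbitrary: x)
  case 0
  have "\<exists>b. singular_chain (Suc 0) (real_moment_angle m \<Sigma>) b \<and> frag_of x - chain_boundary (Suc 0) b \<in> cube_subcomplex m \<Sigma> 0"
    using 0 by (intro cube_contraction_exists[OF \<Sigma>]) (simp_all add: singular_chain_of)
  from someI_ex[OF this] show ?case by (simp add: chain_boundary_def contract_chain_simps)
next
  case (Suc n)
  let ?bx = "chain_boundary (Suc n) (frag_of x)"
  have x: "singular_chain (Suc n) (real_moment_angle m \<Sigma>) (frag_of x)" using Suc.prems by (simp add: singular_chain_of)
  have bx: "singular_chain n (real_moment_angle m \<Sigma>) ?bx" using singular_chain_boundary[OF x] by simp
  have "chain_boundary n ?bx = 0" using chain_boundary_boundary_alt[OF x] .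
  with contract_chain_step[OF \<Sigma> Suc.IH bx]
  have s: "singular_chain (Suc n) (real_moment_angle m \<Sigma>) (contract_chain m \<Sigma> n ?bx)"
    "?bx - chain_boundary (Suc n) (contract_chain m \<Sigma> n ?bx) \<in> cube_subcomplex m \<Sigma> n"
    by (simp_all add: contract_chain_simps)
  have "\<exists>b. singular_chain (Suc (Suc n)) (real_moment_angle m \<Sigma>) b \<and>
     frag_of x - contract_chain m \<Sigma> n ?bx - chain_boundary (Suc (Suc n)) b \<in> cube_subcomplex m \<Sigma> (Suc n)"
    using s by (intro cube_contraction_exists[OF \<Sigma> singular_chain_diff[OF x s(1)]]) (simp add: chain_boundary_diff)
  from someI_ex[OF this] show ?case unfolding contract_chain_def by simp
qed

lemma
  assumes "simplicial_complex_on m \<Sigma>" "singular_chain n (real_moment_angle m \<Sigma>) c"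
  shows contract_chain_singular: "singular_chain (Suc n) (real_moment_angle m \<Sigma>) (contract_chain m \<Sigma> n c)"
    and contract_chain_homotopy: "c - contract_chain m \<Sigma> (n - 1) (chain_boundary n c) -
      chain_boundary (Suc n) (contract_chain m \<Sigma> n c) \<in> cube_subcomplex m \<Sigma> n"
  using contract_chain_step[OF assms(1) cube_contraction_spec[OF assms(1)] assms(2)] by simp_all

text \<open>Modulo \<open>cube_subcomplex\<close> every 0-chain is a boundary. A cocycle kills
  boundaries, and one in the kernel of the evaluation kills the subcomplex.\<close>

lemma cube_eval_kernel_degree_0:
  assumes \<Sigma>: "simplicial_complex_on m \<Sigma>"
    and g: "\<gamma> \<in> component (cochain_dga (real_moment_angle m \<Sigma>)) 0" "cochain_diff (real_moment_angle m \<Sigma>) \<gamma> = (\<lambda>n c. 0)"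
    and 0: "\<And>f. f \<in> cube_faces m \<Sigma> \<Longrightarrow> cube_eval m \<gamma> f = 0"
  shows "\<gamma> = (\<lambda>n c. 0)"
proof (intro ext)
  let ?X = "real_moment_angle m \<Sigma>"
  fix n c
  note N = cochain_componentD[OF g(1)]
  show "\<gamma> n c = 0"
  proof (cases "n = 0 \<and> singular_chain 0 ?X c")
    case True
    let ?b = "contract_chain m \<Sigma> 0 c"
    have b: "singular_chain 1 ?X ?b" using contract_chain_singular[OF \<Sigma>, of 0 c] True by simp
    have "c - chain_boundary 1 ?b \<in> cube_subcomplex m \<Sigma> 0"
      using contract_chain_homotopy[OF \<Sigma>, of 0 c] True by (simp add: chain_boundary_def[of 0] contract_chain_simps)
    note cochain_cube_subcomplex[OF N(1) 0 this]
    moreover have "\<gamma> 0 (chain_boundary 1 ?b) = 0"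
      using fun_cong[OF fun_cong[OF g(2), of 1], of ?b] b by (simp add: cochain_diff_def)
    moreover have "\<gamma> 0 c = \<gamma> 0 (c - chain_boundary 1 ?b) + \<gamma> 0 (chain_boundary 1 ?b)"
      using True singular_chain_boundary_alt[of 0 ?X ?b] b normalized_cochain_add[OF N(1)[of 0], of "c - chain_boundary 1 ?b" "chain_boundary 1 ?b"]
      by (simp add: singular_chain_diff)
    ultimately show ?thesis using True by simp
  next
    case False
    then show ?thesis using N(1)[of n] N(2)[of n] normalized_cochain_non_chain[OF N(1)[of 0], of c] by (cases "n = 0") auto
  qed
qed

text \<open>The primitive is the cocycle composed with the contraction. In the homotopy formula for
  \<open>c\<close> the cocycle kills both the boundary term and the term in
  \<open>cube_subcomplex\<close>.\<close>

lemma cube_eval_kernel_acyclic: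
  assumes \<Sigma>: "simplicial_complex_on m \<Sigma>"
    and g: "\<gamma> \<in> component (cochain_dga (real_moment_angle m \<Sigma>)) (Suc n)" "cochain_diff (real_moment_angle m \<Sigma>) \<gamma> = (\<lambda>n c. 0)"
    and 0: "\<And>f. f \<in> cube_faces m \<Sigma> \<Longrightarrow> cube_eval m \<gamma> f = 0"
  shows "\<exists>\<delta>\<in>component (cochain_dga (real_moment_angle m \<Sigma>)) n.
    (\<forall>f\<in>cube_faces m \<Sigma>. cube_eval m \<delta> f = 0) \<and> \<gamma> = cochain_diff (real_moment_angle m \<Sigma>) \<delta>"
proof -
  let ?X = "real_moment_angle m \<Sigma>"
  note N = cochain_componentD[OF g(1)]
  \<comment> \<open>The sign is the inverse of the one in \<open>cochain_diff\<close> on degree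
    \<open>n\<close>.\<close>
  let ?u = "\<lambda>x. - ((-1) ^ n) * \<gamma> (Suc n) (contract_chain m \<Sigma> n (frag_of x))"
  let ?d = "to_cochain n ?X ?u"
  have d: "?d \<in> normalized_cochains n ?X"
  proof (rule to_cochain_normalized)
    fix x assume "degenerate_simplex n ?X x"
    then have "frag_of x \<in> cube_subcomplex m \<Sigma> n"
      by (intro degenerate_in_cube_subcomplex) (simp add: degenerate_chains_def)
    then show "?u x = 0" using normalized_cochain_cmul[OF N(1)[of "Suc n"], of 0 0] by (simp add: contract_chain_cube_subcomplex)
  qed
  have val: "?d c = - ((-1) ^ n) * \<gamma> (Suc n) (contract_chain m \<Sigma> n c)" if c: "singular_chain n ?X c" for c
  proof -
    have "Poly_Mapping.keys c \<subseteq> {x. singular_simplex n ?X x}" using c by (auto simp: singular_chain_def)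
    then have "singular_chain n ?X c \<and> frag_eval ?u c = - ((-1) ^ n) * \<gamma> (Suc n) (contract_chain m \<Sigma> n c)"
    proof (induction c rule: frag_induction)
      case zero
      then show ?case using normalized_cochain_cmul[OF N(1)[of "Suc n"], of 0 0] by (simp add: contract_chain_simps)
    next
      case (one x)
      then show ?case by (simp add: singular_chain_of)
    next
      case (diff a b)
      have "contract_chain m \<Sigma> n a = contract_chain m \<Sigma> n (a - b) + contract_chain m \<Sigma> n b" by (simp add: contract_chain_simps)
      moreover have "singular_chain n ?X (a - b)" using diff by (simp add: singular_chain_diff)
      ultimately have "\<gamma> (Suc n) (contract_chain m \<Sigma> n a) = \<gamma> (Suc n) (contract_chain m \<Sigma> n (a - b)) + \<gamma> (Suc n) (contract_chain m \<Sigma> n b)"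
        using diff contract_chain_singular[OF \<Sigma>] normalized_cochain_add[OF N(1)[of "Suc n"]] by simp
      then show ?case using diff \<open>singular_chain n ?X (a - b)\<close> by (simp add: frag_eval_diff algebra_simps)
    qed
    then show ?thesis using c by (simp add: to_cochain_def)
  qed
  let ?\<delta> = "\<lambda>k. if k = n then ?d else (\<lambda>c. 0)"
  have comp: "?\<delta> \<in> component (cochain_dga ?X) n"
    using d by (simp add: cochain_dga_simps)
  have "cube_eval m ?\<delta> f = 0" if f: "f \<in> cube_faces m \<Sigma>" for f
  proof (cases "card (zeros m f) = n")
    case True
    have "contract_chain m \<Sigma> n (cube_chain m f) = 0"
      using contract_chain_cube_subcomplex[OF cube_chain_in_cube_subcomplex[OF f True]] .
    then show ?thesis
      using val[of "cube_chain m f"] singular_chain_cube_chain[OF f] True normalized_cochain_cmul[OF N(1)[of "Suc n"], of 0 0] by (simp add: cube_eval_def)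
  qed (simp add: cube_eval_def)
  moreover have "\<gamma> = cochain_diff ?X ?\<delta>"
  proof (intro ext)
    fix k c
    show "\<gamma> k c = cochain_diff ?X ?\<delta> k c"
    proof (cases "k = Suc n \<and> singular_chain (Suc n) ?X c")
      case True
      then have c: "singular_chain (Suc n) ?X c" by simp
      let ?b = "contract_chain m \<Sigma> (Suc n) c" and ?a = "contract_chain m \<Sigma> n (chain_boundary (Suc n) c)"
      have b: "singular_chain (Suc (Suc n)) ?X ?b" using contract_chain_singular[OF \<Sigma> c] .
      have bc: "singular_chain n ?X (chain_boundary (Suc n) c)" using singular_chain_boundary[OF c] by simp
      have a: "singular_chain (Suc n) ?X ?a" by (rule contract_chain_singular[OF \<Sigma> bc])
      have bb: "singular_chain (Suc n) ?X (chain_boundary (Suc (Suc n)) ?b)" using singular_chain_boundary[OF b] by simp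
      let ?l = "c - ?a - chain_boundary (Suc (Suc n)) ?b"
      have l: "?l \<in> cube_subcomplex m \<Sigma> (Suc n)" using contract_chain_homotopy[OF \<Sigma> c] by simp
      have "\<gamma> (Suc n) (chain_boundary (Suc (Suc n)) ?b) = 0"
        using fun_cong[OF fun_cong[OF g(2), of "Suc (Suc n)"], of ?b] b by (simp add: cochain_diff_def)
      moreover have "\<gamma> (Suc n) ?l = 0" by (rule cochain_cube_subcomplex[OF N(1) 0 l])
      moreover have "\<gamma> (Suc n) (?l + ?a + chain_boundary (Suc (Suc n)) ?b) =
         \<gamma> (Suc n) ?l + \<gamma> (Suc n) ?a + \<gamma> (Suc n) (chain_boundary (Suc (Suc n)) ?b)"
        using cube_subcomplex_singular[OF l] a bb
        by (simp only: normalized_cochain_add[OF N(1)] singular_chain_add)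
      ultimately have "\<gamma> (Suc n) c = \<gamma> (Suc n) ?a" by simp
      moreover have "((-1::int) ^ n) * (-1) ^ n = 1" by (simp flip: power_mult_distrib)
      ultimately show ?thesis using True val[OF bc] by (simp add: cochain_diff_def)
    next
      case False
      then show ?thesis using N(2)[of k] normalized_cochain_non_chain[OF N(1)[of "Suc n"], of c] by (cases "k = Suc n") (auto simp: cochain_diff_def)
    qed
  qed
  ultimately show ?thesis using comp by blast
qed

section \<open>Surjections of dgas with acyclic kernel\<close>

lemma comm_group_cocycle_group:
  assumes "dga A"
  shows "comm_group (cocycle_group A n)"
proof -
  interpret dga A by fact
  interpret N: additive_subgroup "component A n" A by (rule component_subgroup)
  have C: "x \<in> carrier A" if "x \<in> component A n" for x using that N.a_subset by blast
  have d0: "diff A \<zero>\<^bsub>A\<^esub> = \<zero>\<^bsub>A\<^esub>"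
    using diff_add[OF zero_closed zero_closed] additive_subgroup.a_subset[OF component_subgroup]
      diff_component[OF N.zero_closed] by (simp add: subset_iff)
  show ?thesis
  proof (rule comm_groupI)
    fix x assume x: "x \<in> carrier (cocycle_group A n)"
    then have xN: "x \<in> component A n" "diff A x = \<zero>\<^bsub>A\<^esub>" by (auto simp: cocycle_group_def)
    have neg: "\<ominus>\<^bsub>A\<^esub> x \<in> component A n" using xN(1) by (rule N.a_inv_closed)
    have "diff A (\<ominus>\<^bsub>A\<^esub> x \<oplus>\<^bsub>A\<^esub> x) = diff A (\<ominus>\<^bsub>A\<^esub> x) \<oplus>\<^bsub>A\<^esub> diff A x"
      using C[OF neg] C[OF xN(1)] by (rule diff_add)
    then have "diff A (\<ominus>\<^bsub>A\<^esub> x) = \<zero>\<^bsub>A\<^esub>"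
      using C[OF xN(1)] d0 xN(2) diff_component[OF neg] additive_subgroup.a_subset[OF component_subgroup]
      by (simp add: l_neg subset_iff)
    then show "\<exists>y\<in>carrier (cocycle_group A n). y \<otimes>\<^bsub>cocycle_group A n\<^esub> x = \<one>\<^bsub>cocycle_group A n\<^esub>"
      using neg C[OF xN(1)] by (intro bexI[of _ "\<ominus>\<^bsub>A\<^esub> x"]) (auto simp: cocycle_group_def l_neg)
  qed (auto simp: cocycle_group_def C d0 diff_add a_assoc intro: a_comm)
qed

lemma subgroup_coboundaries:
  assumes "dga A"
  shows "subgroup (coboundaries A n) (cocycle_group A n)"
proof (cases n)
  case 0
  then show ?thesis
    using group.triv_subgroup[OF comm_group.axioms(2)[OF comm_group_cocycle_group[OF assms, of n]]]
    by (simp add: coboundaries_def cocycle_group_def)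
next
  case (Suc k)
  interpret dga A by fact
  interpret Z: comm_group "cocycle_group A k" by (rule comm_group_cocycle_group[OF assms])
  interpret Z': comm_group "cocycle_group A n" by (rule comm_group_cocycle_group[OF assms])
  interpret N: additive_subgroup "component A k" A by (rule component_subgroup)
  have C: "x \<in> carrier A" if "x \<in> component A k" for x using that N.a_subset by blast
  let ?K = "\<lparr>carrier = component A k, monoid.mult = add A, one = \<zero>\<^bsub>A\<^esub>\<rparr>"
  have "group ?K"
  proof (rule groupI)
    fix x assume "x \<in> carrier ?K"
    then show "\<exists>y\<in>carrier ?K. y \<otimes>\<^bsub>?K\<^esub> x = \<one>\<^bsub>?K\<^esub>"
      using N.a_inv_closed[of x] C[of x] by (intro bexI[of _ "\<ominus>\<^bsub>A\<^esub> x"]) (auto simp: l_neg)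
  qed (auto simp: C a_assoc)
  moreover have "diff A \<in> hom ?K (cocycle_group A n)"
    using diff_component[of _ k] by (intro homI) (auto simp: cocycle_group_def Suc C diff_diff diff_add)
  ultimately have "group_hom ?K (cocycle_group A n) (diff A)"
    by (simp add: group_hom_def group_hom_axioms_def)
  from group_hom.img_is_subgroup[OF this] show ?thesis
    by (simp add: coboundaries_def Suc)
qed

lemma (in group_hom) image_coset_kernel:
  assumes "g \<in> carrier G"
  shows "h ` (kernel G H h #> g) = {h g}"
  using assms by (auto simp: kernel_def r_coset_def intro!: imageI)

text \<open>The usual diagram chase. If \<open>x\<close> lifts a cocycle, then
  \<open>diff A x\<close> is a cocycle in the kernel, so it equals \<open>diff A z\<close> with
  \<open>z\<close> in the kernel, and \<open>x\<close> minus \<open>z\<close> is a cocycle lift. If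
  the image of a cocycle bounds, lifting the primitive leaves a cocycle in the kernel, which bounds
  as well; in degree 0 it has to vanish.\<close>

lemma dga_quasi_isoI:
  assumes A: "dga A" and B: "dga B" and f: "f \<in> dga_hom A B"
    and surj: "\<And>n y. y \<in> component B n \<Longrightarrow> \<exists>x\<in>component A n. f x = y"
    and ker_0: "\<And>x. \<lbrakk>x \<in> component A 0; diff A x = \<zero>\<^bsub>A\<^esub>; f x = \<zero>\<^bsub>B\<^esub>\<rbrakk> \<Longrightarrow> x = \<zero>\<^bsub>A\<^esub>"
    and ker_Suc: "\<And>n x. \<lbrakk>x \<in> component A (Suc n); diff A x = \<zero>\<^bsub>A\<^esub>; f x = \<zero>\<^bsub>B\<^esub>\<rbrakk>
      \<Longrightarrow> \<exists>z\<in>component A n. f z = \<zero>\<^bsub>B\<^esub> \<and> x = diff A z"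
  shows "dga_quasi_iso A B f"
proof -
  interpret A: dga A by fact
  interpret B: dga B by fact
  have fr: "f \<in> ring_hom A B" and fc: "\<And>n x. x \<in> component A n \<Longrightarrow> f x \<in> component B n"
    and fd: "\<And>x. x \<in> carrier A \<Longrightarrow> f (diff A x) = diff B (f x)"
    using f by (auto simp: dga_hom_def)
  interpret F: ring_hom_ring A B f by (rule ring_hom_ringI2[OF A.ring_axioms B.ring_axioms fr])
  have C: "x \<in> carrier A" if "x \<in> component A n" for x n
    using that additive_subgroup.a_subset[OF A.component_subgroup] by blast
  have CB: "x \<in> carrier B" if "x \<in> component B n" for x n
    using that additive_subgroup.a_subset[OF B.component_subgroup] by blast
  have minus: "x \<ominus>\<^bsub>A\<^esub> y \<in> component A n" if "x \<in> component A n" "y \<in> component A n" for x y n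
    unfolding a_minus_def
    using that additive_subgroup.a_closed[OF A.component_subgroup] additive_subgroup.a_inv_closed[OF A.component_subgroup] by blast
  have diff_minus: "diff A (x \<ominus>\<^bsub>A\<^esub> y) = diff A x \<ominus>\<^bsub>A\<^esub> diff A y" if "x \<in> component A n" "y \<in> component A n" for x y n
  proof -
    note c = C[OF that(1)] C[OF that(2)] C[OF minus[OF that]] C[OF A.diff_component[OF that(1)]]
      C[OF A.diff_component[OF that(2)]] C[OF A.diff_component[OF minus[OF that]]]
    have "diff A x = diff A ((x \<ominus>\<^bsub>A\<^esub> y) \<oplus>\<^bsub>A\<^esub> y)"
      using c by (simp add: a_minus_def A.a_assoc A.l_neg)
    also have "\<dots> = diff A (x \<ominus>\<^bsub>A\<^esub> y) \<oplus>\<^bsub>A\<^esub> diff A y" using c by (intro A.diff_add)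
    finally show ?thesis using c by (simp add: a_minus_def A.a_assoc A.r_neg)
  qed
  have f_minus: "f (x \<ominus>\<^bsub>A\<^esub> y) = f x \<ominus>\<^bsub>B\<^esub> f y" if "x \<in> carrier A" "y \<in> carrier A" for x y
    using that by (simp add: a_minus_def)
  have "cohomology_map B n f \<in> iso (cohomology A n) (cohomology B n)" for n
  proof -
    let ?Z = "cocycle_group A n" and ?Z' = "cocycle_group B n" and ?I = "coboundaries A n" and ?I' = "coboundaries B n"
    interpret Z: comm_group ?Z by (rule comm_group_cocycle_group[OF A])
    interpret Z': comm_group ?Z' by (rule comm_group_cocycle_group[OF B])
    note sub = subgroup_coboundaries[OF A, of n] and sub' = subgroup_coboundaries[OF B, of n]
    have nrm: "?I' \<lhd> ?Z'" by (rule Z'.subgroup_imp_normal[OF sub'])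
    \<comment> \<open>This composite into the cohomology of \<open>B\<close> is shown to be onto
      with kernel the coboundaries of \<open>A\<close>; the first isomorphism theorem then gives the
      map on cosets, which agrees with \<open>cohomology_map\<close>.\<close>
    let ?g = "\<lambda>x. ?I' #>\<^bsub>?Z'\<^esub> f x"
    have fZ: "f x \<in> carrier ?Z'" if "x \<in> carrier ?Z" for x
      using that fc[of x n] fd[OF C[of x n]] by (auto simp: cocycle_group_def)
    have "f \<in> hom ?Z ?Z'"
      using fZ C by (intro homI) (auto simp: cocycle_group_def)
    from hom_compose[OF this normal.r_coset_hom_Mod[OF nrm]]
    have g: "?g \<in> hom ?Z (cohomology B n)" by (simp add: comp_def cohomology_def)
    have "group (cohomology B n)" unfolding cohomology_def by (rule normal.factorgroup_is_group[OF nrm])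
    with g interpret G: group_hom ?Z "cohomology B n" ?g
      by (simp add: group_hom_def group_hom_axioms_def Z.group_axioms)
    have one: "\<one>\<^bsub>cohomology B n\<^esub> = ?I'" by (simp add: cohomology_def FactGroup_def)
    have img: "?g ` carrier ?Z = carrier (cohomology B n)"
    proof
      show "?g ` carrier ?Z \<subseteq> carrier (cohomology B n)" using G.hom_closed by blast
      show "carrier (cohomology B n) \<subseteq> ?g ` carrier ?Z"
      proof
        fix Y assume "Y \<in> carrier (cohomology B n)"
        then obtain y where y: "y \<in> component B n" "diff B y = \<zero>\<^bsub>B\<^esub>" "Y = ?I' #>\<^bsub>?Z'\<^esub> y"
          by (auto simp: cohomology_def FactGroup_def RCOSETS_def cocycle_group_def)
        obtain x where x: "x \<in> component A n" "f x = y" using surj[OF y(1)] by blast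
        have "diff A (diff A x) = \<zero>\<^bsub>A\<^esub>" "f (diff A x) = \<zero>\<^bsub>B\<^esub>"
          using A.diff_diff[OF C[OF x(1)]] fd[OF C[OF x(1)]] x(2) y(2) by simp_all
        then obtain z where z: "z \<in> component A n" "f z = \<zero>\<^bsub>B\<^esub>" "diff A x = diff A z"
          using ker_Suc[OF A.diff_component[OF x(1)]] by blast
        have "diff A (x \<ominus>\<^bsub>A\<^esub> z) = \<zero>\<^bsub>A\<^esub>"
          unfolding diff_minus[OF x(1) z(1)] z(3) using C[OF A.diff_component[OF z(1)]] by (simp add: a_minus_def A.r_neg)
        then have "x \<ominus>\<^bsub>A\<^esub> z \<in> carrier ?Z" using minus[OF x(1) z(1)] by (simp add: cocycle_group_def)
        moreover have "f (x \<ominus>\<^bsub>A\<^esub> z) = y"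
          using f_minus[OF C[OF x(1)] C[OF z(1)]] x(2) z(2) CB[OF y(1)] by (simp add: a_minus_def)
        ultimately show "Y \<in> ?g ` carrier ?Z" using y(3) by blast
      qed
    qed
    have ker: "kernel ?Z (cohomology B n) ?g = ?I"
    proof
      show "?I \<subseteq> kernel ?Z (cohomology B n) ?g"
      proof
        fix x assume x: "x \<in> ?I"
        then have xZ: "x \<in> carrier ?Z" using subgroup.mem_carrier[OF sub] by blast
        have "f x \<in> ?I'"
        proof (cases n)
          case 0
          then show ?thesis using x by (simp add: coboundaries_def)
        next
          case (Suc k)
          then obtain w where "w \<in> component A k" "x = diff A w" using x by (auto simp: coboundaries_def)
          then show ?thesis using fd[OF C] fc Suc by (auto simp: coboundaries_def)
        qed
        then have "?g x = ?I'" using Z'.coset_join2[OF fZ[OF xZ] sub'] by blast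
        then show "x \<in> kernel ?Z (cohomology B n) ?g" using xZ by (simp add: kernel_def one)
      qed
      show "kernel ?Z (cohomology B n) ?g \<subseteq> ?I"
      proof
        fix x assume "x \<in> kernel ?Z (cohomology B n) ?g"
        then have xZ: "x \<in> carrier ?Z" and gx: "?g x = ?I'" by (auto simp: kernel_def one)
        then have x: "x \<in> component A n" "diff A x = \<zero>\<^bsub>A\<^esub>" by (auto simp: cocycle_group_def)
        have fx: "f x \<in> ?I'" by (rule Z'.coset_join1[OF gx fZ[OF xZ] sub'])
        show "x \<in> ?I"
        proof (cases n)
          case 0
          then show ?thesis using fx ker_0[of x] x by (simp add: coboundaries_def)
        next
          case (Suc k)
          then obtain y where y: "y \<in> component B k" "f x = diff B y" using fx by (auto simp: coboundaries_def)
          obtain w where w: "w \<in> component A k" "f w = y" using surj[OF y(1)] by blast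
          have dw: "diff A w \<in> component A n" using A.diff_component[OF w(1)] Suc by simp
          note c = C[OF x(1)] C[OF dw] C[OF w(1)]
          have "diff A (x \<ominus>\<^bsub>A\<^esub> diff A w) = \<zero>\<^bsub>A\<^esub>"
            unfolding diff_minus[OF x(1) dw] x(2) A.diff_diff[OF c(3)] by (simp add: a_minus_def)
          moreover have "f (x \<ominus>\<^bsub>A\<^esub> diff A w) = \<zero>\<^bsub>B\<^esub>"
            unfolding f_minus[OF c(1,2)] fd[OF c(3)] w(2) y(2)
            using CB[OF B.diff_component[OF y(1)]] by (simp add: a_minus_def B.r_neg)
          ultimately obtain z where z: "z \<in> component A k" "x \<ominus>\<^bsub>A\<^esub> diff A w = diff A z"
            using ker_Suc[of "x \<ominus>\<^bsub>A\<^esub> diff A w" k] minus[OF x(1) dw] Suc by blast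
          have "x = (x \<ominus>\<^bsub>A\<^esub> diff A w) \<oplus>\<^bsub>A\<^esub> diff A w" using c by (simp add: a_minus_def A.a_assoc A.l_neg)
          also have "\<dots> = diff A (z \<oplus>\<^bsub>A\<^esub> w)" unfolding z(2) using A.diff_add[OF C[OF z(1)] c(3)] by simp
          finally show ?thesis
            using additive_subgroup.a_closed[OF A.component_subgroup z(1) w(1)] Suc by (auto simp: coboundaries_def)
        qed
      qed
    qed
    have iso: "(\<lambda>X. the_elem (?g ` X)) \<in> iso (cohomology A n) (cohomology B n)"
      using G.FactGroup_iso_set[OF img] unfolding ker cohomology_def[of A] .
    have eq: "cohomology_map B n f X = the_elem (?g ` X)" if X: "X \<in> carrier (cohomology A n)" for X
    proof -
      obtain x where x: "x \<in> carrier ?Z" "X = kernel ?Z (cohomology B n) ?g #>\<^bsub>?Z\<^esub> x"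
        using X unfolding ker by (auto simp: cohomology_def FactGroup_def RCOSETS_def)
      have "?g ` X = {?g x}" unfolding x(2) by (rule G.image_coset_kernel[OF x(1)])
      then show ?thesis by (simp add: cohomology_map_def)
    qed
    interpret HA: group "cohomology A n"
      unfolding cohomology_def by (rule normal.factorgroup_is_group[OF Z.subgroup_imp_normal[OF sub]])
    have "cohomology_map B n f \<in> hom (cohomology A n) (cohomology B n)"
      using iso eq HA.m_closed unfolding iso_def by (auto simp: hom_def)
    moreover have "bij_betw (cohomology_map B n f) (carrier (cohomology A n)) (carrier (cohomology B n))"
      using iso eq unfolding iso_def by (auto cong: bij_betw_cong)
    ultimately show ?thesis by (simp add: iso_def)
  qed
  then show ?thesis using A B f by (simp add: dga_quasi_iso_def)
qed

lemma face_map_quasi_iso: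
  assumes \<Sigma>: "simplicial_complex_on m \<Sigma>"
  shows "dga_quasi_iso (cochain_dga (real_moment_angle m \<Sigma>)) (B_dga m \<Sigma>) (face_map m \<Sigma>)"
proof (rule dga_quasi_isoI[OF dga_cochain_dga dga_B_dga[OF \<Sigma>] face_map_in_dga_hom[OF \<Sigma>]])
  show "\<exists>x\<in>component (cochain_dga (real_moment_angle m \<Sigma>)) n. face_map m \<Sigma> x = y"
    if "y \<in> component (B_dga m \<Sigma>) n" for n y
    by (rule face_map_surj[OF \<Sigma> that])
qed (simp_all add: face_map_eq_zero[OF \<Sigma>] cochain_dga_simps(4,7)
  cube_eval_kernel_degree_0[OF \<Sigma>] cube_eval_kernel_acyclic[OF \<Sigma>])

theorem theorem3p2:
  fixes m :: nat and \<Sigma> :: "nat set set"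
  assumes "m \<ge> 1" and "simplicial_complex_on m \<Sigma>"
  shows "\<exists>\<phi> :: nat set set \<Rightarrow> (nat \<Rightarrow> real) cochain \<Rightarrow> (B_gen list \<Rightarrow>\<^sub>0 int) set.
    (\<forall>\<Sigma>'. simplicial_complex_on m \<Sigma>' \<and> \<Sigma>' \<subseteq> \<Sigma> \<longrightarrow>
      dga_quasi_iso (cochain_dga (real_moment_angle m \<Sigma>')) (B_dga m \<Sigma>') (\<phi> \<Sigma>')) \<and>
    (\<forall>\<Sigma>' \<Sigma>''. simplicial_complex_on m \<Sigma>' \<and> simplicial_complex_on m \<Sigma>'' \<and>
        \<Sigma>'' \<subseteq> \<Sigma>' \<and> \<Sigma>' \<subseteq> \<Sigma> \<longrightarrow>
      (\<forall>\<gamma> \<in> carrier (cochain_dga (real_moment_angle m \<Sigma>')).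
        \<phi> \<Sigma>'' (cochain_restriction (real_moment_angle m \<Sigma>'') \<gamma>) =
          B_projection m \<Sigma>'' (\<phi> \<Sigma>' \<gamma>)))"
proof (intro exI[of _ "face_map m"] conjI allI impI ballI; elim conjE)
  fix \<Sigma>' assume "simplicial_complex_on m \<Sigma>'"
  then show "dga_quasi_iso (cochain_dga (real_moment_angle m \<Sigma>')) (B_dga m \<Sigma>') (face_map m \<Sigma>')"
    by (rule face_map_quasi_iso)
next
  fix \<Sigma>' \<Sigma>'' and \<gamma> :: "(nat \<Rightarrow> real) cochain"
  assume "simplicial_complex_on m \<Sigma>''" "\<Sigma>'' \<subseteq> \<Sigma>'"
  then show "face_map m \<Sigma>'' (cochain_restriction (real_moment_angle m \<Sigma>'') \<gamma>) = B_projection m \<Sigma>'' (face_map m \<Sigma>' \<gamma>)"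
    by (rule face_map_restriction)
qed

end
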